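(* Let $R$ be a unital associative (possibly non-commutative) ring, let $L = R[x,x^{-1},y,y^{-1}]$ be the Laurent polynomial ring in two (commuting, central) indeterminates, and let $C$ be a bounded cochain complex of finitely generated free $L$-modules. Then the following two statements are equivalent: (a) The complex $C$ is $R$-finitely dominated, i.e., $C$ is homotopy equivalent, as an $R$-module cochain complex, to a bounded cochain complex of finitely generated projective $R$-modules. (b) The following eight cochain complexes are acyclic (all tensor products taken over $L$): $$C \otimes R[x,x^{-1}]((y)),\quad C \otimes R[x,x^{-1}]((y^{-1})),\quad C \otimes R[y,y^{-1}]((x)),\quad C \otimes R[y,y^{-1}]((x^{-1})),$$ $$C \otimes R((x,y)),\quad C \otimes R((x^{-1},y^{-1})),\quad C \otimes R((x,y^{-1})),\quad C \otimes R((x^{-1},y)).$$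
   Context: Modules are unital right modules; cochain complexes have differentials raising the degree. For a ring $K$ and an indeterminate $z$, $K((z)) = K[[z]][z^{-1}]$ is the ring of formal Laurent series in $z$ (finitely many negative powers of $z$), and $K((z^{-1})) = K[[z^{-1}]][z]$. The ring $R((x,y)) = R[[x,y]][(xy)^{-1}]$ is the ring of those formal Laurent series $f$ in $x$ and $y$ such that $x^k y^k f \in R[[x,y]]$ for $k$ sufficiently large. The rings $R((x^{-1},y))$, $R((x,y^{-1}))$, $R((x^{-1},y^{-1}))$ are defined in the same way with $x$ and/or $y$ replaced by its inverse. All these rings contain $L$. *)

theory Defs
  imports
    "HOL-Algebra.Module"
    "HOL-Algebra.Coset"
    "HOL-Algebra.Generated_Groups"
    "HOL-Algebra.Free_Abelian_Groups"
    "HOL-Library.Product_Plus"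
    "HOL-Library.FuncSet"
begin

section \<open>Right modules over a not necessarily commutative ring\<close>

text \<open>
  As for \<^type>\<open>module\<close>, the record extends \<^type>\<open>ring\<close> because the additive
  notions (\<^const>\<open>abelian_group\<close>, \<^const>\<open>finsum\<close>) live on that record.
  The multiplicative fields carry no meaning.
\<close>

record ('a, 'm) right_module = "'m ring" +
  ract :: "['m, 'a] \<Rightarrow> 'm" (infixl \<open>\<cdot>\<index>\<close> 70)

locale right_module = R?: ring R + M?: abelian_group M
  for R (structure) and M (structure) +
  assumes ract_closed:
      "\<lbrakk>x \<in> carrier M; a \<in> carrier R\<rbrakk> \<Longrightarrow> x \<cdot>\<^bsub>M\<^esub> a \<in> carrier M"
    and ract_add_ring:
      "\<lbrakk>x \<in> carrier M; a \<in> carrier R; b \<in> carrier R\<rbrakk>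
        \<Longrightarrow> x \<cdot>\<^bsub>M\<^esub> (a \<oplus>\<^bsub>R\<^esub> b) = x \<cdot>\<^bsub>M\<^esub> a \<oplus>\<^bsub>M\<^esub> x \<cdot>\<^bsub>M\<^esub> b"
    and ract_add_module:
      "\<lbrakk>x \<in> carrier M; y \<in> carrier M; a \<in> carrier R\<rbrakk>
        \<Longrightarrow> (x \<oplus>\<^bsub>M\<^esub> y) \<cdot>\<^bsub>M\<^esub> a = x \<cdot>\<^bsub>M\<^esub> a \<oplus>\<^bsub>M\<^esub> y \<cdot>\<^bsub>M\<^esub> a"
    and ract_mult:
      "\<lbrakk>x \<in> carrier M; a \<in> carrier R; b \<in> carrier R\<rbrakk>
        \<Longrightarrow> x \<cdot>\<^bsub>M\<^esub> (a \<otimes>\<^bsub>R\<^esub> b) = (x \<cdot>\<^bsub>M\<^esub> a) \<cdot>\<^bsub>M\<^esub> b"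
    and ract_one:
      "x \<in> carrier M \<Longrightarrow> x \<cdot>\<^bsub>M\<^esub> \<one>\<^bsub>R\<^esub> = x"

definition rmod_hom ::
    "('a, 'c) ring_scheme \<Rightarrow> ('a, 'm) right_module \<Rightarrow> ('a, 'n) right_module \<Rightarrow> ('m \<Rightarrow> 'n) set"
  where "rmod_hom R M N =
    {h. h \<in> carrier M \<rightarrow> carrier N
      \<and> (\<forall>x\<in>carrier M. \<forall>y\<in>carrier M. h (x \<oplus>\<^bsub>M\<^esub> y) = h x \<oplus>\<^bsub>N\<^esub> h y)
      \<and> (\<forall>x\<in>carrier M. \<forall>a\<in>carrier R. h (x \<cdot>\<^bsub>M\<^esub> a) = h x \<cdot>\<^bsub>N\<^esub> a)}"

definition lin_comb :: "('a, 'c) ring_scheme \<Rightarrow> ('a, 'm) right_module \<Rightarrow> 'm set \<Rightarrow> ('m \<Rightarrow> 'a) \<Rightarrow> 'm"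
  where "lin_comb R M B c = (\<Oplus>\<^bsub>M\<^esub>b\<in>{b \<in> B. c b \<noteq> \<zero>\<^bsub>R\<^esub>}. b \<cdot>\<^bsub>M\<^esub> c b)"

definition is_basis :: "('a, 'c) ring_scheme \<Rightarrow> ('a, 'm) right_module \<Rightarrow> 'm set \<Rightarrow> bool"
  where "is_basis R M B \<longleftrightarrow> B \<subseteq> carrier M \<and>
    (\<forall>x\<in>carrier M. \<exists>!c. c \<in> B \<rightarrow>\<^sub>E carrier R \<and> finite {b \<in> B. c b \<noteq> \<zero>\<^bsub>R\<^esub>} \<and> x = lin_comb R M B c)"

definition free_rmod :: "('a, 'c) ring_scheme \<Rightarrow> ('a, 'm) right_module \<Rightarrow> bool"
  where "free_rmod R M \<longleftrightarrow> right_module R M \<and> (\<exists>B. is_basis R M B)"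

definition fg_free_rmod :: "('a, 'c) ring_scheme \<Rightarrow> ('a, 'm) right_module \<Rightarrow> bool"
  where "fg_free_rmod R M \<longleftrightarrow> right_module R M \<and> (\<exists>B. finite B \<and> is_basis R M B)"

definition fg_rmod :: "('a, 'c) ring_scheme \<Rightarrow> ('a, 'm) right_module \<Rightarrow> bool"
  where "fg_rmod R M \<longleftrightarrow> right_module R M \<and>
    (\<exists>B. finite B \<and> B \<subseteq> carrier M \<and>
      (\<forall>x\<in>carrier M. \<exists>c. c \<in> B \<rightarrow> carrier R \<and> x = lin_comb R M B c))"

text \<open>
  A module is projective if it is a direct summand of a free module. Elements of the free
  module have type \<open>'m \<Rightarrow> 'a\<close>; this is no restriction, since the finitely supported functions
  from the carrier of \<open>P\<close> to \<open>R\<close> form a free module that surjects onto \<open>P\<close>.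
\<close>

definition projective_rmod :: "('a, 'c) ring_scheme \<Rightarrow> ('a, 'm) right_module \<Rightarrow> bool"
  where "projective_rmod R P \<longleftrightarrow> right_module R P \<and>
    (\<exists>F :: ('a, 'm \<Rightarrow> 'a) right_module. free_rmod R F \<and>
      (\<exists>i\<in>rmod_hom R P F. \<exists>p\<in>rmod_hom R F P. \<forall>x\<in>carrier P. p (i x) = x))"


section \<open>Cochain complexes\<close>

record ('a, 'm) cochain =
  obj :: "int \<Rightarrow> ('a, 'm) right_module"
  diff :: "int \<Rightarrow> 'm \<Rightarrow> 'm"

definition cochain_complex :: "('a, 'c) ring_scheme \<Rightarrow> ('a, 'm) cochain \<Rightarrow> bool"
  where "cochain_complex R C \<longleftrightarrow>
    (\<forall>n. right_module R (obj C n)) \<and>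
    (\<forall>n. diff C n \<in> rmod_hom R (obj C n) (obj C (n + 1))) \<and>
    (\<forall>n. \<forall>x\<in>carrier (obj C n). diff C (n + 1) (diff C n x) = \<zero>\<^bsub>obj C (n + 2)\<^esub>)"

definition bounded_cochain :: "('a, 'm) cochain \<Rightarrow> bool"
  where "bounded_cochain C \<longleftrightarrow>
    (\<exists>a b. \<forall>n. n < a \<or> b < n \<longrightarrow> carrier (obj C n) = {\<zero>\<^bsub>obj C n\<^esub>})"

definition acyclic_cochain :: "('a, 'm) cochain \<Rightarrow> bool"
  where "acyclic_cochain C \<longleftrightarrow>
    (\<forall>n. {x \<in> carrier (obj C n). diff C n x = \<zero>\<^bsub>obj C (n + 1)\<^esub>}
       = diff C (n - 1) ` carrier (obj C (n - 1)))"

definition cochain_map ::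
    "('a, 'c) ring_scheme \<Rightarrow> ('a, 'm) cochain \<Rightarrow> ('a, 'n) cochain \<Rightarrow> (int \<Rightarrow> 'm \<Rightarrow> 'n) \<Rightarrow> bool"
  where "cochain_map R C D f \<longleftrightarrow>
    (\<forall>n. f n \<in> rmod_hom R (obj C n) (obj D n)) \<and>
    (\<forall>n. \<forall>x\<in>carrier (obj C n). f (n + 1) (diff C n x) = diff D n (f n x))"

definition cochain_homotopic ::
    "('a, 'c) ring_scheme \<Rightarrow> ('a, 'm) cochain \<Rightarrow> ('a, 'n) cochain
      \<Rightarrow> (int \<Rightarrow> 'm \<Rightarrow> 'n) \<Rightarrow> (int \<Rightarrow> 'm \<Rightarrow> 'n) \<Rightarrow> bool"
  where "cochain_homotopic R C D f g \<longleftrightarrow>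
    (\<exists>s. (\<forall>n. s n \<in> rmod_hom R (obj C n) (obj D (n - 1))) \<and>
      (\<forall>n. \<forall>x\<in>carrier (obj C n).
        f n x \<ominus>\<^bsub>obj D n\<^esub> g n x = diff D (n - 1) (s n x) \<oplus>\<^bsub>obj D n\<^esub> s (n + 1) (diff C n x)))"

definition homotopy_equivalent_cochains ::
    "('a, 'c) ring_scheme \<Rightarrow> ('a, 'm) cochain \<Rightarrow> ('a, 'n) cochain \<Rightarrow> bool"
  where "homotopy_equivalent_cochains R C D \<longleftrightarrow>
    (\<exists>f g. cochain_map R C D f \<and> cochain_map R D C g \<and>
      cochain_homotopic R C C (\<lambda>n x. g n (f n x)) (\<lambda>n x. x) \<and>
      cochain_homotopic R D D (\<lambda>n x. f n (g n x)) (\<lambda>n x. x))"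

definition restrict_scalars :: "('b \<Rightarrow> 'a) \<Rightarrow> ('a, 'm) right_module \<Rightarrow> ('b, 'm) right_module"
  where "restrict_scalars \<phi> M =
    \<lparr>carrier = carrier M, mult = undefined, one = undefined,
     ring.zero = \<zero>\<^bsub>M\<^esub>, ring.add = add M, ract = (\<lambda>x b. x \<cdot>\<^bsub>M\<^esub> \<phi> b)\<rparr>"

definition restrict_cochain :: "('b \<Rightarrow> 'a) \<Rightarrow> ('a, 'm) cochain \<Rightarrow> ('b, 'm) cochain"
  where "restrict_cochain \<phi> C = \<lparr>obj = (\<lambda>n. restrict_scalars \<phi> (obj C n)), diff = diff C\<rparr>"

text \<open>
  The modules of the complex \<open>D\<close> have elements of type \<open>nat \<Rightarrow> 'a\<close>. This is no restriction: a
  finitely generated \<open>R\<close>-module is a quotient of some \<open>R\<^sup>n\<close>, so its carrier injects into that type.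
\<close>

definition finitely_dominated :: "('a, 'c) ring_scheme \<Rightarrow> ('a, 'm) cochain \<Rightarrow> bool"
  where "finitely_dominated R C \<longleftrightarrow>
    (\<exists>D :: ('a, nat \<Rightarrow> 'a) cochain.
      cochain_complex R D \<and> bounded_cochain D \<and>
      (\<forall>n. fg_rmod R (obj D n) \<and> projective_rmod R (obj D n)) \<and>
      homotopy_equivalent_cochains R C D)"


section \<open>Tensor products\<close>

text \<open>
  For a right \<open>K\<close>-module \<open>M\<close> and a ring \<open>S\<close> containing \<open>K\<close>, the right \<open>S\<close>-module
  \<open>M \<otimes>\<^sub>K S\<close> is the free abelian group on \<open>M \<times> S\<close> modulo the
  usual relations; its elements are cosets.
\<close>

definition tensor_rels ::
    "('a, 'c) ring_scheme \<Rightarrow> ('a, 'm) right_module \<Rightarrow> ('a, 'd) ring_scheme \<Rightarrow> ('m \<times> 'a \<Rightarrow>\<^sub>0 int) set"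
  where "tensor_rels K M S =
    {frag_of (x \<oplus>\<^bsub>M\<^esub> y, s) - frag_of (x, s) - frag_of (y, s) |x y s.
       x \<in> carrier M \<and> y \<in> carrier M \<and> s \<in> carrier S}
    \<union> {frag_of (x, s \<oplus>\<^bsub>S\<^esub> t) - frag_of (x, s) - frag_of (x, t) |x s t.
       x \<in> carrier M \<and> s \<in> carrier S \<and> t \<in> carrier S}
    \<union> {frag_of (x \<cdot>\<^bsub>M\<^esub> a, s) - frag_of (x, a \<otimes>\<^bsub>S\<^esub> s) |x a s.
       x \<in> carrier M \<and> a \<in> carrier K \<and> s \<in> carrier S}"

abbreviation tensor_free ::
    "('a, 'm) right_module \<Rightarrow> ('a, 'd) ring_scheme \<Rightarrow> ('m \<times> 'a \<Rightarrow>\<^sub>0 int) monoid"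
  where "tensor_free M S \<equiv> free_Abelian_group (carrier M \<times> carrier S)"

definition tensor_ker ::
    "('a, 'c) ring_scheme \<Rightarrow> ('a, 'm) right_module \<Rightarrow> ('a, 'd) ring_scheme \<Rightarrow> ('m \<times> 'a \<Rightarrow>\<^sub>0 int) set"
  where "tensor_ker K M S = generate (tensor_free M S) (tensor_rels K M S)"

text \<open>
  The map between tensor products induced by \<open>\<phi>\<close> on pure tensors: the coset of \<open>c\<close> is sent to
  the coset of the image of \<open>c\<close> under the linear extension of \<open>\<phi>\<close>.
\<close>

definition tensor_map ::
    "('a, 'c) ring_scheme \<Rightarrow> ('a, 'n) right_module \<Rightarrow> ('a, 'd) ring_scheme \<Rightarrow> ('m \<times> 'a \<Rightarrow> 'n \<times> 'a)
      \<Rightarrow> ('m \<times> 'a \<Rightarrow>\<^sub>0 int) set \<Rightarrow> ('n \<times> 'a \<Rightarrow>\<^sub>0 int) set"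
  where "tensor_map K N S \<phi> X =
    the_elem ((\<lambda>c. tensor_ker K N S #>\<^bsub>tensor_free N S\<^esub> frag_extend (frag_of \<circ> \<phi>) c) ` X)"

definition tensor_rmod ::
    "('a, 'c) ring_scheme \<Rightarrow> ('a, 'm) right_module \<Rightarrow> ('a, 'd) ring_scheme
      \<Rightarrow> ('a, ('m \<times> 'a \<Rightarrow>\<^sub>0 int) set) right_module"
  where "tensor_rmod K M S =
    (let Q = tensor_free M S Mod tensor_ker K M S in
      \<lparr>carrier = carrier Q, mult = undefined, one = undefined,
       ring.zero = \<one>\<^bsub>Q\<^esub>, ring.add = mult Q,
       ract = (\<lambda>X t. tensor_map K M S (\<lambda>(x, s). (x, s \<otimes>\<^bsub>S\<^esub> t)) X)\<rparr>)"

definition tensor_cochain ::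
    "('a, 'c) ring_scheme \<Rightarrow> ('a, 'm) cochain \<Rightarrow> ('a, 'd) ring_scheme
      \<Rightarrow> ('a, ('m \<times> 'a \<Rightarrow>\<^sub>0 int) set) cochain"
  where "tensor_cochain K C S =
    \<lparr>obj = (\<lambda>n. tensor_rmod K (obj C n) S),
     diff = (\<lambda>n. tensor_map K (obj C (n + 1)) S (\<lambda>(x, s). (diff C n x, s)))\<rparr>"


section \<open>Laurent polynomials and Laurent series in two variables\<close>

text \<open>
  A function \<open>f\<close> on \<open>int \<times> int\<close> stands for the formal Laurent series with coefficient
  \<open>f (i, j)\<close> at \<open>x\<^sup>i y\<^sup>j\<close>. All rings below are sets of such series with pointwise
  addition and the convolution product, so that they contain the Laurent polynomial
  ring literally. The convolution sums are finite in each of them.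
\<close>

type_synonym 'a series = "int \<times> int \<Rightarrow> 'a"

definition series_mult :: "('a, 'c) ring_scheme \<Rightarrow> 'a series \<Rightarrow> 'a series \<Rightarrow> 'a series"
  where "series_mult R f g =
    (\<lambda>n. \<Oplus>\<^bsub>R\<^esub>p\<in>{p. f p \<noteq> \<zero>\<^bsub>R\<^esub> \<and> g (n - p) \<noteq> \<zero>\<^bsub>R\<^esub>}. f p \<otimes>\<^bsub>R\<^esub> g (n - p))"

definition series_const :: "('a, 'c) ring_scheme \<Rightarrow> 'a \<Rightarrow> 'a series"
  where "series_const R r = (\<lambda>n. if n = 0 then r else \<zero>\<^bsub>R\<^esub>)"

definition series_ring :: "('a, 'c) ring_scheme \<Rightarrow> 'a series set \<Rightarrow> 'a series ring"
  where "series_ring R A =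
    \<lparr>carrier = A, mult = series_mult R, one = series_const R \<one>\<^bsub>R\<^esub>,
     ring.zero = series_const R \<zero>\<^bsub>R\<^esub>, ring.add = (\<lambda>f g n. f n \<oplus>\<^bsub>R\<^esub> g n)\<rparr>"

definition series_on :: "('a, 'c) ring_scheme \<Rightarrow> 'a series set"
  where "series_on R = {f. \<forall>n. f n \<in> carrier R}"

definition monom_shift :: "int \<times> int \<Rightarrow> 'a series \<Rightarrow> 'a series"
  where "monom_shift v f = (\<lambda>n. f (n - v))"

definition laurent_polys :: "('a, 'c) ring_scheme \<Rightarrow> 'a series set"
  where "laurent_polys R = {f \<in> series_on R. finite {n. f n \<noteq> \<zero>\<^bsub>R\<^esub>}}"

text \<open>
  The signs \<open>\<epsilon>, \<delta> \<in> {1, -1}\<close> select between a variable and its inverse.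
  For \<open>K = R[x,x\<^sup>-\<^sup>1]\<close> and \<open>z = y\<^sup>\<delta>\<close>, a series \<open>f\<close> lies in \<open>K[[z]]\<close> if only
  nonnegative powers of \<open>z\<close> occur and the coefficient of each power is a Laurent
  polynomial in \<open>x\<close>; it lies in \<open>K((z))\<close> if \<open>z\<^sup>k f\<close> lies in \<open>K[[z]]\<close> for some \<open>k\<close>.
\<close>

definition power_series_y :: "('a, 'c) ring_scheme \<Rightarrow> int \<Rightarrow> 'a series set"
  where "power_series_y R \<delta> = {f \<in> series_on R.
    (\<forall>j. finite {i. f (i, j) \<noteq> \<zero>\<^bsub>R\<^esub>}) \<and> (\<forall>i j. f (i, j) \<noteq> \<zero>\<^bsub>R\<^esub> \<longrightarrow> 0 \<le> \<delta> * j)}"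

definition laurent_series_y :: "('a, 'c) ring_scheme \<Rightarrow> int \<Rightarrow> 'a series set"
  where "laurent_series_y R \<delta> =
    {f. \<exists>k::nat. monom_shift (0, \<delta> * int k) f \<in> power_series_y R \<delta>}"

definition power_series_x :: "('a, 'c) ring_scheme \<Rightarrow> int \<Rightarrow> 'a series set"
  where "power_series_x R \<epsilon> = {f \<in> series_on R.
    (\<forall>i. finite {j. f (i, j) \<noteq> \<zero>\<^bsub>R\<^esub>}) \<and> (\<forall>i j. f (i, j) \<noteq> \<zero>\<^bsub>R\<^esub> \<longrightarrow> 0 \<le> \<epsilon> * i)}"

definition laurent_series_x :: "('a, 'c) ring_scheme \<Rightarrow> int \<Rightarrow> 'a series set"
  where "laurent_series_x R \<epsilon> =
    {f. \<exists>k::nat. monom_shift (\<epsilon> * int k, 0) f \<in> power_series_x R \<epsilon>}"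

definition power_series_xy :: "('a, 'c) ring_scheme \<Rightarrow> int \<Rightarrow> int \<Rightarrow> 'a series set"
  where "power_series_xy R \<epsilon> \<delta> = {f \<in> series_on R.
    \<forall>i j. f (i, j) \<noteq> \<zero>\<^bsub>R\<^esub> \<longrightarrow> 0 \<le> \<epsilon> * i \<and> 0 \<le> \<delta> * j}"

definition laurent_series_xy :: "('a, 'c) ring_scheme \<Rightarrow> int \<Rightarrow> int \<Rightarrow> 'a series set"
  where "laurent_series_xy R \<epsilon> \<delta> =
    {f. \<exists>k0::nat. \<forall>k\<ge>k0. monom_shift (\<epsilon> * int k, \<delta> * int k) f \<in> power_series_xy R \<epsilon> \<delta>}"

definition LPoly :: "('a, 'c) ring_scheme \<Rightarrow> 'a series ring"
  where "LPoly R = series_ring R (laurent_polys R)"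

definition LSer_y :: "('a, 'c) ring_scheme \<Rightarrow> int \<Rightarrow> 'a series ring"
  where "LSer_y R \<delta> = series_ring R (laurent_series_y R \<delta>)"

definition LSer_x :: "('a, 'c) ring_scheme \<Rightarrow> int \<Rightarrow> 'a series ring"
  where "LSer_x R \<epsilon> = series_ring R (laurent_series_x R \<epsilon>)"

definition LSer_xy :: "('a, 'c) ring_scheme \<Rightarrow> int \<Rightarrow> int \<Rightarrow> 'a series ring"
  where "LSer_xy R \<epsilon> \<delta> = series_ring R (laurent_series_xy R \<epsilon> \<delta>)"

end

(*
  The differential of C is a finitely supported matrix over the lattice of monomials, so C and all its tensor
  products with rings of series consist of functions on the lattice, with supports in various families.
  R-finite domination means that there is an R-linear homotopy h such that 1 - dh - hd has image supported
  in a fixed finite set. Such an h gives acyclicity over each ring of series by an infinite "telescope" along a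
  direction in which the series are allowed to be infinite. Conversely the contractions over the four edge rings
  and the four corner rings, truncated to half planes and quadrants, are glued to such an h. Finally h splits the
  idempotent up to homotopy inside a sum of finitely generated free R-modules, which gives the complex D.
*)
theory Submission
  imports Defs "HOL-Library.Function_Algebras" "HOL.Modules" "HOL-Library.Countable"
begin

text \<open>The telescope cannot run in \<open>C\<close> itself: \<open>h\<close> is only R-linear,
  while a completion of \<open>C\<close> is a tensor product over Laurent polynomials. It runs on
  functions of two lattice points, which model the tensor product over R. Moving a monomial from one
  factor to the other is a shift \<open>T\<close>, and the completion of \<open>C\<close> reappears
  as the functions invariant under all such moves. Two directions span the lattice, but a telescope
  exists only along the one in which series may be infinite. There it makes \<open>1 - T\<close> a
  quasi-isomorphism, so the invariant functions form an acyclic complex, and an acyclic complex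
  passes through the second direction for formal reasons.

  In the converse the contractions over two adjacent edges need not agree on the corner between
  them. A contraction over the corner ring makes their difference null-homotopic, and subtracting a
  boundary from the homotopies on the half planes in x makes the pieces match. The half planes
  retreat with the degree, so that truncation is compatible with the differential; since
  \<open>C\<close> is bounded below, they can be chosen so that opposite ones are disjoint in every
  degree from \<open>lo\<close> on.\<close>

definition add_subgroup :: "'v::ab_group_add set \<Rightarrow> bool"
  where "add_subgroup A \<longleftrightarrow> 0 \<in> A \<and> (\<forall>x\<in>A. \<forall>y\<in>A. x - y \<in> A)"

lemma add_subgroup_zero: "add_subgroup A \<Longrightarrow> 0 \<in> A"
  and add_subgroup_diff: "add_subgroup A \<Longrightarrow> x \<in> A \<Longrightarrow> y \<in> A \<Longrightarrow> x - y \<in> A"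
  by (auto simp: add_subgroup_def)

lemma add_subgroup_minus: "add_subgroup A \<Longrightarrow> x \<in> A \<Longrightarrow> - x \<in> A"
  using add_subgroup_diff[of A 0 x] add_subgroup_zero[of A] by simp

lemma add_subgroup_add: "add_subgroup A \<Longrightarrow> x \<in> A \<Longrightarrow> y \<in> A \<Longrightarrow> x + y \<in> A"
  using add_subgroup_diff[of A x "- y"] add_subgroup_minus[of A y] by simp

lemma add_subgroup_sum: "add_subgroup A \<Longrightarrow> (\<And>i. i \<in> I \<Longrightarrow> f i \<in> A) \<Longrightarrow> sum f I \<in> A"
  by (induction I rule: infinite_finite_induct) (auto simp: add_subgroup_zero add_subgroup_add)

lemma sum_fun_app: "(\<Sum>i\<in>I. f i) x = (\<Sum>i\<in>I. f i x)"
  by (induction I rule: infinite_finite_induct) auto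

section \<open>Acyclicity of a quotient complex\<close>

text \<open>
  If \<open>0 \<rightarrow> X \<rightarrow> X \<rightarrow> Y \<rightarrow> 0\<close> is an exact sequence of complexes whose first map \<open>u\<close> is a
  quasi-isomorphism, then \<open>Y\<close> is acyclic.
\<close>

lemma ses_acyclic:
  fixes X Y :: "int \<Rightarrow> 'x::ab_group_add set" and d :: "int \<Rightarrow> 'x \<Rightarrow> 'x"
  assumes X: "\<And>n. add_subgroup (X n)"
    and d: "\<And>n x. x \<in> X n \<Longrightarrow> d n x \<in> X (n + 1)"
    and dd: "\<And>n x. x \<in> X n \<Longrightarrow> d (n + 1) (d n x) = 0"
    and d_add: "\<And>n. additive (d n)"
    and u: "\<And>n x. x \<in> X n \<Longrightarrow> u x \<in> X n"
    and u_add: "additive u"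
    and ud: "\<And>n x. x \<in> X n \<Longrightarrow> u (d n x) = d n (u x)"
    and u_inj: "\<And>n x. x \<in> X n \<Longrightarrow> u x = 0 \<Longrightarrow> x = 0"
    and p: "\<And>n x. x \<in> X n \<Longrightarrow> p x \<in> Y n"
    and p_add: "\<And>n x y. x \<in> X n \<Longrightarrow> y \<in> X n \<Longrightarrow> p (x + y) = p x + p y"
    and pd: "\<And>n x. x \<in> X n \<Longrightarrow> p (d n x) = d n (p x)"
    and p_surj: "\<And>n y. y \<in> Y n \<Longrightarrow> \<exists>x\<in>X n. p x = y"
    and pu: "\<And>n x. x \<in> X n \<Longrightarrow> p (u x) = 0"
    and p_ker: "\<And>n x. x \<in> X n \<Longrightarrow> p x = 0 \<Longrightarrow> \<exists>b\<in>X n. x = u b"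
    and H_inj: "\<And>n a x. a \<in> X (n + 1) \<Longrightarrow> d (n + 1) a = 0 \<Longrightarrow> x \<in> X n \<Longrightarrow> u a = d n x
      \<Longrightarrow> \<exists>c\<in>X n. a = d n c"
    and H_surj: "\<And>n z. z \<in> X (n + 1) \<Longrightarrow> d (n + 1) z = 0
      \<Longrightarrow> \<exists>y\<in>X (n + 1). \<exists>w\<in>X n. d (n + 1) y = 0 \<and> z = u y + d n w"
    and y: "y \<in> Y (n + 1)" "d (n + 1) y = 0"
  shows "\<exists>w\<in>Y n. d n w = y"
proof -
  interpret d: additive "d k" for k by (rule d_add)
  interpret u: additive u by (rule u_add)
  obtain x where x: "x \<in> X (n + 1)" "p x = y" using p_surj[OF y(1)] by (elim bexE)
  have "p (d (n + 1) x) = 0" using pd x y by simp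
  then obtain a where a: "a \<in> X (n + 1 + 1)" "d (n + 1) x = u a"
    using p_ker[OF d[OF x(1)]] by blast
  have "u (d (n + 1 + 1) a) = 0" using ud[OF a(1)] a(2) dd[OF x(1)] by simp
  then have "d (n + 1 + 1) a = 0" using u_inj[OF d[OF a(1)]] by blast
  \<comment> \<open>The cocycle \<open>a\<close> becomes the boundary of \<open>x\<close> under
    \<open>u\<close>, so injectivity on cohomology makes it a boundary \<open>d c\<close>.
    Correcting \<open>x\<close> by \<open>u c\<close> is invisible to \<open>p\<close> and produces
    a cocycle.\<close>
  then obtain c where c: "c \<in> X (n + 1)" "a = d (n + 1) c"
    using H_inj[OF a(1) _ x(1)] a(2) by auto
  have xc: "x - u c \<in> X (n + 1)" using add_subgroup_diff[OF X] x(1) u c(1) by blast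
  have "d (n + 1) (x - u c) = 0" using a(2) c ud[OF c(1)] by (simp add: d.diff)
  \<comment> \<open>Surjectivity on cohomology: up to a boundary the corrected lift lies in the
    image of \<open>u\<close>, which \<open>p\<close> kills.\<close>
  then obtain z w where z: "z \<in> X (n + 1)" "w \<in> X n" "x - u c = u z + d n w"
    using H_surj[OF xc] by blast
  then have "x = u (c + z) + d n w" by (simp add: u.add algebra_simps)
  moreover have cz: "c + z \<in> X (n + 1)" using add_subgroup_add[OF X] c(1) z(1) by blast
  ultimately have "p x = p (u (c + z)) + p (d n w)" using p_add u d z(2) by blast
  then have "d n (p w) = y" using x(2) pu[OF cz] pd[OF z(2)] by simp
  then show ?thesis using p z(2) by blast
qed


section \<open>Sums over the translates of a function\<close>

text \<open>Only the nonzero terms are summed, so the index set is finite wherever the sum makes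
  sense; a sum over an infinite set would silently be 0.\<close>

definition transl_sum :: "(int \<Rightarrow> 'g) \<Rightarrow> int set \<Rightarrow> ('g::ab_group_add \<Rightarrow> 'v) \<Rightarrow> 'g \<Rightarrow> 'v::ab_group_add"
  where "transl_sum \<tau> I c \<gamma> = (\<Sum>i\<in>{i\<in>I. c (\<gamma> - \<tau> i) \<noteq> 0}. c (\<gamma> - \<tau> i))"

definition slab :: "('g \<Rightarrow> int) \<Rightarrow> ('g \<Rightarrow> 'v::ab_group_add) set"
  where "slab l = {c. \<exists>N. \<forall>\<gamma>. c \<gamma> \<noteq> 0 \<longrightarrow> \<bar>l \<gamma>\<bar> \<le> N}"

definition translate :: "'g::ab_group_add \<Rightarrow> ('g \<Rightarrow> 'v) \<Rightarrow> 'g \<Rightarrow> 'v"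
  where "translate a c = (\<lambda>\<gamma>. c (\<gamma> - a))"

definition invariant :: "(int \<Rightarrow> 'g::ab_group_add) \<Rightarrow> ('g \<Rightarrow> 'v) set"
  where "invariant \<tau> = {c. \<forall>i \<gamma>. c (\<gamma> - \<tau> i) = c \<gamma>}"

text \<open>The coefficients \<open>\<delta>\<close> and the translations \<open>\<theta>\<close>
  are separate parameters because the same coefficients act on the lattice with
  \<open>\<theta> p = p\<close> and on its square with \<open>\<theta> p = (0, p)\<close>.\<close>

definition local_op :: "'p set \<Rightarrow> ('p \<Rightarrow> 'v \<Rightarrow> 'v) \<Rightarrow> ('p \<Rightarrow> 'g::ab_group_add) \<Rightarrow> ('g \<Rightarrow> 'v) \<Rightarrow> 'g \<Rightarrow> 'v::ab_group_add"
  where "local_op P \<delta> \<theta> c \<gamma> = (\<Sum>p\<in>P. \<delta> p (c (\<gamma> - \<theta> p)))"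

lemma local_op_add:
  assumes "\<And>p. additive (\<delta> p)"
  shows "additive (local_op P \<delta> \<theta>)"
  by (rule additive.intro) (simp add: local_op_def fun_eq_iff additive.add[OF assms] sum.distrib)

lemma local_op_translate: "local_op P \<delta> \<theta> (translate a c) = translate a (local_op P \<delta> \<theta> c)"
  by (simp add: local_op_def translate_def fun_eq_iff algebra_simps)

lemma translate_additive: "additive (translate a)"
  by (rule additive.intro) (simp add: translate_def fun_eq_iff)

lemma transl_sum_eq:
  assumes "finite J" "{i\<in>I. c (\<gamma> - \<tau> i) \<noteq> 0} \<subseteq> J" "J \<subseteq> I"
  shows "transl_sum \<tau> I c \<gamma> = (\<Sum>i\<in>J. c (\<gamma> - \<tau> i))"
  unfolding transl_sum_def by (rule sum.mono_neutral_left) (use assms in auto)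

text \<open>
  For \<open>X\<close> the functions in \<open>Y\<close> that are supported in a slab and \<open>T\<close> the translation by \<open>\<tau> 1\<close>,
  summation over the translates makes \<open>0 \<rightarrow> X \<rightarrow> X \<rightarrow> Z \<rightarrow> 0\<close> exact, where the first map is
  \<open>1 - T\<close> and \<open>Z\<close> are the \<open>\<tau>\<close>-invariant functions in \<open>Y\<close>.
\<close>

lemma invariant_acyclic:
  fixes P :: "'p set" and \<theta> :: "'p \<Rightarrow> 'g::ab_group_add" and Y :: "int \<Rightarrow> ('g::ab_group_add \<Rightarrow> 'v::ab_group_add) set"
    and \<tau> :: "int \<Rightarrow> 'g" and l :: "'g \<Rightarrow> int" and \<delta> :: "int \<Rightarrow> 'p \<Rightarrow> 'v \<Rightarrow> 'v"
  defines "d \<equiv> \<lambda>n. local_op P (\<delta> n) \<theta>"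
    and "X \<equiv> \<lambda>n. Y n \<inter> slab l"
    and "u \<equiv> \<lambda>c. c - translate (\<tau> 1) c"
  assumes P: "finite P" and \<delta>: "\<And>n p. additive (\<delta> n p)"
    and l: "\<And>a b. l (a - b) = l a - l b" and \<tau>: "\<And>i j. \<tau> (i + j) = \<tau> i + \<tau> j"
    and l\<tau>: "\<And>i. l (\<tau> i) = i"
    and Y: "\<And>n. add_subgroup (Y n)"
    and Y_d: "\<And>n c. c \<in> Y n \<Longrightarrow> d n c \<in> Y (n + 1)"
    and dd: "\<And>n c. c \<in> Y n \<Longrightarrow> d (n + 1) (d n c) = 0"
    and Y_T: "\<And>n c. c \<in> Y n \<Longrightarrow> translate (\<tau> 1) c \<in> Y n"
    and Y_restr: "\<And>n c. c \<in> Y n \<Longrightarrow> (\<lambda>\<gamma>. if l \<gamma> = 0 then c \<gamma> else 0) \<in> Y n"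
    and Y_sum: "\<And>n c I. c \<in> Y n \<Longrightarrow> c \<in> slab l \<Longrightarrow> transl_sum \<tau> I c \<in> Y n"
    and H_inj: "\<And>n a x. a \<in> X (n + 1) \<Longrightarrow> d (n + 1) a = 0 \<Longrightarrow> x \<in> X n \<Longrightarrow> u a = d n x
      \<Longrightarrow> \<exists>c\<in>X n. a = d n c"
    and H_surj: "\<And>n z. z \<in> X (n + 1) \<Longrightarrow> d (n + 1) z = 0
      \<Longrightarrow> \<exists>y\<in>X (n + 1). \<exists>w\<in>X n. d (n + 1) y = 0 \<and> z = u y + d n w"
    and y: "y \<in> Y (n + 1)" "y \<in> invariant \<tau>" "d (n + 1) y = 0"
  shows "\<exists>w \<in> Y n \<inter> invariant \<tau>. d n w = y"
proof -
  define \<pi> :: "('g \<Rightarrow> 'v) \<Rightarrow> 'g \<Rightarrow> 'v" where "\<pi> = transl_sum \<tau> UNIV"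
  have \<tau>0: "\<tau> 0 = 0" using \<tau>[of 0 0] by simp
  have l0: "l 0 = 0" using l[of 0 0] by simp
  have \<tau>d: "\<tau> (i - j) = \<tau> i - \<tau> j" for i j using \<tau>[of "i - j" j] by simp
  have l\<gamma>: "l (\<gamma> - \<tau> i) = l \<gamma> - i" for \<gamma> i by (simp add: l l\<tau>)
  interpret d: additive "d k" for k unfolding d_def by (rule local_op_add) (rule \<delta>)
  interpret T: additive "translate a" for a :: 'g by (rule translate_additive)
  have slabD: "i \<in> {l \<gamma> - N..l \<gamma> + N}" if "\<forall>\<gamma>. c \<gamma> \<noteq> 0 \<longrightarrow> \<bar>l \<gamma>\<bar> \<le> N" "c (\<gamma> - \<tau> i) \<noteq> 0" for c :: "'g \<Rightarrow> 'v" and N \<gamma> i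
    using that(1)[rule_format, OF that(2)] unfolding l\<gamma> by (auto simp: abs_le_iff)
  have \<pi>_eq: "\<pi> c \<gamma> = (\<Sum>i\<in>{a..b}. c (\<gamma> - \<tau> i))"
    if "\<forall>\<gamma>. c \<gamma> \<noteq> 0 \<longrightarrow> \<bar>l \<gamma>\<bar> \<le> N" "a \<le> l \<gamma> - N" "l \<gamma> + N \<le> b" for c \<gamma> N a b
    unfolding \<pi>_def by (rule transl_sum_eq) (use slabD[OF that(1)] that(2,3) in force)+
  have slab_sub: "add_subgroup (slab l :: ('g \<Rightarrow> 'v) set)"
  proof -
    have "x - y \<in> slab l" if xy: "x \<in> slab l" "y \<in> slab l" for x y :: "'g \<Rightarrow> 'v"
    proof -
      obtain N M where "\<forall>\<gamma>. x \<gamma> \<noteq> 0 \<longrightarrow> \<bar>l \<gamma>\<bar> \<le> N" "\<forall>\<gamma>. y \<gamma> \<noteq> 0 \<longrightarrow> \<bar>l \<gamma>\<bar> \<le> M"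
        using xy by (auto simp: slab_def)
      then have "\<forall>\<gamma>. (x - y) \<gamma> \<noteq> 0 \<longrightarrow> \<bar>l \<gamma>\<bar> \<le> max N M"
        by (auto simp: le_max_iff_disj) (metis diff_zero)
      then show ?thesis unfolding slab_def by blast
    qed
    then show ?thesis by (auto simp: add_subgroup_def slab_def)
  qed
  have slab_T: "translate a c \<in> slab l" if "c \<in> slab l" for a and c :: "'g \<Rightarrow> 'v"
  proof -
    obtain N where N: "\<forall>\<gamma>. c \<gamma> \<noteq> 0 \<longrightarrow> \<bar>l \<gamma>\<bar> \<le> N" using \<open>c \<in> slab l\<close> by (auto simp: slab_def)
    have "\<bar>l \<gamma>\<bar> \<le> N + \<bar>l a\<bar>" if "c (\<gamma> - a) \<noteq> 0" for \<gamma>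
      using N[rule_format, OF that] by (simp add: l)
    then show ?thesis by (auto simp: slab_def translate_def)
  qed
  have slab_d: "d n c \<in> slab l" and slab_bd: "\<exists>N M. 0 \<le> M \<and> (\<forall>\<gamma>. c \<gamma> \<noteq> 0 \<longrightarrow> \<bar>l \<gamma>\<bar> \<le> N) \<and> (\<forall>p\<in>P. \<bar>l (\<theta> p)\<bar> \<le> M)
      \<and> (\<forall>\<gamma>. d n c \<gamma> \<noteq> 0 \<longrightarrow> \<bar>l \<gamma>\<bar> \<le> N + M)" if c: "c \<in> slab l" for n c
  proof -
    obtain N where N: "\<forall>\<gamma>. c \<gamma> \<noteq> 0 \<longrightarrow> \<bar>l \<gamma>\<bar> \<le> N" using c by (auto simp: slab_def)
    define M where "M = (\<Sum>p\<in>P. \<bar>l (\<theta> p)\<bar>)"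
    have M: "\<bar>l (\<theta> p)\<bar> \<le> M" if "p \<in> P" for p unfolding M_def by (rule member_le_sum) (use that P in auto)
    have "M \<ge> 0" unfolding M_def by (simp add: sum_nonneg)
    moreover have "\<bar>l \<gamma>\<bar> \<le> N + M" if nz: "d n c \<gamma> \<noteq> 0" for \<gamma>
    proof -
      obtain p where p: "p \<in> P" "\<delta> n p (c (\<gamma> - \<theta> p)) \<noteq> 0"
        by (rule sum.not_neutral_contains_not_neutral[OF nz[unfolded d_def local_op_def]])
      then have "c (\<gamma> - \<theta> p) \<noteq> 0" using additive.zero[OF \<delta>] by metis
      then show ?thesis using N[rule_format, of "\<gamma> - \<theta> p"] M[OF p(1)] by (simp add: l)
    qed
    ultimately show "\<exists>N M. 0 \<le> M \<and> (\<forall>\<gamma>. c \<gamma> \<noteq> 0 \<longrightarrow> \<bar>l \<gamma>\<bar> \<le> N) \<and> (\<forall>p\<in>P. \<bar>l (\<theta> p)\<bar> \<le> M)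
      \<and> (\<forall>\<gamma>. d n c \<gamma> \<noteq> 0 \<longrightarrow> \<bar>l \<gamma>\<bar> \<le> N + M)" using N M by blast
    then show "d n c \<in> slab l" by (auto simp: slab_def)
  qed
  show ?thesis
  proof (rule ses_acyclic[of X d u \<pi> "\<lambda>n. Y n \<inter> invariant \<tau>" y n])
    show X: "add_subgroup (X n)" for n
      using Y[of n] slab_sub by (auto simp: X_def add_subgroup_def)
    show "d n x \<in> X (n + 1)" if "x \<in> X n" for n x using that Y_d slab_d by (auto simp: X_def)
    show "d (n + 1) (d n x) = 0" if "x \<in> X n" for n x using that dd by (auto simp: X_def)
    show "additive (d n)" for n by (rule d.additive_axioms)
    show uX: "u x \<in> X n" if "x \<in> X n" for n x
      unfolding u_def by (rule add_subgroup_diff[OF X]) (use that Y_T slab_T in \<open>auto simp: X_def\<close>)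
    show "additive u" by (rule additive.intro) (simp add: u_def T.add)
    show "u (d n x) = d n (u x)" for n x
      by (simp add: u_def d.diff) (simp add: d_def local_op_translate)
    show "x = 0" if x: "x \<in> X n" and ux: "u x = 0" for n x
    proof
      fix \<gamma>
      have step: "x (\<gamma> - \<tau> 1) = x \<gamma>" for \<gamma>
        using fun_cong[OF ux, of \<gamma>] by (simp add: u_def translate_def)
      \<comment> \<open>A function fixed by the translation is constant along \<open>\<tau>\<close>,
        so a nonzero value would recur at arbitrarily low height, outside the slab.\<close>
      have it: "x (\<gamma> - \<tau> (int k)) = x \<gamma>" for k
      proof (induction k)
        case (Suc k)
        have e: "\<gamma> - \<tau> (int (Suc k)) = (\<gamma> - \<tau> (int k)) - \<tau> 1" using \<tau>[of "int k" 1] by (simp add: algebra_simps)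
        show ?case unfolding e step by (rule Suc)
      qed (simp add: \<tau>0)
      obtain N where N: "\<forall>\<gamma>. x \<gamma> \<noteq> 0 \<longrightarrow> \<bar>l \<gamma>\<bar> \<le> N" using x by (auto simp: X_def slab_def)
      show "x \<gamma> = 0 \<gamma>"
      proof (rule ccontr)
        assume "x \<gamma> \<noteq> 0 \<gamma>"
        then have "\<bar>l (\<gamma> - \<tau> (int (nat (\<bar>N\<bar> + \<bar>l \<gamma>\<bar> + 1))))\<bar> \<le> N" by (intro N[rule_format]) (simp only: it, simp)
        then show False unfolding l\<gamma> by simp
      qed
    qed
    show "\<pi> x \<in> Y n \<inter> invariant \<tau>" if x: "x \<in> X n" for n x
    proof -
      obtain N where N: "\<forall>\<gamma>. x \<gamma> \<noteq> 0 \<longrightarrow> \<bar>l \<gamma>\<bar> \<le> N" using x by (auto simp: X_def slab_def)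
      have "\<pi> x (\<gamma> - \<tau> j) = \<pi> x \<gamma>" for \<gamma> j
      proof -
        have "\<pi> x (\<gamma> - \<tau> j) = (\<Sum>i\<in>{l \<gamma> - j - N..l \<gamma> - j + N}. x (\<gamma> - \<tau> (i + j)))"
          by (subst \<pi>_eq[OF N, of "l \<gamma> - j - N" _ "l \<gamma> - j + N"]) (simp_all add: l\<gamma> \<tau> algebra_simps)
        also have "\<dots> = (\<Sum>i\<in>{l \<gamma> - N..l \<gamma> + N}. x (\<gamma> - \<tau> i))"
          by (rule sum.reindex_bij_witness[of _ "\<lambda>i. i - j" "\<lambda>i. i + j"]) auto
        also have "\<dots> = \<pi> x \<gamma>" by (rule \<pi>_eq[OF N, symmetric]) auto
        finally show ?thesis .
      qed
      then show ?thesis using x Y_sum by (auto simp: X_def \<pi>_def invariant_def)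
    qed
    show \<pi>_add: "\<pi> (x + y) = \<pi> x + \<pi> y" if xy: "x \<in> X n" "y \<in> X n" for n x y
    proof -
      obtain N M where N: "\<forall>\<gamma>. x \<gamma> \<noteq> 0 \<longrightarrow> \<bar>l \<gamma>\<bar> \<le> N" "\<forall>\<gamma>. y \<gamma> \<noteq> 0 \<longrightarrow> \<bar>l \<gamma>\<bar> \<le> M"
        using xy by (auto simp: X_def slab_def)
      have s: "\<forall>\<gamma>. (x + y) \<gamma> \<noteq> 0 \<longrightarrow> \<bar>l \<gamma>\<bar> \<le> max N M"
        using N by (auto simp: le_max_iff_disj) (metis add_0)
      show ?thesis
      proof
        fix \<gamma>
        let ?J = "{l \<gamma> - max N M..l \<gamma> + max N M}"
        show "\<pi> (x + y) \<gamma> = (\<pi> x + \<pi> y) \<gamma>"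
          using \<pi>_eq[OF s, of "l \<gamma> - max N M" \<gamma> "l \<gamma> + max N M"]
            \<pi>_eq[OF N(1), of "l \<gamma> - max N M" \<gamma> "l \<gamma> + max N M"]
            \<pi>_eq[OF N(2), of "l \<gamma> - max N M" \<gamma> "l \<gamma> + max N M"]
          by (simp add: sum.distrib plus_fun_def)
      qed
    qed
    show "\<pi> (d n x) = d n (\<pi> x)" if x: "x \<in> X n" for n x
    proof
      fix \<gamma>
      obtain N M where N: "0 \<le> M" "\<forall>\<gamma>. x \<gamma> \<noteq> 0 \<longrightarrow> \<bar>l \<gamma>\<bar> \<le> N" "\<And>p. p \<in> P \<Longrightarrow> \<bar>l (\<theta> p)\<bar> \<le> M"
        "\<forall>\<gamma>. d n x \<gamma> \<noteq> 0 \<longrightarrow> \<bar>l \<gamma>\<bar> \<le> N + M"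
        using slab_bd[of x n] x by (auto simp: X_def)
      \<comment> \<open>The window is widened by \<open>M\<close>, a bound on the heights of the
        translations \<open>\<theta>\<close>, so that one index set serves \<open>x\<close> at every
        point that \<open>d n\<close> reads.\<close>
      let ?J = "{l \<gamma> - (N + M)..l \<gamma> + (N + M)}"
      have "\<pi> (d n x) \<gamma> = (\<Sum>i\<in>?J. d n x (\<gamma> - \<tau> i))" by (rule \<pi>_eq[OF N(4)]) auto
      also have "\<dots> = (\<Sum>p\<in>P. \<Sum>i\<in>?J. \<delta> n p (x (\<gamma> - \<tau> i - \<theta> p)))"
        unfolding d_def local_op_def by (rule sum.swap)
      also have "\<dots> = (\<Sum>p\<in>P. \<delta> n p (\<pi> x (\<gamma> - \<theta> p)))"
      proof (rule sum.cong[OF refl])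
        fix p assume p: "p \<in> P"
        have "\<pi> x (\<gamma> - \<theta> p) = (\<Sum>i\<in>?J. x (\<gamma> - \<theta> p - \<tau> i))"
          by (rule \<pi>_eq[OF N(2)]) (use N(3)[OF p] in \<open>auto simp: l\<close>)
        then show "(\<Sum>i\<in>?J. \<delta> n p (x (\<gamma> - \<tau> i - \<theta> p))) = \<delta> n p (\<pi> x (\<gamma> - \<theta> p))"
          by (simp add: additive.sum[OF \<delta>] algebra_simps)
      qed
      finally show "\<pi> (d n x) \<gamma> = d n (\<pi> x) \<gamma>" by (simp add: d_def local_op_def)
    qed
    show "\<exists>x\<in>X n. \<pi> x = y" if y: "y \<in> Y n \<inter> invariant \<tau>" for n y
    proof
      \<comment> \<open>Every orbit of \<open>\<tau>\<close> meets height 0 exactly once. Cutting an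
        invariant function to height 0 keeps one point of each orbit, and summing the translates
        restores the function.\<close>
      let ?c = "\<lambda>\<gamma>. if l \<gamma> = 0 then y \<gamma> else 0"
      have "?c \<in> slab l" unfolding slab_def by (auto intro!: exI[of _ 0])
      then show "?c \<in> X n" using y Y_restr by (auto simp: X_def)
      show "\<pi> ?c = y"
      proof
        fix \<gamma>
        have "\<pi> ?c \<gamma> = (\<Sum>i\<in>{l \<gamma>}. ?c (\<gamma> - \<tau> i))"
          unfolding \<pi>_def by (rule transl_sum_eq) (auto simp: l\<gamma> split: if_splits)
        then show "\<pi> ?c \<gamma> = y \<gamma>" using y by (simp add: l\<gamma> invariant_def)
      qed
    qed
    show "\<pi> (u x) = 0" if x: "x \<in> X n" for n x
    proof
      fix \<gamma>
      obtain N where N: "\<forall>\<gamma>. x \<gamma> \<noteq> 0 \<longrightarrow> \<bar>l \<gamma>\<bar> \<le> N" using x by (auto simp: X_def slab_def)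
      have N': "\<forall>\<gamma>. u x \<gamma> \<noteq> 0 \<longrightarrow> \<bar>l \<gamma>\<bar> \<le> N + 1"
      proof (intro allI impI)
        fix \<gamma> assume "u x \<gamma> \<noteq> 0"
        then have "x \<gamma> \<noteq> 0 \<or> x (\<gamma> - \<tau> 1) \<noteq> 0" by (auto simp: u_def translate_def)
        then show "\<bar>l \<gamma>\<bar> \<le> N + 1" using N[rule_format, of \<gamma>] N[rule_format, of "\<gamma> - \<tau> 1"] by (auto simp: l\<gamma>)
      qed
      let ?a = "l \<gamma> - (N + 2)" and ?b = "l \<gamma> + (N + 2)"
      have "\<pi> (u x) \<gamma> = (\<Sum>i\<in>{?a..?b}. x (\<gamma> - \<tau> i)) - (\<Sum>i\<in>{?a..?b}. x (\<gamma> - \<tau> (i + 1)))"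
        by (subst \<pi>_eq[OF N', of ?a _ ?b])
          (simp_all add: u_def translate_def sum_subtractf \<tau> algebra_simps)
      also have "(\<Sum>i\<in>{?a..?b}. x (\<gamma> - \<tau> (i + 1))) = (\<Sum>i\<in>{?a + 1..?b + 1}. x (\<gamma> - \<tau> i))"
        by (rule sum.reindex_bij_witness[of _ "\<lambda>i. i - 1" "\<lambda>i. i + 1"]) auto
      also have "\<dots> = \<pi> x \<gamma>" by (rule \<pi>_eq[OF N, symmetric]) auto
      also have "(\<Sum>i\<in>{?a..?b}. x (\<gamma> - \<tau> i)) = \<pi> x \<gamma>" by (rule \<pi>_eq[OF N, symmetric]) auto
      finally show "\<pi> (u x) \<gamma> = 0 \<gamma>" by simp
    qed
    show "\<exists>b\<in>X n. x = u b" if x: "x \<in> X n" and \<pi>x: "\<pi> x = 0" for n x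
    proof
      \<comment> \<open>Formally \<open>b\<close> is the sum of \<open>T^k x\<close> over k >= 0,
        the inverse of \<open>1 - T\<close>. Its support is plainly bounded below; the bound above
        is what \<open>\<pi> x = 0\<close> provides.\<close>
      define b where "b = transl_sum \<tau> {0..} x"
      obtain N where N: "\<forall>\<gamma>. x \<gamma> \<noteq> 0 \<longrightarrow> \<bar>l \<gamma>\<bar> \<le> N" using x by (auto simp: X_def slab_def)
      have b_eq: "b \<gamma> = (\<Sum>i\<in>{0..m}. x (\<gamma> - \<tau> i))" if "m \<ge> l \<gamma> + N" for \<gamma> m
        unfolding b_def by (rule transl_sum_eq) (use slabD[OF N] that in force)+
      have "\<bar>l \<gamma>\<bar> \<le> N" if "b \<gamma> \<noteq> 0" for \<gamma>
      proof -
        have "{i \<in> {0..}. x (\<gamma> - \<tau> i) \<noteq> 0} \<noteq> {}"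
          using that unfolding b_def transl_sum_def by (metis sum.empty)
        then obtain i where i: "i \<ge> 0" "x (\<gamma> - \<tau> i) \<noteq> 0" by auto
        have "i \<le> l \<gamma> + N" using slabD[OF N i(2)] by simp
        then have 1: "- N \<le> l \<gamma>" using i by simp
        have "l \<gamma> \<le> N"
        proof (rule ccontr)
          assume "\<not> l \<gamma> \<le> N"
          \<comment> \<open>Above height \<open>N\<close> every index with a nonzero term is
            positive, so the one-sided sum equals the full one.\<close>
          then have "b \<gamma> = \<pi> x \<gamma>" unfolding b_def \<pi>_def transl_sum_def
            by (intro sum.cong) (use slabD[OF N] in force)+
          then show False using \<pi>x that by simp
        qed
        then show ?thesis using 1 by simp
      qed
      then have "b \<in> slab l" by (auto simp: slab_def)
      moreover have "b \<in> Y n" using x Y_sum by (auto simp: b_def X_def)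
      ultimately show "b \<in> X n" by (simp add: X_def)
      show "x = u b"
      proof
        fix \<gamma>
        define m where "m = \<bar>l \<gamma>\<bar> + \<bar>N\<bar> + 1"
        have m: "m \<ge> 0" "m \<ge> l \<gamma> + N" "m - 1 \<ge> 0" by (auto simp: m_def)
        have ins: "{0..m} = insert 0 {1..m}" using m(1) by auto
        have "b \<gamma> = x (\<gamma> - \<tau> 0) + (\<Sum>i\<in>{1..m}. x (\<gamma> - \<tau> i))"
          unfolding b_eq[OF m(2)] ins by (subst sum.insert) auto
        also have "(\<Sum>i\<in>{1..m}. x (\<gamma> - \<tau> i)) = (\<Sum>i\<in>{0..m - 1}. x (\<gamma> - \<tau> (i + 1)))"
          by (rule sum.reindex_bij_witness[of _ "\<lambda>i. i + 1" "\<lambda>i. i - 1"]) auto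
        also have "\<dots> = (\<Sum>i\<in>{0..m - 1}. x (\<gamma> - \<tau> 1 - \<tau> i))" by (simp add: \<tau> algebra_simps)
        also have "\<dots> = b (\<gamma> - \<tau> 1)" by (rule b_eq[symmetric]) (use m(2) in \<open>simp add: l\<gamma>\<close>)
        finally show "x \<gamma> = u b \<gamma>" by (simp add: u_def translate_def \<tau>0)
      qed
    qed
  qed (use H_inj H_surj y in \<open>auto simp: X_def\<close>)
qed

declare split_paired_All [simp del] split_paired_Ex [simp del]

section \<open>Complexes over the lattice of monomials\<close>

definition supp :: "('g \<Rightarrow> 'v::zero) \<Rightarrow> 'g set"
  where "supp f = {v. f v \<noteq> 0}"

lemma supp_add: "supp (f + g) \<subseteq> supp f \<union> supp (g :: 'g \<Rightarrow> 'v::ab_group_add)"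
  and supp_diff: "supp (f - g) \<subseteq> supp f \<union> supp (g :: 'g \<Rightarrow> 'v::ab_group_add)"
  by (auto simp: supp_def)

definition smul :: "int \<Rightarrow> int \<times> int \<Rightarrow> int \<times> int"
  where "smul i t = (i * fst t, i * snd t)"

lemma smul_simps [simp]: "smul 0 t = 0" "smul 1 t = t"
  by (simp_all add: smul_def prod_eq_iff)

lemma smul_add: "smul (i + j) t = smul i t + smul j t" "smul i (a + b) = smul i a + smul i b"
  by (simp_all add: smul_def prod_eq_iff algebra_simps)

text \<open>Stability under subsets, finite unions and translations makes the functions with support
  in the family a module over Laurent polynomials.\<close>

definition support_ideal :: "(int \<times> int) set set \<Rightarrow> bool"
  where "support_ideal \<S> \<longleftrightarrow> {} \<in> \<S> \<and> (\<forall>U V. U \<in> \<S> \<longrightarrow> V \<subseteq> U \<longrightarrow> V \<in> \<S>)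
    \<and> (\<forall>U V. U \<in> \<S> \<longrightarrow> V \<in> \<S> \<longrightarrow> U \<union> V \<in> \<S>)
    \<and> (\<forall>U a. U \<in> \<S> \<longrightarrow> {v. v - a \<in> U} \<in> \<S>)"

lemma support_idealD:
  assumes "support_ideal \<S>"
  shows "{} \<in> \<S>" "U \<in> \<S> \<Longrightarrow> V \<subseteq> U \<Longrightarrow> V \<in> \<S>" "U \<in> \<S> \<Longrightarrow> V \<in> \<S> \<Longrightarrow> U \<union> V \<in> \<S>"
    "U \<in> \<S> \<Longrightarrow> {v. v - a \<in> U} \<in> \<S>"
  using assms unfolding support_ideal_def by blast+

lemma support_ideal_UN:
  assumes "support_ideal \<S>" "finite I" "\<And>i. i \<in> I \<Longrightarrow> U i \<in> \<S>"
  shows "(\<Union>i\<in>I. U i) \<in> \<S>"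
  using assms(2,3) by (induction I) (auto simp: support_idealD(1,3)[OF assms(1)])

text \<open>One finite set \<open>P\<close> of exponents serves all degrees. The law
  \<open>dd0\<close> is asked of arbitrary functions, finitely supported or not, so that the same
  differential acts on every completion.\<close>

locale local_complex =
  fixes P :: "(int \<times> int) set" and \<delta> :: "int \<Rightarrow> int \<times> int \<Rightarrow> 'v::ab_group_add \<Rightarrow> 'v"
    and A :: "int \<Rightarrow> 'v set"
  assumes P: "finite P" and \<delta>_add: "\<And>n p. additive (\<delta> n p)"
    and A: "\<And>n. add_subgroup (A n)"
    and \<delta>_A: "\<And>n p a. a \<in> A n \<Longrightarrow> \<delta> n p a \<in> A (n + 1)"
    and dd0: "\<And>n (f :: int \<times> int \<Rightarrow> 'v). (\<And>v. f v \<in> A n) \<Longrightarrow>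
      local_op P (\<delta> (n + 1)) (\<lambda>p. p) (local_op P (\<delta> n) (\<lambda>p. p) f) = 0"
begin

definition dif :: "int \<Rightarrow> (int \<times> int \<Rightarrow> 'v) \<Rightarrow> int \<times> int \<Rightarrow> 'v"
  where "dif n = local_op P (\<delta> n) (\<lambda>p. p)"

definition cmpl :: "(int \<times> int) set set \<Rightarrow> int \<Rightarrow> (int \<times> int \<Rightarrow> 'v) set"
  where "cmpl \<S> n = {f. (\<forall>v. f v \<in> A n) \<and> supp f \<in> \<S>}"

definition pol :: "int \<Rightarrow> (int \<times> int \<Rightarrow> 'v) set"
  where "pol n = cmpl {U. finite U} n"

lemma pol_iff: "f \<in> pol n \<longleftrightarrow> (\<forall>v. f v \<in> A n) \<and> finite (supp f)"
  by (simp add: pol_def cmpl_def)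

lemma A_zero [simp]: "0 \<in> A n"
  using A by (rule add_subgroup_zero)

lemma dif_additive: "additive (dif n)"
  unfolding dif_def by (rule local_op_add) (rule \<delta>_add)

lemmas dif_add = additive.add[OF dif_additive]
  and dif_diff = additive.diff[OF dif_additive]
  and dif_zero = additive.zero[OF dif_additive]
  and dif_sum = additive.sum[OF dif_additive]

lemma \<delta>_zero [simp]: "\<delta> n p 0 = 0"
  by (rule additive.zero[OF \<delta>_add])

lemma dif_apply: "dif n f v = (\<Sum>p\<in>P. \<delta> n p (f (v - p)))"
  by (simp add: dif_def local_op_def)

lemma dif_cong: "(\<And>p. p \<in> P \<Longrightarrow> f (v - p) = g (v - p)) \<Longrightarrow> dif n f v = dif n g v"
  by (simp add: dif_apply)

lemma dif_A: "(\<And>v. f v \<in> A n) \<Longrightarrow> dif n f v \<in> A (n + 1)"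
  unfolding dif_apply by (rule add_subgroup_sum[OF A]) (simp add: \<delta>_A)

lemma dif_dif: "(\<And>v. f v \<in> A n) \<Longrightarrow> dif (n + 1) (dif n f) = 0"
  unfolding dif_def by (rule dd0)

lemma dif_translate: "dif n (translate a f) = translate a (dif n f)"
  by (simp add: dif_def local_op_translate)

lemma supp_dif: "supp (dif n f) \<subseteq> (\<Union>p\<in>P. {v. v - p \<in> supp f})"
proof
  fix v assume "v \<in> supp (dif n f)"
  then have "(\<Sum>p\<in>P. \<delta> n p (f (v - p))) \<noteq> 0" by (simp add: supp_def dif_apply)
  then obtain p where "p \<in> P" "\<delta> n p (f (v - p)) \<noteq> 0"
    by (rule sum.not_neutral_contains_not_neutral)
  then show "v \<in> (\<Union>p\<in>P. {v. v - p \<in> supp f})" by (force simp: supp_def)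
qed

lemma supp_dif_ideal: "support_ideal \<S> \<Longrightarrow> supp f \<in> \<S> \<Longrightarrow> supp (dif n f) \<in> \<S>"
  by (rule support_idealD(2)[OF _ support_ideal_UN[OF _ P] supp_dif]) (auto intro: support_idealD)

lemma dif_cmpl: "support_ideal \<S> \<Longrightarrow> f \<in> cmpl \<S> n \<Longrightarrow> dif n f \<in> cmpl \<S> (n + 1)"
  by (simp add: cmpl_def dif_A supp_dif_ideal)

lemma finite_support_ideal: "support_ideal {U. finite U}"
proof -
  have "finite {v. v - a \<in> U}" if "finite U" for U :: "(int \<times> int) set" and a
    by (rule finite_subset[of _ "(\<lambda>v. v + a) ` U"]) (use that in \<open>force simp: image_iff\<close>)+
  then show ?thesis by (auto simp: support_ideal_def intro: finite_subset)
qed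

lemma dif_pol: "f \<in> pol n \<Longrightarrow> dif n f \<in> pol (n + 1)"
  unfolding pol_def by (rule dif_cmpl[OF finite_support_ideal])

lemma dif_pol': "f \<in> pol (n - 1) \<Longrightarrow> dif (n - 1) f \<in> pol n"
  using dif_pol[of f "n - 1"] by simp

lemma cmpl_subgroup: "support_ideal \<S> \<Longrightarrow> add_subgroup (cmpl \<S> n)"
proof -
  assume S: "support_ideal \<S>"
  have "supp (f - g) \<in> \<S>" if "supp f \<in> \<S>" "supp g \<in> \<S>" for f g :: "int \<times> int \<Rightarrow> 'v"
    using support_idealD(2)[OF S support_idealD(3)[OF S that] supp_diff] .
  moreover have "supp (0 :: int \<times> int \<Rightarrow> 'v) = {}" by (simp add: supp_def)
  ultimately show ?thesis
    using support_idealD(1)[OF S] by (auto simp: cmpl_def add_subgroup_def add_subgroup_diff[OF A])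
qed

lemma pol_subgroup: "add_subgroup (pol n)"
  unfolding pol_def by (rule cmpl_subgroup[OF finite_support_ideal])

lemmas pol_zero = add_subgroup_zero[OF pol_subgroup]
  and pol_add = add_subgroup_add[OF pol_subgroup]
  and pol_diff = add_subgroup_diff[OF pol_subgroup]
  and pol_sum = add_subgroup_sum[OF pol_subgroup]

text \<open>
  On polynomials, \<open>R\<close>-linear maps are tame since a finitely generated \<open>R\<close>-submodule has
  finitely generated image.
\<close>

definition tame :: "int \<Rightarrow> int \<Rightarrow> ((int \<times> int \<Rightarrow> 'v) \<Rightarrow> int \<times> int \<Rightarrow> 'v) \<Rightarrow> bool"
  where "tame n m B \<longleftrightarrow> (\<forall>f\<in>pol n. B f \<in> pol m) \<and> (\<forall>f\<in>pol n. \<forall>g\<in>pol n. B (f + g) = B f + B g)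
    \<and> (\<forall>F. finite F \<longrightarrow> (\<exists>F'. finite F' \<and> (\<forall>f\<in>pol n. supp f \<subseteq> F \<longrightarrow> supp (B f) \<subseteq> F')))"

definition small :: "int \<Rightarrow> int \<Rightarrow> ((int \<times> int \<Rightarrow> 'v) \<Rightarrow> int \<times> int \<Rightarrow> 'v) \<Rightarrow> bool"
  where "small n m B \<longleftrightarrow> tame n m B \<and> (\<exists>F. finite F \<and> (\<forall>f\<in>pol n. supp (B f) \<subseteq> F))"

lemma tameD:
  assumes "tame n m B"
  shows "f \<in> pol n \<Longrightarrow> B f \<in> pol m" "f \<in> pol n \<Longrightarrow> g \<in> pol n \<Longrightarrow> B (f + g) = B f + B g"
    "finite F \<Longrightarrow> \<exists>F'. finite F' \<and> (\<forall>f\<in>pol n. supp f \<subseteq> F \<longrightarrow> supp (B f) \<subseteq> F')"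
  using assms unfolding tame_def by blast+

lemma tame_zero: "tame n m B \<Longrightarrow> B 0 = 0"
  using tameD(2)[of n m B 0 0] pol_zero by simp

lemma tame_diff:
  assumes "tame n m B" "f \<in> pol n" "g \<in> pol n"
  shows "B (f - g) = B f - B g"
  using tameD(2)[OF assms(1) pol_diff[OF assms(2,3)] assms(3)] by simp

lemma tame_sum:
  assumes B: "tame n m B" and "\<And>i. i \<in> I \<Longrightarrow> f i \<in> pol n"
  shows "B (\<Sum>i\<in>I. f i) = (\<Sum>i\<in>I. B (f i))"
  using assms(2)
proof (induction I rule: infinite_finite_induct)
  case (insert x F)
  have "B (f x + sum f F) = B (f x) + B (sum f F)"
    by (rule tameD(2)[OF B]) (use insert.prems in \<open>auto intro!: pol_sum\<close>)
  moreover have "B (sum f F) = (\<Sum>i\<in>F. B (f i))" by (rule insert.IH) (use insert.prems in auto)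
  ultimately show ?case unfolding sum.insert[OF insert.hyps] by (rule trans[OF _ arg_cong])
qed (simp_all add: tame_zero[OF B])

lemma tame_comp:
  assumes B: "tame n m B" and C: "tame m k C"
  shows "tame n k (\<lambda>f. C (B f))"
proof -
  have "\<exists>F'. finite F' \<and> (\<forall>f\<in>pol n. supp f \<subseteq> F \<longrightarrow> supp (C (B f)) \<subseteq> F')" if "finite F" for F
    using tameD(3)[OF B that] tameD(3)[OF C] tameD(1)[OF B] by metis
  then show ?thesis
    using tameD(1,2)[OF B] tameD(1,2)[OF C] by (simp add: tame_def)
qed

lemma tame_diff_fun:
  assumes B: "tame n m B" and C: "tame n m C"
  shows "tame n m (\<lambda>f. B f - C f)"
proof -
  have "\<exists>F'. finite F' \<and> (\<forall>f\<in>pol n. supp f \<subseteq> F \<longrightarrow> supp (B f - C f) \<subseteq> F')" if F: "finite F" for F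
  proof -
    obtain F1 F2 where "finite F1" "\<forall>f\<in>pol n. supp f \<subseteq> F \<longrightarrow> supp (B f) \<subseteq> F1"
      "finite F2" "\<forall>f\<in>pol n. supp f \<subseteq> F \<longrightarrow> supp (C f) \<subseteq> F2"
      using tameD(3)[OF B F] tameD(3)[OF C F] by auto
    then have "finite (F1 \<union> F2)" "\<forall>f\<in>pol n. supp f \<subseteq> F \<longrightarrow> supp (B f - C f) \<subseteq> F1 \<union> F2"
      using supp_diff[of "B _" "C _"] by blast+
    then show ?thesis by blast
  qed
  then show ?thesis
    using tameD(1,2)[OF B] tameD(1,2)[OF C] by (simp add: tame_def pol_diff)
qed

lemma tame_id: "tame n n (\<lambda>f. f)"
  by (auto simp: tame_def)

lemma tame_translate: "tame n n (translate a)"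
proof -
  have s: "supp (translate a f) = {v. v - a \<in> supp f}" for f :: "int \<times> int \<Rightarrow> 'v"
    by (auto simp: supp_def translate_def)
  have fin: "finite {v. v - a \<in> U}" if "finite U" for U
    using support_idealD(4)[OF finite_support_ideal, of U a] that by simp
  show ?thesis unfolding tame_def
  proof (intro conjI allI impI ballI)
    fix F :: "(int \<times> int) set" assume "finite F"
    then show "\<exists>F'. finite F' \<and> (\<forall>f\<in>pol n. supp f \<subseteq> F \<longrightarrow> supp (translate a f) \<subseteq> F')"
      unfolding s using fin[of F] by blast
  next
    show "translate a f \<in> pol n" if "f \<in> pol n" for f
      using that fin unfolding pol_iff s by (simp add: translate_def)
  qed (rule additive.add[OF translate_additive])
qed

lemma tame_dif: "tame n (n + 1) (dif n)"
  unfolding tame_def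
proof (intro conjI allI impI ballI)
  fix F :: "(int \<times> int) set" assume F: "finite F"
  have "finite {v. v - p \<in> F}" for p
    using support_idealD(4)[OF finite_support_ideal, of F p] F by simp
  then have "finite (\<Union>p\<in>P. {v. v - p \<in> F})" using P by blast
  moreover have "supp (dif n f) \<subseteq> (\<Union>p\<in>P. {v. v - p \<in> F})" if "supp f \<subseteq> F" for f
    by (rule order_trans[OF supp_dif]) (use that in auto)
  ultimately show "\<exists>F'. finite F' \<and> (\<forall>f\<in>pol n. supp f \<subseteq> F \<longrightarrow> supp (dif n f) \<subseteq> F')" by metis
qed (simp_all add: dif_pol dif_add)

lemma tame_dif': "tame (n - 1) n (dif (n - 1))"
  using tame_dif[of "n - 1"] by simp

lemma small_tame: "small n m B \<Longrightarrow> tame n m B"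
  by (simp add: small_def)

lemma small_comp1:
  assumes "small n m B" "tame m k C"
  shows "small n k (\<lambda>f. C (B f))"
proof -
  obtain F where F: "finite F" "\<forall>f\<in>pol n. supp (B f) \<subseteq> F" using assms(1) by (auto simp: small_def)
  obtain F' where "finite F'" "\<forall>f\<in>pol m. supp f \<subseteq> F \<longrightarrow> supp (C f) \<subseteq> F'"
    using tameD(3)[OF assms(2) F(1)] by auto
  then show ?thesis
    using F tame_comp[OF small_tame[OF assms(1)] assms(2)] tameD(1)[OF small_tame[OF assms(1)]]
    by (auto simp: small_def intro!: exI[of _ F'])
qed

lemma small_comp2: "tame n m B \<Longrightarrow> small m k C \<Longrightarrow> small n k (\<lambda>f. C (B f))"
  using tame_comp tameD(1) unfolding small_def by metis

lemma small_diff: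
  assumes "small n m B" "small n m C"
  shows "small n m (\<lambda>f. B f - C f)"
proof -
  obtain F G where "finite F" "\<forall>f\<in>pol n. supp (B f) \<subseteq> F" "finite G" "\<forall>f\<in>pol n. supp (C f) \<subseteq> G"
    using assms by (auto simp: small_def)
  then have "finite (F \<union> G)" "\<forall>f\<in>pol n. supp (B f - C f) \<subseteq> F \<union> G"
    using supp_diff[of "B _" "C _"] by blast+
  then show ?thesis using assms tame_diff_fun by (auto simp: small_def)
qed

text \<open>For tame \<open>h\<close> this is a chain map homotopic to the identity, hence an
  idempotent only up to homotopy.\<close>

definition retr :: "(int \<Rightarrow> (int \<times> int \<Rightarrow> 'v) \<Rightarrow> int \<times> int \<Rightarrow> 'v) \<Rightarrow> int \<Rightarrow> (int \<times> int \<Rightarrow> 'v) \<Rightarrow> int \<times> int \<Rightarrow> 'v"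
  where "retr h n f = f - dif (n - 1) (h n f) - h (n + 1) (dif n f)"

definition finite_homotopy :: "(int \<Rightarrow> (int \<times> int \<Rightarrow> 'v) \<Rightarrow> int \<times> int \<Rightarrow> 'v) \<Rightarrow> bool"
  where "finite_homotopy h \<longleftrightarrow> (\<forall>n. tame n (n - 1) (h n)) \<and> (\<forall>n. small n n (retr h n))"

lemma tame_retr:
  assumes "\<And>n. tame n (n - 1) (h n)"
  shows "tame n n (retr h n)"
proof -
  have "tame (n + 1) n (h (n + 1))" using assms[of "n + 1"] by simp
  then have "tame n n (\<lambda>f. f - dif (n - 1) (h n f) - h (n + 1) (dif n f))"
    by (intro tame_diff_fun tame_id tame_comp[OF assms tame_dif'] tame_comp[OF tame_dif])
  then show ?thesis by (simp add: retr_def[abs_def])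
qed

lemma retr_dif:
  assumes h: "\<And>n. tame n (n - 1) (h n)" and f: "f \<in> pol n"
  shows "retr h (n + 1) (dif n f) = dif n (retr h n f)"
proof -
  have f': "f v \<in> A n" "h n f v \<in> A (n - 1)" for v
    using f tameD(1)[OF h f] by (auto simp: pol_iff)
  have "dif (n + 1) (dif n f) = 0" using dif_dif f' by blast
  moreover have "dif n (dif (n - 1) (h n f)) = 0" using dif_dif[of "h n f" "n - 1"] f' by simp
  moreover have "h (n + 1 + 1) 0 = 0" by (rule tame_zero[OF h])
  ultimately show ?thesis by (simp add: retr_def dif_diff)
qed

end

section \<open>Finite homotopies make completions acyclic\<close>

lemma translate_translate: "translate a (translate b f) = translate (a + b) f"
  by (simp add: translate_def algebra_simps)

lemma translate_0 [simp]: "translate 0 f = f" "translate a 0 = 0"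
  by (simp_all add: translate_def fun_eq_iff)

lemma translate_eq_0_iff [simp]: "translate a f = 0 \<longleftrightarrow> f = 0"
proof
  assume "translate a f = 0"
  then have "translate (- a) (translate a f) = 0" by simp
  then show "f = 0" by (simp add: translate_translate)
qed simp

lemmas translate_add = additive.add[OF translate_additive]
  and translate_diff = additive.diff[OF translate_additive]
  and translate_sum = additive.sum[OF translate_additive]

text \<open>A function on pairs is read as a series in its first argument whose coefficients are
  functions of the second. This models a tensor product over R, on which an R-linear operator such
  as \<open>h\<close> acts slice by slice; on a tensor product over Laurent polynomials it would not
  act.\<close>

definition slice :: "('a \<times> 'b \<Rightarrow> 'v) \<Rightarrow> 'a \<Rightarrow> 'b \<Rightarrow> 'v"
  where "slice c v = (\<lambda>q. c (v, q))"

definition lift_op :: "(('b \<Rightarrow> 'v) \<Rightarrow> 'b \<Rightarrow> 'v) \<Rightarrow> ('a \<times> 'b \<Rightarrow> 'v) \<Rightarrow> 'a \<times> 'b \<Rightarrow> 'v"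
  where "lift_op B c = (\<lambda>\<gamma>. B (slice c (fst \<gamma>)) (snd \<gamma>))"

lemma slice_eqI: "(\<And>v. slice c v = slice c' v) \<Longrightarrow> c = c'"
  by (auto simp: slice_def fun_eq_iff)

lemma slice_lift [simp]: "slice (lift_op B c) v = B (slice c v)"
  by (simp add: slice_def lift_op_def)

lemma slice_add [simp]: "slice (c + c') v = slice c v + slice c' v"
  and slice_diff [simp]: "slice (c - c' :: 'a \<times> 'b \<Rightarrow> 'v::ab_group_add) v = slice c v - slice c' v"
  and slice_zero [simp]: "slice 0 v = 0"
  by (simp_all add: slice_def fun_eq_iff)

lemma slice_translate: "slice (translate (a, b) c) v = translate b (slice c (v - a))"
  by (simp add: slice_def translate_def)

context local_complex
begin

definition lift_dif :: "int \<Rightarrow> ((int \<times> int) \<times> int \<times> int \<Rightarrow> 'v) \<Rightarrow> (int \<times> int) \<times> int \<times> int \<Rightarrow> 'v"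
  where "lift_dif n = local_op P (\<delta> n) (\<lambda>p. (0, p))"

lemma lift_dif_eq: "lift_dif n c = lift_op (dif n) c"
  by (rule ext) (auto simp: lift_dif_def local_op_def lift_op_def slice_def dif_apply)

lemma lift_dif_additive: "additive (lift_dif n)"
  unfolding lift_dif_def by (rule local_op_add) (rule \<delta>_add)

end

text \<open>The vector \<open>t\<close> is a direction in which series may be infinite:
  \<open>cone\<close> lets supports be spread along all nonnegative multiples of \<open>t\<close>,
  and \<open>cone_fin\<close> says that at each point only finitely many of these translates arrive,
  so that geometric series in the shift make sense.\<close>

locale completion = local_complex P \<delta> A
  for P and \<delta> :: "int \<Rightarrow> int \<times> int \<Rightarrow> 'v::ab_group_add \<Rightarrow> 'v" and A +
  fixes \<S> :: "(int \<times> int) set set" and t :: "int \<times> int"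
  assumes ideal: "support_ideal \<S>"
    and cone: "\<And>U. U \<in> \<S> \<Longrightarrow> {v. \<exists>k::nat. v - smul (int k) t \<in> U} \<in> \<S>"
    and cone_fin: "\<And>U v. U \<in> \<S> \<Longrightarrow> finite {k::nat. v - smul (int k) t \<in> U}"
begin

text \<open>The polynomials tensored over R with the series. The common finite set \<open>F\<close>
  of second exponents is what distinguishes finite sums of tensors from general series with
  polynomial coefficients.\<close>

definition tens :: "int \<Rightarrow> ((int \<times> int) \<times> int \<times> int \<Rightarrow> 'v) set"
  where "tens n = {c. (\<forall>v. slice c v \<in> pol n) \<and> {v. slice c v \<noteq> 0} \<in> \<S>
    \<and> (\<exists>F. finite F \<and> (\<forall>v. supp (slice c v) \<subseteq> F))}"

lemma tensD:
  assumes "c \<in> tens n"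
  shows "slice c v \<in> pol n" "{v. slice c v \<noteq> 0} \<in> \<S>" "\<exists>F. finite F \<and> (\<forall>v. supp (slice c v) \<subseteq> F)"
  using assms by (auto simp: tens_def)

lemma tensI:
  assumes "\<And>v. slice c v \<in> pol n" "{v. slice c v \<noteq> 0} \<in> \<S>" "finite F" "\<And>v. supp (slice c v) \<subseteq> F"
  shows "c \<in> tens n"
  using assms unfolding tens_def by blast

lemma tens_subgroup: "add_subgroup (tens n)"
  unfolding add_subgroup_def
proof (intro conjI ballI)
  show "0 \<in> tens n"
    by (rule tensI[of _ _ "{}"]) (simp_all add: support_idealD(1)[OF ideal] pol_zero supp_def)
  fix c c' assume c: "c \<in> tens n" and c': "c' \<in> tens n"
  obtain F F' where F: "finite F" "\<And>v. supp (slice c v) \<subseteq> F" "finite F'" "\<And>v. supp (slice c' v) \<subseteq> F'"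
    using tensD(3)[OF c] tensD(3)[OF c'] by auto
  show "c - c' \<in> tens n"
  proof (rule tensI[OF _ _ finite_UnI[OF F(1,3)]])
    show "slice (c - c') v \<in> pol n" for v
      unfolding slice_diff by (rule pol_diff[OF tensD(1)[OF c] tensD(1)[OF c']])
    show "supp (slice (c - c') v) \<subseteq> F \<union> F'" for v
      unfolding slice_diff using supp_diff[of "slice c v" "slice c' v"] F(2,4)[of v] by blast
    have "{v. slice (c - c') v \<noteq> 0} \<subseteq> {v. slice c v \<noteq> 0} \<union> {v. slice c' v \<noteq> 0}"
      unfolding slice_diff by auto
    then show "{v. slice (c - c') v \<noteq> 0} \<in> \<S>"
      by (rule support_idealD(2)[OF ideal support_idealD(3)[OF ideal tensD(2)[OF c] tensD(2)[OF c']]])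
  qed
qed

lemmas tens_diff = add_subgroup_diff[OF tens_subgroup]
  and tens_add = add_subgroup_add[OF tens_subgroup]

lemma lift_tens:
  assumes B: "tame n m B" and c: "c \<in> tens n"
  shows "lift_op B c \<in> tens m"
proof -
  obtain F where F: "finite F" "\<And>v. supp (slice c v) \<subseteq> F" using tensD(3)[OF c] by auto
  obtain F' where F': "finite F'" "\<forall>f\<in>pol n. supp f \<subseteq> F \<longrightarrow> supp (B f) \<subseteq> F'"
    using tameD(3)[OF B F(1)] by auto
  have "{v. B (slice c v) \<noteq> 0} \<subseteq> {v. slice c v \<noteq> 0}" using tame_zero[OF B] by auto
  then have "{v. B (slice c v) \<noteq> 0} \<in> \<S>" using support_idealD(2)[OF ideal tensD(2)[OF c]] by simp
  moreover have "supp (B (slice c v)) \<subseteq> F'" for v using F' F(2) tensD(1)[OF c] by blast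
  moreover have "B (slice c v) \<in> pol m" for v by (rule tameD(1)[OF B tensD(1)[OF c]])
  ultimately show ?thesis using tensI[of "lift_op B c" m, OF _ _ F'(1)] unfolding slice_lift by blast
qed

lemma lift_dif_tens: "c \<in> tens n \<Longrightarrow> lift_dif n c \<in> tens (n + 1)"
  unfolding lift_dif_eq by (rule lift_tens[OF tame_dif])

lemma lift_diff:
  assumes "tame n m B" "c \<in> tens n" "c' \<in> tens n"
  shows "lift_op B (c - c') = lift_op B c - lift_op B c'"
  by (rule slice_eqI) (unfold slice_lift slice_diff,
    rule tame_diff[OF assms(1) tensD(1)[OF assms(2)] tensD(1)[OF assms(3)]])

lemma lift_add:
  assumes "tame n m B" "c \<in> tens n" "c' \<in> tens n"
  shows "lift_op B (c + c') = lift_op B c + lift_op B c'"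
  by (rule slice_eqI) (unfold slice_lift slice_add,
    rule tameD(2)[OF assms(1) tensD(1)[OF assms(2)] tensD(1)[OF assms(3)]])

text \<open>Moves the monomial with exponent \<open>smul k t\<close> from the polynomial factor to
  the series factor. Dividing by \<open>1 - shift 1\<close> imposes the relation that this monomial
  may cross the tensor sign.\<close>

definition shift :: "int \<Rightarrow> ((int \<times> int) \<times> int \<times> int \<Rightarrow> 'v) \<Rightarrow> (int \<times> int) \<times> int \<times> int \<Rightarrow> 'v"
  where "shift k = translate (smul k t, - smul k t)"

lemma slice_shift: "slice (shift k c) v = translate (- smul k t) (slice c (v - smul k t))"
  by (simp add: shift_def slice_translate)

lemma slice_shift_eq_0: "slice (shift k c) v = 0 \<longleftrightarrow> slice c (v - smul k t) = 0"
  by (simp add: slice_shift)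

lemma shift_shift: "shift k (shift l c) = shift (k + l) c"
  by (simp add: shift_def translate_translate smul_add)

lemma shift_tens:
  assumes c: "c \<in> tens n"
  shows "shift k c \<in> tens n"
proof -
  obtain F where F: "finite F" "\<And>v. supp (slice c v) \<subseteq> F" using tensD(3)[OF c] by auto
  obtain F' where F': "finite F'" "\<forall>f\<in>pol n. supp f \<subseteq> F \<longrightarrow> supp (translate (- smul k t) f) \<subseteq> F'"
    using tameD(3)[OF tame_translate[of n "- smul k t"] F(1)] by auto
  have "{v. slice (shift k c) v \<noteq> 0} \<in> \<S>"
    using support_idealD(4)[OF ideal tensD(2)[OF c], of "smul k t"] by (simp add: slice_shift_eq_0)
  moreover have "supp (slice (shift k c) v) \<subseteq> F'" for v
    unfolding slice_shift using F' F(2) tensD(1)[OF c] by blast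
  moreover have "slice (shift k c) v \<in> pol n" for v
    unfolding slice_shift by (rule tameD(1)[OF tame_translate tensD(1)[OF c]])
  ultimately show ?thesis using tensI[of "shift k c" n, OF _ _ F'(1)] by blast
qed

lemma lift_dif_shift: "lift_dif n (shift k c) = shift k (lift_dif n c)"
  by (simp add: lift_dif_def shift_def local_op_translate)

definition steps :: "((int \<times> int) \<times> int \<times> int \<Rightarrow> 'v) \<Rightarrow> int \<times> int \<Rightarrow> nat set"
  where "steps c v = {k. slice (shift (int k) c) v \<noteq> 0}"

lemma finite_steps: "c \<in> tens n \<Longrightarrow> finite (steps c v)"
  using cone_fin[OF tensD(2), of c n v] by (simp add: steps_def slice_shift_eq_0)

text \<open>The geometric series \<open>\<Sum>k. B T\<^sup>k\<close> for the shift \<open>T\<close>.\<close>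

definition geom :: "((int \<times> int \<Rightarrow> 'v) \<Rightarrow> int \<times> int \<Rightarrow> 'v) \<Rightarrow> ((int \<times> int) \<times> int \<times> int \<Rightarrow> 'v)
    \<Rightarrow> (int \<times> int) \<times> int \<times> int \<Rightarrow> 'v"
  where "geom B c = (\<lambda>\<gamma>. (\<Sum>k\<in>steps c (fst \<gamma>). B (slice (shift (int k) c) (fst \<gamma>))) (snd \<gamma>))"

lemma slice_geom0: "slice (geom B c) v = (\<Sum>k\<in>steps c v. B (slice (shift (int k) c) v))"
  by (simp add: geom_def slice_def)

lemma slice_geom:
  assumes "tame n m B" "finite K" "steps c v \<subseteq> K"
  shows "slice (geom B c) v = (\<Sum>k\<in>K. B (slice (shift (int k) c) v))"
  unfolding slice_geom0
  by (rule sum.mono_neutral_left) (use assms tame_zero[OF assms(1)] in \<open>auto simp: steps_def\<close>)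

lemma slice_shift_pol: "c \<in> tens n \<Longrightarrow> slice (shift k c) v \<in> pol n"
  using shift_tens tensD(1) by blast

text \<open>Smallness of \<open>B\<close> is decisive: the k-th shift pushes the second exponents
  arbitrarily far away, and only an image in one fixed finite set bounds them again. The first
  exponents are controlled by \<open>cone\<close>.\<close>

lemma geom_tens:
  assumes B: "small n m B" and c: "c \<in> tens n"
  shows "geom B c \<in> tens m"
proof -
  have tB: "tame n m B" using B by (rule small_tame)
  obtain F where F: "finite F" "\<And>f. f \<in> pol n \<Longrightarrow> supp (B f) \<subseteq> F" using B by (auto simp: small_def)
  have p: "B (slice (shift (int k) c) v) \<in> pol m" for k v
    using tameD(1)[OF tB] slice_shift_pol[OF c] by blast
  have "{v. slice (geom B c) v \<noteq> 0} \<subseteq> {v. \<exists>k::nat. v - smul (int k) t \<in> {v. slice c v \<noteq> 0}}"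
  proof
    fix v assume "v \<in> {v. slice (geom B c) v \<noteq> 0}"
    then have "steps c v \<noteq> {}" by (auto simp: slice_geom0)
    then show "v \<in> {v. \<exists>k::nat. v - smul (int k) t \<in> {v. slice c v \<noteq> 0}}"
      by (auto simp: steps_def slice_shift_eq_0)
  qed
  then have "{v. slice (geom B c) v \<noteq> 0} \<in> \<S>"
    using support_idealD(2)[OF ideal cone[OF tensD(2)[OF c]]] by blast
  moreover have "supp (slice (geom B c) v) \<subseteq> F" for v
  proof
    fix q assume "q \<in> supp (slice (geom B c) v)"
    then have "(\<Sum>k\<in>steps c v. B (slice (shift (int k) c) v) q) \<noteq> 0"
      by (simp add: supp_def slice_geom0 sum_fun_app)
    then obtain k where "B (slice (shift (int k) c) v) q \<noteq> 0"
      by (rule sum.not_neutral_contains_not_neutral)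
    then show "q \<in> F" using F(2)[OF slice_shift_pol[OF c, of "int k" v]] by (auto simp: supp_def)
  qed
  moreover have "slice (geom B c) v \<in> pol m" for v
    unfolding slice_geom0 by (rule pol_sum) (rule p)
  ultimately show ?thesis using tensI[of "geom B c" m, OF _ _ F(1)] by blast
qed

lemma lift_geom:
  assumes B: "tame n m B" and C: "tame m k C" and c: "c \<in> tens n"
  shows "lift_op C (geom B c) = geom (\<lambda>f. C (B f)) c"
  by (rule slice_eqI)
    (simp add: slice_geom0 tame_sum[OF C tameD(1)[OF B slice_shift_pol[OF c]]])

lemma geom_lift_dif:
  assumes B: "tame (n + 1) m B" and c: "c \<in> tens n"
  shows "geom B (lift_dif n c) = geom (\<lambda>f. B (dif n f)) c"
proof (rule slice_eqI)
  fix v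
  let ?K = "steps c v \<union> steps (lift_dif n c) v"
  have K: "finite ?K" using finite_steps c lift_dif_tens by blast
  have "slice (geom B (lift_dif n c)) v = (\<Sum>k\<in>?K. B (slice (shift (int k) (lift_dif n c)) v))"
    by (rule slice_geom[OF B K]) simp
  also have "\<dots> = (\<Sum>k\<in>?K. B (dif n (slice (shift (int k) c) v)))"
    by (simp add: lift_dif_shift[symmetric]) (simp add: lift_dif_eq)
  also have "\<dots> = slice (geom (\<lambda>f. B (dif n f)) c) v"
    by (rule slice_geom[symmetric, OF tame_comp[OF tame_dif B] K]) simp
  finally show "slice (geom B (lift_dif n c)) v = slice (geom (\<lambda>f. B (dif n f)) c) v" .
qed

lemma geom_diff_fun: "geom (\<lambda>f. B f - C f) c = geom B c - geom C c"
  by (rule slice_eqI) (simp add: slice_geom0 sum_subtractf)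

lemma geom_add_fun: "geom (\<lambda>f. B f + C f) c = geom B c + geom C c"
  by (rule slice_eqI) (simp add: slice_geom0 sum.distrib)

lemma geom_cong: "c \<in> tens n \<Longrightarrow> (\<And>f. f \<in> pol n \<Longrightarrow> B f = C f) \<Longrightarrow> geom B c = geom C c"
  by (rule slice_eqI) (simp add: slice_geom0 slice_shift_pol)

lemma geom_diff:
  assumes B: "tame n m B" and c: "c \<in> tens n" and c': "c' \<in> tens n"
  shows "geom B (c - c') = geom B c - geom B c'"
proof (rule slice_eqI)
  fix v
  let ?K = "steps c v \<union> steps c' v \<union> steps (c - c') v"
  have K: "finite ?K" using finite_steps tens_diff[OF c c'] c c' by blast
  have "slice (geom B (c - c')) v = (\<Sum>k\<in>?K. B (slice (shift (int k) (c - c')) v))"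
    by (rule slice_geom[OF B K]) simp
  also have "\<dots> = (\<Sum>k\<in>?K. B (slice (shift (int k) c) v)) - (\<Sum>k\<in>?K. B (slice (shift (int k) c') v))"
    unfolding sum_subtractf[symmetric] shift_def translate_diff slice_diff
    by (rule sum.cong[OF refl], rule tame_diff[OF B])
      (use slice_shift_pol[OF c] slice_shift_pol[OF c'] in \<open>auto simp: shift_def\<close>)
  also have "\<dots> = slice (geom B c - geom B c') v"
    by (simp only: slice_diff) (intro arg_cong2[of _ _ _ _ minus] slice_geom[symmetric, OF B K]; auto)
  finally show "slice (geom B (c - c')) v = slice (geom B c - geom B c') v" .
qed

text \<open>Shifting first turns the k-th term into the next one, so the geometric series loses
  exactly its initial term.\<close>

lemma geom_shift:
  assumes B: "tame n m B" and c: "c \<in> tens n"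
  shows "geom B (shift 1 c) = geom B c - lift_op B c"
proof (rule slice_eqI)
  fix v
  have "finite (steps c v \<union> steps (shift 1 c) v)" using finite_steps shift_tens c by blast
  then obtain N where N: "steps c v \<union> steps (shift 1 c) v \<subseteq> {..<N}" using finite_nat_iff_bounded by blast
  let ?b = "\<lambda>k. B (slice (shift (int k) c) v)"
  have "slice (geom B (shift 1 c)) v = (\<Sum>k<N. B (slice (shift (int k) (shift 1 c)) v))"
    by (rule slice_geom[OF B]) (use N in auto)
  also have "\<dots> = (\<Sum>k<N. ?b (Suc k))" by (simp add: shift_shift add.commute)
  also have "\<dots> = (\<Sum>k<Suc N. ?b k) - ?b 0" by (simp only: sum.lessThan_Suc_shift) simp
  also have "(\<Sum>k<Suc N. ?b k) = slice (geom B c) v"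
    by (rule slice_geom[symmetric, OF B]) (use N in \<open>auto intro: less_SucI\<close>)
  finally show "slice (geom B (shift 1 c)) v = slice (geom B c - lift_op B c) v"
    by (simp add: slice_shift fun_eq_iff)
qed

definition conj_op :: "((int \<times> int \<Rightarrow> 'v) \<Rightarrow> int \<times> int \<Rightarrow> 'v) \<Rightarrow> (int \<times> int \<Rightarrow> 'v) \<Rightarrow> int \<times> int \<Rightarrow> 'v"
  where "conj_op B f = translate (- t) (B (translate t f))"

text \<open>The shift also translates the second variable, on which \<open>B\<close> acts, so it
  passes the series only at the cost of conjugating \<open>B\<close> by a translation.\<close>

lemma shift_geom: "shift 1 (geom B c) = geom (conj_op B) (shift 1 c)"
proof (rule slice_eqI)
  fix v
  have s: "slice (shift k (shift 1 c)) v = translate (- t) (slice (shift k c) (v - t))" for k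
    by (simp only: shift_shift add.commute[of k 1]) (simp only: shift_shift[symmetric] slice_shift[of 1] smul_simps)
  have st: "steps (shift 1 c) v = steps c (v - t)"
    unfolding steps_def s by simp
  show "slice (shift 1 (geom B c)) v = slice (geom (conj_op B) (shift 1 c)) v"
    unfolding slice_shift[of 1] slice_geom0 smul_simps st translate_sum s conj_op_def
    by (simp add: translate_translate)
qed

lemma tame_conj: "tame n m B \<Longrightarrow> tame n m (conj_op B)"
  unfolding conj_op_def[abs_def] by (intro tame_comp[OF tame_translate] tame_comp[OF _ tame_translate])

lemma small_conj: "small n m B \<Longrightarrow> small n m (conj_op B)"
  unfolding conj_op_def[abs_def]
  by (intro small_comp2[OF tame_translate] small_comp1[OF _ tame_translate])

lemma retr_conj: "retr (\<lambda>n. conj_op (h n)) n f = conj_op (retr h n) f"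
  by (simp add: retr_def conj_op_def dif_translate translate_diff translate_translate)

end

section \<open>The map \<open>1 - T\<close> on cohomology\<close>

context completion
begin

context
  fixes h
  assumes h: "finite_homotopy h"
begin

lemma h_tame: "tame n (n - 1) (h n)" and h_tame': "tame (n + 1) n (h (n + 1))"
  and h_small: "small n n (retr h n)"
proof -
  show 1: "tame n (n - 1) (h n)" for n using h unfolding finite_homotopy_def by blast
  show "tame (n + 1) n (h (n + 1))" using 1[of "n + 1"] by simp
  show "small n n (retr h n)" using h unfolding finite_homotopy_def by blast
qed

lemma lift_retr:
  assumes g: "\<And>n. tame n (n - 1) (g n)" and c: "c \<in> tens (n + 1)" "lift_dif (n + 1) c = 0"
  shows "lift_op (retr g (n + 1)) c = c - lift_dif n (lift_op (g (n + 1)) c)"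
proof (rule slice_eqI)
  fix v
  have "dif (n + 1) (slice c v) = 0"
    using arg_cong[OF c(2), of "\<lambda>c. slice c v"] by (simp add: lift_dif_eq)
  then show "slice (lift_op (retr g (n + 1)) c) v = slice (c - lift_dif n (lift_op (g (n + 1)) c)) v"
    using tame_zero[OF g, of "n + 1 + 1"]
    by (simp only: lift_dif_eq retr_def slice_lift slice_diff add_diff_cancel_right' diff_zero)
qed

text \<open>Write e for \<open>retr h\<close>. Telescoping gives e a as the sum of e T^k applied to
  a - T a = d x, hence as the boundary of the sum of e T^k x. For a cocycle a - e a is the boundary
  of h a, so a itself is a boundary.\<close>

lemma shift_H_inj:
  assumes a: "a \<in> tens (n + 1)" "lift_dif (n + 1) a = 0"
    and x: "x \<in> tens n" and ax: "a - shift 1 a = lift_dif n x"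
  shows "\<exists>c\<in>tens n. a = lift_dif n c"
proof -
  let ?e = "retr h"
  have e: "tame n n (?e n)" for n by (rule small_tame[OF h_small])
  have "lift_op (?e (n + 1)) a = geom (?e (n + 1)) (a - shift 1 a)"
    using geom_diff[OF e a(1) shift_tens[OF a(1)]] geom_shift[OF e a(1)] by simp
  also have "\<dots> = geom (\<lambda>f. ?e (n + 1) (dif n f)) x"
    unfolding ax by (rule geom_lift_dif[OF e x])
  also have "\<dots> = geom (\<lambda>f. dif n (?e n f)) x"
    by (rule geom_cong[OF x]) (rule retr_dif[OF h_tame])
  also have "\<dots> = lift_dif n (geom (?e n) x)"
    unfolding lift_dif_eq by (rule lift_geom[symmetric, OF e tame_dif x])
  finally have "a = lift_dif n (geom (?e n) x) + lift_dif n (lift_op (h (n + 1)) a)"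
    using lift_retr[OF h_tame a] by (simp add: algebra_simps)
  then have "a = lift_dif n (geom (?e n) x + lift_op (h (n + 1)) a)"
    by (simp add: additive.add[OF lift_dif_additive])
  moreover have "geom (?e n) x + lift_op (h (n + 1)) a \<in> tens n"
    using tens_add geom_tens[OF h_small x] lift_tens[OF h_tame' a(1)] by blast
  ultimately show ?thesis by blast
qed

text \<open>
  With \<open>e\<close> the finite homotopy idempotent, \<open>e'\<close> its conjugate by \<open>t\<close> and \<open>u = 1 - T\<close>,
  one has \<open>u (\<Sum> e T\<^sup>k) = \<Sum> (e - e') T\<^sup>k + e'\<close>. The sum on the right is null-homotopic only after
  composition with \<open>e\<close>, since the homotopy \<open>h' - h\<close> from \<open>e\<close> to \<open>e'\<close> is not small.
\<close>

lemma shift_H_surj: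
  assumes z: "z \<in> tens (n + 1)" "lift_dif (n + 1) z = 0"
  shows "\<exists>y\<in>tens (n + 1). \<exists>w\<in>tens n. lift_dif (n + 1) y = 0 \<and> z = (y - shift 1 y) + lift_dif n w"
proof -
  define m where "m = n + 1"
  define h' where "h' = (\<lambda>n. conj_op (h n))"
  let ?e = "retr h" and ?e' = "retr h'"
  define B where "B = (\<lambda>k f. ?e (k - 1) (h' k f - h k f))"
  define y where "y = geom (?e m) z"
  define x where "x = y - shift 1 y"
  have z': "z \<in> tens m" "lift_dif m z = 0" using z by (simp_all add: m_def)
  have e: "tame n n (?e n)" for n by (rule small_tame[OF h_small])
  have h': "tame k (k - 1) (h' k)" for k unfolding h'_def by (rule tame_conj[OF h_tame])
  have h'1: "tame m n (h' m)" "tame m n (h m)" using h'[of m] h_tame[of m] by (simp_all add: m_def)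
  have e'_eq: "?e' k = conj_op (?e k)" for k
    by (rule ext) (simp only: h'_def retr_conj)
  have e'_small: "small k k (?e' k)" for k unfolding e'_eq by (rule small_conj[OF h_small])
  note e' = small_tame[OF e'_small]
  have B: "small k (k - 1) (B k)" for k
    unfolding B_def by (rule small_comp2[OF tame_diff_fun[OF h' h_tame] h_small])
  have B1: "small m n (B m)" "small (m + 1) m (B (m + 1))"
    using B[of m] B[of "m + 1"] by (simp_all only: m_def add_diff_cancel_right')
  have y: "y \<in> tens m" unfolding y_def by (rule geom_tens[OF h_small z'(1)])
  have ly: "lift_dif m y = 0"
  proof -
    have "lift_dif m y = geom (\<lambda>f. dif m (?e m f)) z"
      unfolding lift_dif_eq y_def by (rule lift_geom[OF e tame_dif z'(1)])
    also have "\<dots> = geom (\<lambda>f. ?e (m + 1) (dif m f)) z"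
      by (rule geom_cong[OF z'(1)]) (rule retr_dif[OF h_tame, symmetric])
    also have "\<dots> = geom (?e (m + 1)) 0"
      using geom_lift_dif[OF e z'(1)] z'(2) by simp
    also have "\<dots> = 0" using geom_diff_fun[of "?e (m + 1)" "?e (m + 1)" 0]
      by (intro slice_eqI) (simp add: slice_geom0 steps_def slice_shift)
    finally show ?thesis .
  qed
  have x: "x \<in> tens m" unfolding x_def by (rule tens_diff[OF y shift_tens[OF y]])
  have lx: "lift_dif m x = 0"
    unfolding x_def additive.diff[OF lift_dif_additive] lift_dif_shift ly by (simp add: shift_def)
  have "shift 1 y = geom (?e' m) z - lift_op (?e' m) z"
    unfolding y_def shift_geom e'_eq[symmetric] by (rule geom_shift[OF e' z'(1)])
  then have x_eq: "x = geom (\<lambda>f. ?e m f - ?e' m f) z + lift_op (?e' m) z"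
    by (simp add: x_def y_def geom_diff_fun)
  \<comment> \<open>\<open>?e\<close> and \<open>?e'\<close> both arise from homotopies, so they
    differ by the boundary of \<open>h' - h\<close>. As \<open>?e\<close> is a chain map, composing
    with it turns \<open>h' - h\<close> into the small homotopy \<open>B\<close>.\<close>
  have hB: "?e m (?e m f - ?e' m f) = dif n (B m f) + B (m + 1) (dif m f)" if f: "f \<in> pol m" for f
  proof -
    have p: "h m f \<in> pol n" "h' m f \<in> pol n" using tameD(1)[OF h'1(1) f] tameD(1)[OF h'1(2) f] by auto
    have hm: "tame (m + 1) m (h (m + 1))" "tame (m + 1) m (h' (m + 1))"
      using h_tame[of "m + 1"] h'[of "m + 1"] by simp_all
    have "?e m f - ?e' m f = dif n (h' m f - h m f) + (h' (m + 1) (dif m f) - h (m + 1) (dif m f))"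
      by (simp add: retr_def m_def dif_diff)
    moreover have "dif n (h' m f - h m f) \<in> pol m" unfolding m_def by (intro dif_pol pol_diff p[unfolded m_def])
    moreover have "h' (m + 1) (dif m f) - h (m + 1) (dif m f) \<in> pol m"
      using tameD(1)[OF hm(1) dif_pol[OF f]] tameD(1)[OF hm(2) dif_pol[OF f]] by (rule pol_diff[rotated])
    ultimately have "?e m (?e m f - ?e' m f)
        = ?e m (dif n (h' m f - h m f)) + ?e m (h' (m + 1) (dif m f) - h (m + 1) (dif m f))"
      by (simp add: tameD(2)[OF e])
    also have "?e m (dif n (h' m f - h m f)) = dif n (B m f)"
      using retr_dif[OF h_tame pol_diff[OF p(2,1)]] by (simp add: B_def m_def)
    also have "?e m (h' (m + 1) (dif m f) - h (m + 1) (dif m f)) = B (m + 1) (dif m f)"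
      unfolding B_def by (simp only: add_diff_cancel_right')
    finally show ?thesis .
  qed
  have "lift_op (?e m) x = lift_op (?e m) (geom (\<lambda>f. ?e m f - ?e' m f) z) + lift_op (?e m) (lift_op (?e' m) z)"
    unfolding x_eq by (rule lift_add[OF e geom_tens[OF small_diff[OF h_small e'_small] z'(1)] lift_tens[OF e' z'(1)]])
  also have "lift_op (?e m) (geom (\<lambda>f. ?e m f - ?e' m f) z) = geom (\<lambda>f. ?e m (?e m f - ?e' m f)) z"
    by (rule lift_geom[OF tame_diff_fun[OF e e'] e z'(1)])
  also have "\<dots> = geom (\<lambda>f. dif n (B m f) + B (m + 1) (dif m f)) z"
    by (rule geom_cong[OF z'(1) hB])
  also have "\<dots> = lift_dif n (geom (B m) z) + geom (B (m + 1)) (lift_dif m z)"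
    unfolding geom_add_fun lift_dif_eq[of n] lift_geom[OF small_tame[OF B1(1)] tame_dif z'(1)]
      geom_lift_dif[OF small_tame[OF B1(2)] z'(1)] ..
  also have "geom (B (m + 1)) (lift_dif m z) = 0"
    unfolding z'(2) by (intro slice_eqI) (simp add: slice_geom0 steps_def slice_shift)
  also have "lift_op (?e' m) z = z - lift_dif n (lift_op (h' m) z)"
    unfolding m_def by (rule lift_retr[OF h' z])
  finally have 1: "lift_op (?e m) x = lift_dif n (geom (B m) z)
      + lift_op (?e m) (z - lift_dif n (lift_op (h' m) z))" unfolding add_0_right .
  have hz: "lift_op (h' m) z \<in> tens n" by (rule lift_tens[OF h'1(1) z'(1)])
  have "lift_dif n (lift_op (h' m) z) \<in> tens m" using lift_dif_tens[OF hz] by (simp only: m_def)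
  then have 2: "lift_op (?e m) (z - lift_dif n (lift_op (h' m) z))
      = lift_op (?e m) z - lift_op (?e m) (lift_dif n (lift_op (h' m) z))"
    by (rule lift_diff[OF e z'(1)])
  have 3: "lift_op (?e m) (lift_dif n (lift_op (h' m) z)) = lift_dif n (lift_op (?e n) (lift_op (h' m) z))"
    unfolding lift_dif_eq m_def
    by (rule slice_eqI) (unfold slice_lift, rule retr_dif[OF h_tame tensD(1)[OF hz, unfolded m_def slice_lift]])
  have 4: "lift_op (?e m) z = z - lift_dif n (lift_op (h m) z)"
    "lift_op (?e m) x = x - lift_dif n (lift_op (h m) x)"
    using lift_retr[OF h_tame z] lift_retr[OF h_tame, of x n] x lx by (simp_all add: m_def)
  \<comment> \<open>Modulo boundaries \<open>x\<close>, \<open>?e x\<close>,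
    \<open>?e (?e' z)\<close>, \<open>?e z\<close> and \<open>z\<close> all agree; the four terms of
    \<open>?w\<close> collect the homotopies used along this chain.\<close>
  let ?w = "lift_op (h m) z + lift_op (?e n) (lift_op (h' m) z) - geom (B m) z - lift_op (h m) x"
  have "z = x + lift_dif n ?w"
    using 1 unfolding 2 3 4
    by (simp add: additive.add[OF lift_dif_additive] additive.diff[OF lift_dif_additive] algebra_simps)
  moreover have "?w \<in> tens n"
    by (intro tens_add tens_diff lift_tens[OF h'1(2)] lift_tens[OF e] hz geom_tens[OF B1(1)] z' x)
  ultimately show ?thesis using y ly unfolding x_def m_def by blast
qed

end

end

section \<open>Descent to functions of the sum of both exponents\<close>

context completion
begin

text \<open>Invariant functions are spread over all second exponents and do not fit into
  \<open>tens\<close>. Here the support is controlled only for each fixed second exponent.\<close>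

definition ftens :: "int \<Rightarrow> ((int \<times> int) \<times> int \<times> int \<Rightarrow> 'v) set"
  where "ftens n = {c. (\<forall>\<gamma>. c \<gamma> \<in> A n) \<and> (\<forall>q. {v. c (v, q) \<noteq> 0} \<in> \<S>)}"

lemma ftensD:
  assumes "c \<in> ftens n"
  shows "c \<gamma> \<in> A n" "{v. c (v, q) \<noteq> 0} \<in> \<S>"
  using assms unfolding ftens_def by blast+

lemma ftensI: "(\<And>\<gamma>. c \<gamma> \<in> A n) \<Longrightarrow> (\<And>q. {v. c (v, q) \<noteq> 0} \<in> \<S>) \<Longrightarrow> c \<in> ftens n"
  unfolding ftens_def by blast

lemma ftens_subgroup: "add_subgroup (ftens n)"
  unfolding add_subgroup_def
proof (intro conjI ballI)
  show "0 \<in> ftens n" by (rule ftensI) (simp_all add: support_idealD(1)[OF ideal])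
  fix c c' assume c: "c \<in> ftens n" and c': "c' \<in> ftens n"
  show "c - c' \<in> ftens n"
  proof (rule ftensI)
    show "(c - c') \<gamma> \<in> A n" for \<gamma>
      using add_subgroup_diff[OF A ftensD(1)[OF c] ftensD(1)[OF c']] by simp
    have "{v. (c - c') (v, q) \<noteq> 0} \<subseteq> {v. c (v, q) \<noteq> 0} \<union> {v. c' (v, q) \<noteq> 0}" for q by auto
    then show "{v. (c - c') (v, q) \<noteq> 0} \<in> \<S>" for q
      by (rule support_idealD(2)[OF ideal support_idealD(3)[OF ideal ftensD(2)[OF c] ftensD(2)[OF c']]])
  qed
qed

lemma lift_dif_apply: "lift_dif n c (v, q) = (\<Sum>p\<in>P. \<delta> n p (c (v, q - p)))"
  by (simp add: lift_dif_def local_op_def)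

lemma lift_dif_support:
  assumes "lift_dif n c (v, q) \<noteq> 0"
  obtains p where "p \<in> P" "c (v, q - p) \<noteq> 0"
proof -
  obtain p where "p \<in> P" "\<delta> n p (c (v, q - p)) \<noteq> 0"
    by (rule sum.not_neutral_contains_not_neutral[OF assms[unfolded lift_dif_apply]])
  then show thesis using that[of p] \<delta>_zero[of n p] by metis
qed

lemma lift_dif_ftens:
  assumes c: "c \<in> ftens n"
  shows "lift_dif n c \<in> ftens (n + 1)"
proof (rule ftensI)
  show "lift_dif n c \<gamma> \<in> A (n + 1)" for \<gamma>
    unfolding lift_dif_def local_op_def
    by (rule add_subgroup_sum[OF A]) (rule \<delta>_A[OF ftensD(1)[OF c]])
  have "{v. lift_dif n c (v, q) \<noteq> 0} \<subseteq> (\<Union>p\<in>P. {v. c (v, q - p) \<noteq> 0})" for q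
    by (auto elim: lift_dif_support)
  moreover have "(\<Union>p\<in>P. {v. c (v, q - p) \<noteq> 0}) \<in> \<S>" for q
    by (rule support_ideal_UN[OF ideal P]) (rule ftensD(2)[OF c])
  ultimately show "{v. lift_dif n c (v, q) \<noteq> 0} \<in> \<S>" for q
    by (rule support_idealD(2)[OF ideal, rotated])
qed

lemma lift_dif_lift_dif:
  assumes c: "c \<in> ftens n"
  shows "lift_dif (n + 1) (lift_dif n c) = 0"
  by (rule slice_eqI, unfold lift_dif_eq slice_lift slice_zero, rule dif_dif)
    (simp add: slice_def ftensD(1)[OF c])

lemma translate_ftens:
  assumes c: "c \<in> ftens n"
  shows "translate (a, b) c \<in> ftens n"
proof (rule ftensI)
  show "translate (a, b) c \<gamma> \<in> A n" for \<gamma> unfolding translate_def by (rule ftensD(1)[OF c])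
  show "{v. translate (a, b) c (v, q) \<noteq> 0} \<in> \<S>" for q
    using support_idealD(4)[OF ideal ftensD(2)[OF c, of "q - b"], of a] by (simp add: translate_def)
qed

lemma restrict_ftens: "c \<in> ftens n \<Longrightarrow> (\<lambda>\<gamma>. if Q \<gamma> then c \<gamma> else 0) \<in> ftens n"
proof (rule ftensI)
  assume c: "c \<in> ftens n"
  show "(if Q \<gamma> then c \<gamma> else 0) \<in> A n" for \<gamma> using ftensD(1)[OF c] by simp
  show "{v. (if Q (v, q) then c (v, q) else 0) \<noteq> 0} \<in> \<S>" for q
    by (rule support_idealD(2)[OF ideal ftensD(2)[OF c, of q]]) auto
qed

lemma transl_sum_support:
  assumes "transl_sum \<tau> I c \<gamma> \<noteq> 0"
  obtains i where "i \<in> I" "c (\<gamma> - \<tau> i) \<noteq> 0"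
proof -
  have "{i \<in> I. c (\<gamma> - \<tau> i) \<noteq> 0} \<noteq> {}" using assms unfolding transl_sum_def by (metis sum.empty)
  then show thesis using that by blast
qed

text \<open>For a fixed second exponent the slab condition leaves finitely many translates, so the
  support lies in a finite union of translates of members of the family.\<close>

lemma transl_sum_ftens:
  fixes s :: "int \<times> int" and l :: "int \<times> int \<Rightarrow> int"
  assumes c: "c \<in> ftens n" and sl: "c \<in> slab (\<lambda>\<gamma>. - l (snd \<gamma>))"
    and l: "\<And>q i. l (q + smul i s) = l q + i"
  shows "transl_sum (\<lambda>i. (smul i s, - smul i s)) I c \<in> ftens n"
proof (rule ftensI)
  show "transl_sum (\<lambda>i. (smul i s, - smul i s)) I c \<gamma> \<in> A n" for \<gamma>
    unfolding transl_sum_def by (rule add_subgroup_sum[OF A]) (rule ftensD(1)[OF c])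
  obtain N where N: "\<And>v q. c (v, q) \<noteq> 0 \<Longrightarrow> \<bar>l q\<bar> \<le> N" using sl by (force simp: slab_def)
  show "{v. transl_sum (\<lambda>i. (smul i s, - smul i s)) I c (v, q) \<noteq> 0} \<in> \<S>" for q
  proof (rule support_idealD(2)[OF ideal support_ideal_UN[OF ideal]])
    show "finite {- l q - N..- l q + N}" by simp
    show "{v. v - smul i s \<in> {v. c (v, q + smul i s) \<noteq> 0}} \<in> \<S>" for i
      by (rule support_idealD(4)[OF ideal ftensD(2)[OF c]])
    show "{v. transl_sum (\<lambda>i. (smul i s, - smul i s)) I c (v, q) \<noteq> 0}
      \<subseteq> (\<Union>i\<in>{- l q - N..- l q + N}. {v. v - smul i s \<in> {v. c (v, q + smul i s) \<noteq> 0}})"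
    proof
      fix v assume "v \<in> {v. transl_sum (\<lambda>i. (smul i s, - smul i s)) I c (v, q) \<noteq> 0}"
      then obtain i where i: "c (v - smul i s, q + smul i s) \<noteq> 0" by (auto elim!: transl_sum_support)
      moreover have "i \<in> {- l q - N..- l q + N}" using N[OF i] by (simp add: l) linarith
      ultimately show "v \<in> (\<Union>i\<in>{- l q - N..- l q + N}. {v. v - smul i s \<in> {v. c (v, q + smul i s) \<noteq> 0}})"
        by auto
    qed
  qed
qed

end

lemma slab_subgroup: "add_subgroup (slab l)"
proof -
  have "x - y \<in> slab l" if xy: "x \<in> slab l" "y \<in> slab l" for x y :: "'a \<Rightarrow> 'b::ab_group_add"
  proof -
    obtain N M where "\<forall>\<gamma>. x \<gamma> \<noteq> 0 \<longrightarrow> \<bar>l \<gamma>\<bar> \<le> N" "\<forall>\<gamma>. y \<gamma> \<noteq> 0 \<longrightarrow> \<bar>l \<gamma>\<bar> \<le> M"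
      using xy by (auto simp: slab_def)
    then have "\<forall>\<gamma>. (x - y) \<gamma> \<noteq> 0 \<longrightarrow> \<bar>l \<gamma>\<bar> \<le> max N M"
      by (auto simp: le_max_iff_disj) (metis diff_zero)
    then show ?thesis unfolding slab_def by blast
  qed
  then show ?thesis by (auto simp: add_subgroup_def slab_def)
qed

lemma invariant_subgroup: "add_subgroup (invariant \<tau>)"
  by (auto simp: add_subgroup_def invariant_def)

lemma add_subgroup_Int: "add_subgroup X \<Longrightarrow> add_subgroup Y \<Longrightarrow> add_subgroup (X \<inter> Y)"
  by (auto simp: add_subgroup_def)

context completion
begin

text \<open>\<open>\<alpha>\<close> and \<open>\<beta>\<close> are the coordinates with respect to
  the lattice basis \<open>t\<close>, \<open>w\<close>. Passing to invariants along \<open>t\<close>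
  uses the telescope and yields an acyclic complex; passing to invariants along \<open>w\<close>
  preserves this. A function on pairs that is invariant in both directions is a function of the sum
  of its arguments, that is, an element of the completion.\<close>

theorem completion_acyclic:
  fixes w :: "int \<times> int" and \<alpha> \<beta> :: "int \<times> int \<Rightarrow> int"
  assumes h: "finite_homotopy h"
    and lin: "\<And>a b. \<alpha> (a - b) = \<alpha> a - \<alpha> b" "\<And>a b. \<beta> (a - b) = \<beta> a - \<beta> b"
    and \<alpha>: "\<And>q i. \<alpha> (q + smul i t) = \<alpha> q + i" "\<And>q i. \<beta> (q + smul i t) = \<beta> q"
    and \<beta>: "\<And>q i. \<alpha> (q + smul i w) = \<alpha> q" "\<And>q i. \<beta> (q + smul i w) = \<beta> q + i"
    and basis: "\<And>q. q = smul (\<alpha> q) t + smul (\<beta> q) w"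
    and f: "f \<in> cmpl \<S> (n + 1)" "dif (n + 1) f = 0"
  shows "\<exists>g\<in>cmpl \<S> n. dif n g = f"
proof -
  define \<tau> \<sigma> :: "int \<Rightarrow> (int \<times> int) \<times> int \<times> int"
    where "\<tau> = (\<lambda>i. (smul i t, - smul i t))" and "\<sigma> = (\<lambda>i. (smul i w, - smul i w))"
  define k l :: "(int \<times> int) \<times> int \<times> int \<Rightarrow> int"
    where "k = (\<lambda>\<gamma>. - \<alpha> (snd \<gamma>))" and "l = (\<lambda>\<gamma>. - \<beta> (snd \<gamma>))"
  have lin0: "\<alpha> 0 = 0" "\<beta> 0 = 0" using lin(1)[of 0 0] lin(2)[of 0 0] by simp_all
  have kl_diff: "k (a - b) = k a - k b" "l (a - b) = l a - l b" for a b
    by (simp_all add: k_def l_def lin)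
  have k\<tau>: "k (\<tau> i) = i" "l (\<tau> i) = 0" and l\<sigma>: "k (\<sigma> i) = 0" "l (\<sigma> i) = i" for i
    using \<alpha>[of 0 i] \<beta>[of 0 i] lin(1)[of 0 "smul i t"] lin(2)[of 0 "smul i t"]
      lin(1)[of 0 "smul i w"] lin(2)[of 0 "smul i w"] lin0
    by (simp_all add: k_def l_def \<tau>_def \<sigma>_def)
  have \<tau>_add: "\<tau> (i + j) = \<tau> i + \<tau> j" "\<sigma> (i + j) = \<sigma> i + \<sigma> j" for i j
    by (simp_all add: \<tau>_def \<sigma>_def smul_add)
  \<comment> \<open>Bounding both coordinates of the second exponent confines it to a finite box, so
    \<open>tens\<close> is cut out of \<open>ftens\<close> by two slabs, one for each direction of
    descent.\<close>
  have tens_eq: "tens n = ftens n \<inter> slab l \<inter> slab k" for n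
  proof (intro equalityI subsetI)
    fix c assume c: "c \<in> tens n"
    obtain F where F: "finite F" "\<And>v. supp (slice c v) \<subseteq> F" using tensD(3)[OF c] by auto
    have ftens: "c \<in> ftens n"
    proof (rule ftensI)
      show "c \<gamma> \<in> A n" for \<gamma>
        using tensD(1)[OF c, of "fst \<gamma>"] by (auto simp: pol_iff slice_def) (metis prod.collapse)
      show "{v. c (v, q) \<noteq> 0} \<in> \<S>" for q
        by (rule support_idealD(2)[OF ideal tensD(2)[OF c]]) (auto simp: slice_def fun_eq_iff)
    qed
    have "c \<in> slab (\<lambda>\<gamma>. - b (snd \<gamma>))" for b :: "int \<times> int \<Rightarrow> int"
      unfolding slab_def
    proof (rule CollectI, rule exI, intro allI impI)
      fix \<gamma> assume "c \<gamma> \<noteq> 0"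
      then have "snd \<gamma> \<in> F" using F(2)[of "fst \<gamma>"] by (auto simp: supp_def slice_def)
      then show "\<bar>- b (snd \<gamma>)\<bar> \<le> (\<Sum>q\<in>F. \<bar>b q\<bar>)"
        using member_le_sum[of "snd \<gamma>" F "\<lambda>q. \<bar>b q\<bar>"] F(1) by simp
    qed
    then show "c \<in> ftens n \<inter> slab l \<inter> slab k" using ftens by (simp add: k_def l_def)
  next
    fix c assume c: "c \<in> ftens n \<inter> slab l \<inter> slab k"
    then obtain N M where N: "\<And>v q. c (v, q) \<noteq> 0 \<Longrightarrow> \<bar>\<alpha> q\<bar> \<le> N" and M: "\<And>v q. c (v, q) \<noteq> 0 \<Longrightarrow> \<bar>\<beta> q\<bar> \<le> M"
      by (fastforce simp: slab_def k_def l_def)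
    define F where "F = (\<lambda>(i, j). smul i t + smul j w) ` ({-N..N} \<times> {-M..M})"
    have F: "finite F" "\<And>v q. c (v, q) \<noteq> 0 \<Longrightarrow> q \<in> F"
    proof -
      show "finite F" by (simp add: F_def)
      fix v q assume "c (v, q) \<noteq> 0"
      then have "(\<alpha> q, \<beta> q) \<in> {-N..N} \<times> {-M..M}" using N[of v q] M[of v q] by auto
      then show "q \<in> F" unfolding F_def by (rule rev_image_eqI) (simp add: basis[symmetric])
    qed
    have cA: "c \<in> ftens n" using c by blast
    show "c \<in> tens n"
    proof (rule tensI[OF _ _ F(1)])
      show s: "supp (slice c v) \<subseteq> F" for v unfolding supp_def slice_def using F(2) by blast
      show "slice c v \<in> pol n" for v
        using ftensD(1)[OF cA] finite_subset[OF s F(1)] by (auto simp: pol_iff slice_def)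
      have "{v. slice c v \<noteq> 0} \<subseteq> (\<Union>q\<in>F. {v. c (v, q) \<noteq> 0})"
        using F(2) by (fastforce simp: slice_def fun_eq_iff)
      moreover have "(\<Union>q\<in>F. {v. c (v, q) \<noteq> 0}) \<in> \<S>"
        by (rule support_ideal_UN[OF ideal F(1)]) (rule ftensD(2)[OF cA])
      ultimately show "{v. slice c v \<noteq> 0} \<in> \<S>"
        by (rule support_idealD(2)[OF ideal, rotated])
    qed
  qed
  have slab_l: "lift_dif n c \<in> slab l" "translate (\<tau> 1) c \<in> slab l"
      "(\<lambda>\<gamma>. if k \<gamma> = 0 then c \<gamma> else 0) \<in> slab l" "transl_sum \<tau> I c \<in> slab l"
    if c: "c \<in> slab l" for c :: "(int \<times> int) \<times> int \<times> int \<Rightarrow> 'v" and n I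
  proof -
    obtain N where N: "\<And>\<gamma>. c \<gamma> \<noteq> 0 \<Longrightarrow> \<bar>l \<gamma>\<bar> \<le> N" using c by (auto simp: slab_def)
    have lt: "l (\<gamma> - \<tau> i) = l \<gamma>" for \<gamma> i by (simp add: kl_diff k\<tau>)
    have "\<bar>l (v, q)\<bar> \<le> N + (\<Sum>p\<in>P. \<bar>\<beta> p\<bar>)" if "lift_dif n c (v, q) \<noteq> 0" for v q
    proof -
      obtain p where p: "p \<in> P" "c (v, q - p) \<noteq> 0" by (rule lift_dif_support[OF \<open>lift_dif n c (v, q) \<noteq> 0\<close>])
      have "\<bar>\<beta> p\<bar> \<le> (\<Sum>p\<in>P. \<bar>\<beta> p\<bar>)" using p(1) P by (intro member_le_sum) auto
      then show ?thesis using N[OF p(2)] by (simp add: l_def lin)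
    qed
    then show "lift_dif n c \<in> slab l" by (force simp: slab_def)
    have "\<bar>l \<gamma>\<bar> \<le> N" if "c (\<gamma> - \<tau> 1) \<noteq> 0" for \<gamma> using N[OF that] by (simp add: lt)
    then show "translate (\<tau> 1) c \<in> slab l" unfolding slab_def translate_def by blast
    have "\<bar>l \<gamma>\<bar> \<le> N" if "(if k \<gamma> = 0 then c \<gamma> else 0) \<noteq> 0" for \<gamma>
      using that N[of \<gamma>] by (simp split: if_splits)
    then show "(\<lambda>\<gamma>. if k \<gamma> = 0 then c \<gamma> else 0) \<in> slab l" unfolding slab_def by blast
    have "\<bar>l \<gamma>\<bar> \<le> N" if "transl_sum \<tau> I c \<gamma> \<noteq> 0" for \<gamma>
      using transl_sum_support[OF that] N lt by metis
    then show "transl_sum \<tau> I c \<in> slab l" unfolding slab_def by blast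
  qed
  \<comment> \<open>Along \<open>t\<close> the two conditions on cohomology are supplied by the
    telescope; the slab in the other coordinate is carried along.\<close>
  have step1: "\<exists>w \<in> (ftens n \<inter> slab l) \<inter> invariant \<tau>. lift_dif n w = y"
    if "y \<in> ftens (n + 1) \<inter> slab l" "y \<in> invariant \<tau>" "lift_dif (n + 1) y = 0" for y n
  proof (rule invariant_acyclic[where l = k and \<tau> = \<tau> and \<delta> = \<delta> and P = P and \<theta> = "\<lambda>p. (0, p)"
      and Y = "\<lambda>n. ftens n \<inter> slab l", folded lift_dif_def])
    show "add_subgroup (ftens n \<inter> slab l)" for n
      by (intro add_subgroup_Int ftens_subgroup slab_subgroup)
    show "lift_dif n c \<in> ftens (n + 1) \<inter> slab l" if "c \<in> ftens n \<inter> slab l" for n c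
      using that lift_dif_ftens slab_l(1)[of c] by blast
    show "lift_dif (n + 1) (lift_dif n c) = 0" if "c \<in> ftens n \<inter> slab l" for n c
      using that lift_dif_lift_dif by blast
    show "translate (\<tau> 1) c \<in> ftens n \<inter> slab l" if "c \<in> ftens n \<inter> slab l" for n c
      using that translate_ftens[of c n "smul 1 t" "- smul 1 t"] slab_l(2)[of c] by (auto simp: \<tau>_def)
    show "(\<lambda>\<gamma>. if k \<gamma> = 0 then c \<gamma> else 0) \<in> ftens n \<inter> slab l" if "c \<in> ftens n \<inter> slab l" for n c
      using that restrict_ftens[of c n "\<lambda>\<gamma>. k \<gamma> = 0"] slab_l(3)[of c] by blast
    show "transl_sum \<tau> I c \<in> ftens n \<inter> slab l" if "c \<in> ftens n \<inter> slab l" "c \<in> slab k" for n c I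
      using that transl_sum_ftens[of c n \<alpha> t I] \<alpha>(1) slab_l(4)[of c I] by (auto simp: \<tau>_def k_def)
    show "\<exists>c\<in>ftens n \<inter> slab l \<inter> slab k. a = lift_dif n c"
      if "a \<in> ftens (n + 1) \<inter> slab l \<inter> slab k" "lift_dif (n + 1) a = 0"
        "x \<in> ftens n \<inter> slab l \<inter> slab k" "a - translate (\<tau> 1) a = lift_dif n x" for n a x
      using shift_H_inj[OF h, of a n x] that unfolding tens_eq shift_def \<tau>_def by blast
    show "\<exists>y\<in>ftens (n + 1) \<inter> slab l \<inter> slab k. \<exists>w\<in>ftens n \<inter> slab l \<inter> slab k.
        lift_dif (n + 1) y = 0 \<and> z = y - translate (\<tau> 1) y + lift_dif n w"
      if "z \<in> ftens (n + 1) \<inter> slab l \<inter> slab k" "lift_dif (n + 1) z = 0" for n z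
      using shift_H_surj[OF h, of z n] that unfolding tens_eq shift_def \<tau>_def by blast
  qed (use that P \<delta>_add kl_diff \<tau>_add k\<tau> in auto)
  have inv_\<tau>: "lift_dif n c \<in> invariant \<tau>" "translate (\<sigma> 1) c \<in> invariant \<tau>"
      "(\<lambda>\<gamma>. if l \<gamma> = 0 then c \<gamma> else 0) \<in> invariant \<tau>" "transl_sum \<sigma> I c \<in> invariant \<tau>"
    if c: "c \<in> invariant \<tau>" for c :: "(int \<times> int) \<times> int \<times> int \<Rightarrow> 'v" and n I
  proof -
    have c': "c (\<gamma> - \<tau> i) = c \<gamma>" "c (\<gamma> - \<tau> i - a) = c (\<gamma> - a)" for \<gamma> i a
    proof -
      show "c (\<gamma> - \<tau> i) = c \<gamma>" for \<gamma> using c by (auto simp: invariant_def)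
      from this[of "\<gamma> - a"] show "c (\<gamma> - \<tau> i - a) = c (\<gamma> - a)" by (simp add: algebra_simps)
    qed
    show "lift_dif n c \<in> invariant \<tau>" by (auto simp: invariant_def lift_dif_def local_op_def c')
    show "translate (\<sigma> 1) c \<in> invariant \<tau>" by (auto simp: invariant_def translate_def c')
    show "(\<lambda>\<gamma>. if l \<gamma> = 0 then c \<gamma> else 0) \<in> invariant \<tau>" by (auto simp: invariant_def c' kl_diff k\<tau>)
    show "transl_sum \<sigma> I c \<in> invariant \<tau>" by (auto simp: invariant_def transl_sum_def c')
  qed
  have step2: "\<exists>w \<in> (ftens n \<inter> invariant \<tau>) \<inter> invariant \<sigma>. lift_dif n w = y"
    if "y \<in> ftens (n + 1) \<inter> invariant \<tau>" "y \<in> invariant \<sigma>" "lift_dif (n + 1) y = 0" for y n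
  proof (rule invariant_acyclic[where l = l and \<tau> = \<sigma> and \<delta> = \<delta> and P = P and \<theta> = "\<lambda>p. (0, p)"
      and Y = "\<lambda>n. ftens n \<inter> invariant \<tau>", folded lift_dif_def])
    show "add_subgroup (ftens n \<inter> invariant \<tau>)" for n
      by (intro add_subgroup_Int ftens_subgroup invariant_subgroup)
    show "lift_dif n c \<in> ftens (n + 1) \<inter> invariant \<tau>" if "c \<in> ftens n \<inter> invariant \<tau>" for n c
      using that lift_dif_ftens inv_\<tau>(1)[of c] by blast
    show "lift_dif (n + 1) (lift_dif n c) = 0" if "c \<in> ftens n \<inter> invariant \<tau>" for n c
      using that lift_dif_lift_dif by blast
    show "translate (\<sigma> 1) c \<in> ftens n \<inter> invariant \<tau>" if "c \<in> ftens n \<inter> invariant \<tau>" for n c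
      using that translate_ftens[of c n "smul 1 w" "- smul 1 w"] inv_\<tau>(2)[of c] by (auto simp: \<sigma>_def)
    show "(\<lambda>\<gamma>. if l \<gamma> = 0 then c \<gamma> else 0) \<in> ftens n \<inter> invariant \<tau>" if "c \<in> ftens n \<inter> invariant \<tau>" for n c
      using that restrict_ftens[of c n "\<lambda>\<gamma>. l \<gamma> = 0"] inv_\<tau>(3)[of c] by blast
    show "transl_sum \<sigma> I c \<in> ftens n \<inter> invariant \<tau>" if "c \<in> ftens n \<inter> invariant \<tau>" "c \<in> slab l" for n c I
      using that transl_sum_ftens[of c n \<beta> w I] \<beta>(2) inv_\<tau>(4)[of c I] by (auto simp: \<sigma>_def l_def)
    \<comment> \<open>Along \<open>w\<close> the conditions on cohomology hold because the complex
      in question is acyclic by \<open>step1\<close>: every cocycle is already a boundary, and the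
      cocycle component can be taken to be 0.\<close>
    show "\<exists>c\<in>ftens n \<inter> invariant \<tau> \<inter> slab l. a = lift_dif n c"
      if "a \<in> ftens (n + 1) \<inter> invariant \<tau> \<inter> slab l" "lift_dif (n + 1) a = 0" for n a
      using step1[of a n] that by blast
    show "\<exists>y\<in>ftens (n + 1) \<inter> invariant \<tau> \<inter> slab l. \<exists>w\<in>ftens n \<inter> invariant \<tau> \<inter> slab l.
        lift_dif (n + 1) y = 0 \<and> z = y - translate (\<sigma> 1) y + lift_dif n w"
      if z: "z \<in> ftens (n + 1) \<inter> invariant \<tau> \<inter> slab l" "lift_dif (n + 1) z = 0" for n z
    proof -
      obtain w where w: "w \<in> ftens n \<inter> invariant \<tau> \<inter> slab l" "lift_dif n w = z"
        using step1[of z n] z by blast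
      have "lift_dif (n + 1) 0 = 0" by (rule additive.zero[OF lift_dif_additive])
      moreover have "z = 0 - translate (\<sigma> 1) 0 + lift_dif n w" using w(2) by simp
      moreover have "0 \<in> ftens (n + 1) \<inter> invariant \<tau> \<inter> slab l"
        by (intro add_subgroup_zero add_subgroup_Int ftens_subgroup invariant_subgroup slab_subgroup)
      ultimately show ?thesis using w(1) by blast
    qed
  qed (use that P \<delta>_add kl_diff \<tau>_add l\<sigma> in auto)
  \<comment> \<open>Elements of the completion correspond to doubly invariant functions through
    addition of the two exponents, and the differential in the second variable becomes
    \<open>dif\<close>.\<close>
  define F where "F = (\<lambda>\<gamma>. f (fst \<gamma> + snd \<gamma>))"
  have "F \<in> ftens (n + 1)"
  proof (rule ftensI)
    show "F \<gamma> \<in> A (n + 1)" for \<gamma> using f(1) by (auto simp: F_def cmpl_def)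
    have "{v. F (v, q) \<noteq> 0} = {v. v - (- q) \<in> supp f}" for q by (auto simp: F_def supp_def)
    then show "{v. F (v, q) \<noteq> 0} \<in> \<S>" for q
      using support_idealD(4)[OF ideal, of "supp f" "- q"] f(1) by (simp add: cmpl_def)
  qed
  moreover have "F \<in> invariant \<tau>" "F \<in> invariant \<sigma>"
    by (simp_all add: invariant_def F_def \<tau>_def \<sigma>_def)
  moreover have "lift_dif (n + 1) F = 0"
  proof -
    have "lift_dif (n + 1) F (v, q) = 0" for v q
      using fun_cong[OF f(2), of "v + q"] by (simp add: lift_dif_apply dif_apply F_def add_diff_eq)
    then show ?thesis by auto
  qed
  ultimately obtain G where G: "G \<in> ftens n" "G \<in> invariant \<tau>" "G \<in> invariant \<sigma>" "lift_dif n G = F"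
    using step2[of F n] by blast
  define g where "g = (\<lambda>v. G (v, 0))"
  \<comment> \<open>As \<open>t\<close> and \<open>w\<close> span the lattice, invariance moves any
    second exponent to 0.\<close>
  have Gg: "G (v, q) = g (v + q)" for v q
  proof -
    have "G ((v, q) - \<tau> (- \<alpha> q) - \<sigma> (- \<beta> q)) = G (v, q)"
      using G(2,3) unfolding invariant_def by simp
    moreover have "(v, q) - \<tau> (- \<alpha> q) - \<sigma> (- \<beta> q) = (v + (smul (\<alpha> q) t + smul (\<beta> q) w), q - (smul (\<alpha> q) t + smul (\<beta> q) w))"
      by (simp add: \<tau>_def \<sigma>_def smul_def prod_eq_iff)
    ultimately show ?thesis unfolding basis[symmetric] by (simp add: g_def)
  qed
  have "dif n g = f"
  proof
    fix v
    have "lift_dif n G (v, 0) = dif n g v" by (simp add: lift_dif_apply dif_apply Gg)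
    then show "dif n g v = f v" using G(4) by (simp add: F_def)
  qed
  moreover have "g \<in> cmpl \<S> n"
    using ftensD[OF G(1)] by (simp add: cmpl_def g_def supp_def)
  ultimately show ?thesis by blast
qed

end

section \<open>Convolution with kernels\<close>

definition conv :: "(int \<times> int \<Rightarrow> 'v \<Rightarrow> 'v) \<Rightarrow> (int \<times> int \<Rightarrow> 'v) \<Rightarrow> int \<times> int \<Rightarrow> 'v::ab_group_add"
  where "conv K f v = (\<Sum>q\<in>{q. K (v - q) (f q) \<noteq> 0}. K (v - q) (f q))"

definition trunc :: "'g set \<Rightarrow> ('g \<Rightarrow> 'v) \<Rightarrow> 'g \<Rightarrow> 'v::zero"
  where "trunc W f = (\<lambda>v. if v \<in> W then f v else 0)"

text \<open>This finiteness makes every sum finite when a kernel supported in \<open>U\<close> is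
  convolved with a function supported in \<open>W\<close>.\<close>

definition proper_pair :: "(int \<times> int) set \<Rightarrow> (int \<times> int) set \<Rightarrow> bool"
  where "proper_pair U W \<longleftrightarrow> (\<forall>v. finite {q. v - q \<in> U \<and> q \<in> W})"

lemma trunc_add: "trunc W (f + g) = trunc W f + trunc W (g :: 'g \<Rightarrow> 'v::ab_group_add)"
  and trunc_diff: "trunc W (f - g) = trunc W f - trunc W (g :: 'g \<Rightarrow> 'v::ab_group_add)"
  by (auto simp: trunc_def)

lemma supp_trunc: "supp (trunc W f) = supp f \<inter> W"
  by (auto simp: supp_def trunc_def)

lemma trunc_trunc: "trunc W (trunc W' f) = trunc (W \<inter> W') f"
  by (auto simp: trunc_def)

locale lin_complex = local_complex P \<delta> A
  for P and \<delta> :: "int \<Rightarrow> int \<times> int \<Rightarrow> 'v::ab_group_add \<Rightarrow> 'v" and A +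
  fixes Rs :: "'r set" and \<rho> :: "'r \<Rightarrow> 'v \<Rightarrow> 'v"
  assumes \<rho>_add: "\<And>r. additive (\<rho> r)"
    and \<rho>_A: "\<And>n r a. r \<in> Rs \<Longrightarrow> a \<in> A n \<Longrightarrow> \<rho> r a \<in> A n"
    and \<delta>_\<rho>: "\<And>n p r a. r \<in> Rs \<Longrightarrow> a \<in> A n \<Longrightarrow> \<delta> n p (\<rho> r a) = \<rho> r (\<delta> n p a)"
begin

lemmas \<rho>_zero = additive.zero[OF \<rho>_add]
  and \<rho>_diff = additive.diff[OF \<rho>_add]
  and \<rho>_plus = additive.add[OF \<rho>_add]
  and \<rho>_sum = additive.sum[OF \<rho>_add]

section \<open>R-linear maps between polynomial complexes\<close>

definition scale :: "'r \<Rightarrow> (int \<times> int \<Rightarrow> 'v) \<Rightarrow> int \<times> int \<Rightarrow> 'v"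
  where "scale r f = (\<lambda>v. \<rho> r (f v))"

definition rlin :: "int \<Rightarrow> int \<Rightarrow> ((int \<times> int \<Rightarrow> 'v) \<Rightarrow> int \<times> int \<Rightarrow> 'v) \<Rightarrow> bool"
  where "rlin n m B \<longleftrightarrow> (\<forall>f\<in>pol n. B f \<in> pol m) \<and> (\<forall>f\<in>pol n. \<forall>g\<in>pol n. B (f + g) = B f + B g)
    \<and> (\<forall>r\<in>Rs. \<forall>f\<in>pol n. B (scale r f) = scale r (B f))"

lemma rlinI:
  assumes "\<And>f. f \<in> pol n \<Longrightarrow> B f \<in> pol m" "\<And>f g. f \<in> pol n \<Longrightarrow> g \<in> pol n \<Longrightarrow> B (f + g) = B f + B g"
    "\<And>r f. r \<in> Rs \<Longrightarrow> f \<in> pol n \<Longrightarrow> B (scale r f) = scale r (B f)"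
  shows "rlin n m B"
  using assms unfolding rlin_def by blast

lemma rlinD:
  assumes "rlin n m B"
  shows "f \<in> pol n \<Longrightarrow> B f \<in> pol m" "f \<in> pol n \<Longrightarrow> g \<in> pol n \<Longrightarrow> B (f + g) = B f + B g"
    "r \<in> Rs \<Longrightarrow> f \<in> pol n \<Longrightarrow> B (scale r f) = scale r (B f)"
  using assms unfolding rlin_def by blast+

lemma scale_additive: "additive (scale r)"
  by (rule additive.intro) (simp add: scale_def fun_eq_iff \<rho>_plus)

lemma supp_scale: "supp (scale r f) \<subseteq> supp f"
  by (auto simp: supp_def scale_def \<rho>_zero)

lemma scale_pol: "r \<in> Rs \<Longrightarrow> f \<in> pol n \<Longrightarrow> scale r f \<in> pol n"
  using finite_subset[OF supp_scale[of r f]] by (simp add: pol_iff) (simp add: scale_def \<rho>_A)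

lemma rlin_comp:
  assumes "rlin n m B" "rlin m k C"
  shows "rlin n k (\<lambda>f. C (B f))"
  by (rule rlinI) (simp_all only: rlinD[OF assms(1)] rlinD[OF assms(2)])

lemma rlin_diff_fun: 
  assumes "rlin n m B" "rlin n m C"
  shows "rlin n m (\<lambda>f. B f - C f)"
  by (rule rlinI) (simp_all add: rlinD[OF assms(1)] rlinD[OF assms(2)] pol_diff additive.diff[OF scale_additive])

lemma rlin_id: "rlin n n (\<lambda>f. f)"
  by (rule rlinI) simp_all

lemma scale_dif: "r \<in> Rs \<Longrightarrow> (\<And>v. f v \<in> A n) \<Longrightarrow> dif n (scale r f) = scale r (dif n f)"
  by (simp add: fun_eq_iff dif_apply scale_def \<rho>_sum \<delta>_\<rho>)

lemma rlin_dif: "rlin n (n + 1) (dif n)"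
  by (rule rlinI) (simp_all only: dif_pol dif_add, rule scale_dif, simp_all add: pol_iff)

lemma trunc_pol: "f \<in> pol n \<Longrightarrow> trunc W f \<in> pol n"
  by (simp add: pol_iff supp_trunc) (simp add: trunc_def)

lemma scale_trunc: "scale r (trunc W f) = trunc W (scale r f)"
  by (auto simp: scale_def trunc_def \<rho>_zero)

lemma rlin_trunc: "rlin n n (trunc W)"
  by (rule rlinI) (auto simp: trunc_pol trunc_add scale_trunc)

text \<open>A matrix over a completed ring, read as a family of maps on coefficients. Convolution
  with it is the translation-equivariant map given by that matrix, and it also acts on series whose
  supports are proper with respect to \<open>U\<close>.\<close>

definition kern :: "(int \<times> int) set \<Rightarrow> int \<Rightarrow> int \<Rightarrow> (int \<times> int \<Rightarrow> 'v \<Rightarrow> 'v) \<Rightarrow> bool"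
  where "kern U n m K \<longleftrightarrow> (\<forall>v. additive (K v)) \<and> (\<forall>v. \<forall>a\<in>A n. K v a \<in> A m)
    \<and> (\<forall>v. \<forall>a\<in>A n. v \<notin> U \<longrightarrow> K v a = 0) \<and> (\<forall>v. \<forall>r\<in>Rs. \<forall>a\<in>A n. K v (\<rho> r a) = \<rho> r (K v a))"

lemma kernD:
  assumes "kern U n m K"
  shows "additive (K v)" "a \<in> A n \<Longrightarrow> K v a \<in> A m" "a \<in> A n \<Longrightarrow> v \<notin> U \<Longrightarrow> K v a = 0"
    "r \<in> Rs \<Longrightarrow> a \<in> A n \<Longrightarrow> K v (\<rho> r a) = \<rho> r (K v a)" "K v 0 = 0"
  using assms additive.zero[of "K v"] unfolding kern_def by blast+

lemma kern_mono: "kern U n m K \<Longrightarrow> U \<subseteq> U' \<Longrightarrow> kern U' n m K"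
  unfolding kern_def by blast

lemma conv_eq:
  assumes K: "kern U n m K" and f: "\<And>v. f v \<in> A n"
    and Q: "finite Q" "\<And>q. v - q \<in> U \<Longrightarrow> f q \<noteq> 0 \<Longrightarrow> q \<in> Q"
  shows "conv K f v = (\<Sum>q\<in>Q. K (v - q) (f q))"
  unfolding conv_def
proof (rule sum.mono_neutral_left[OF Q(1)])
  show "{q. K (v - q) (f q) \<noteq> 0} \<subseteq> Q"
  proof
    fix q assume "q \<in> {q. K (v - q) (f q) \<noteq> 0}"
    then have "K (v - q) (f q) \<noteq> 0" by simp
    then show "q \<in> Q" using Q(2)[of q] kernD(3)[OF K f, of "v - q" q] kernD(5)[OF K] by metis
  qed
qed auto

lemma conv_A:
  assumes K: "kern U n m K" and f: "\<And>v. f v \<in> A n"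
  shows "conv K f v \<in> A m"
  unfolding conv_def by (rule add_subgroup_sum[OF A]) (rule kernD(2)[OF K f])

lemma conv_support:
  assumes K: "kern U n m K" and f: "\<And>v. f v \<in> A n" and nz: "conv K f v \<noteq> 0"
  obtains q where "v - q \<in> U" "q \<in> supp f"
proof -
  have "{q. K (v - q) (f q) \<noteq> 0} \<noteq> {}" using nz unfolding conv_def by (metis sum.empty)
  then obtain q where q: "K (v - q) (f q) \<noteq> 0" by blast
  have "v - q \<in> U" using q kernD(3)[OF K f] by blast
  moreover have "f q \<noteq> 0" using q kernD(5)[OF K] by metis
  ultimately show thesis using that by (simp add: supp_def)
qed

lemma supp_conv:
  assumes "kern U n m K" "\<And>v. f v \<in> A n"
  shows "supp (conv K f) \<subseteq> {v. \<exists>q\<in>supp f. v - q \<in> U}"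
proof
  fix v assume "v \<in> supp (conv K f)"
  then have "conv K f v \<noteq> 0" by (simp add: supp_def)
  then show "v \<in> {v. \<exists>q\<in>supp f. v - q \<in> U}" by (rule conv_support[OF assms]) blast
qed

lemma conv_add:
  assumes K: "kern U n m K" and f: "\<And>v. f v \<in> A n" "\<And>v. g v \<in> A n"
    and W: "proper_pair U W" "supp f \<subseteq> W" "supp g \<subseteq> W"
  shows "conv K (f + g) = conv K f + conv K g"
proof
  fix v
  let ?Q = "{q. v - q \<in> U \<and> q \<in> W}"
  have Q: "finite ?Q" using W(1) by (simp add: proper_pair_def)
  have fg: "(f + g) v \<in> A n" for v using add_subgroup_add[OF A f] by simp
  have "conv K (f + g) v = (\<Sum>q\<in>?Q. K (v - q) ((f + g) q))"
    by (rule conv_eq[OF K fg Q]) (use W(2,3) supp_add[of f g] in \<open>unfold supp_def, blast\<close>)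
  also have "\<dots> = (\<Sum>q\<in>?Q. K (v - q) (f q)) + (\<Sum>q\<in>?Q. K (v - q) (g q))"
    by (simp add: additive.add[OF kernD(1)[OF K]] sum.distrib)
  also have "(\<Sum>q\<in>?Q. K (v - q) (f q)) = conv K f v"
    by (rule conv_eq[OF K f(1) Q, symmetric]) (use W(2) in \<open>auto simp: supp_def\<close>)
  also have "(\<Sum>q\<in>?Q. K (v - q) (g q)) = conv K g v"
    by (rule conv_eq[OF K f(2) Q, symmetric]) (use W(3) in \<open>auto simp: supp_def\<close>)
  finally show "conv K (f + g) v = (conv K f + conv K g) v" unfolding plus_fun_apply .
qed

lemma conv_diff:
  assumes K: "kern U n m K" and f: "\<And>v. f v \<in> A n" "\<And>v. g v \<in> A n"
    and W: "proper_pair U W" "supp f \<subseteq> W" "supp g \<subseteq> W"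
  shows "conv K (f - g) = conv K f - conv K g"
proof -
  have fg: "(f - g) v \<in> A n" for v using add_subgroup_diff[OF A f] by simp
  have "supp (f - g) \<subseteq> W" using supp_diff[of f g] W(2,3) by blast
  then have "conv K (f - g + g) = conv K (f - g) + conv K g" by (intro conv_add[OF K fg f(2) W(1) _ W(3)])
  then show ?thesis by (simp only: diff_add_cancel) (simp add: fun_eq_iff)
qed

lemma conv_scale:
  assumes K: "kern U n m K" and f: "\<And>v. f v \<in> A n" and r: "r \<in> Rs"
    and W: "proper_pair U W" "supp f \<subseteq> W"
  shows "conv K (scale r f) = scale r (conv K f)"
proof
  fix v
  let ?Q = "{q. v - q \<in> U \<and> q \<in> W}"
  have Q: "finite ?Q" using W(1) by (simp add: proper_pair_def)
  have "conv K (scale r f) v = (\<Sum>q\<in>?Q. K (v - q) (scale r f q))"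
    by (rule conv_eq[OF K _ Q]) (use W(2) \<rho>_A[OF r f] supp_scale[of r f] in \<open>auto simp: supp_def scale_def\<close>)
  also have "\<dots> = \<rho> r (\<Sum>q\<in>?Q. K (v - q) (f q))"
    by (simp add: scale_def \<rho>_sum kernD(4)[OF K r f])
  also have "(\<Sum>q\<in>?Q. K (v - q) (f q)) = conv K f v"
    by (rule conv_eq[OF K f Q, symmetric]) (use W(2) in \<open>auto simp: supp_def\<close>)
  finally show "conv K (scale r f) v = scale r (conv K f) v" by (simp add: scale_def)
qed

lemma proper_pair_finite: "finite W \<Longrightarrow> proper_pair U W"
  by (simp add: proper_pair_def)

text \<open>Both sides of a contraction identity only involve finitely many coefficients at each point.\<close>

lemma conv_contraction:
  assumes K: "kern U n (n - 1) K" and K': "kern U (n + 1) n K'"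
    and id: "\<And>f. f \<in> pol n \<Longrightarrow> dif (n - 1) (conv K f) + conv K' (dif n f) = f"
    and w: "\<And>v. w v \<in> A n" and U: "proper_pair U W" and W: "supp w \<subseteq> W"
    and WP: "\<And>p q. p \<in> P \<Longrightarrow> q \<in> supp w \<Longrightarrow> q + p \<in> W"
  shows "dif (n - 1) (conv K w) + conv K' (dif n w) = w"
proof
  fix v
  \<comment> \<open>\<open>Q\<close> contains all points read by the convolutions at
    \<open>v\<close> and at the \<open>v - p\<close>; \<open>Q'\<close> adds \<open>v\<close> and
    the points that the differential reads on \<open>Q\<close>. Cutting \<open>w\<close> to
    \<open>Q'\<close> gives a polynomial for which the identity at \<open>v\<close> has the same
    terms.\<close>
  define Q where "Q = {q. v - q \<in> U \<and> q \<in> W} \<union> (\<Union>p\<in>P. {q. (v - p) - q \<in> U \<and> q \<in> W})"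
  define Q' where "Q' = insert v (Q \<union> (\<Union>p\<in>P. (\<lambda>q. q - p) ` Q))"
  define w' where "w' = trunc Q' w"
  have Qf: "finite Q" using U P by (simp add: Q_def proper_pair_def)
  then have Q'f: "finite Q'" using P by (simp add: Q'_def)
  have w'A: "w' v \<in> A n" for v using w by (simp add: w'_def trunc_def)
  have "w' \<in> pol n" using Q'f w'A by (simp add: pol_iff) (simp add: w'_def supp_trunc)
  note id' = fun_cong[OF id[OF this], of v]
  have w'_eq: "w' q = w q" if "q \<in> Q'" for q using that by (simp add: w'_def trunc_def)
  have w'_supp: "w q \<noteq> 0" if "w' q \<noteq> 0" for q using that by (simp add: w'_def trunc_def split: if_splits)
  have 1: "conv K w (v - p) = conv K w' (v - p)" if p: "p \<in> P" for p
  proof -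
    have "conv K w (v - p) = (\<Sum>q\<in>Q. K (v - p - q) (w q))"
      by (rule conv_eq[OF K w Qf]) (use p W in \<open>auto simp: Q_def supp_def\<close>)
    also have "\<dots> = (\<Sum>q\<in>Q. K (v - p - q) (w' q))"
      by (rule sum.cong[OF refl]) (simp add: w'_eq Q'_def)
    also have "\<dots> = conv K w' (v - p)"
      by (rule conv_eq[OF K w'A Qf, symmetric]) (use p W w'_supp in \<open>auto simp: Q_def supp_def\<close>)
    finally show ?thesis .
  qed
  have 2: "conv K' (dif n w) v = conv K' (dif n w') v"
  proof -
    have in_Q: "q \<in> Q" if "v - q \<in> U" "\<And>p. p \<in> P \<Longrightarrow> g (q - p) \<noteq> 0 \<Longrightarrow> w (q - p) \<noteq> 0" "dif n g q \<noteq> 0" for q g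
    proof -
      have "q \<in> supp (dif n g)" using that(3) by (simp add: supp_def)
      then obtain p where p: "p \<in> P" "g (q - p) \<noteq> 0" using supp_dif[of n g] by (auto simp: supp_def)
      then have "q - p \<in> supp w" using that(2) by (simp add: supp_def)
      then have "q \<in> W" using WP[OF p(1), of "q - p"] by simp
      then show ?thesis using that(1) by (simp add: Q_def)
    qed
    have de: "dif n w q = dif n w' q" if "q \<in> Q" for q
      by (rule dif_cong, rule w'_eq[symmetric]) (use that in \<open>auto simp: Q'_def\<close>)
    have "conv K' (dif n w) v = (\<Sum>q\<in>Q. K' (v - q) (dif n w q))"
      by (rule conv_eq[OF K' dif_A[OF w] Qf]) (rule in_Q[of _ w])
    also have "\<dots> = (\<Sum>q\<in>Q. K' (v - q) (dif n w' q))"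
      by (rule sum.cong[OF refl]) (simp only: de)
    also have "\<dots> = conv K' (dif n w') v"
      by (rule conv_eq[OF K' dif_A[OF w'A] Qf, symmetric]) (rule in_Q[of _ w'], use w'_supp in auto)
    finally show ?thesis .
  qed
  have "dif (n - 1) (conv K w) v = dif (n - 1) (conv K w') v" by (rule dif_cong) (rule 1)
  then show "(dif (n - 1) (conv K w) + conv K' (dif n w)) v = w v"
    using id' 2 w'_eq[of v] by (simp add: Q'_def)
qed

text \<open>A contracting homotopy recorded by matrices over the completed ring. The identity is
  demanded on polynomials only; \<open>conv_contraction\<close> extends it to series with proper
  supports.\<close>

definition contraction :: "(int \<times> int) set set \<Rightarrow> (int \<Rightarrow> int \<times> int \<Rightarrow> 'v \<Rightarrow> 'v) \<Rightarrow> bool"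
  where "contraction \<S> \<kappa> \<longleftrightarrow> (\<forall>n. \<exists>U\<in>\<S>. kern U n (n - 1) (\<kappa> n))
    \<and> (\<forall>n. \<forall>f\<in>pol n. dif (n - 1) (conv (\<kappa> n) f) + conv (\<kappa> (n + 1)) (dif n f) = f)"

lemma contractionE:
  assumes "contraction \<S> \<kappa>"
  obtains U where "U \<in> \<S>" "kern U n (n - 1) (\<kappa> n)"
  using assms unfolding contraction_def by blast

lemma contraction_id:
  "contraction \<S> \<kappa> \<Longrightarrow> f \<in> pol n \<Longrightarrow> dif (n - 1) (conv (\<kappa> n) f) + conv (\<kappa> (n + 1)) (dif n f) = f"
  unfolding contraction_def by blast

lemma conv_pol_cmpl:
  assumes S: "support_ideal \<S>" and c: "contraction \<S> \<kappa>" and f: "f \<in> pol n"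
  shows "conv (\<kappa> n) f \<in> cmpl \<S> (n - 1)"
proof -
  obtain U where U: "U \<in> \<S>" "kern U n (n - 1) (\<kappa> n)" by (rule contractionE[OF c])
  have fA: "f v \<in> A n" for v using f by (simp add: pol_iff)
  have "supp (conv (\<kappa> n) f) \<subseteq> (\<Union>q\<in>supp f. {v. v - q \<in> U})"
    by (rule order_trans[OF supp_conv[OF U(2) fA]]) auto
  moreover have "(\<Union>q\<in>supp f. {v. v - q \<in> U}) \<in> \<S>"
    by (rule support_ideal_UN[OF S]) (use f support_idealD(4)[OF S U(1)] in \<open>auto simp: pol_iff\<close>)
  ultimately have "supp (conv (\<kappa> n) f) \<in> \<S>" by (rule support_idealD(2)[OF S, rotated])
  then show ?thesis using conv_A[OF U(2) fA] by (simp add: cmpl_def)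
qed

text \<open>The differential read on \<open>W (n + 1)\<close> depends only on values in
  \<open>W n\<close>. Hence restriction to \<open>W\<close> is the projection onto a quotient
  complex, which is what makes truncated homotopy identities meaningful.\<close>

definition open_region :: "(int \<Rightarrow> (int \<times> int) set) \<Rightarrow> bool"
  where "open_region W \<longleftrightarrow> (\<forall>n. \<forall>v\<in>W (n + 1). \<forall>p\<in>P. v - p \<in> W n)"

lemma trunc_dif_trunc:
  assumes "open_region W"
  shows "trunc (W (n + 1)) (dif n (trunc (W n) f)) = trunc (W (n + 1)) (dif n f)"
proof
  fix v
  show "trunc (W (n + 1)) (dif n (trunc (W n) f)) v = trunc (W (n + 1)) (dif n f) v"
    using assms unfolding open_region_def trunc_def by (simp add: dif_apply)
qed

lemma trunc_dif_trunc': "open_region W \<Longrightarrow> trunc (W n) (dif (n - 1) (trunc (W (n - 1)) f)) = trunc (W n) (dif (n - 1) f)"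
  using trunc_dif_trunc[of W "n - 1" f] by simp

lemma open_region_Int: "open_region W \<Longrightarrow> open_region W' \<Longrightarrow> open_region (\<lambda>n. W n \<inter> W' n)"
  unfolding open_region_def by blast

text \<open>Supports in the family meet the region in finite sets, so truncating the contraction
  yields polynomials. The contraction identity survives truncation because restriction to an open
  region is compatible with the differential.\<close>

lemma edge_homotopy:
  assumes S: "support_ideal \<S>" and c: "contraction \<S> \<kappa>" and W: "open_region W"
    and fin: "\<And>n U. U \<in> \<S> \<Longrightarrow> finite (U \<inter> W n)"
  defines "h \<equiv> \<lambda>n f. trunc (W (n - 1)) (conv (\<kappa> n) f)"
  shows "rlin n (n - 1) (h n)"
    and "f \<in> pol n \<Longrightarrow> trunc (W n) (dif (n - 1) (h n f)) + h (n + 1) (dif n f) = trunc (W n) f"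
proof -
  obtain U where U: "U \<in> \<S>" "kern U n (n - 1) (\<kappa> n)" by (rule contractionE[OF c])
  have pA: "f v \<in> A n" if "f \<in> pol n" for f v using that by (simp add: pol_iff)
  show "rlin n (n - 1) (h n)"
  proof (rule rlinI)
    fix f assume f: "f \<in> pol n"
    have C: "conv (\<kappa> n) f \<in> cmpl \<S> (n - 1)" by (rule conv_pol_cmpl[OF S c f])
    then have "finite (supp (conv (\<kappa> n) f) \<inter> W (n - 1))" by (intro fin) (simp add: cmpl_def)
    then show "h n f \<in> pol (n - 1)"
      using C unfolding h_def pol_iff supp_trunc by (simp add: trunc_def cmpl_def)
  next
    fix f g assume f: "f \<in> pol n" and g: "g \<in> pol n"
    have "finite (supp f \<union> supp g)" using f g by (simp add: pol_iff)
    from conv_add[OF U(2) pA[OF f] pA[OF g] proper_pair_finite[OF this] Un_upper1 Un_upper2]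
    have "conv (\<kappa> n) (f + g) = conv (\<kappa> n) f + conv (\<kappa> n) g" .
    then show "h n (f + g) = h n f + h n g" by (simp only: h_def trunc_add)
  next
    fix r f assume r: "r \<in> Rs" and f: "f \<in> pol n"
    have "conv (\<kappa> n) (scale r f) = scale r (conv (\<kappa> n) f)"
      by (rule conv_scale[OF U(2) pA[OF f] r proper_pair_finite order_refl]) (use f in \<open>simp add: pol_iff\<close>)
    then show "h n (scale r f) = scale r (h n f)" by (simp only: h_def scale_trunc)
  qed
  show "trunc (W n) (dif (n - 1) (h n f)) + h (n + 1) (dif n f) = trunc (W n) f" if f: "f \<in> pol n"
  proof -
    have "trunc (W n) (dif (n - 1) (h n f)) = trunc (W n) (dif (n - 1) (conv (\<kappa> n) f))"
      unfolding h_def by (rule trunc_dif_trunc'[OF W])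
    moreover have "h (n + 1) (dif n f) = trunc (W n) (conv (\<kappa> (n + 1)) (dif n f))"
      by (simp only: h_def add_diff_cancel_right')
    ultimately show ?thesis using trunc_add contraction_id[OF c f] by metis
  qed
qed

text \<open>
  On a corner region the two edge homotopies differ by a chain map of degree \<open>-1\<close>, which extends
  to the corner completion and hence is null-homotopic.
\<close>

lemma corner_homotopy:
  assumes S: "support_ideal \<S>" and x: "contraction \<X> \<kappa>" and y: "contraction \<Y> \<mu>" and c: "contraction \<S> \<sigma>"
    and W: "open_region W"
    and ideals: "support_ideal \<X>" "support_ideal \<Y>"
    and proper: "\<And>U V. U \<in> \<X> \<Longrightarrow> V \<in> \<S> \<Longrightarrow> proper_pair U V" "\<And>U V. U \<in> \<Y> \<Longrightarrow> V \<in> \<S> \<Longrightarrow> proper_pair U V"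
    and fin: "\<And>n U V. U \<in> \<X> \<Longrightarrow> V \<in> \<S> \<Longrightarrow> finite {v \<in> W n. \<exists>q\<in>V. v - q \<in> U}"
      "\<And>n U V. U \<in> \<Y> \<Longrightarrow> V \<in> \<S> \<Longrightarrow> finite {v \<in> W n. \<exists>q\<in>V. v - q \<in> U}"
  defines "k \<equiv> \<lambda>n f. trunc (W (n - 1 - 1))
      (conv (\<mu> (n - 1)) (conv (\<sigma> n) f) - conv (\<kappa> (n - 1)) (conv (\<sigma> n) f))"
  shows "rlin n (n - 1 - 1) (k n)"
    and "f \<in> pol n \<Longrightarrow> trunc (W (n - 1)) (dif (n - 1 - 1) (k n f)) - k (n + 1) (dif n f)
      = trunc (W (n - 1)) (conv (\<kappa> n) f - conv (\<mu> n) f)"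
proof -
  have pA: "f v \<in> A n" if "f \<in> pol n" for n f v using that by (simp add: pol_iff)
  have cA: "g v \<in> A m" "supp g \<in> \<S>" if "g \<in> cmpl \<S> m" for g v m
    using that by (simp_all add: cmpl_def)
  note g = conv_pol_cmpl[OF S c]
  \<comment> \<open>This fact and the next ones are stated for an arbitrary edge family and are then
    used for both \<open>\<kappa>\<close> and \<open>\<mu>\<close>.\<close>
  have conv_W: "trunc (W m) (conv (\<kappa> n) g) \<in> pol (n - 1)"
    if x: "contraction \<X> \<kappa>" and fin: "\<And>n U V. U \<in> \<X> \<Longrightarrow> V \<in> \<S> \<Longrightarrow> finite {v \<in> W n. \<exists>q\<in>V. v - q \<in> U}"
      and g: "g \<in> cmpl \<S> n" for n m g \<X> and \<kappa> :: "int \<Rightarrow> int \<times> int \<Rightarrow> 'v \<Rightarrow> 'v"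
  proof -
    obtain U where U: "U \<in> \<X>" "kern U n (n - 1) (\<kappa> n)" by (rule contractionE[OF x])
    have "supp (conv (\<kappa> n) g) \<inter> W m \<subseteq> {v \<in> W m. \<exists>q\<in>supp g. v - q \<in> U}"
      using subsetD[OF supp_conv[OF U(2) cA(1)[OF g]]] by auto
    then have "finite (supp (conv (\<kappa> n) g) \<inter> W m)" by (rule finite_subset[OF _ fin[OF U(1) cA(2)[OF g]]])
    then show ?thesis
      using conv_A[OF U(2) cA(1)[OF g]] unfolding pol_iff supp_trunc by (simp add: trunc_def)
  qed
  have add: "conv (\<kappa> n) (g + g') = conv (\<kappa> n) g + conv (\<kappa> n) g'"
    and sub: "conv (\<kappa> n) (g - g') = conv (\<kappa> n) g - conv (\<kappa> n) g'"
    and scl: "r \<in> Rs \<Longrightarrow> conv (\<kappa> n) (scale r g) = scale r (conv (\<kappa> n) g)"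
    if x: "contraction \<X> \<kappa>" and p: "\<And>U V. U \<in> \<X> \<Longrightarrow> V \<in> \<S> \<Longrightarrow> proper_pair U V"
      and g: "g \<in> cmpl \<S> n" "g' \<in> cmpl \<S> n" for n g g' r \<X> and \<kappa> :: "int \<Rightarrow> int \<times> int \<Rightarrow> 'v \<Rightarrow> 'v"
  proof -
    obtain U where U: "U \<in> \<X>" "kern U n (n - 1) (\<kappa> n)" by (rule contractionE[OF x])
    have V: "proper_pair U (supp g \<union> supp g')" by (intro p U support_idealD(3)[OF S] cA(2)[OF g(1)] cA(2)[OF g(2)])
    show "conv (\<kappa> n) (g + g') = conv (\<kappa> n) g + conv (\<kappa> n) g'"
      by (rule conv_add[OF U(2) cA(1)[OF g(1)] cA(1)[OF g(2)] V]) auto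
    show "conv (\<kappa> n) (g - g') = conv (\<kappa> n) g - conv (\<kappa> n) g'"
      by (rule conv_diff[OF U(2) cA(1)[OF g(1)] cA(1)[OF g(2)] V]) auto
    show "conv (\<kappa> n) (scale r g) = scale r (conv (\<kappa> n) g)" if "r \<in> Rs"
      by (rule conv_scale[OF U(2) cA(1)[OF g(1)] that V]) auto
  qed
  have contr: "dif (n - 1) (conv (\<kappa> n) g) + conv (\<kappa> (n + 1)) (dif n g) = g"
    if x: "contraction \<X> \<kappa>" and X: "support_ideal \<X>" and p: "\<And>U V. U \<in> \<X> \<Longrightarrow> V \<in> \<S> \<Longrightarrow> proper_pair U V"
      and g: "g \<in> cmpl \<S> n" for n g \<X> and \<kappa> :: "int \<Rightarrow> int \<times> int \<Rightarrow> 'v \<Rightarrow> 'v"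
  proof -
    obtain U where U: "U \<in> \<X>" "kern U n (n - 1) (\<kappa> n)" by (rule contractionE[OF x])
    obtain U' where U': "U' \<in> \<X>" "kern U' (n + 1) (n + 1 - 1) (\<kappa> (n + 1))" by (rule contractionE[OF x])
    define V where "V = supp g \<union> (\<Union>p\<in>P. {v. v - p \<in> supp g})"
    have V: "V \<in> \<S>" unfolding V_def
      by (intro support_idealD(3)[OF S] support_ideal_UN[OF S P] support_idealD(4)[OF S] cA(2)[OF g])
    have UU: "U \<union> U' \<in> \<X>" by (rule support_idealD(3)[OF X U(1) U'(1)])
    show ?thesis
    proof (rule conv_contraction[OF kern_mono[OF U(2) Un_upper1] _ _ cA(1)[OF g] p[OF UU V]])
      show "kern (U \<union> U') (n + 1) n (\<kappa> (n + 1))" using kern_mono[OF U'(2) Un_upper2[of U' U]] by simp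
      show "dif (n - 1) (conv (\<kappa> n) f) + conv (\<kappa> (n + 1)) (dif n f) = f" if "f \<in> pol n" for f
        by (rule contraction_id[OF x that])
      show "q + p \<in> V" if "p \<in> P" "q \<in> supp g" for p q
        using that by (auto simp: V_def intro!: bexI[of _ p])
    qed (simp add: V_def)
  qed
  obtain Uc where Uc: "Uc \<in> \<S>" "kern Uc n (n - 1) (\<sigma> n)" by (rule contractionE[OF c])
  show "rlin n (n - 1 - 1) (k n)"
  proof (rule rlinI)
    fix f assume f: "f \<in> pol n"
    show "k n f \<in> pol (n - 1 - 1)"
      unfolding k_def trunc_diff by (intro pol_diff conv_W[OF x fin(1) g[OF f]] conv_W[OF y fin(2) g[OF f]])
  next
    fix f f' assume f: "f \<in> pol n" and f': "f' \<in> pol n"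
    have "finite (supp f \<union> supp f')" using f f' by (simp add: pol_iff)
    from conv_add[OF Uc(2) pA[OF f] pA[OF f'] proper_pair_finite[OF this] Un_upper1 Un_upper2]
    have "conv (\<sigma> n) (f + f') = conv (\<sigma> n) f + conv (\<sigma> n) f'" .
    then show "k n (f + f') = k n f + k n f'"
      unfolding k_def by (simp only: add[OF x proper(1) g[OF f] g[OF f']] add[OF y proper(2) g[OF f] g[OF f']] trunc_add trunc_diff)
        (simp add: fun_eq_iff)
  next
    fix r f assume r: "r \<in> Rs" and f: "f \<in> pol n"
    have "conv (\<sigma> n) (scale r f) = scale r (conv (\<sigma> n) f)"
      by (rule conv_scale[OF Uc(2) pA[OF f] r proper_pair_finite order_refl]) (use f in \<open>simp add: pol_iff\<close>)
    then show "k n (scale r f) = scale r (k n f)"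
      unfolding k_def by (simp only: scl[OF x proper(1) g[OF f] g[OF f] r] scl[OF y proper(2) g[OF f] g[OF f] r]
          scale_trunc additive.diff[OF scale_additive])
  qed
  assume f: "f \<in> pol n"
  define a where "a = conv (\<sigma> n) f"
  define b where "b = conv (\<sigma> (n + 1)) (dif n f)"
  have a: "a \<in> cmpl \<S> (n - 1)" unfolding a_def by (rule g[OF f])
  have b: "b \<in> cmpl \<S> n" unfolding b_def using g[OF dif_pol[OF f]] by simp
  \<comment> \<open>That the support of a polynomial lies in \<open>\<S>\<close> is read off the
    contraction identity, which writes \<open>f\<close> as a sum of two elements of the
    completion.\<close>
  have fc: "f \<in> cmpl \<S> n"
  proof -
    have "dif (n - 1) a + b = f" unfolding a_def b_def by (rule contraction_id[OF c f])
    moreover have "dif (n - 1) a \<in> cmpl \<S> n" using dif_cmpl[OF S a] by simp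
    ultimately show ?thesis using add_subgroup_add[OF cmpl_subgroup[OF S] _ b] by metis
  qed
  have da: "dif (n - 1) a = f - b"
    using contraction_id[OF c f] unfolding a_def b_def by (simp add: fun_eq_iff algebra_simps)
  have ed: "dif (n - 1 - 1) (conv (\<kappa> (n - 1)) a) = a - conv (\<kappa> n) f + conv (\<kappa> n) b"
    if x: "contraction \<X> \<kappa>" and X: "support_ideal \<X>" and p: "\<And>U V. U \<in> \<X> \<Longrightarrow> V \<in> \<S> \<Longrightarrow> proper_pair U V"
    for \<X> and \<kappa> :: "int \<Rightarrow> int \<times> int \<Rightarrow> 'v \<Rightarrow> 'v"
    using contr[OF x X p a] sub[OF x p fc b] unfolding diff_add_cancel da
    by (simp add: fun_eq_iff algebra_simps)
  show "trunc (W (n - 1)) (dif (n - 1 - 1) (k n f)) - k (n + 1) (dif n f)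
      = trunc (W (n - 1)) (conv (\<kappa> n) f - conv (\<mu> n) f)"
  proof -
    have "trunc (W (n - 1)) (dif (n - 1 - 1) (k n f))
        = trunc (W (n - 1)) (dif (n - 1 - 1) (conv (\<mu> (n - 1)) a - conv (\<kappa> (n - 1)) a))"
      unfolding k_def a_def by (rule trunc_dif_trunc'[OF W])
    moreover have "k (n + 1) (dif n f) = trunc (W (n - 1)) (conv (\<mu> n) b - conv (\<kappa> n) b)"
      by (simp only: k_def add_diff_cancel_right' b_def)
    \<comment> \<open>Each edge contraction applied to \<open>a\<close> returns \<open>a\<close> up
      to terms in \<open>f\<close> and \<open>b\<close>; in the difference \<open>a\<close> cancels
      and the terms in \<open>b\<close> are exactly those of \<open>k (n + 1)\<close>.\<close>
    moreover have "dif (n - 1 - 1) (conv (\<mu> (n - 1)) a - conv (\<kappa> (n - 1)) a)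
        - (conv (\<mu> n) b - conv (\<kappa> n) b) = conv (\<kappa> n) f - conv (\<mu> n) f"
    proof -
      have "dif (n - 1 - 1) (conv (\<kappa> (n - 1)) a) = a - conv (\<kappa> n) f + conv (\<kappa> n) b"
        by (rule ed[OF x ideals(1) proper(1)])
      moreover have "dif (n - 1 - 1) (conv (\<mu> (n - 1)) a) = a - conv (\<mu> n) f + conv (\<mu> n) b"
        by (rule ed[OF y ideals(2) proper(2)])
      ultimately show ?thesis by (simp only: dif_diff) (simp add: fun_eq_iff)
    qed
    ultimately show ?thesis using trunc_diff by metis
  qed
qed

end

section \<open>Gluing the homotopies\<close>

context lin_complex
begin

lemma rlin_add_fun:
  assumes "rlin n m B" "rlin n m C"
  shows "rlin n m (\<lambda>f. B f + C f)"
proof (rule rlinI)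
  show "B f + C f \<in> pol m" if "f \<in> pol n" for f using that by (intro pol_add rlinD[OF assms(1)] rlinD[OF assms(2)])
  show "B (f + g) + C (f + g) = B f + C f + (B g + C g)" if "f \<in> pol n" "g \<in> pol n" for f g
    unfolding rlinD(2)[OF assms(1) that] rlinD(2)[OF assms(2) that] by (simp add: fun_eq_iff)
  show "B (scale r f) + C (scale r f) = scale r (B f + C f)" if "r \<in> Rs" "f \<in> pol n" for r f
    by (simp only: rlinD(3)[OF assms(1) that] rlinD(3)[OF assms(2) that] additive.add[OF scale_additive])
qed

lemma rlin_zero: "rlin n m B \<Longrightarrow> B 0 = 0"
  using rlinD(2)[of n m B 0 0] pol_zero[of n] by simp

lemma dif_dif_pol: "f \<in> pol n \<Longrightarrow> dif (n + 1) (dif n f) = 0" "f \<in> pol (n - 1) \<Longrightarrow> dif n (dif (n - 1) f) = 0"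
  using dif_dif[of f n] dif_dif[of f "n - 1"] by (simp_all add: pol_iff)

lemma trunc_0 [simp]: "trunc W 0 = 0"
  by (auto simp: trunc_def)

lemma trunc_eqD: "trunc W f = trunc W g \<Longrightarrow> v \<in> W \<Longrightarrow> f v = g v"
  by (metis trunc_def)

text \<open>The homotopies on the half planes \<open>U\<close> are corrected by boundaries of the
  maps \<open>k\<close>, so that on each quadrant they agree with the homotopies on the half planes
  \<open>V\<close>. The pieces then define one \<open>h\<close> whose homotopy identity holds on all
  four half planes and can fail only on the finite complement.\<close>

lemma glue_homotopy:
  fixes U V :: "bool \<Rightarrow> int \<Rightarrow> (int \<times> int) set"
    and hU hV :: "bool \<Rightarrow> int \<Rightarrow> (int \<times> int \<Rightarrow> 'v) \<Rightarrow> int \<times> int \<Rightarrow> 'v"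
    and k :: "bool \<Rightarrow> bool \<Rightarrow> int \<Rightarrow> (int \<times> int \<Rightarrow> 'v) \<Rightarrow> int \<times> int \<Rightarrow> 'v"
  assumes U: "\<And>i. open_region (U i)" and V: "\<And>j. open_region (V j)"
    and low: "\<And>n. n < lo \<Longrightarrow> A n = {0}"
    and disj: "\<And>n. lo \<le> n \<Longrightarrow> U True n \<inter> U False n = {}" "\<And>n. lo \<le> n \<Longrightarrow> V True n \<inter> V False n = {}"
    and fin: "\<And>n. finite (- (U True n \<union> U False n \<union> V True n \<union> V False n))"
    and hU: "\<And>i n. rlin n (n - 1) (hU i n)" and hV: "\<And>j n. rlin n (n - 1) (hV j n)"
    and k: "\<And>i j n. rlin n (n - 1 - 1) (k i j n)"
    and hU_supp: "\<And>i n f. supp (hU i n f) \<subseteq> U i (n - 1)"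
    and hV_supp: "\<And>j n f. supp (hV j n f) \<subseteq> V j (n - 1)"
    and k_supp: "\<And>i j n f. supp (k i j n f) \<subseteq> U i (n - 1 - 1) \<inter> V j (n - 1 - 1)"
    and hU_id: "\<And>i n f. f \<in> pol n \<Longrightarrow> trunc (U i n) (dif (n - 1) (hU i n f)) + hU i (n + 1) (dif n f) = trunc (U i n) f"
    and hV_id: "\<And>j n f. f \<in> pol n \<Longrightarrow> trunc (V j n) (dif (n - 1) (hV j n f)) + hV j (n + 1) (dif n f) = trunc (V j n) f"
    and k_id: "\<And>i j n f. f \<in> pol n \<Longrightarrow>
        trunc (U i (n - 1) \<inter> V j (n - 1)) (dif (n - 1 - 1) (k i j n f)) - k i j (n + 1) (dif n f)
        = trunc (U i (n - 1) \<inter> V j (n - 1)) (hU i n f - hV j n f)"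
  shows "\<exists>h. (\<forall>n. rlin n (n - 1) (h n)) \<and> (\<forall>n. \<exists>F. finite F \<and> (\<forall>f\<in>pol n. supp (retr h n f) \<subseteq> F))"
proof -
  \<comment> \<open>The boundary of \<open>k i j\<close>, which on the quadrant is the discrepancy
    of the two edge homotopies. It is truncated to \<open>U i\<close> and not to the quadrant, so
    that it is a cycle on all of \<open>U i\<close>.\<close>
  define X where "X = (\<lambda>i j n f. trunc (U i (n - 1)) (dif (n - 1 - 1) (k i j n f)) - k i j (n + 1) (dif n f))"
  define g where "g = (\<lambda>i n f. hU i n f - X i True n f - X i False n f)"
  \<comment> \<open>The pieces are cut to disjoint sets, so \<open>h\<close> is well defined and
    R-linear from the outset; \<open>compat\<close> shows that on overlaps the precedence given to
    \<open>U\<close> changes nothing.\<close>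
  define h where "h = (\<lambda>n f. trunc (U True (n - 1)) (g True n f) + trunc (U False (n - 1) - U True (n - 1)) (g False n f)
    + trunc (V True (n - 1) - (U True (n - 1) \<union> U False (n - 1))) (hV True n f)
    + trunc (V False (n - 1) - (V True (n - 1) \<union> U True (n - 1) \<union> U False (n - 1))) (hV False n f))"
  have dif2: "rlin (n - 1 - 1) (n - 1) (dif (n - 1 - 1))" for n using rlin_dif[of "n - 1 - 1"] by simp
  have k1: "rlin (n + 1) (n - 1) (k i j (n + 1))" for i j n using k[of "n + 1" i j] by simp
  have X_lin: "rlin n (n - 1) (X i j n)" for i j n unfolding X_def
    by (intro rlin_diff_fun rlin_comp[OF rlin_comp[OF k dif2] rlin_trunc] rlin_comp[OF rlin_dif k1])
  have g_lin: "rlin n (n - 1) (g i n)" for i n unfolding g_def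
    by (intro rlin_diff_fun hU X_lin)
  have h_lin: "rlin n (n - 1) (h n)" for n unfolding h_def
    by (intro rlin_add_fun rlin_comp[OF g_lin rlin_trunc] rlin_comp[OF hV rlin_trunc])
  have supp_trunc_id: "trunc W f = f" if "supp f \<subseteq> W" for W and f :: "int \<times> int \<Rightarrow> 'v"
    using that by (auto simp: trunc_def supp_def fun_eq_iff)
  have trunc_disj: "trunc W f = 0" if "supp f \<inter> W = {}" for W and f :: "int \<times> int \<Rightarrow> 'v"
    using that by (auto simp: trunc_def supp_def fun_eq_iff)
  have pol_low: "f = 0" if "f \<in> pol n" "n < lo" for f n
    using that low by (auto simp: pol_iff fun_eq_iff)
  have X_same: "trunc (U i (n - 1) \<inter> V j (n - 1)) (X i j n f) = trunc (U i (n - 1) \<inter> V j (n - 1)) (hU i n f - hV j n f)"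
    if f: "f \<in> pol n" for i j n f
  proof -
    have "trunc (U i (n - 1) \<inter> V j (n - 1)) (k i j (n + 1) (dif n f)) = k i j (n + 1) (dif n f)"
      by (rule supp_trunc_id) (use k_supp[of i j "n + 1"] in simp)
    moreover have "U i (n - 1) \<inter> V j (n - 1) \<inter> U i (n - 1) = U i (n - 1) \<inter> V j (n - 1)" by blast
    ultimately show ?thesis unfolding X_def trunc_diff[of _ "trunc _ _"] trunc_trunc using k_id[OF f, of i j] by simp
  qed
  have X_other: "trunc (U i (n - 1) \<inter> V j (n - 1)) (X i (\<not> j) n f) = 0"
    if f: "f \<in> pol n" and n: "lo \<le> n - 1" for i j n f
  proof -
    let ?W = "\<lambda>n. U i n \<inter> V j n"
    have disjV: "V (\<not> j) n \<inter> V j n = {}" if "lo \<le> n" for n using disj(2)[OF that] by (cases j) auto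
    \<comment> \<open>The maps \<open>k\<close> lower the degree by 2, so the target may lie below
      \<open>lo\<close>, where opposite half planes may overlap; the module is zero there.\<close>
    have 1: "trunc (?W (n - 1 - 1)) (k i (\<not> j) n f) = 0"
    proof (cases "lo \<le> n - 1 - 1")
      case True
      show ?thesis by (rule trunc_disj) (use k_supp[of i "\<not> j" n f] disjV[OF True] in blast)
    next
      case False
      then have "k i (\<not> j) n f = 0" by (intro pol_low[OF rlinD(1)[OF k f]]) simp
      then show ?thesis by simp
    qed
    have "trunc (?W (n - 1)) (dif (n - 1 - 1) (k i (\<not> j) n f)) = 0"
      using trunc_dif_trunc'[OF open_region_Int[OF U V], of i "n - 1" j "k i (\<not> j) n f"]
      unfolding 1 dif_zero by simp
    moreover have "trunc (?W (n - 1)) (k i (\<not> j) (n + 1) (dif n f)) = 0"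
      by (rule trunc_disj) (use k_supp[of i "\<not> j" "n + 1" "dif n f"] disjV[OF n] in auto)
    moreover have "?W (n - 1) \<inter> U i (n - 1) = ?W (n - 1)" by blast
    ultimately show ?thesis unfolding X_def trunc_diff trunc_trunc by simp
  qed
  have g_supp: "supp (g i n f) \<subseteq> U i (n - 1)" for i n f
  proof -
    have X: "supp (X i j n f) \<subseteq> U i (n - 1)" for j
      unfolding X_def
      by (rule order_trans[OF supp_diff Un_least]) (use k_supp[of i j "n + 1" "dif n f"] in \<open>auto simp: supp_trunc\<close>)
    show ?thesis unfolding g_def
      by (rule order_trans[OF supp_diff Un_least[OF order_trans[OF supp_diff Un_least[OF hU_supp X]] X]])
  qed
  have compat: "trunc (U i (n - 1) \<inter> V j (n - 1)) (g i n f) = trunc (U i (n - 1) \<inter> V j (n - 1)) (hV j n f)"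
    if f: "f \<in> pol n" and n: "lo \<le> n - 1" for i j n f
  proof -
    let ?T = "trunc (U i (n - 1) \<inter> V j (n - 1))"
    have "g i n f = hU i n f - X i j n f - X i (\<not> j) n f"
      unfolding g_def by (cases j) (simp_all add: fun_eq_iff)
    then have "?T (g i n f) = ?T (hU i n f) - ?T (X i j n f) - ?T (X i (\<not> j) n f)"
      by (simp only: trunc_diff)
    then show ?thesis unfolding X_same[OF f] X_other[OF f n] trunc_diff by simp
  qed
  have g_id: "trunc (U i n) (dif (n - 1) (g i n f)) + g i (n + 1) (dif n f) = trunc (U i n) f"
    if f: "f \<in> pol n" for i n f
  proof -
    \<comment> \<open>Both composites with the differential reduce to \<open>dif\<close> applied
      twice, so the correction leaves the homotopy identity on \<open>U i\<close> untouched.\<close>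
    have X0: "trunc (U i n) (dif (n - 1) (X i j n f)) + X i j (n + 1) (dif n f) = 0" for j
    proof -
      have "trunc (U i n) (dif (n - 1) (trunc (U i (n - 1)) (dif (n - 1 - 1) (k i j n f)))) = 0"
        unfolding trunc_dif_trunc'[OF U] dif_dif_pol(2)[OF rlinD(1)[OF k f]] by simp
      moreover have "k i j (n + 1 + 1) (dif (n + 1) (dif n f)) = 0"
        unfolding dif_dif_pol(1)[OF f] by (rule rlin_zero[OF k])
      ultimately show ?thesis unfolding X_def dif_diff trunc_diff[of _ "dif _ _"] by simp
    qed
    have "trunc (U i n) (dif (n - 1) (g i n f)) + g i (n + 1) (dif n f)
      = (trunc (U i n) (dif (n - 1) (hU i n f)) + hU i (n + 1) (dif n f))
        - (trunc (U i n) (dif (n - 1) (X i True n f)) + X i True (n + 1) (dif n f))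
        - (trunc (U i n) (dif (n - 1) (X i False n f)) + X i False (n + 1) (dif n f))"
      unfolding g_def dif_diff trunc_diff by (simp add: fun_eq_iff)
    then show ?thesis unfolding X0 hU_id[OF f] by simp
  qed
  have h_U: "trunc (U i (n - 1)) (h n f) = g i n f" and h_V: "trunc (V j (n - 1)) (h n f) = hV j n f"
    if f: "f \<in> pol n" for i j n f
  proof -
    have "trunc (U i (n - 1)) (h n f) = g i n f \<and> trunc (V j (n - 1)) (h n f) = hV j n f"
    proof (cases "lo \<le> n - 1")
      case True
      have c: "g i n f v = hV j n f v" if "v \<in> U i (n - 1)" "v \<in> V j (n - 1)" for i j v
        using trunc_eqD[OF compat[OF f True, of i j], of v] that by simp
      have hv: "h n f v = g i n f v" if "v \<in> U i (n - 1)" for i v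
        using that disj(1)[OF True] by (cases i) (auto simp: h_def trunc_def)
      have hw: "h n f v = hV j n f v" if "v \<in> V j (n - 1)" for j v
      proof (cases "v \<in> U True (n - 1) \<union> U False (n - 1)")
        case True
        then obtain i where "v \<in> U i (n - 1)" by blast
        then show ?thesis using hv c[OF _ that] by simp
      next
        case out: False
        then show ?thesis using that disj(2)[OF True] by (cases j) (auto simp: h_def trunc_def)
      qed
      have "trunc (U i (n - 1)) (h n f) = trunc (U i (n - 1)) (g i n f)"
        "trunc (V j (n - 1)) (h n f) = trunc (V j (n - 1)) (hV j n f)"
        using hv[of _ i] hw[of _ j] by (simp_all add: trunc_def fun_eq_iff)
      then show ?thesis unfolding supp_trunc_id[OF g_supp] supp_trunc_id[OF hV_supp] by simp
    next
      case False
      then have "h n f = 0" "g i n f = 0" "hV j n f = 0"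
        using pol_low[OF rlinD(1)[OF h_lin f]] pol_low[OF rlinD(1)[OF g_lin f]] pol_low[OF rlinD(1)[OF hV f]] by auto
      then show ?thesis by simp
    qed
    then show "trunc (U i (n - 1)) (h n f) = g i n f" "trunc (V j (n - 1)) (h n f) = hV j n f" by simp_all
  qed
  \<comment> \<open>On each half plane \<open>h\<close> coincides with a homotopy whose truncated
    identity holds there, so \<open>retr h\<close> vanishes on it.\<close>
  have small: "supp (retr h n f) \<subseteq> - (U True n \<union> U False n \<union> V True n \<union> V False n)" if f: "f \<in> pol n" for n f
  proof -
    have df: "dif n f \<in> pol (n + 1)" by (rule dif_pol[OF f])
    have eqU: "trunc (U i n) (dif (n - 1) (h n f)) + trunc (U i n) (h (n + 1) (dif n f)) = trunc (U i n) f" for i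
      using g_id[OF f, of i] h_U[OF df, of i] trunc_dif_trunc'[OF U, of i n "h n f"] h_U[OF f, of i] by simp
    have 1: "trunc (U i n) (retr h n f) = 0" for i
      unfolding retr_def trunc_diff eqU[symmetric] by (simp add: fun_eq_iff)
    have eqV: "trunc (V i n) (dif (n - 1) (h n f)) + trunc (V i n) (h (n + 1) (dif n f)) = trunc (V i n) f" for i
      using hV_id[OF f, of i] h_V[OF df, of i] trunc_dif_trunc'[OF V, of i n "h n f"] h_V[OF f, of i] by simp
    have 2: "trunc (V i n) (retr h n f) = 0" for i
      unfolding retr_def trunc_diff eqV[symmetric] by (simp add: fun_eq_iff)
    have "retr h n f v = 0" if "v \<in> U i n \<or> v \<in> V i n" for v i
      using fun_cong[OF 1[of i], of v] fun_cong[OF 2[of i], of v] that by (auto simp: trunc_def)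
    then show ?thesis by (auto simp: supp_def)
  qed
  show ?thesis
  proof (intro exI[of _ h] conjI allI)
    show "rlin n (n - 1) (h n)" for n by (rule h_lin)
    show "\<exists>F. finite F \<and> (\<forall>f\<in>pol n. supp (retr h n f) \<subseteq> F)" for n
      using fin[of n] small[of _ n] by metis
  qed
qed

end

section \<open>Supports of Laurent series\<close>

text \<open>The supports of the Laurent series in \<open>x^\<epsilon>\<close> whose coefficients are
  Laurent polynomials in y.\<close>

definition edge_x :: "int \<Rightarrow> (int \<times> int) set set"
  where "edge_x \<epsilon> = {U. (\<exists>k. \<forall>v\<in>U. - k \<le> \<epsilon> * fst v) \<and> (\<forall>i. finite {j. (i, j) \<in> U})}"

definition edge_y :: "int \<Rightarrow> (int \<times> int) set set"
  where "edge_y \<epsilon> = {U. (\<exists>k. \<forall>v\<in>U. - k \<le> \<epsilon> * snd v) \<and> (\<forall>j. finite {i. (i, j) \<in> U})}"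

definition corner :: "int \<Rightarrow> int \<Rightarrow> (int \<times> int) set set"
  where "corner \<epsilon> \<epsilon>' = {U. \<exists>k. \<forall>v\<in>U. - k \<le> \<epsilon> * fst v \<and> - k \<le> \<epsilon>' * snd v}"

lemma support_ideal_edge_x: "support_ideal (edge_x \<epsilon>)"
  unfolding support_ideal_def
proof (intro conjI allI impI)
  show "{} \<in> edge_x \<epsilon>" by (simp add: edge_x_def)
  fix U V assume U: "U \<in> edge_x \<epsilon>"
  obtain k where k: "\<forall>v\<in>U. - k \<le> \<epsilon> * fst v" and f: "\<And>i. finite {j. (i, j) \<in> U}"
    using U by (auto simp: edge_x_def)
  show "V \<in> edge_x \<epsilon>" if "V \<subseteq> U"
  proof -
    have "finite {j. (i, j) \<in> V}" for i by (rule finite_subset[OF _ f[of i]]) (use that in auto)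
    then show ?thesis using k that unfolding edge_x_def by blast
  qed
  show "U \<union> V \<in> edge_x \<epsilon>" if V: "V \<in> edge_x \<epsilon>"
  proof -
    obtain l where l: "\<forall>v\<in>V. - l \<le> \<epsilon> * fst v" and g: "\<And>i. finite {j. (i, j) \<in> V}"
      using V by (auto simp: edge_x_def)
    have "\<forall>v\<in>U \<union> V. - max k l \<le> \<epsilon> * fst v" using k l by fastforce
    moreover have "finite {j. (i, j) \<in> U \<union> V}" for i using f[of i] g[of i] by (simp add: Collect_disj_eq)
    ultimately show ?thesis unfolding edge_x_def by blast
  qed
  fix a :: "int \<times> int"
  have "\<forall>v\<in>{v. v - a \<in> U}. - (k - \<epsilon> * fst a) \<le> \<epsilon> * fst v" using k by (fastforce simp: algebra_simps)
  moreover have "finite {j. (i, j) \<in> {v. v - a \<in> U}}" for i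
    by (rule finite_subset[OF _ finite_imageI[OF f[of "i - fst a"], of "\<lambda>j. j + snd a"]])
      (auto simp: image_iff minus_prod_def intro!: exI[of _ "_ - snd a"])
  ultimately show "{v. v - a \<in> U} \<in> edge_x \<epsilon>" unfolding edge_x_def by blast
qed

lemma swap_proj: "fst (prod.swap v) = snd v" "snd (prod.swap v) = fst v"
  by (cases v; simp)+

lemma swap_mem: "v \<in> prod.swap ` U \<longleftrightarrow> prod.swap v \<in> U"
  by (cases v) simp

lemma swap_diff: "prod.swap (a - b) = prod.swap a - prod.swap (b :: int \<times> int)"
  by (simp add: prod_eq_iff swap_proj)

lemma edge_y_swap: "U \<in> edge_y \<epsilon> \<longleftrightarrow> prod.swap ` U \<in> edge_x \<epsilon>"
  unfolding edge_x_def edge_y_def by (simp add: swap_proj)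

lemma support_ideal_edge_y: "support_ideal (edge_y \<epsilon>)"
proof -
  note i = support_idealD[OF support_ideal_edge_x[of \<epsilon>]]
  show ?thesis
    unfolding support_ideal_def edge_y_swap
  proof (intro conjI allI impI)
    show "prod.swap ` {} \<in> edge_x \<epsilon>" using i(1) by simp
    show "prod.swap ` V \<in> edge_x \<epsilon>" if "prod.swap ` U \<in> edge_x \<epsilon>" "V \<subseteq> U" for U V
      using i(2)[OF that(1)] that(2) by blast
    show "prod.swap ` (U \<union> V) \<in> edge_x \<epsilon>" if "prod.swap ` U \<in> edge_x \<epsilon>" "prod.swap ` V \<in> edge_x \<epsilon>" for U V
      using i(3)[OF that] by (simp add: image_Un)
    show "prod.swap ` {v. v - a \<in> U} \<in> edge_x \<epsilon>" if "prod.swap ` U \<in> edge_x \<epsilon>" for U a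
    proof -
      have "prod.swap ` {v. v - a \<in> U} = {v. v - prod.swap a \<in> prod.swap ` U}"
        by (rule Set.set_eqI) (simp add: swap_mem swap_diff)
      then show ?thesis using i(4)[OF that] by simp
    qed
  qed
qed

lemma support_ideal_corner: "support_ideal (corner \<epsilon> \<epsilon>')"
  unfolding support_ideal_def
proof (intro conjI allI impI)
  show "{} \<in> corner \<epsilon> \<epsilon>'" by (simp add: corner_def)
  fix U V assume U: "U \<in> corner \<epsilon> \<epsilon>'"
  obtain k where k: "\<forall>v\<in>U. - k \<le> \<epsilon> * fst v \<and> - k \<le> \<epsilon>' * snd v"
    using U by (auto simp: corner_def)
  show "V \<in> corner \<epsilon> \<epsilon>'" if "V \<subseteq> U"
    using k that unfolding corner_def by blast
  show "U \<union> V \<in> corner \<epsilon> \<epsilon>'" if V: "V \<in> corner \<epsilon> \<epsilon>'"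
  proof -
    obtain l where l: "\<forall>v\<in>V. - l \<le> \<epsilon> * fst v \<and> - l \<le> \<epsilon>' * snd v"
      using V by (auto simp: corner_def)
    have "\<forall>v\<in>U \<union> V. - max k l \<le> \<epsilon> * fst v \<and> - max k l \<le> \<epsilon>' * snd v" using k l by fastforce
    then show ?thesis unfolding corner_def by blast
  qed
  fix a :: "int \<times> int"
  have "\<forall>v\<in>{v. v - a \<in> U}. - (k + \<bar>\<epsilon> * fst a\<bar> + \<bar>\<epsilon>' * snd a\<bar>) \<le> \<epsilon> * fst v
      \<and> - (k + \<bar>\<epsilon> * fst a\<bar> + \<bar>\<epsilon>' * snd a\<bar>) \<le> \<epsilon>' * snd v"
  proof
    fix v assume "v \<in> {v. v - a \<in> U}"
    then have "- k \<le> \<epsilon> * (fst v - fst a) \<and> - k \<le> \<epsilon>' * (snd v - snd a)" using k by fastforce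
    then show "- (k + \<bar>\<epsilon> * fst a\<bar> + \<bar>\<epsilon>' * snd a\<bar>) \<le> \<epsilon> * fst v
      \<and> - (k + \<bar>\<epsilon> * fst a\<bar> + \<bar>\<epsilon>' * snd a\<bar>) \<le> \<epsilon>' * snd v"
      unfolding right_diff_distrib by linarith
  qed
  then show "{v. v - a \<in> U} \<in> corner \<epsilon> \<epsilon>'" unfolding corner_def by blast
qed

text \<open>In direction \<open>\<epsilon>\<close> the first exponents are bounded below in
  \<open>U\<close> and in \<open>V\<close>. For a given sum only finitely many columns of
  \<open>U\<close> remain, and each of them is finite.\<close>

lemma edge_x_proper:
  assumes \<epsilon>: "\<epsilon> = 1 \<or> \<epsilon> = - 1" and U: "U \<in> edge_x \<epsilon>" and V: "V \<in> corner \<epsilon> \<epsilon>'"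
  shows "proper_pair U V"
  unfolding proper_pair_def
proof
  fix v :: "int \<times> int"
  obtain k where k: "\<forall>v\<in>U. - k \<le> \<epsilon> * fst v" and f: "\<And>i. finite {j. (i, j) \<in> U}"
    using U by (auto simp: edge_x_def)
  obtain l where l: "\<forall>v\<in>V. - l \<le> \<epsilon> * fst v" using V by (auto simp: corner_def)
  let ?N = "\<bar>k\<bar> + \<bar>l\<bar> + \<bar>fst v\<bar>"
  show "finite {q. v - q \<in> U \<and> q \<in> V}"
  proof (rule finite_subset)
    show "finite (\<Union>i\<in>{-?N..?N}. (\<lambda>j. (fst v - i, snd v - j)) ` {j. (i, j) \<in> U})" using f by blast
    show "{q. v - q \<in> U \<and> q \<in> V} \<subseteq> (\<Union>i\<in>{-?N..?N}. (\<lambda>j. (fst v - i, snd v - j)) ` {j. (i, j) \<in> U})"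
    proof
      fix q assume q: "q \<in> {q. v - q \<in> U \<and> q \<in> V}"
      then have "- k \<le> \<epsilon> * (fst v - fst q)" "- l \<le> \<epsilon> * fst q" using k l by fastforce+
      then have "fst v - fst q \<in> {-?N..?N}" using \<epsilon> by auto
      moreover have "(fst v - fst q, snd v - snd q) \<in> U" using q by (simp add: minus_prod_def)
      ultimately show "q \<in> (\<Union>i\<in>{-?N..?N}. (\<lambda>j. (fst v - i, snd v - j)) ` {j. (i, j) \<in> U})"
        by (intro UN_I[of "fst v - fst q"] image_eqI[of _ _ "snd v - snd q"]) simp_all
    qed
  qed
qed

text \<open>The bound on the first exponent of \<open>v\<close> leaves finitely many columns for
  \<open>v - q\<close>, hence finitely many second exponents of \<open>v - q\<close>. As the second
  exponent of \<open>q\<close> is bounded below in direction \<open>\<epsilon>'\<close>, that of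
  \<open>v\<close> lies in a bounded range.\<close>

lemma edge_x_finite:
  assumes \<epsilon>: "\<epsilon> = 1 \<or> \<epsilon> = - 1" "\<epsilon>' = 1 \<or> \<epsilon>' = - 1" and U: "U \<in> edge_x \<epsilon>" and V: "V \<in> corner \<epsilon> \<epsilon>'"
  shows "finite {v. \<epsilon> * fst v < a \<and> \<epsilon>' * snd v < b \<and> (\<exists>q\<in>V. v - q \<in> U)}"
proof -
  obtain k where k: "\<forall>v\<in>U. - k \<le> \<epsilon> * fst v" and f: "\<And>i. finite {j. (i, j) \<in> U}"
    using U by (auto simp: edge_x_def)
  obtain l where l: "\<forall>v\<in>V. - l \<le> \<epsilon> * fst v \<and> - l \<le> \<epsilon>' * snd v" using V by (auto simp: corner_def)
  let ?N = "\<bar>k\<bar> + \<bar>l\<bar> + \<bar>a\<bar>"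
  define J where "J = (\<Union>i\<in>{-?N..?N}. {j. (i, j) \<in> U})"
  have J: "finite J" using f by (auto simp: J_def)
  define L where "L = (\<Sum>j\<in>J. \<bar>j\<bar>) + \<bar>l\<bar> + \<bar>b\<bar>"
  show ?thesis
  proof (rule finite_subset)
    show "finite ({-?N..?N} \<times> {-L..L})" by blast
    show "{v. \<epsilon> * fst v < a \<and> \<epsilon>' * snd v < b \<and> (\<exists>q\<in>V. v - q \<in> U)} \<subseteq> {-?N..?N} \<times> {-L..L}"
    proof
      fix v assume "v \<in> {v. \<epsilon> * fst v < a \<and> \<epsilon>' * snd v < b \<and> (\<exists>q\<in>V. v - q \<in> U)}"
      then obtain q where v: "\<epsilon> * fst v < a" "\<epsilon>' * snd v < b" and q: "q \<in> V" "v - q \<in> U" by blast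
      have 1: "- k \<le> \<epsilon> * (fst v - fst q)" "- l \<le> \<epsilon> * fst q" "- l \<le> \<epsilon>' * snd q" using k l q by fastforce+
      have "fst v - fst q \<in> {-?N..?N}" using 1 v \<epsilon>(1) by auto
      moreover have "(fst v - fst q, snd v - snd q) \<in> U" using q by (simp add: minus_prod_def)
      ultimately have "snd v - snd q \<in> J" unfolding J_def by blast
      then have "\<bar>snd v - snd q\<bar> \<le> (\<Sum>j\<in>J. \<bar>j\<bar>)" using J by (intro member_le_sum) auto
      then have "snd v \<in> {-L..L}" using 1(3) v(2) \<epsilon>(2) unfolding L_def by auto
      moreover have "fst v \<in> {-?N..?N}" using 1 v \<epsilon>(1) by auto
      ultimately show "v \<in> {-?N..?N} \<times> {-L..L}" by (simp add: mem_Times_iff)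
    qed
  qed
qed

lemma edge_x_region:
  assumes \<epsilon>: "\<epsilon> = 1 \<or> \<epsilon> = - 1" and U: "U \<in> edge_x \<epsilon>"
  shows "finite (U \<inter> {v. \<epsilon> * fst v < a})"
proof -
  obtain k where k: "\<forall>v\<in>U. - k \<le> \<epsilon> * fst v" and f: "\<And>i. finite {j. (i, j) \<in> U}"
    using U by (auto simp: edge_x_def)
  let ?N = "\<bar>k\<bar> + \<bar>a\<bar>"
  show ?thesis
  proof (rule finite_subset)
    show "finite (\<Union>i\<in>{-?N..?N}. Pair i ` {j. (i, j) \<in> U})" using f by blast
    show "U \<inter> {v. \<epsilon> * fst v < a} \<subseteq> (\<Union>i\<in>{-?N..?N}. Pair i ` {j. (i, j) \<in> U})"
    proof
      fix v assume v: "v \<in> U \<inter> {v. \<epsilon> * fst v < a}"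
      then have "fst v \<in> {-?N..?N}" using k \<epsilon> by fastforce
      moreover have "v \<in> Pair (fst v) ` {j. (fst v, j) \<in> U}" using v by (intro image_eqI[of _ _ "snd v"]) auto
      ultimately show "v \<in> (\<Union>i\<in>{-?N..?N}. Pair i ` {j. (i, j) \<in> U})" by (rule UN_I)
    qed
  qed
qed

lemma bex_swap: "(\<exists>q\<in>prod.swap ` V. v - q \<in> prod.swap ` U) \<longleftrightarrow> (\<exists>q\<in>V. prod.swap v - q \<in> U)"
  for v :: "int \<times> int"
  by (simp only: bex_simps swap_mem swap_diff swap_swap)

lemma swap_corner: "V \<in> corner \<epsilon> \<epsilon>' \<longleftrightarrow> prod.swap ` V \<in> corner \<epsilon>' \<epsilon>"
  unfolding corner_def by (auto simp: swap_proj)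

lemma inj_on_swap: "inj_on prod.swap A"
  by (rule inj_onI) (metis swap_swap)

lemma edge_y_proper:
  assumes \<epsilon>: "\<epsilon>' = 1 \<or> \<epsilon>' = - 1" and U: "U \<in> edge_y \<epsilon>'" and V: "V \<in> corner \<epsilon> \<epsilon>'"
  shows "proper_pair U V"
  unfolding proper_pair_def
proof
  fix v
  have "finite {q. prod.swap v - q \<in> prod.swap ` U \<and> q \<in> prod.swap ` V}"
    using edge_x_proper[OF \<epsilon> iffD1[OF edge_y_swap U] iffD1[OF swap_corner V]] by (simp add: proper_pair_def)
  moreover have "{q. prod.swap v - q \<in> prod.swap ` U \<and> q \<in> prod.swap ` V} = prod.swap ` {q. v - q \<in> U \<and> q \<in> V}"
    by (rule Set.set_eqI) (simp add: swap_mem swap_diff swap_proj Bex_def)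
  ultimately show "finite {q. v - q \<in> U \<and> q \<in> V}"
    by (simp only:) (rule finite_imageD[OF _ inj_on_swap])
qed

lemma edge_y_finite:
  assumes \<epsilon>: "\<epsilon> = 1 \<or> \<epsilon> = - 1" "\<epsilon>' = 1 \<or> \<epsilon>' = - 1" and U: "U \<in> edge_y \<epsilon>'" and V: "V \<in> corner \<epsilon> \<epsilon>'"
  shows "finite {v. \<epsilon> * fst v < a \<and> \<epsilon>' * snd v < b \<and> (\<exists>q\<in>V. v - q \<in> U)}"
proof -
  have "finite {v. \<epsilon>' * fst v < b \<and> \<epsilon> * snd v < a \<and> (\<exists>q\<in>V. prod.swap v - q \<in> U)}"
    using edge_x_finite[OF \<epsilon>(2,1) iffD1[OF edge_y_swap U] iffD1[OF swap_corner V], of b a]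
    unfolding bex_swap .
  moreover have "{v. \<epsilon>' * fst v < b \<and> \<epsilon> * snd v < a \<and> (\<exists>q\<in>V. prod.swap v - q \<in> U)}
      = prod.swap ` {v. \<epsilon> * fst v < a \<and> \<epsilon>' * snd v < b \<and> (\<exists>q\<in>V. v - q \<in> U)}"
    by (auto simp only: swap_mem mem_Collect_eq swap_proj swap_swap)
  ultimately show ?thesis by (simp only:) (rule finite_imageD[OF _ inj_on_swap])
qed

lemma edge_y_region:
  assumes \<epsilon>: "\<epsilon> = 1 \<or> \<epsilon> = - 1" and U: "U \<in> edge_y \<epsilon>"
  shows "finite (U \<inter> {v. \<epsilon> * snd v < a})"
proof -
  have "finite (prod.swap ` U \<inter> {v. \<epsilon> * fst v < a})"
    by (rule edge_x_region[OF \<epsilon> iffD1[OF edge_y_swap U]])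
  moreover have "prod.swap ` U \<inter> {v. \<epsilon> * fst v < a} = prod.swap ` (U \<inter> {v. \<epsilon> * snd v < a})"
    by (rule Set.set_eqI) (simp add: swap_mem swap_proj)
  ultimately show ?thesis by (simp only:) (rule finite_imageD[OF _ inj_on_swap])
qed

definition sign :: "bool \<Rightarrow> int"
  where "sign b = (if b then 1 else - 1)"

lemma sign_cases: "sign b = 1 \<or> sign b = - 1"
  by (simp add: sign_def)

section \<open>From contractions over the eight rings to a finite homotopy\<close>

context lin_complex
begin

theorem contractions_imp_finite_homotopy:
  assumes low: "\<And>n. n < lo \<Longrightarrow> A n = {0}"
    and x: "\<And>b. \<exists>\<kappa>. contraction (edge_x (sign b)) \<kappa>"
    and y: "\<And>b. \<exists>\<kappa>. contraction (edge_y (sign b)) \<kappa>"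
    and c: "\<And>b b'. \<exists>\<kappa>. contraction (corner (sign b) (sign b')) \<kappa>"
  shows "\<exists>h. (\<forall>n. rlin n (n - 1) (h n)) \<and> (\<forall>n. \<exists>F. finite F \<and> (\<forall>f\<in>pol n. supp (retr h n f) \<subseteq> F))"
proof -
  obtain \<kappa> where \<kappa>: "\<And>b. contraction (edge_x (sign b)) (\<kappa> b)" using x by metis
  obtain \<mu> where \<mu>: "\<And>b. contraction (edge_y (sign b)) (\<mu> b)" using y by metis
  obtain \<sigma> where \<sigma>: "\<And>b b'. contraction (corner (sign b) (sign b')) (\<sigma> b b')" using c by metis
  define M where "M = (\<Sum>p\<in>P. \<bar>fst p\<bar> + \<bar>snd p\<bar>)"
  have M: "\<bar>fst p\<bar> \<le> M" "\<bar>snd p\<bar> \<le> M" if "p \<in> P" for p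
    using member_le_sum[of p P "\<lambda>p. \<bar>fst p\<bar> + \<bar>snd p\<bar>"] P that unfolding M_def by auto
  have M0: "M \<ge> 0" unfolding M_def by (rule sum_nonneg) simp
  \<comment> \<open>\<open>M\<close> bounds every exponent of the differential, so lowering the
    threshold by \<open>M\<close> in each degree makes the half planes open regions. The threshold
    is 0 in degree \<open>lo\<close> and at most 0 above it, which makes opposite half planes
    disjoint there.\<close>
  define a where "a = (\<lambda>n. M * (lo - n))"
  have a_Suc: "a (n + 1) = a n - M" for n by (simp add: a_def algebra_simps)
  have a_lo: "a n \<le> 0" if "lo \<le> n" for n using M0 that by (simp add: a_def mult_nonneg_nonpos)
  define U where "U = (\<lambda>b n. {v :: int \<times> int. sign b * fst v < a n})"
  define V where "V = (\<lambda>b n. {v :: int \<times> int. sign b * snd v < a n})"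
  have U: "open_region (U b)" for b
    unfolding open_region_def U_def
  proof (intro allI ballI CollectI)
    fix n and v p :: "int \<times> int" assume "v \<in> {v. sign b * fst v < a (n + 1)}" "p \<in> P"
    then show "sign b * fst (v - p) < a n"
      using M(1)[of p] sign_cases[of b] by (auto simp: a_Suc)
  qed
  have V: "open_region (V b)" for b
    unfolding open_region_def V_def
  proof (intro allI ballI CollectI)
    fix n and v p :: "int \<times> int" assume "v \<in> {v. sign b * snd v < a (n + 1)}" "p \<in> P"
    then show "sign b * snd (v - p) < a n"
      using M(2)[of p] sign_cases[of b] by (auto simp: a_Suc)
  qed
  define hU where "hU = (\<lambda>b n f. trunc (U b (n - 1)) (conv (\<kappa> b n) f))"
  define hV where "hV = (\<lambda>b n f. trunc (V b (n - 1)) (conv (\<mu> b n) f))"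
  define k where "k = (\<lambda>b b' n f. trunc (U b (n - 1 - 1) \<inter> V b' (n - 1 - 1))
      (conv (\<mu> b' (n - 1)) (conv (\<sigma> b b' n) f) - conv (\<kappa> b (n - 1)) (conv (\<sigma> b b' n) f)))"
  have finU: "finite (S \<inter> U b n)" if "S \<in> edge_x (sign b)" for S b n
    unfolding U_def by (rule edge_x_region[OF sign_cases that])
  have finV: "finite (S \<inter> V b n)" if "S \<in> edge_y (sign b)" for S b n
    unfolding V_def by (rule edge_y_region[OF sign_cases that])
  note eU = edge_homotopy[OF support_ideal_edge_x \<kappa> U finU]
  note eV = edge_homotopy[OF support_ideal_edge_y \<mu> V finV]
  have fx: "finite {v \<in> U b n \<inter> V b' n. \<exists>q\<in>T. v - q \<in> S}"
    if "S \<in> edge_x (sign b)" "T \<in> corner (sign b) (sign b')" for b b' n S T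
    using edge_x_finite[OF sign_cases sign_cases that, of "a n" "a n"] by (simp add: U_def V_def conj_assoc)
  have fy: "finite {v \<in> U b n \<inter> V b' n. \<exists>q\<in>T. v - q \<in> S}"
    if "S \<in> edge_y (sign b')" "T \<in> corner (sign b) (sign b')" for b b' n S T
    using edge_y_finite[OF sign_cases sign_cases that, of "a n" "a n"] by (simp add: U_def V_def conj_assoc)
  note ck = corner_homotopy[OF support_ideal_corner \<kappa> \<mu> \<sigma> open_region_Int[OF U V]
      support_ideal_edge_x support_ideal_edge_y edge_x_proper[OF sign_cases] edge_y_proper[OF sign_cases] fx fy]
  show ?thesis
  proof (rule glue_homotopy[of U V lo hU hV k])
    show "U True n \<inter> U False n = {}" "V True n \<inter> V False n = {}" if "lo \<le> n" for n
      using a_lo[OF that] by (auto simp: U_def V_def sign_def)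
    show "finite (- (U True n \<union> U False n \<union> V True n \<union> V False n))" for n
      by (rule finite_subset[of _ "{a n..- a n} \<times> {a n..- a n}"])
        (auto simp: U_def V_def sign_def mem_Times_iff not_less)
    show "rlin n (n - 1) (hU i n)" for i n unfolding hU_def by (rule eU(1))
    show "rlin n (n - 1) (hV i n)" for i n unfolding hV_def by (rule eV(1))
    show "rlin n (n - 1 - 1) (k i j n)" for i j n unfolding k_def by (rule ck(1))
    show "supp (hU i n f) \<subseteq> U i (n - 1)" for i n f unfolding hU_def supp_trunc by blast
    show "supp (hV i n f) \<subseteq> V i (n - 1)" for i n f unfolding hV_def supp_trunc by blast
    show "supp (k i j n f) \<subseteq> U i (n - 1 - 1) \<inter> V j (n - 1 - 1)" for i j n f
      unfolding k_def supp_trunc by blast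
    show "trunc (U i n) (dif (n - 1) (hU i n f)) + hU i (n + 1) (dif n f) = trunc (U i n) f"
      if "f \<in> pol n" for i n f
      unfolding hU_def by (rule eU(2)[OF _ that])
    show "trunc (V i n) (dif (n - 1) (hV i n f)) + hV i (n + 1) (dif n f) = trunc (V i n) f"
      if "f \<in> pol n" for i n f unfolding hV_def by (rule eV(2)[OF _ that])
    show "trunc (U i (n - 1) \<inter> V j (n - 1)) (dif (n - 1 - 1) (k i j n f)) - k i j (n + 1) (dif n f)
        = trunc (U i (n - 1) \<inter> V j (n - 1)) (hU i n f - hV j n f)" if f: "f \<in> pol n" for i j n f
    proof -
      have "trunc (U i (n - 1) \<inter> V j (n - 1)) (dif (n - 1 - 1) (k i j n f)) - k i j (n + 1) (dif n f)
          = trunc (U i (n - 1) \<inter> V j (n - 1)) (conv (\<kappa> i n) f - conv (\<mu> j n) f)"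
        unfolding k_def by (rule ck(2)) (assumption | rule f)+
      then show ?thesis by (auto simp: hU_def hV_def trunc_def fun_eq_iff)
    qed
  qed (rule U V low | assumption)+
qed

lemma conv_sum:
  assumes K: "kern U n m K" and g: "\<And>i. i \<in> I \<Longrightarrow> g i \<in> pol n"
  shows "conv K (\<Sum>i\<in>I. g i) = (\<Sum>i\<in>I. conv K (g i))"
  using g
proof (induction I rule: infinite_finite_induct)
  case (insert i I)
  have p: "g i \<in> pol n" "(\<Sum>i\<in>I. g i) \<in> pol n" using insert.prems by (auto intro!: pol_sum)
  then have "finite (supp (g i) \<union> supp (\<Sum>i\<in>I. g i))" by (simp add: pol_iff)
  from conv_add[OF K _ _ proper_pair_finite[OF this] Un_upper1 Un_upper2]
  have 1: "conv K (g i + (\<Sum>i\<in>I. g i)) = conv K (g i) + conv K (\<Sum>i\<in>I. g i)" using p by (simp add: pol_iff)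
  have IH: "conv K (\<Sum>i\<in>I. g i) = (\<Sum>i\<in>I. conv K (g i))"
    by (rule insert.IH) (use insert.prems in auto)
  show ?case unfolding sum.insert[OF insert.hyps] 1 IH ..
qed (simp_all add: conv_def kernD(5)[OF K] fun_eq_iff)

lemma conv_translate: "conv K (translate a f) = translate a (conv K f)"
proof
  fix v
  show "conv K (translate a f) v = translate a (conv K f) v"
    unfolding conv_def translate_def
    by (rule sum.reindex_bij_witness[of _ "\<lambda>q. q + a" "\<lambda>q. q - a"]) (auto simp: algebra_simps)
qed

lemma conv_zero: "kern U n m K \<Longrightarrow> conv K 0 = 0"
  by (simp add: conv_def kernD(5) fun_eq_iff)

end


section \<open>Complexes of finitely generated free modules\<close>

text \<open>Vectors are functions on all natural numbers that vanish from \<open>m\<close> on, so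
  that modules of different ranks share one type. The condition with \<open>e\<close> says that the
  entries belong to R.\<close>

definition vecs :: "'u::ring \<Rightarrow> nat \<Rightarrow> (nat \<Rightarrow> 'u) set"
  where "vecs e m = {a. (\<forall>i. e * a i = a i) \<and> (\<forall>i\<ge>m. a i = 0)}"

lemma vecsD: "a \<in> vecs e m \<Longrightarrow> e * a i = a i" "a \<in> vecs e m \<Longrightarrow> m \<le> i \<Longrightarrow> a i = 0"
  by (simp_all add: vecs_def)

lemma vecsI: "(\<And>i. e * a i = a i) \<Longrightarrow> (\<And>i. m \<le> i \<Longrightarrow> a i = 0) \<Longrightarrow> a \<in> vecs e m"
  by (simp add: vecs_def)

definition mat_act :: "nat \<Rightarrow> nat \<Rightarrow> (nat \<Rightarrow> nat \<Rightarrow> 'u::ring) \<Rightarrow> (nat \<Rightarrow> 'u) \<Rightarrow> nat \<Rightarrow> 'u"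
  where "mat_act m n M a = (\<lambda>i. if i < m then \<Sum>j<n. M i j * a j else 0)"

text \<open>
  The ring \<open>R\<close> is the corner \<open>e * U\<close> of an ambient ring \<open>U\<close> cut out by a central idempotent \<open>e\<close>.
\<close>

locale free_complex =
  fixes e :: "'u::ring" and rk :: "int \<Rightarrow> nat" and P :: "(int \<times> int) set"
    and D :: "int \<Rightarrow> int \<times> int \<Rightarrow> nat \<Rightarrow> nat \<Rightarrow> 'u" and lo hi :: int
  assumes e_central: "\<And>x. e * x = x * e" and e_idem: "e * e = e"
    and finP: "finite P" and eD: "\<And>n p i j. e * D n p i j = D n p i j"
    and DD: "\<And>n (f :: int \<times> int \<Rightarrow> nat \<Rightarrow> 'u). (\<And>v. f v \<in> vecs e (rk n)) \<Longrightarrow>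
      local_op P (\<lambda>p. mat_act (rk (n + 1 + 1)) (rk (n + 1)) (D (n + 1) p)) (\<lambda>p. p)
        (local_op P (\<lambda>p. mat_act (rk (n + 1)) (rk n) (D n p)) (\<lambda>p. p) f) = 0"
    and bounded: "\<And>n. n < lo \<or> hi < n \<Longrightarrow> vecs e (rk n) = {0}"

text \<open>Matrices multiply columns from the left and scalars act on entries from the right, so
  linearity over the noncommutative ring R is associativity.\<close>

sublocale free_complex \<subseteq> lin_complex P "\<lambda>n p. mat_act (rk (n + 1)) (rk n) (D n p)" "\<lambda>n. vecs e (rk n)"
    "{r. e * r = r}" "\<lambda>r a i. a i * r"
proof
  show "finite P" by (rule finP)
  show "mat_act (rk (n + 1)) (rk n) (D n p) (x + y) = mat_act (rk (n + 1)) (rk n) (D n p) x + mat_act (rk (n + 1)) (rk n) (D n p) y"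
    for n p x y by (simp add: mat_act_def fun_eq_iff distrib_left sum.distrib)
  show "add_subgroup (vecs e (rk n))" for n
    by (simp add: add_subgroup_def vecs_def right_diff_distrib)
  show "mat_act (rk (n + 1)) (rk n) (D n p) a \<in> vecs e (rk (n + 1))" for n p a
    by (simp add: mat_act_def vecs_def sum_distrib_left mult.assoc[symmetric] eD)
  show "(\<lambda>i. (x + y) i * r) = (\<lambda>i. x i * r) + (\<lambda>i. y i * r)" for r and x y :: "nat \<Rightarrow> 'u"
    by (simp add: fun_eq_iff distrib_right)
  show "(\<lambda>i. a i * r) \<in> vecs e (rk n)" if "a \<in> vecs e (rk n)" for a r n
    using that by (simp add: vecs_def mult.assoc[symmetric])
  show "mat_act (rk (n + 1)) (rk n) (D n p) (\<lambda>i. a i * r) = (\<lambda>i. mat_act (rk (n + 1)) (rk n) (D n p) a i * r)" for n p a r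
    by (simp add: mat_act_def fun_eq_iff sum_distrib_right mult.assoc)
qed (rule DD)

section \<open>Expansion in monomials and contraction of acyclic completions\<close>

context free_complex
begin

definition unit_pol :: "nat \<Rightarrow> int \<times> int \<Rightarrow> nat \<Rightarrow> 'u"
  where "unit_pol i = (\<lambda>v j. if v = 0 \<and> j = i then e else 0)"

lemma unit_pol: "i < rk n \<Longrightarrow> unit_pol i \<in> pol n"
proof -
  assume i: "i < rk n"
  have "supp (unit_pol i) \<subseteq> {0}" by (auto simp: supp_def unit_pol_def fun_eq_iff split: if_splits)
  then have "finite (supp (unit_pol i))" by (rule finite_subset) simp
  moreover have "unit_pol i v \<in> vecs e (rk n)" for v
    using i by (intro vecsI) (auto simp: unit_pol_def e_idem)
  ultimately show ?thesis by (simp add: pol_iff)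
qed

lemma translate_pol: "f \<in> pol n \<Longrightarrow> translate a f \<in> pol n"
  by (rule tameD(1)[OF tame_translate])

lemma pol_e: "f \<in> pol n \<Longrightarrow> e * f q i = f q i"
  using vecsD(1)[of "f q" e "rk n"] by (simp add: pol_iff)

lemma pol_expand:
  assumes f: "f \<in> pol n"
  shows "f = (\<Sum>q\<in>supp f. \<Sum>i<rk n. scale (f q i) (translate q (unit_pol i)))"
proof (intro ext)
  fix v j
  have fin: "finite (supp f)" using f by (simp add: pol_iff)
  have z: "f v j = 0" if "\<not> j < rk n" for v
    using f that vecsD(2)[of "f v" e "rk n" j] by (simp add: pol_iff)
  have "(\<Sum>q\<in>supp f. \<Sum>i<rk n. scale (f q i) (translate q (unit_pol i))) v j
      = (\<Sum>q\<in>supp f. \<Sum>i<rk n. if v = q \<and> j = i then f q i else 0)"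
    unfolding sum_fun_app scale_def translate_def unit_pol_def
    by (intro sum.cong refl) (simp add: pol_e[OF f])
  also have "\<dots> = (\<Sum>q\<in>supp f. if v = q then f q j else 0)"
    by (intro sum.cong refl) (simp add: z)
  also have "\<dots> = f v j" using fin by (simp add: supp_def fun_eq_iff) 
  finally show "f v j = (\<Sum>q\<in>supp f. \<Sum>i<rk n. scale (f q i) (translate q (unit_pol i))) v j" by simp
qed

lemma expand_pol: "f \<in> pol n \<Longrightarrow> i < rk n \<Longrightarrow> scale (f q i) (translate q (unit_pol i)) \<in> pol n"
  by (rule scale_pol) (simp_all add: pol_e translate_pol unit_pol)

lemma rlin_sum:
  assumes B: "rlin n m B" and "\<And>i. i \<in> I \<Longrightarrow> g i \<in> pol n"
  shows "B (\<Sum>i\<in>I. g i) = (\<Sum>i\<in>I. B (g i))"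
  using assms(2)
proof (induction I rule: infinite_finite_induct)
  case (insert i I)
  have 1: "B (g i + (\<Sum>i\<in>I. g i)) = B (g i) + B (\<Sum>i\<in>I. g i)"
    by (rule rlinD(2)[OF B]) (use insert.prems in \<open>auto intro!: pol_sum\<close>)
  have IH: "B (\<Sum>i\<in>I. g i) = (\<Sum>i\<in>I. B (g i))"
    by (rule insert.IH) (use insert.prems in auto)
  show ?case unfolding sum.insert[OF insert.hyps] 1 IH ..
qed (simp_all add: rlin_zero[OF B])

lemma rlin_expand:
  assumes B: "rlin n m B" and f: "f \<in> pol n"
  shows "B f = (\<Sum>q\<in>supp f. \<Sum>i<rk n. scale (f q i) (B (translate q (unit_pol i))))"
proof -
  have s: "(\<Sum>i<rk n. scale (f q i) (translate q (unit_pol i))) \<in> pol n" for q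
    by (rule pol_sum) (simp add: expand_pol[OF f])
  have "B f = B (\<Sum>q\<in>supp f. \<Sum>i<rk n. scale (f q i) (translate q (unit_pol i)))"
    using pol_expand[OF f] by simp
  also have "\<dots> = (\<Sum>q\<in>supp f. \<Sum>i<rk n. scale (f q i) (B (translate q (unit_pol i))))"
    unfolding rlin_sum[OF B s]
    by (rule sum.cong[OF refl], subst rlin_sum[OF B])
      (simp_all add: expand_pol[OF f] rlinD(3)[OF B _ translate_pol[OF unit_pol]] pol_e[OF f])
  finally show ?thesis .
qed

lemma supp_sum: "supp (\<Sum>i\<in>I. g i) \<subseteq> (\<Union>i\<in>I. supp (g i))" for g :: "'i \<Rightarrow> int \<times> int \<Rightarrow> nat \<Rightarrow> 'u"
proof
  fix v assume "v \<in> supp (\<Sum>i\<in>I. g i)"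
  then have "(\<Sum>i\<in>I. g i v) \<noteq> 0" by (simp add: supp_def sum_fun_app)
  then obtain i where "i \<in> I" "g i v \<noteq> 0" by (rule sum.not_neutral_contains_not_neutral)
  then show "v \<in> (\<Union>i\<in>I. supp (g i))" by (auto simp: supp_def)
qed

lemma rlin_tame:
  assumes B: "rlin n m B"
  shows "tame n m B"
  unfolding tame_def
proof (intro conjI ballI allI impI)
  fix F :: "(int \<times> int) set" assume F: "finite F"
  define F' where "F' = (\<Union>q\<in>F. \<Union>i<rk n. supp (B (translate q (unit_pol i))))"
  have "finite F'" unfolding F'_def
    using F rlinD(1)[OF B translate_pol[OF unit_pol]] by (auto simp: pol_iff)
  moreover have "supp (B f) \<subseteq> F'" if f: "f \<in> pol n" and sf: "supp f \<subseteq> F" for f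
  proof -
    have "supp (B f) \<subseteq> (\<Union>q\<in>supp f. \<Union>i<rk n. supp (scale (f q i) (B (translate q (unit_pol i)))))"
      unfolding rlin_expand[OF B f] by (intro order_trans[OF supp_sum] UN_mono order_refl)
    also have "\<dots> \<subseteq> F'" unfolding F'_def using sf supp_scale by fastforce
    finally show ?thesis .
  qed
  ultimately show "\<exists>F'. finite F' \<and> (\<forall>f\<in>pol n. supp f \<subseteq> F \<longrightarrow> supp (B f) \<subseteq> F')" by blast
qed (use rlinD[OF B] in auto)

definition acyclic_on :: "(int \<times> int) set set \<Rightarrow> bool"
  where "acyclic_on \<S> \<longleftrightarrow> (\<forall>n. \<forall>f\<in>cmpl \<S> n. dif n f = 0 \<longrightarrow> (\<exists>g\<in>cmpl \<S> (n - 1). dif (n - 1) g = f))"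

text \<open>\<open>K\<close> is the matrix with columns \<open>y i\<close>, so convolution with it
  is the equivariant R-linear map that sends the i-th unit vector to \<open>y i\<close>. Its values
  can therefore be prescribed freely on unit vectors.\<close>

lemma unit_kernel:
  assumes S: "support_ideal \<S>" and y: "\<And>i. i < rk n \<Longrightarrow> y i \<in> cmpl \<S> m"
  defines "K \<equiv> \<lambda>v a j. \<Sum>i<rk n. y i v j * a i"
  shows "\<exists>U\<in>\<S>. kern U n m K"
    and "f \<in> pol n \<Longrightarrow> conv K f = (\<Sum>q\<in>supp f. \<Sum>i<rk n. scale (f q i) (translate q (y i)))"
proof -
  define U where "U = (\<Union>i<rk n. supp (y i))"
  have US: "U \<in> \<S>" unfolding U_def by (rule support_ideal_UN[OF S]) (use y in \<open>auto simp: cmpl_def\<close>)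
  have U: "kern U n m K"
    unfolding kern_def
  proof (intro conjI allI ballI impI)
    show "additive (K v)" for v
      by (rule additive.intro) (simp add: K_def fun_eq_iff distrib_left sum.distrib)
    show "K v a \<in> vecs e (rk m)" if a: "a \<in> vecs e (rk n)" for v a
    proof -
      have yv: "y i v \<in> vecs e (rk m)" if "i < rk n" for i using y[OF that] by (simp add: cmpl_def)
      show ?thesis
        by (rule vecsI) (simp_all add: K_def sum_distrib_left mult.assoc[symmetric] vecsD[OF yv])
    qed
    show "K v a = 0" if "v \<notin> U" for v a
      using that by (simp add: K_def U_def supp_def fun_eq_iff)
    show "K v (\<lambda>i. a i * r) = (\<lambda>i. K v a i * r)" for v r a
      by (simp add: K_def sum_distrib_right mult.assoc)
  qed
  then show "\<exists>U\<in>\<S>. kern U n m K" using US by blast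
  assume f: "f \<in> pol n"
  have fin: "finite (supp f)" using f by (simp add: pol_iff)
  show "conv K f = (\<Sum>q\<in>supp f. \<Sum>i<rk n. scale (f q i) (translate q (y i)))"
  proof
    fix v
    have "conv K f v = (\<Sum>q\<in>supp f. K (v - q) (f q))"
      by (rule conv_eq[OF U _ fin]) (use f in \<open>auto simp: pol_iff supp_def\<close>)
    then show "conv K f v = (\<Sum>q\<in>supp f. \<Sum>i<rk n. scale (f q i) (translate q (y i))) v"
      by (simp add: sum_fun_app K_def scale_def translate_def fun_eq_iff)
  qed
qed

text \<open>The usual argument for bounded acyclic complexes of free modules: from the top degree
  downwards, preimages are chosen for the unit vectors after the part already contracted has been
  removed.\<close>

lemma acyclic_contraction:
  assumes S: "support_ideal \<S>" "{U. finite U} \<subseteq> \<S>" and acyc: "acyclic_on \<S>"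
  shows "\<exists>\<kappa>. contraction \<S> \<kappa>"
proof -
  define good where "good = (\<lambda>\<kappa> n. (\<exists>U\<in>\<S>. kern U n (n - 1) (\<kappa> n))
    \<and> (\<forall>f\<in>pol n. dif (n - 1) (conv (\<kappa> n) f) + conv (\<kappa> (n + 1)) (dif n f) = f))"
  have pol0: "f = 0" if "f \<in> pol n" "n < lo \<or> hi < n" for f n
    using that bounded[of n] by (auto simp: pol_iff fun_eq_iff)
  have zero_kern: "kern {} n m (\<lambda>v a. 0)" for n m by (simp add: kern_def additive.intro fun_eq_iff)
  have empty: "{} \<in> \<S>" by (rule support_idealD(1)[OF S(1)])
  \<comment> \<open>The identity in degree n involves \<open>\<kappa>\<close> only in degrees n and
    n + 1, so extending \<open>\<kappa>\<close> downwards leaves the identities above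
    intact.\<close>
  have "\<exists>\<kappa>. \<forall>n \<ge> hi + 1 - int j. good \<kappa> n" for j
  proof (induction j)
    case 0
    have "good (\<lambda>n v a. 0) n" if "n \<ge> hi + 1" for n
      unfolding good_def
    proof (intro conjI ballI bexI[OF _ empty] zero_kern)
      fix f assume "f \<in> pol n"
      then have "f = 0" using that pol0 by auto
      then show "dif (n - 1) (conv (\<lambda>v a. 0) f) + conv (\<lambda>v a. 0) (dif n f) = f"
        by (simp add: dif_zero conv_zero[OF zero_kern])
    qed
    then show ?case by auto
  next
    case (Suc j)
    then obtain \<kappa> where \<kappa>: "\<And>n. n \<ge> hi + 1 - int j \<Longrightarrow> good \<kappa> n" by blast
    define k where "k = hi + 1 - int (Suc j)"
    have good1: "good \<kappa> (k + 1)" by (rule \<kappa>) (simp add: k_def)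
    then obtain U where U: "U \<in> \<S>" "kern U (k + 1) k (\<kappa> (k + 1))" by (auto simp: good_def)
    have "good \<kappa> (k + 1 + 1)" by (rule \<kappa>) (simp add: k_def)
    then obtain U' where "kern U' (k + 1 + 1) (k + 1 + 1 - 1) (\<kappa> (k + 1 + 1))"
      unfolding good_def by blast
    then have U': "kern U' (k + 1 + 1) (k + 1) (\<kappa> (k + 1 + 1))" by (simp only: add_diff_cancel_right')
    define c where "c = (\<lambda>i. conv (\<kappa> (k + 1)) (dif k (unit_pol i)))"
    define z where "z = (\<lambda>i. unit_pol i - c i)"
    have y: "\<exists>y\<in>cmpl \<S> (k - 1). dif (k - 1) y = z i" if i: "i < rk k" for i
    proof -
      have u: "unit_pol i \<in> pol k" by (rule unit_pol[OF i])
      have du: "dif k (unit_pol i) \<in> pol (k + 1)" by (rule dif_pol[OF u])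
      have duA: "dif k (unit_pol i) v \<in> vecs e (rk (k + 1))" for v using du by (simp add: pol_iff)
      have "supp (c i) \<in> \<S>"
      proof (rule support_idealD(2)[OF S(1)])
        show "supp (c i) \<subseteq> (\<Union>q\<in>supp (dif k (unit_pol i)). {v. v - q \<in> U})"
          unfolding c_def by (rule order_trans[OF supp_conv[OF U(2) duA]]) auto
        show "(\<Union>q\<in>supp (dif k (unit_pol i)). {v. v - q \<in> U}) \<in> \<S>"
          by (rule support_ideal_UN[OF S(1)]) (use du support_idealD(4)[OF S(1) U(1)] in \<open>auto simp: pol_iff\<close>)
      qed
      then have "c i \<in> cmpl \<S> k" using conv_A[OF U(2) duA] by (simp add: cmpl_def c_def)
      moreover have "unit_pol i \<in> cmpl \<S> k" using u S(2) by (auto simp: pol_iff cmpl_def)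
      ultimately have zc: "z i \<in> cmpl \<S> k"
        unfolding z_def by (intro add_subgroup_diff[OF cmpl_subgroup[OF S(1)]])
      \<comment> \<open>The identity of degree \<open>k + 1\<close>, applied to the cocycle
        \<open>dif k (unit_pol i)\<close>, says that \<open>c i\<close> and
        \<open>unit_pol i\<close> have the same differential. Hence \<open>z i\<close> is a cocycle
        and has a preimage.\<close>
      have "dif k (c i) + conv (\<kappa> (k + 1 + 1)) (dif (k + 1) (dif k (unit_pol i))) = dif k (unit_pol i)"
        using good1 du unfolding good_def c_def by (simp only: add_diff_cancel_right')
      then have "dif k (c i) = dif k (unit_pol i)"
        unfolding dif_dif_pol(1)[OF u] conv_zero[OF U'] by simp
      then have "dif k (z i) = 0" by (simp add: z_def dif_diff)
      then show ?thesis using acyc zc unfolding acyclic_on_def by blast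
    qed
    then have "\<forall>i\<in>{..<rk k}. \<exists>y. y \<in> cmpl \<S> (k - 1) \<and> dif (k - 1) y = z i" by auto
    from bchoice[OF this] obtain y where "\<forall>i\<in>{..<rk k}. y i \<in> cmpl \<S> (k - 1) \<and> dif (k - 1) (y i) = z i"
      by (elim exE)
    then have y: "\<And>i. i < rk k \<Longrightarrow> y i \<in> cmpl \<S> (k - 1)" "\<And>i. i < rk k \<Longrightarrow> dif (k - 1) (y i) = z i"
      by simp_all
    define \<kappa>' where "\<kappa>' = \<kappa>(k := \<lambda>v a j. \<Sum>i<rk k. y i v j * a i)"
    note uk = unit_kernel[where n = k and m = "k - 1" and y = y, OF S(1) y(1)]
    have "good \<kappa>' k"
      unfolding good_def
    proof (intro conjI ballI)
      show "\<exists>U\<in>\<S>. kern U k (k - 1) (\<kappa>' k)" unfolding \<kappa>'_def fun_upd_same by (rule uk(1))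
      fix f assume f: "f \<in> pol k"
      have fR: "f q i \<in> {r. e * r = r}" for q i using pol_e[OF f] by simp
      have conv_y: "conv (\<kappa>' k) f = (\<Sum>q\<in>supp f. \<Sum>i<rk k. scale (f q i) (translate q (y i)))"
        unfolding \<kappa>'_def fun_upd_same by (rule uk(2)[OF _ f])
      have tA: "translate q (y i) v \<in> vecs e (rk (k - 1))" if "i < rk k" for q i v
        using y(1)[OF that] by (simp add: cmpl_def translate_def)
      have "dif (k - 1) (conv (\<kappa>' k) f) = (\<Sum>q\<in>supp f. \<Sum>i<rk k. scale (f q i) (translate q (z i)))"
        unfolding conv_y dif_sum
        by (intro sum.cong refl) (simp add: scale_dif[OF fR tA] dif_translate y(2))
      moreover have "conv (\<kappa>' (k + 1)) (dif k f) = (\<Sum>q\<in>supp f. \<Sum>i<rk k. scale (f q i) (translate q (c i)))"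
      proof -
        have up: "translate q (unit_pol i) \<in> pol k" if "i < rk k" for q i by (rule translate_pol[OF unit_pol[OF that]])
        have dup: "dif k (unit_pol i) \<in> pol (k + 1)" if "i < rk k" for i by (rule dif_pol[OF unit_pol[OF that]])
        have sp: "scale (f q i) (translate q (dif k (unit_pol i))) \<in> pol (k + 1)" if "i < rk k" for q i
          by (rule scale_pol[OF fR translate_pol[OF dup[OF that]]])
        have sps: "(\<Sum>i<rk k. scale (f q i) (translate q (dif k (unit_pol i)))) \<in> pol (k + 1)" for q
          by (rule pol_sum) (simp add: sp)
        have dk: "dif k f = (\<Sum>q\<in>supp f. \<Sum>i<rk k. scale (f q i) (translate q (dif k (unit_pol i))))"
          unfolding rlin_expand[OF rlin_dif f] dif_translate ..
        have "conv (\<kappa> (k + 1)) (dif k f)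
            = (\<Sum>q\<in>supp f. \<Sum>i<rk k. conv (\<kappa> (k + 1)) (scale (f q i) (translate q (dif k (unit_pol i)))))"
          unfolding dk conv_sum[OF U(2) sps]
          by (intro sum.cong refl conv_sum[OF U(2)]) (simp add: sp)
        also have "\<dots> = (\<Sum>q\<in>supp f. \<Sum>i<rk k. scale (f q i) (translate q (c i)))"
        proof (intro sum.cong refl)
          fix q i assume "i \<in> {..<rk k}"
          then have tp: "translate q (dif k (unit_pol i)) \<in> pol (k + 1)" using translate_pol[OF dup] by simp
          show "conv (\<kappa> (k + 1)) (scale (f q i) (translate q (dif k (unit_pol i)))) = scale (f q i) (translate q (c i))"
            unfolding c_def conv_translate[symmetric]
            by (rule conv_scale[OF U(2) _ fR proper_pair_finite order_refl]) (use tp in \<open>simp_all add: pol_iff\<close>)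
        qed
        finally show ?thesis by (simp add: \<kappa>'_def)
      qed
      moreover have "scale (f q i) (translate q (z i)) + scale (f q i) (translate q (c i))
          = scale (f q i) (translate q (unit_pol i))" for q i
        unfolding z_def translate_diff additive.diff[OF scale_additive] by (simp add: fun_eq_iff)
      ultimately show "dif (k - 1) (conv (\<kappa>' k) f) + conv (\<kappa>' (k + 1)) (dif k f) = f"
        using pol_expand[OF f] by (simp only: sum.distrib[symmetric])
    qed
    moreover have "good \<kappa>' n" if "n \<ge> k + 1" for n
      using \<kappa>[of n] that unfolding good_def \<kappa>'_def k_def by simp
    ultimately have "\<forall>n \<ge> k. good \<kappa>' n" by (metis le_less zless_imp_add1_zle)
    then show ?case unfolding k_def by blast
  qed
  from this[of "nat (hi + 1 - lo)"] obtain \<kappa> where \<kappa>: "\<And>n. n \<ge> lo \<Longrightarrow> good \<kappa> n"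
    by (metis diff_diff_eq2 diff_add_cancel int_nat_eq le_cases nat_le_iff order_trans diff_ge_0_iff_ge add.commute add_diff_cancel_left' diff_0_right)
  \<comment> \<open>The induction reaches down to \<open>lo\<close>; below \<open>lo\<close> the
    modules vanish and the zero kernel serves.\<close>
  define \<kappa>' where "\<kappa>' = (\<lambda>n. if n < lo then (\<lambda>v a. 0) else \<kappa> n)"
  have "good \<kappa>' n" for n
  proof (cases "n < lo")
    case True
    have "\<exists>U\<in>\<S>. kern U (n + 1) n (\<kappa>' (n + 1))"
      using \<kappa>[of "n + 1"] zero_kern empty by (auto simp: \<kappa>'_def good_def)
    then obtain U where U: "kern U (n + 1) n (\<kappa>' (n + 1))" by blast
    show ?thesis
      unfolding good_def
    proof (intro conjI ballI)
      show "\<exists>U\<in>\<S>. kern U n (n - 1) (\<kappa>' n)" using True zero_kern empty by (auto simp: \<kappa>'_def)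
      fix f assume "f \<in> pol n"
      then have f: "f = 0" using True pol0 by auto
      have c: "conv (\<kappa>' n) 0 = 0" using conv_zero[OF zero_kern] True by (simp add: \<kappa>'_def)
      show "dif (n - 1) (conv (\<kappa>' n) f) + conv (\<kappa>' (n + 1)) (dif n f) = f"
        unfolding f c dif_zero conv_zero[OF U] by simp
    qed
  qed (use \<kappa>[of n] in \<open>simp add: good_def \<kappa>'_def\<close>)
  then show ?thesis unfolding contraction_def good_def by blast
qed

end

section \<open>Finite homotopies and acyclic completions\<close>

lemma finite_in_families:
  "{U. finite U} \<subseteq> edge_x \<epsilon>" "{U. finite U} \<subseteq> edge_y \<epsilon>" "{U. finite U} \<subseteq> corner \<epsilon> \<epsilon>'"
proof -
  have b: "\<exists>k. \<forall>v\<in>U. - k \<le> g v" if "finite U" for U and g :: "int \<times> int \<Rightarrow> int"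
  proof (intro exI ballI)
    fix v assume "v \<in> U"
    then have "\<bar>g v\<bar> \<le> (\<Sum>v\<in>U. \<bar>g v\<bar>)" using that by (intro member_le_sum) auto
    then show "- (\<Sum>v\<in>U. \<bar>g v\<bar>) \<le> g v" by linarith
  qed
  have f: "finite {j. (i, j) \<in> U}" "finite {j. (j, i) \<in> U}" if "finite U" for i and U :: "(int \<times> int) set"
    by (rule finite_subset[OF _ finite_imageI[OF that, of snd]], force)
      (rule finite_subset[OF _ finite_imageI[OF that, of fst]], force)
  show "{U. finite U} \<subseteq> edge_x \<epsilon>"
    using b[of _ "\<lambda>v. \<epsilon> * fst v"] f(1) by (simp add: edge_x_def subset_iff)
  show "{U. finite U} \<subseteq> edge_y \<epsilon>"
    using b[of _ "\<lambda>v. \<epsilon> * snd v"] f(2) by (simp add: edge_y_def subset_iff)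
  show "{U. finite U} \<subseteq> corner \<epsilon> \<epsilon>'"
  proof
    fix U :: "(int \<times> int) set" assume "U \<in> {U. finite U}"
    then obtain k where k: "\<forall>v\<in>U. - k \<le> min (\<epsilon> * fst v) (\<epsilon>' * snd v)"
      using b[of U "\<lambda>v. min (\<epsilon> * fst v) (\<epsilon>' * snd v)"] by blast
    then show "U \<in> corner \<epsilon> \<epsilon>'" unfolding corner_def by auto
  qed
qed

text \<open>Since \<open>\<epsilon> * \<epsilon> = 1\<close>, each step raises
  \<open>\<epsilon> * fst v\<close> by 1. The lower bound \<open>- b\<close> on \<open>U\<close>
  therefore limits the number of steps that can end at a given first exponent.\<close>

lemma edge_x_cone:
  assumes \<epsilon>: "\<epsilon> = 1 \<or> \<epsilon> = - 1" and U: "U \<in> edge_x \<epsilon>"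
  shows "{v. \<exists>k::nat. v - smul (int k) (\<epsilon>, 0) \<in> U} \<in> edge_x \<epsilon>"
    and "finite {k::nat. v - smul (int k) (\<epsilon>, 0) \<in> U}"
proof -
  obtain b where b: "\<forall>v\<in>U. - b \<le> \<epsilon> * fst v" and f: "\<And>i. finite {j. (i, j) \<in> U}"
    using U by (auto simp: edge_x_def)
  have e: "v - smul (int k) (\<epsilon>, 0) = (fst v - int k * \<epsilon>, snd v)" for v k by (simp add: smul_def minus_prod_def)
  have bd: "int k \<le> \<epsilon> * fst v + b" if "(fst v - int k * \<epsilon>, snd v) \<in> U" for v k
    using b that \<epsilon> by (force simp: algebra_simps)
  have "\<forall>v\<in>{v. \<exists>k::nat. v - smul (int k) (\<epsilon>, 0) \<in> U}. - b \<le> \<epsilon> * fst v"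
  proof
    fix v assume "v \<in> {v. \<exists>k::nat. v - smul (int k) (\<epsilon>, 0) \<in> U}"
    then obtain k :: nat where "(fst v - int k * \<epsilon>, snd v) \<in> U" unfolding e by blast
    from bd[OF this] show "- b \<le> \<epsilon> * fst v" by simp
  qed
  moreover have "finite {j. (i, j) \<in> {v. \<exists>k::nat. v - smul (int k) (\<epsilon>, 0) \<in> U}}" for i
  proof (rule finite_subset)
    show "finite (\<Union>k\<in>{..nat (\<epsilon> * i + b)}. {j. (i - int k * \<epsilon>, j) \<in> U})" using f by blast
    show "{j. (i, j) \<in> {v. \<exists>k::nat. v - smul (int k) (\<epsilon>, 0) \<in> U}} \<subseteq> (\<Union>k\<in>{..nat (\<epsilon> * i + b)}. {j. (i - int k * \<epsilon>, j) \<in> U})"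
    proof
      fix j assume "j \<in> {j. (i, j) \<in> {v. \<exists>k::nat. v - smul (int k) (\<epsilon>, 0) \<in> U}}"
      then obtain k :: nat where k: "(i - int k * \<epsilon>, j) \<in> U" by (auto simp: e)
      then have "k \<le> nat (\<epsilon> * i + b)" using bd[of "(i, j)" k] by simp
      then show "j \<in> (\<Union>k\<in>{..nat (\<epsilon> * i + b)}. {j. (i - int k * \<epsilon>, j) \<in> U})" using k by blast
    qed
  qed
  ultimately show "{v. \<exists>k::nat. v - smul (int k) (\<epsilon>, 0) \<in> U} \<in> edge_x \<epsilon>" unfolding edge_x_def by blast
  have "{k::nat. v - smul (int k) (\<epsilon>, 0) \<in> U} \<subseteq> {..nat (\<epsilon> * fst v + b)}"
  proof
    fix k assume "k \<in> {k::nat. v - smul (int k) (\<epsilon>, 0) \<in> U}"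
    then show "k \<in> {..nat (\<epsilon> * fst v + b)}" using bd[of v k] by (simp add: e)
  qed
  then show "finite {k::nat. v - smul (int k) (\<epsilon>, 0) \<in> U}" by (rule finite_subset) simp
qed

lemma edge_y_cone:
  assumes \<epsilon>: "\<epsilon> = 1 \<or> \<epsilon> = - 1" and U: "U \<in> edge_y \<epsilon>"
  shows "{v. \<exists>k::nat. v - smul (int k) (0, \<epsilon>) \<in> U} \<in> edge_y \<epsilon>"
    and "finite {k::nat. v - smul (int k) (0, \<epsilon>) \<in> U}"
proof -
  have e: "v - smul k (0, \<epsilon>) \<in> U \<longleftrightarrow> prod.swap v - smul k (\<epsilon>, 0) \<in> prod.swap ` U" for v k
    by (simp only: swap_mem swap_diff swap_swap) (simp add: smul_def)
  note x = edge_x_cone[OF \<epsilon> iffD1[OF edge_y_swap U]]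
  have "prod.swap ` {v. \<exists>k::nat. v - smul (int k) (0, \<epsilon>) \<in> U} = {v. \<exists>k::nat. v - smul (int k) (\<epsilon>, 0) \<in> prod.swap ` U}"
    unfolding e by (rule Set.set_eqI) (simp only: swap_mem[of _ "Collect _"] mem_Collect_eq swap_swap)
  then show "{v. \<exists>k::nat. v - smul (int k) (0, \<epsilon>) \<in> U} \<in> edge_y \<epsilon>" using x(1) unfolding edge_y_swap by simp
  show "finite {k::nat. v - smul (int k) (0, \<epsilon>) \<in> U}" unfolding e by (rule x(2))
qed

lemma corner_cone:
  assumes \<epsilon>: "\<epsilon> = 1 \<or> \<epsilon> = - 1" "\<epsilon>' = 1 \<or> \<epsilon>' = - 1" and U: "U \<in> corner \<epsilon> \<epsilon>'"
  shows "{v. \<exists>k::nat. v - smul (int k) (\<epsilon>, \<epsilon>') \<in> U} \<in> corner \<epsilon> \<epsilon>'"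
    and "finite {k::nat. v - smul (int k) (\<epsilon>, \<epsilon>') \<in> U}"
proof -
  obtain b where b: "\<forall>v\<in>U. - b \<le> \<epsilon> * fst v \<and> - b \<le> \<epsilon>' * snd v" using U by (auto simp: corner_def)
  have bd: "int k \<le> \<epsilon> * fst v + b" "int k \<le> \<epsilon>' * snd v + b" if "v - smul (int k) (\<epsilon>, \<epsilon>') \<in> U" for v k
    using bspec[OF b that] \<epsilon> by (auto simp: smul_def)
  have "\<forall>v\<in>{v. \<exists>k::nat. v - smul (int k) (\<epsilon>, \<epsilon>') \<in> U}. - b \<le> \<epsilon> * fst v \<and> - b \<le> \<epsilon>' * snd v"
  proof
    fix v assume "v \<in> {v. \<exists>k::nat. v - smul (int k) (\<epsilon>, \<epsilon>') \<in> U}"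
    then obtain k :: nat where "v - smul (int k) (\<epsilon>, \<epsilon>') \<in> U" by blast
    from bd[OF this] show "- b \<le> \<epsilon> * fst v \<and> - b \<le> \<epsilon>' * snd v" by simp
  qed
  then show "{v. \<exists>k::nat. v - smul (int k) (\<epsilon>, \<epsilon>') \<in> U} \<in> corner \<epsilon> \<epsilon>'" unfolding corner_def by blast
  have "{k::nat. v - smul (int k) (\<epsilon>, \<epsilon>') \<in> U} \<subseteq> {..nat (\<epsilon> * fst v + b)}"
  proof
    fix k assume "k \<in> {k::nat. v - smul (int k) (\<epsilon>, \<epsilon>') \<in> U}"
    then show "k \<in> {..nat (\<epsilon> * fst v + b)}" using bd(1)[of v k] by simp
  qed
  then show "finite {k::nat. v - smul (int k) (\<epsilon>, \<epsilon>') \<in> U}" by (rule finite_subset) simp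
qed

section \<open>Finite homotopies and acyclicity over the eight rings\<close>

context free_complex
begin

text \<open>The telescope runs along the distinguished variable for an edge and along the diagonal
  for a corner. In each case a second vector completes the direction to a basis of the
  lattice.\<close>

lemma finite_homotopy_acyclic:
  assumes h: "finite_homotopy h"
  shows "acyclic_on (edge_x (sign b))" "acyclic_on (edge_y (sign b))" "acyclic_on (corner (sign b) (sign b'))"
proof -
  note sgn = sign_cases[of b] sign_cases[of b']
  let ?\<delta> = "\<lambda>n p. mat_act (rk (n + 1)) (rk n) (D n p)" and ?A = "\<lambda>n. vecs e (rk n)"
  show "acyclic_on (edge_x (sign b))"
    unfolding acyclic_on_def
  proof (intro allI ballI impI)
    fix n f assume f: "f \<in> cmpl (edge_x (sign b)) n" "dif n f = 0"
    interpret completion P ?\<delta> ?A "edge_x (sign b)" "(sign b, 0)"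
      by unfold_locales (rule support_ideal_edge_x, (erule edge_x_cone[OF sgn(1)])+)
    show "\<exists>g\<in>cmpl (edge_x (sign b)) (n - 1). dif (n - 1) g = f"
    proof (rule completion_acyclic[OF h, of "\<lambda>q. sign b * fst q" snd "(0, 1)" f "n - 1"])
      show "sign b * fst (a - c) = sign b * fst a - sign b * fst c" for a c by (simp add: right_diff_distrib)
      show "snd (a - c) = snd a - snd c" for a c by (simp add: right_diff_distrib)
      show "sign b * fst (q + smul i (sign b, 0)) = sign b * fst q + i" for q i
        using sgn by (auto simp: smul_def distrib_left)
      show "snd (q + smul i (sign b, 0)) = snd q" for q i
        using sgn by (auto simp: smul_def distrib_left)
      show "sign b * fst (q + smul i (0, 1)) = sign b * fst q" for q i by (simp add: smul_def)
      show "snd (q + smul i (0, 1)) = snd q + i" for q i by (simp add: smul_def)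
      show "q = smul (sign b * fst q) (sign b, 0) + smul (snd q) (0, 1)" for q
        using sgn by (auto simp: smul_def prod_eq_iff)
      show "f \<in> cmpl (edge_x (sign b)) (n - 1 + 1)" "dif (n - 1 + 1) f = 0" using f by simp_all
    qed
  qed
  show "acyclic_on (edge_y (sign b))"
    unfolding acyclic_on_def
  proof (intro allI ballI impI)
    fix n f assume f: "f \<in> cmpl (edge_y (sign b)) n" "dif n f = 0"
    interpret completion P ?\<delta> ?A "edge_y (sign b)" "(0, sign b)"
      by unfold_locales (rule support_ideal_edge_y, (erule edge_y_cone[OF sgn(1)])+)
    show "\<exists>g\<in>cmpl (edge_y (sign b)) (n - 1). dif (n - 1) g = f"
    proof (rule completion_acyclic[OF h, of "\<lambda>q. sign b * snd q" fst "(1, 0)" f "n - 1"])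
      show "sign b * snd (a - c) = sign b * snd a - sign b * snd c" for a c by (simp add: right_diff_distrib)
      show "fst (a - c) = fst a - fst c" for a c by (simp add: right_diff_distrib)
      show "sign b * snd (q + smul i (0, sign b)) = sign b * snd q + i" for q i
        using sgn by (auto simp: smul_def distrib_left)
      show "fst (q + smul i (0, sign b)) = fst q" for q i
        using sgn by (auto simp: smul_def distrib_left)
      show "sign b * snd (q + smul i (1, 0)) = sign b * snd q" for q i by (simp add: smul_def)
      show "fst (q + smul i (1, 0)) = fst q + i" for q i by (simp add: smul_def)
      show "q = smul (sign b * snd q) (0, sign b) + smul (fst q) (1, 0)" for q
        using sgn by (auto simp: smul_def prod_eq_iff)
      show "f \<in> cmpl (edge_y (sign b)) (n - 1 + 1)" "dif (n - 1 + 1) f = 0" using f by simp_all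
    qed
  qed
  show "acyclic_on (corner (sign b) (sign b'))"
    unfolding acyclic_on_def
  proof (intro allI ballI impI)
    fix n f assume f: "f \<in> cmpl (corner (sign b) (sign b')) n" "dif n f = 0"
    interpret completion P ?\<delta> ?A "corner (sign b) (sign b')" "(sign b, sign b')"
      by unfold_locales (rule support_ideal_corner, (erule corner_cone[OF sgn])+)
    show "\<exists>g\<in>cmpl (corner (sign b) (sign b')) (n - 1). dif (n - 1) g = f"
    \<comment> \<open>The two functionals are the coordinates with respect to the diagonal
      \<open>(sign b, sign b')\<close> and \<open>(0, 1)\<close>. The first is found from the first
      component, and the second is what is left of the second component.\<close>
    proof (rule completion_acyclic[OF h, of "\<lambda>q. sign b * fst q" "\<lambda>q. snd q - sign b' * (sign b * fst q)" "(0, 1)" f "n - 1"])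
      show "sign b * fst (a - c) = sign b * fst a - sign b * fst c" for a c by (simp add: algebra_simps)
      show "snd (a - c) - sign b' * (sign b * fst (a - c)) = (snd a - sign b' * (sign b * fst a)) - (snd c - sign b' * (sign b * fst c))" for a c by (simp add: algebra_simps)
      show "sign b * fst (q + smul i (sign b, sign b')) = sign b * fst q + i" for q i
        by (cases b; cases b'; simp add: smul_def sign_def)
      show "snd (q + smul i (sign b, sign b')) - sign b' * (sign b * fst (q + smul i (sign b, sign b'))) = snd q - sign b' * (sign b * fst q)" for q i
        by (cases b; cases b'; simp add: smul_def sign_def)
      show "sign b * fst (q + smul i (0, 1)) = sign b * fst q" for q i by (simp add: smul_def)
      show "snd (q + smul i (0, 1)) - sign b' * (sign b * fst (q + smul i (0, 1))) = snd q - sign b' * (sign b * fst q) + i" for q i by (simp add: smul_def)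
      show "q = smul (sign b * fst q) (sign b, sign b') + smul (snd q - sign b' * (sign b * fst q)) (0, 1)" for q
        by (cases b; cases b'; simp add: smul_def sign_def prod_eq_iff)
      show "f \<in> cmpl (corner (sign b) (sign b')) (n - 1 + 1)" "dif (n - 1 + 1) f = 0" using f by simp_all
    qed
  qed
qed

text \<open>Compared with \<open>finite_homotopy\<close>, tameness is strengthened to R-linearity.
  Tameness suffices for the telescope, R-linearity is needed for modules over R, and
  \<open>rlin_tame\<close> connects the two.\<close>

definition small_homotopy :: "(int \<Rightarrow> (int \<times> int \<Rightarrow> nat \<Rightarrow> 'u) \<Rightarrow> int \<times> int \<Rightarrow> nat \<Rightarrow> 'u) \<Rightarrow> bool"
  where "small_homotopy h \<longleftrightarrow> (\<forall>n. rlin n (n - 1) (h n))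
    \<and> (\<forall>n. \<exists>F. finite F \<and> (\<forall>f\<in>pol n. supp (retr h n f) \<subseteq> F))"

theorem small_homotopy_iff_acyclic:
  "(\<exists>h. small_homotopy h) \<longleftrightarrow> (\<forall>b. acyclic_on (edge_x (sign b))) \<and> (\<forall>b. acyclic_on (edge_y (sign b)))
    \<and> (\<forall>b b'. acyclic_on (corner (sign b) (sign b')))"
proof
  assume "\<exists>h. small_homotopy h"
  then obtain h where h: "\<And>n. rlin n (n - 1) (h n)" "\<And>n. \<exists>F. finite F \<and> (\<forall>f\<in>pol n. supp (retr h n f) \<subseteq> F)"
    unfolding small_homotopy_def by blast
  have t: "tame n (n - 1) (h n)" for n by (rule rlin_tame[OF h(1)])
  have "finite_homotopy h"
    unfolding finite_homotopy_def small_def using t h(2) tame_retr[OF t] by blast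
  then show "(\<forall>b. acyclic_on (edge_x (sign b))) \<and> (\<forall>b. acyclic_on (edge_y (sign b)))
      \<and> (\<forall>b b'. acyclic_on (corner (sign b) (sign b')))"
    using finite_homotopy_acyclic by blast
next
  assume a: "(\<forall>b. acyclic_on (edge_x (sign b))) \<and> (\<forall>b. acyclic_on (edge_y (sign b)))
      \<and> (\<forall>b b'. acyclic_on (corner (sign b) (sign b')))"
  show "\<exists>h. small_homotopy h" unfolding small_homotopy_def
  proof (rule contractions_imp_finite_homotopy[of lo])
    show "vecs e (rk n) = {0}" if "n < lo" for n using bounded that by blast
    show "\<exists>\<kappa>. contraction (edge_x (sign b)) \<kappa>" for b
      by (rule acyclic_contraction[OF support_ideal_edge_x finite_in_families(1)]) (use a in blast)
    show "\<exists>\<kappa>. contraction (edge_y (sign b)) \<kappa>" for b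
      by (rule acyclic_contraction[OF support_ideal_edge_y finite_in_families(2)]) (use a in blast)
    show "\<exists>\<kappa>. contraction (corner (sign b) (sign b')) \<kappa>" for b b'
      by (rule acyclic_contraction[OF support_ideal_corner finite_in_families(3)]) (use a in blast)
  qed
qed

end

section \<open>Splitting the homotopy idempotent\<close>

definition lin_on :: "'r set \<Rightarrow> 'x set \<Rightarrow> ('r \<Rightarrow> 'x \<Rightarrow> 'x) \<Rightarrow> 'y set \<Rightarrow> ('r \<Rightarrow> 'y \<Rightarrow> 'y)
    \<Rightarrow> ('x::ab_group_add \<Rightarrow> 'y::ab_group_add) \<Rightarrow> bool"
  where "lin_on Rs X s Y s' B \<longleftrightarrow> (\<forall>x\<in>X. B x \<in> Y) \<and> (\<forall>x\<in>X. \<forall>y\<in>X. B (x + y) = B x + B y)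
    \<and> (\<forall>r\<in>Rs. \<forall>x\<in>X. B (s r x) = s' r (B x))"

lemma lin_onI:
  assumes "\<And>x. x \<in> X \<Longrightarrow> B x \<in> Y" "\<And>x y. x \<in> X \<Longrightarrow> y \<in> X \<Longrightarrow> B (x + y) = B x + B y"
    "\<And>r x. r \<in> Rs \<Longrightarrow> x \<in> X \<Longrightarrow> B (s r x) = s' r (B x)"
  shows "lin_on Rs X s Y s' B"
  using assms unfolding lin_on_def by blast

lemma lin_onD:
  assumes "lin_on Rs X s Y s' B"
  shows "x \<in> X \<Longrightarrow> B x \<in> Y" "x \<in> X \<Longrightarrow> y \<in> X \<Longrightarrow> B (x + y) = B x + B y"
    "r \<in> Rs \<Longrightarrow> x \<in> X \<Longrightarrow> B (s r x) = s' r (B x)"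
  using assms unfolding lin_on_def by blast+

lemma lin_on_comp: "lin_on Rs X s Y s' B \<Longrightarrow> lin_on Rs Y s' Z s'' C \<Longrightarrow> lin_on Rs X s Z s'' (\<lambda>x. C (B x))"
  unfolding lin_on_def by auto

lemma lin_on_add:
  assumes "lin_on Rs X s Y s' B" "lin_on Rs X s Y s' C" "add_subgroup Y" "\<And>r. additive (s' r)"
  shows "lin_on Rs X s Y s' (\<lambda>x. B x + C x)"
  by (rule lin_onI) (simp_all add: lin_onD[OF assms(1)] lin_onD[OF assms(2)] add_subgroup_add[OF assms(3)]
    additive.add[OF assms(4)])

lemma lin_on_diff:
  assumes "lin_on Rs X s Y s' B" "lin_on Rs X s Y s' C" "add_subgroup Y" "\<And>r. additive (s' r)"
  shows "lin_on Rs X s Y s' (\<lambda>x. B x - C x)"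
  by (rule lin_onI) (simp_all add: lin_onD[OF assms(1)] lin_onD[OF assms(2)] add_subgroup_diff[OF assms(3)]
    additive.diff[OF assms(4)])

lemma lin_on_zero: "add_subgroup Y \<Longrightarrow> (\<And>r. additive (s' r)) \<Longrightarrow> lin_on Rs X s Y s' (\<lambda>x. 0)"
  by (rule lin_onI) (simp_all add: add_subgroup_zero additive.zero)

lemma lin_on_mono: "lin_on Rs X s Y s' B \<Longrightarrow> Y \<subseteq> Y' \<Longrightarrow> X' \<subseteq> X \<Longrightarrow> lin_on Rs X' s Y' s' B"
  unfolding lin_on_def by blast

lemma lin_on_id: "lin_on Rs X s X s (\<lambda>x. x)"
  by (rule lin_onI) auto

lemma lin_on_map_zero: "lin_on Rs X s Y s' B \<Longrightarrow> 0 \<in> X \<Longrightarrow> B 0 = 0"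
  using lin_onD(2)[of Rs X s Y s' B 0 0] by simp

lemma lin_on_map_diff: "lin_on Rs X s Y s' B \<Longrightarrow> add_subgroup X \<Longrightarrow> x \<in> X \<Longrightarrow> y \<in> X \<Longrightarrow> B (x - y) = B x - B y"
  using lin_onD(2)[of Rs X s Y s' B "x - y" y] add_subgroup_diff[of X x y] by simp

lemma down_induct:
  fixes n :: int
  assumes "\<And>n. hi < n \<Longrightarrow> Q n" "\<And>n. n \<le> hi \<Longrightarrow> Q (n + 1) \<Longrightarrow> Q n"
  shows "Q n"
proof (cases "n \<le> hi + 1")
  case True
  then show ?thesis
  proof (induction rule: int_le_induct)
    case base
    then show ?case by (rule assms(1)) simp
  next
    case (step i)
    then show ?case using assms(2)[of "i - 1"] by simp
  qed
qed (simp add: assms(1))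

text \<open>
  A homotopy equivalent complex of finitely generated projective modules: in degree \<open>n\<close> the sum
  of the finite submodules \<open>F\<^sup>m\<close> of \<open>C\<^sup>m\<close> over all \<open>m \<ge> n\<close>, except that in the lowest degree the
  image of an idempotent is split off.
\<close>

locale dominated_complex = free_complex e rk P D lo hi
  for e :: "'u::ring" and rk P D lo hi +
  fixes h F
  assumes h: "\<And>n. rlin n (n - 1) (h n)"
    and F: "\<And>n. finite (F n)" "\<And>n f. f \<in> pol n \<Longrightarrow> supp (retr h n f) \<subseteq> F n"
begin

abbreviation Rset :: "'u set"
  where "Rset \<equiv> {r. e * r = r}"

abbreviation lin :: "'x set \<Rightarrow> ('u \<Rightarrow> 'x \<Rightarrow> 'x) \<Rightarrow> 'y set \<Rightarrow> ('u \<Rightarrow> 'y \<Rightarrow> 'y) \<Rightarrow> ('x::ab_group_add \<Rightarrow> 'y::ab_group_add) \<Rightarrow> bool"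
  where "lin \<equiv> lin_on Rset"

lemma rlin_eq: "rlin n m B \<longleftrightarrow> lin (pol n) scale (pol m) scale B"
  unfolding rlin_def lin_on_def ..

text \<open>The finite sets \<open>F\<close> are enlarged degree by degree so that the differential
  maps each box into the next. Starting in the lowest degree \<open>lo\<close>, this keeps every box
  finite.\<close>

primrec gbox :: "nat \<Rightarrow> (int \<times> int) set"
  where "gbox 0 = F lo" | "gbox (Suc k) = F (lo + int (Suc k)) \<union> (\<Union>p\<in>P. {v. v - p \<in> gbox k})"

definition box :: "int \<Rightarrow> (int \<times> int) set"
  where "box n = (if n < lo then {} else gbox (nat (n - lo)))"

lemma finite_box: "finite (box n)"
proof -
  have "finite (gbox k)" for k
  proof (induction k)
    case (Suc k)
    have "finite {v. v - p \<in> gbox k}" for p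
      using support_idealD(4)[OF finite_support_ideal, of "gbox k" p] Suc by simp
    then show ?case using F(1) P by simp
  qed (simp add: F)
  then show ?thesis by (simp add: box_def)
qed

lemma pol_low: "f \<in> pol n \<Longrightarrow> n < lo \<or> hi < n \<Longrightarrow> f = 0"
  using bounded[of n] by (auto simp: pol_iff fun_eq_iff)

lemma F_box:
  assumes "lo \<le> n"
  shows "F n \<subseteq> box n"
proof -
  have "F (lo + int k) \<subseteq> gbox k" for k by (cases k) auto
  from this[of "nat (n - lo)"] show ?thesis using assms by (simp add: box_def)
qed

lemma box_dif:
  assumes n: "lo \<le> n" and v: "p \<in> P" "v - p \<in> box n"
  shows "v \<in> box (n + 1)"
proof -
  have "nat (n + 1 - lo) = Suc (nat (n - lo))" using n by simp
  then show ?thesis using n v by (auto simp: box_def)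
qed

definition fpol :: "int \<Rightarrow> (int \<times> int \<Rightarrow> nat \<Rightarrow> 'u) set"
  where "fpol n = {f \<in> pol n. supp f \<subseteq> box n}"

lemma fpol_pol: "f \<in> fpol n \<Longrightarrow> f \<in> pol n"
  by (simp add: fpol_def)

lemma fpol_subgroup: "add_subgroup (fpol n)"
  unfolding add_subgroup_def
proof (intro conjI ballI)
  show "0 \<in> fpol n" using pol_zero by (simp add: fpol_def supp_def)
  show "f - g \<in> fpol n" if "f \<in> fpol n" "g \<in> fpol n" for f g
    using that pol_diff[of f n g] order_trans[OF supp_diff[of f g], of "box n"] by (simp add: fpol_def)
qed

lemma retr_lin: "lin (pol n) scale (fpol n) scale (retr h n)"
proof -
  have d: "rlin (n - 1) n (dif (n - 1))" using rlin_dif[of "n - 1"] by simp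
  have h1: "rlin (n + 1) n (h (n + 1))" using h[of "n + 1"] by simp
  have "rlin n n (\<lambda>f. f - dif (n - 1) (h n f) - h (n + 1) (dif n f))"
    by (intro rlin_diff_fun rlin_id rlin_comp[OF h d] rlin_comp[OF rlin_dif h1])
  then have "rlin n n (retr h n)" by (simp add: retr_def[abs_def])
  note r = rlinD[OF this]
  have "retr h n f \<in> fpol n" if f: "f \<in> pol n" for f
  proof (cases "lo \<le> n")
    case True
    then show ?thesis using r(1)[OF f] F(2)[OF f] F_box[OF True] by (auto simp: fpol_def)
  next
    case False
    then have "retr h n f = 0" using pol_low[OF r(1)[OF f]] by simp
    then show ?thesis using add_subgroup_zero[OF fpol_subgroup] by simp
  qed
  then show ?thesis by (intro lin_onI r)
qed

lemma dif_fpol: "f \<in> fpol n \<Longrightarrow> dif n f \<in> fpol (n + 1)"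
proof -
  assume f: "f \<in> fpol n"
  show ?thesis
  proof (cases "lo \<le> n")
    case True
    have "supp (dif n f) \<subseteq> box (n + 1)"
    proof (rule order_trans[OF supp_dif], rule UN_least, rule subsetI)
      fix p v assume "p \<in> P" "v \<in> {v. v - p \<in> supp f}"
      then show "v \<in> box (n + 1)" using box_dif[OF True, of p v] f by (auto simp: fpol_def)
    qed
    then show ?thesis using dif_pol[OF fpol_pol[OF f]] by (simp add: fpol_def)
  next
    case False
    then have "f = 0" using pol_low[OF fpol_pol[OF f]] by simp
    then show ?thesis using add_subgroup_zero[OF fpol_subgroup] by (simp add: dif_zero)
  qed
qed

lemma dif_lin: "lin (fpol n) scale (fpol (n + 1)) scale (dif n)"
  using rlin_dif[of n] fpol_pol by (intro lin_onI dif_fpol) (auto simp: rlin_eq lin_on_def)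

section \<open>The sums of the finite submodules and their differential\<close>

definition tot :: "int \<Rightarrow> (int \<Rightarrow> int \<times> int \<Rightarrow> nat \<Rightarrow> 'u) set"
  where "tot n = {x. \<forall>m. x m \<in> fpol m \<and> (m < n \<longrightarrow> x m = 0)}"

abbreviation total :: "(int \<Rightarrow> int \<times> int \<Rightarrow> nat \<Rightarrow> 'u) set"
  where "total \<equiv> tot lo"

definition tscale :: "'u \<Rightarrow> (int \<Rightarrow> int \<times> int \<Rightarrow> nat \<Rightarrow> 'u) \<Rightarrow> int \<Rightarrow> int \<times> int \<Rightarrow> nat \<Rightarrow> 'u"
  where "tscale r x = (\<lambda>m. scale r (x m))"

definition single :: "int \<Rightarrow> (int \<times> int \<Rightarrow> nat \<Rightarrow> 'u) \<Rightarrow> int \<Rightarrow> int \<times> int \<Rightarrow> nat \<Rightarrow> 'u"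
  where "single n c = (\<lambda>m. if m = n then c else 0)"

definition upfrom :: "int \<Rightarrow> (int \<Rightarrow> int \<times> int \<Rightarrow> nat \<Rightarrow> 'u) \<Rightarrow> int \<Rightarrow> int \<times> int \<Rightarrow> nat \<Rightarrow> 'u"
  where "upfrom n x = (\<lambda>m. if n \<le> m then x m else 0)"

lemma scale_0: "scale r 0 = 0"
  by (rule additive.zero[OF scale_additive])

lemma tscale_additive: "additive (tscale r)"
  by (rule additive.intro) (simp add: tscale_def fun_eq_iff additive.add[OF scale_additive])

lemma tot_subgroup: "add_subgroup (tot n)"
  using add_subgroup_zero[OF fpol_subgroup] add_subgroup_diff[OF fpol_subgroup]
  by (auto simp: add_subgroup_def tot_def)

lemma totD: "x \<in> tot n \<Longrightarrow> x m \<in> fpol m" "x \<in> tot n \<Longrightarrow> m < n \<Longrightarrow> x m = 0"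
  by (simp_all add: tot_def)

lemma tot_total: "x \<in> tot n \<Longrightarrow> x \<in> total"
  using pol_low[OF fpol_pol] unfolding tot_def by blast

lemma tot_antimono: "m \<le> n \<Longrightarrow> tot n \<subseteq> tot m"
  unfolding tot_def by auto

lemma scale_fpol: "r \<in> Rset \<Longrightarrow> f \<in> fpol n \<Longrightarrow> scale r f \<in> fpol n"
  using scale_pol[of r f n] supp_scale[of r f] by (auto simp: fpol_def)

lemma tscale_tot: "r \<in> Rset \<Longrightarrow> x \<in> tot n \<Longrightarrow> tscale r x \<in> tot n"
  using scale_fpol unfolding tot_def tscale_def by (simp add: scale_0)

lemma single_lin: "lin (fpol n) scale (tot n) tscale (single n)"
  using add_subgroup_zero[OF fpol_subgroup]
  by (intro lin_onI) (auto simp: tot_def single_def tscale_def scale_0 fun_eq_iff)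

lemma upfrom_lin: "lin total tscale (tot n) tscale (upfrom n)"
  using add_subgroup_zero[OF fpol_subgroup]
  by (intro lin_onI) (auto simp: tot_def upfrom_def tscale_def scale_0 fun_eq_iff)

lemma proj_lin: "lin total tscale (fpol n) scale (\<lambda>x. x n)"
  by (rule lin_onI) (simp_all add: totD tscale_def)

text \<open>Unfolded, \<open>Psi n x\<close> is the sum of \<open>h\<close> iterated m - n times on
  \<open>x m\<close>, over m >= n. The recursion counts degrees down from \<open>hi\<close>, above
  which everything vanishes.\<close>

primrec psi :: "nat \<Rightarrow> (int \<Rightarrow> int \<times> int \<Rightarrow> nat \<Rightarrow> 'u) \<Rightarrow> int \<times> int \<Rightarrow> nat \<Rightarrow> 'u"
  where "psi 0 x = 0" | "psi (Suc k) x = x (hi - int k) + h (hi - int k + 1) (psi k x)"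

definition Psi :: "int \<Rightarrow> (int \<Rightarrow> int \<times> int \<Rightarrow> nat \<Rightarrow> 'u) \<Rightarrow> int \<times> int \<Rightarrow> nat \<Rightarrow> 'u"
  where "Psi n = psi (nat (hi + 1 - n))"

text \<open>A differential of the shape known from the instant finiteness obstruction of Ranicki. By
  the recursion, on \<open>tot (n + 1)\<close> the maps \<open>Del n\<close> and
  \<open>Del (n + 1)\<close> add up to the identity minus
  \<open>retr h (n + 1) (Psi (n + 1) x)\<close> placed in degree \<open>n + 1\<close>. Hence the
  inclusion of each \<open>tot\<close> into the next larger one will serve, up to sign, as a
  homotopy.\<close>

primrec del :: "nat \<Rightarrow> (int \<Rightarrow> int \<times> int \<Rightarrow> nat \<Rightarrow> 'u) \<Rightarrow> int \<Rightarrow> int \<times> int \<Rightarrow> nat \<Rightarrow> 'u"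
  where "del 0 x = 0"
  | "del (Suc k) x = (let n = hi - int k in single (n + 1) (dif n (x n)) + upfrom (n + 1) x
      - single (n + 1) (retr h (n + 1) (psi k x)) - del k x)"

definition Del :: "int \<Rightarrow> (int \<Rightarrow> int \<times> int \<Rightarrow> nat \<Rightarrow> 'u) \<Rightarrow> int \<Rightarrow> int \<times> int \<Rightarrow> nat \<Rightarrow> 'u"
  where "Del n = del (nat (hi + 1 - n))"

lemma Psi_high: "hi < n \<Longrightarrow> Psi n x = 0"
  and Del_high: "hi < n \<Longrightarrow> Del n x = 0"
  by (simp_all add: Psi_def Del_def)

lemma nat_step: "n \<le> hi \<Longrightarrow> nat (hi + 1 - n) = Suc (nat (hi + 1 - (n + 1)))"
  by simp

lemma Psi_rec: "n \<le> hi \<Longrightarrow> Psi n x = x n + h (n + 1) (Psi (n + 1) x)"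
  unfolding Psi_def nat_step by simp

lemma Del_rec: "n \<le> hi \<Longrightarrow> Del n x = single (n + 1) (dif n (x n)) + upfrom (n + 1) x
    - single (n + 1) (retr h (n + 1) (Psi (n + 1) x)) - Del (n + 1) x"
  unfolding Psi_def Del_def nat_step by (simp add: Let_def)

lemma pol_subgroup': "add_subgroup (pol n)" by (rule pol_subgroup)

lemma Psi_lin: "lin total tscale (pol n) scale (Psi n)"
proof (induction n rule: down_induct[where hi = hi])
  case (1 n)
  then have "Psi n = (\<lambda>x. 0)" by (simp add: Psi_high fun_eq_iff)
  then show ?case using lin_on_zero[OF pol_subgroup scale_additive] by (simp only:)
next
  case (2 n)
  have "lin (pol (n + 1)) scale (pol n) scale (h (n + 1))" using h[of "n + 1"] by (simp add: rlin_eq)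
  from lin_on_comp[OF 2(2) this] lin_on_mono[OF proj_lin _ order_refl, of n "pol n"]
  have "lin total tscale (pol n) scale (\<lambda>x. x n + h (n + 1) (Psi (n + 1) x))"
    by (intro lin_on_add[OF _ _ pol_subgroup scale_additive]) (auto simp: fpol_def)
  moreover have "Psi n = (\<lambda>x. x n + h (n + 1) (Psi (n + 1) x))" by (rule ext) (rule Psi_rec[OF 2(1)])
  ultimately show ?case by argo
qed

lemma Del_lin: "lin total tscale (tot (n + 1)) tscale (Del n)"
proof (induction n rule: down_induct[where hi = hi])
  case (1 n)
  then have "Del n = (\<lambda>x. 0)" by (simp add: Del_high fun_eq_iff)
  then show ?case using lin_on_zero[OF tot_subgroup tscale_additive] by (simp only:)
next
  case (2 n)
  have s: "lin total tscale (tot (n + 1)) tscale (\<lambda>x. single (n + 1) (dif n (x n)))"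
    by (rule lin_on_comp[OF lin_on_comp[OF proj_lin dif_lin] single_lin])
  have t: "lin total tscale (tot (n + 1)) tscale (\<lambda>x. single (n + 1) (retr h (n + 1) (Psi (n + 1) x)))"
    by (rule lin_on_comp[OF lin_on_comp[OF Psi_lin retr_lin] single_lin])
  have u: "lin total tscale (tot (n + 1)) tscale (Del (n + 1))"
    by (rule lin_on_mono[OF 2(2) tot_antimono order_refl]) simp
  have eq: "Del n = (\<lambda>x. single (n + 1) (dif n (x n)) + upfrom (n + 1) x
      - single (n + 1) (retr h (n + 1) (Psi (n + 1) x)) - Del (n + 1) x)"
    by (rule ext) (rule Del_rec[OF 2(1)])
  show ?case
    unfolding eq by (intro lin_on_add lin_on_diff s t u upfrom_lin tot_subgroup tscale_additive)
qed

lemma Psi_local: "(\<And>m. n \<le> m \<Longrightarrow> x m = y m) \<Longrightarrow> Psi n x = Psi n y"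
proof (induction n rule: down_induct[where hi = hi])
  case (2 n)
  have "Psi (n + 1) x = Psi (n + 1) y" by (rule 2(2)) (simp add: 2(3))
  then show ?case using 2(3)[of n] unfolding Psi_rec[OF 2(1)] by simp
qed (simp add: Psi_high)

lemma Del_local: "(\<And>m. n \<le> m \<Longrightarrow> x m = y m) \<Longrightarrow> Del n x = Del n y"
proof (induction n rule: down_induct[where hi = hi])
  case (2 n)
  have "Del (n + 1) x = Del (n + 1) y" by (rule 2(2)) (simp add: 2(3))
  moreover have "Psi (n + 1) x = Psi (n + 1) y" by (rule Psi_local) (simp add: 2(3))
  moreover have "upfrom (n + 1) x = upfrom (n + 1) y" using 2(3) by (auto simp: upfrom_def)
  ultimately show ?case using 2(3)[of n] unfolding Del_rec[OF 2(1)] by simp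
qed (simp add: Del_high)

lemma zero_total: "0 \<in> tot n"
  by (rule add_subgroup_zero[OF tot_subgroup])

lemma h_zero: "h n 0 = 0"
  by (rule rlin_zero[OF h])

lemma Psi_below: "(\<And>m. n \<le> m \<Longrightarrow> x m = 0) \<Longrightarrow> Psi n x = 0"
  using Psi_local[of n x 0] lin_on_map_zero[OF Psi_lin zero_total, of n] by simp

lemma Del_below: "(\<And>m. n \<le> m \<Longrightarrow> x m = 0) \<Longrightarrow> Del n x = 0"
  using Del_local[of n x 0] lin_on_map_zero[OF Del_lin zero_total, of n] by simp

lemma Psi_rec': "x \<in> total \<Longrightarrow> Psi n x = x n + h (n + 1) (Psi (n + 1) x)"
proof (cases "n \<le> hi")
  case False
  assume "x \<in> total"
  then have "x n = 0" using False pol_low[OF fpol_pol[OF totD(1)], of x lo n] by simp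
  then show ?thesis using False by (simp add: Psi_high h_zero fun_eq_iff)
qed (simp add: Psi_rec)

lemma retr_zero: "retr h n 0 = 0"
  by (rule lin_on_map_zero[OF retr_lin pol_zero])

lemma Del_rec': "x \<in> total \<Longrightarrow> Del n x = single (n + 1) (dif n (x n)) + upfrom (n + 1) x
    - single (n + 1) (retr h (n + 1) (Psi (n + 1) x)) - Del (n + 1) x"
proof (cases "n \<le> hi")
  case False
  assume "x \<in> total"
  then have x: "x m = 0" if "n \<le> m" for m
    using False that pol_low[OF fpol_pol[OF totD(1)], of x lo m] by simp
  then have "upfrom (n + 1) x = 0" by (auto simp: upfrom_def)
  moreover have "single (n + 1) 0 = 0" by (auto simp: single_def)
  ultimately show ?thesis using False x by (simp add: Psi_high Del_high dif_zero retr_zero)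
qed (simp add: Del_rec)

lemma Psi_single: "c \<in> fpol n \<Longrightarrow> Psi n (single n c) = c"
  using Psi_below[of "n + 1" "single n c"] tot_total[OF lin_onD(1)[OF single_lin]] Psi_rec'[of "single n c" n]
  by (simp add: single_def h_zero)

lemma Psi_upfrom: "Psi n (upfrom n x) = Psi n x" "Del n (upfrom n x) = Del n x"
  by (rule Psi_local Del_local, simp add: upfrom_def)+

lemma single_0: "single n 0 = 0"
  by (auto simp: single_def)

lemma Del_single:
  assumes c: "c \<in> fpol n"
  shows "Del n (single n c) = single (n + 1) (dif n c)"
proof -
  have "Del (n + 1) (single n c) = 0" by (rule Del_below) (simp add: single_def)
  moreover have "Psi (n + 1) (single n c) = 0" by (rule Psi_below) (simp add: single_def)
  moreover have "upfrom (n + 1) (single n c) = 0" by (auto simp: upfrom_def single_def)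
  moreover have "single n c n = c" by (simp add: single_def)
  ultimately show ?thesis
    using Del_rec'[OF tot_total[OF lin_onD(1)[OF single_lin c]], of n]
    by (simp only: retr_zero single_0 add_0_right diff_zero)
qed

lemma upfrom_tot: "x \<in> tot n \<Longrightarrow> upfrom n x = x"
  by (auto simp: upfrom_def tot_def)

text \<open>Both identities go into one downward induction: that \<open>Del\<close> squares to zero
  in degree n uses that \<open>Psi\<close> is a chain map in degree n + 1.\<close>

lemma Psi_Del_and_Del_Del:
  "x \<in> total \<Longrightarrow> dif n (Psi n x) = Psi (n + 1) (Del n x) \<and> Del (n + 1) (Del n x) = 0"
proof (induction n rule: down_induct[where hi = hi])
  case (1 n)
  show ?case
    unfolding Psi_high[OF 1(1)] Del_high[OF 1(1)] dif_zero
    using lin_on_map_zero[OF Psi_lin zero_total] lin_on_map_zero[OF Del_lin zero_total] by metis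
next
  case (2 n)
  have x: "x \<in> total" by (rule 2(3))
  let ?P = "Psi (n + 1) x" and ?y = "Del (n + 1) x"
  have IH: "dif (n + 1) ?P = Psi (n + 1 + 1) ?y" "Del (n + 1 + 1) ?y = 0"
    by (rule conjunct1[OF 2(2)[OF x]]) (rule conjunct2[OF 2(2)[OF x]])
  have P: "?P \<in> pol (n + 1)" by (rule lin_onD(1)[OF Psi_lin x])
  have xn: "x n \<in> fpol n" by (rule totD(1)[OF x])
  have dx: "dif n (x n) \<in> fpol (n + 1)" by (rule dif_fpol[OF xn])
  have eP: "retr h (n + 1) ?P \<in> fpol (n + 1)" by (rule lin_onD(1)[OF retr_lin P])
  have y: "?y \<in> tot (n + 1 + 1)" by (rule lin_onD(1)[OF Del_lin x])
  note yt = tot_total[OF y]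
  note s = tot_total[OF lin_onD(1)[OF single_lin dx]] tot_total[OF lin_onD(1)[OF single_lin eP]]
  have ut: "upfrom (n + 1) x \<in> total" by (rule tot_total[OF lin_onD(1)[OF upfrom_lin x]])
  note sub = add_subgroup_add[OF tot_subgroup] add_subgroup_diff[OF tot_subgroup]
  \<comment> \<open>Stated for an arbitrary linear map because it is used once for
    \<open>Psi (n + 1)\<close> and once for \<open>Del (n + 1)\<close>.\<close>
  have split: "B (Del n x) = B (single (n + 1) (dif n (x n))) + B (upfrom (n + 1) x)
      - B (single (n + 1) (retr h (n + 1) ?P)) - B ?y"
    if B: "lin total tscale Y s' B" for B :: "(int \<Rightarrow> int \<times> int \<Rightarrow> nat \<Rightarrow> 'u) \<Rightarrow> 'z::ab_group_add" and Y s'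
    unfolding Del_rec[OF 2(1)]
    by (simp only: lin_on_map_diff[OF B tot_subgroup sub(2)[OF sub(1)[OF s(1) ut] s(2)] yt]
        lin_on_map_diff[OF B tot_subgroup sub(1)[OF s(1) ut] s(2)] lin_onD(2)[OF B s(1) ut])
  have Py: "Psi (n + 1) ?y = h (n + 1 + 1) (Psi (n + 1 + 1) ?y)"
    using Psi_rec'[OF yt, of "n + 1"] totD(2)[OF y, of "n + 1"] by simp
  have "dif n (h (n + 1) ?P) = ?P - retr h (n + 1) ?P - h (n + 1 + 1) (dif (n + 1) ?P)"
    unfolding retr_def by (simp add: fun_eq_iff)
  moreover have "dif n (Psi n x) = dif n (x n) + dif n (h (n + 1) ?P)"
    unfolding Psi_rec[OF 2(1)] dif_add ..
  ultimately have A: "dif n (Psi n x) = dif n (x n) + (?P - retr h (n + 1) ?P - h (n + 1 + 1) (dif (n + 1) ?P))"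
    by simp
  have PA: "Psi (n + 1) (Del n x) = dif n (x n) + ?P - retr h (n + 1) ?P - h (n + 1 + 1) (dif (n + 1) ?P)"
    unfolding split[OF Psi_lin] Psi_single[OF dx] Psi_single[OF eP] Psi_upfrom Py IH(1) ..
  have "retr h (n + 1 + 1) (dif (n + 1) ?P) = dif (n + 1) (retr h (n + 1) ?P)"
    by (rule retr_dif[OF rlin_tame[OF h] P])
  moreover have "dif (n + 1) (dif n (x n)) = 0" by (rule dif_dif_pol(1)[OF fpol_pol[OF xn]])
  \<comment> \<open>In the recursion for \<open>?y\<close> the first induction hypothesis replaces
    \<open>Psi\<close> by \<open>dif (n + 1) ?P\<close>, and the second removes the last term. The
    remaining terms then cancel because \<open>retr h\<close> commutes with the
    differential.\<close>
  moreover have "Del (n + 1) ?y = ?y - single (n + 1 + 1) (retr h (n + 1 + 1) (dif (n + 1) ?P))"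
    using Del_rec'[OF yt, of "n + 1"] IH totD(2)[OF y, of "n + 1"] upfrom_tot[OF y]
    by (simp add: dif_zero single_0)
  ultimately have "Del (n + 1) (Del n x) = 0"
    unfolding split[OF Del_lin] Del_single[OF dx] Del_single[OF eP] Psi_upfrom by (simp add: single_0)
  then show ?case using A PA by (simp add: fun_eq_iff)
qed

lemmas Psi_Del = Psi_Del_and_Del_Del[THEN conjunct1]
  and Del_Del = Psi_Del_and_Del_Del[THEN conjunct2]

text \<open>Below \<open>lo\<close> both the differential and \<open>Psi\<close> vanish, so on
  \<open>total\<close> consecutive maps \<open>Del\<close> add up to the identity: they alternate
  between one map and its complement.\<close>

definition idem :: "(int \<Rightarrow> int \<times> int \<Rightarrow> nat \<Rightarrow> 'u) \<Rightarrow> int \<Rightarrow> int \<times> int \<Rightarrow> nat \<Rightarrow> 'u"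
  where "idem = Del (lo - 1)"

lemma idem_lin: "lin total tscale total tscale idem"
  using Del_lin[of "lo - 1"] by (simp add: idem_def)

lemma Psi_lo: "x \<in> total \<Longrightarrow> n < lo \<Longrightarrow> Psi n x = 0"
  using pol_low[OF lin_onD(1)[OF Psi_lin]] by blast

text \<open>\<open>Del\<close> in degree \<open>lo - 2\<close> is the complement of
  \<open>idem\<close>, so the rule that \<open>Del\<close> squares to zero says that
  \<open>idem\<close> kills \<open>x - idem x\<close>.\<close>

lemma idem_idem:
  assumes x: "x \<in> total"
  shows "idem (idem x) = idem x"
proof -
  have "x (lo - 2) = 0" "upfrom (lo - 1) x = x"
    using totD(2)[OF x] upfrom_tot[of x "lo - 1"] tot_antimono[of "lo - 1" lo] x by auto
  then have d: "Del (lo - 2) x = x - idem x"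
    using Del_rec'[OF x, of "lo - 2"] Psi_lo[OF x, of "lo - 1"]
    by (simp add: dif_zero single_0 retr_zero idem_def)
  have "idem (x - idem x) = 0" using Del_Del[OF x, of "lo - 2"] unfolding d by (simp add: idem_def)
  then show ?thesis
    using lin_on_map_diff[OF idem_lin tot_subgroup x lin_onD(1)[OF idem_lin x]] by (simp add: fun_eq_iff)
qed

text \<open>In degree \<open>lo\<close> the complement of \<open>idem\<close> is kept.
  \<open>Del lo\<close> kills the image of \<open>idem\<close>, so the differential is determined on
  this summand, which replaces the infinite continuation of the complex below
  \<open>lo\<close>.\<close>

definition proj :: "int \<Rightarrow> (int \<Rightarrow> int \<times> int \<Rightarrow> nat \<Rightarrow> 'u) \<Rightarrow> int \<Rightarrow> int \<times> int \<Rightarrow> nat \<Rightarrow> 'u"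
  where "proj n x = (if n < lo then 0 else if n = lo then x - idem x else upfrom n x)"

definition mods :: "int \<Rightarrow> (int \<Rightarrow> int \<times> int \<Rightarrow> nat \<Rightarrow> 'u) set"
  where "mods n = {x \<in> total. proj n x = x}"

lemma total_total: "lin total tscale total tscale (upfrom n)"
  by (rule lin_on_mono[OF upfrom_lin[of n] subsetI[OF tot_total] order_refl])

lemma proj_total: "lin total tscale total tscale (proj n)"
proof -
  consider "n < lo" | "n = lo" | "lo < n" by linarith
  then show ?thesis
  proof cases
    case 1
    then show ?thesis using lin_on_zero[OF tot_subgroup tscale_additive] by (simp add: proj_def[abs_def])
  next
    case 2
    then show ?thesis
      using lin_on_diff[OF lin_on_id idem_lin tot_subgroup tscale_additive] by (simp add: proj_def[abs_def])
  next
    case 3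
    then show ?thesis using total_total by (simp add: proj_def[abs_def])
  qed
qed

lemma proj_proj:
  assumes x: "x \<in> total"
  shows "proj n (proj n x) = proj n x"
proof -
  have "idem (x - idem x) = 0"
    using lin_on_map_diff[OF idem_lin tot_subgroup x lin_onD(1)[OF idem_lin x]] idem_idem[OF x]
    by (simp only: diff_self)
  then have 1: "x - idem x - idem (x - idem x) = x - idem x" by (simp only: diff_zero)
  have 2: "upfrom n (upfrom n x) = upfrom n x" by (auto simp: upfrom_def)
  consider "n < lo" | "n = lo" | "\<not> n < lo" "n \<noteq> lo" by linarith
  then show ?thesis
  proof cases
    case 1
    then show ?thesis by (simp add: proj_def)
  next
    case n: 2
    show ?thesis unfolding n proj_def using 1 by simp
  next
    case 3
    then show ?thesis using 2 by (simp add: proj_def)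
  qed
qed

lemma proj_mods: "lin total tscale (mods n) tscale (proj n)"
proof (rule lin_onI)
  show "proj n x \<in> mods n" if "x \<in> total" for x
    using lin_onD(1)[OF proj_total that] proj_proj[OF that] unfolding mods_def by blast
qed (rule lin_onD(2,3)[OF proj_total]; assumption)+

lemma mods_subgroup: "add_subgroup (mods n)"
  unfolding add_subgroup_def
proof (intro conjI ballI)
  show "0 \<in> mods n" using zero_total lin_on_map_zero[OF proj_total zero_total, of n] by (simp add: mods_def)
  fix x y assume x: "x \<in> mods n" and y: "y \<in> mods n"
  have xt: "x \<in> total" "y \<in> total" "proj n x = x" "proj n y = y" using x y by (auto simp: mods_def)
  have "proj n (x - y) = x - y"
    using lin_on_map_diff[OF proj_total[of n] tot_subgroup xt(1,2)] unfolding xt(3,4) .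
  then show "x - y \<in> mods n" using add_subgroup_diff[OF tot_subgroup xt(1,2)] by (simp add: mods_def)
qed

lemma mods_tscale: "r \<in> Rset \<Longrightarrow> x \<in> mods n \<Longrightarrow> tscale r x \<in> mods n"
  using tscale_tot[of r x lo] lin_onD(3)[OF proj_total, of r x n] unfolding mods_def by simp

lemma mods_total: "x \<in> mods n \<Longrightarrow> x \<in> total"
  by (simp add: mods_def)

lemma mods_low: "x \<in> mods n \<Longrightarrow> n < lo \<Longrightarrow> x = 0"
  by (auto simp: mods_def proj_def)

lemma mods_lo: "x \<in> mods lo \<Longrightarrow> idem x = 0"
proof -
  assume "x \<in> mods lo"
  then have "x - idem x = x" by (simp add: mods_def proj_def)
  then show "idem x = 0" by (simp add: fun_eq_iff)
qed

lemma mods_high: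
  assumes "lo < n"
  shows "mods n = tot n"
proof (intro equalityI subsetI)
  fix x
  have p: "proj n x = upfrom n x" using assms by (simp add: proj_def)
  show "x \<in> tot n" if "x \<in> mods n"
    using lin_onD(1)[OF upfrom_lin, of x n] that p unfolding mods_def by simp
  show "x \<in> mods n" if "x \<in> tot n"
    using tot_total[OF that] upfrom_tot[OF that] p unfolding mods_def by simp
qed

lemma mods_above:
  assumes n: "hi < n" and x: "x \<in> mods n"
  shows "x = 0"
proof
  fix m
  have m0: "x m = 0" if "m < lo \<or> hi < m"
    using pol_low[OF fpol_pol[OF totD(1)[OF mods_total[OF x]]]] that by blast
  show "x m = 0 m"
  proof (cases "m < lo \<or> hi < m")
    case True
    then show ?thesis using m0 by simp
  next
    case False
    then have "x \<in> tot n" using x mods_high[of n] n by simp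
    from totD(2)[OF this, of m] show ?thesis using n False by simp
  qed
qed

definition Dif :: "int \<Rightarrow> (int \<Rightarrow> int \<times> int \<Rightarrow> nat \<Rightarrow> 'u) \<Rightarrow> int \<Rightarrow> int \<times> int \<Rightarrow> nat \<Rightarrow> 'u"
  where "Dif n x = (if n < lo then 0 else Del n x)"

lemma Dif_lin: "lin (mods n) tscale (mods (n + 1)) tscale (Dif n)"
proof (cases "n < lo")
  case True
  then show ?thesis using lin_on_zero[OF mods_subgroup tscale_additive] by (simp add: Dif_def[abs_def])
next
  case False
  then have "mods (n + 1) = tot (n + 1)" by (intro mods_high) simp
  then show ?thesis
    using False lin_on_mono[OF Del_lin order_refl, of "mods n" n] mods_total by (auto simp: Dif_def[abs_def])
qed

lemma Dif_Dif: "x \<in> mods n \<Longrightarrow> Dif (n + 1) (Dif n x) = 0"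
  using Del_Del[of x n] mods_total lin_on_map_zero[OF Del_lin zero_total, of "n + 1"] by (auto simp: Dif_def)

section \<open>Comparison maps and homotopies\<close>

definition to_model :: "int \<Rightarrow> (int \<times> int \<Rightarrow> nat \<Rightarrow> 'u) \<Rightarrow> int \<Rightarrow> int \<times> int \<Rightarrow> nat \<Rightarrow> 'u"
  where "to_model n c = proj n (single n (retr h n c))"

lemma to_model_lin: "lin (pol n) scale (mods n) tscale (to_model n)"
proof -
  have "lin (pol n) scale total tscale (\<lambda>c. single n (retr h n c))"
    by (rule lin_on_mono[OF lin_on_comp[OF retr_lin single_lin]]) (auto intro: tot_total)
  then show ?thesis unfolding to_model_def[abs_def] by (rule lin_on_comp[OF _ proj_mods])
qed

lemma from_model_lin: "lin (mods n) tscale (pol n) scale (Psi n)"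
  by (rule lin_on_mono[OF Psi_lin order_refl]) (auto simp: mods_def)

text \<open>At the bottom \<open>Psi lo\<close> after \<open>idem\<close> equals
  \<open>dif (lo - 1)\<close> after \<open>Psi (lo - 1)\<close>, and the latter map is zero because
  the complex vanishes there.\<close>

lemma Psi_proj:
  assumes x: "x \<in> total"
  shows "Psi n (proj n x) = Psi n x"
proof -
  consider "n < lo" | "n = lo" | "lo < n" by linarith
  then show ?thesis
  proof cases
    case 1
    then show ?thesis using Psi_lo[OF x] Psi_lo[OF lin_onD(1)[OF proj_total x]] by simp
  next
    case 2
    have "Psi lo (idem x) = dif (lo - 1) (Psi (lo - 1) x)" using Psi_Del[OF x, of "lo - 1"] by (simp add: idem_def)
    also have "\<dots> = 0" using Psi_lo[OF x] by (simp add: dif_zero)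
    finally show ?thesis
      using 2 lin_on_map_diff[OF Psi_lin tot_subgroup x lin_onD(1)[OF idem_lin x]] by (simp add: proj_def)
  next
    case 3
    then show ?thesis by (simp add: proj_def Psi_upfrom)
  qed
qed

lemma single_retr: "c \<in> pol n \<Longrightarrow> single n (retr h n c) \<in> tot n"
  by (rule lin_onD(1)[OF single_lin lin_onD(1)[OF retr_lin]])

lemma from_to_model: "c \<in> pol n \<Longrightarrow> Psi n (to_model n c) = retr h n c"
  unfolding to_model_def
  using Psi_proj[OF tot_total[OF single_retr]] Psi_single[OF lin_onD(1)[OF retr_lin]] by simp

lemma from_model_dif: "x \<in> mods n \<Longrightarrow> Psi (n + 1) (Dif n x) = dif n (Psi n x)"
  using Psi_Del[OF mods_total, of x n n] mods_low[of x n] lin_on_map_zero[OF Psi_lin zero_total] by (auto simp: Dif_def dif_zero)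

lemma Del_idem: "x \<in> total \<Longrightarrow> Del lo (x - idem x) = Del lo x"
  using lin_on_map_diff[OF Del_lin tot_subgroup, of x "idem x" lo] lin_onD(1)[OF idem_lin, of x] Del_Del[of x "lo - 1"]
  by (simp add: idem_def)

lemma to_model_high: "lo < n \<Longrightarrow> to_model n c = single n (retr h n c)"
  by (auto simp: to_model_def proj_def upfrom_def single_def)

lemma to_model_dif:
  assumes c: "c \<in> pol n"
  shows "to_model (n + 1) (dif n c) = Dif n (to_model n c)"
proof -
  have r: "retr h (n + 1) (dif n c) = dif n (retr h n c)" by (rule retr_dif[OF rlin_tame[OF h] c])
  have rc: "retr h n c \<in> fpol n" by (rule lin_onD(1)[OF retr_lin c])
  have D: "Del n (single n (retr h n c)) = single (n + 1) (dif n (retr h n c))" by (rule Del_single[OF rc])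
  consider "n < lo" | "n = lo" | "lo < n" by linarith
  then show ?thesis
  proof cases
    case 1
    then have "c = 0" using pol_low[OF c] by simp
    then have "to_model (n + 1) (dif n c) = 0" "to_model n c = 0"
      using lin_on_map_zero[OF to_model_lin pol_zero] by (simp_all add: dif_zero)
    then show ?thesis using 1 by (simp add: Dif_def)
  next
    case 2
    have "Dif n (to_model n c) = Del n (single n (retr h n c))"
      using Del_idem[OF tot_total[OF single_retr[OF c]]] 2 by (simp add: Dif_def to_model_def proj_def)
    moreover have "to_model (n + 1) (dif n c) = single (n + 1) (dif n (retr h n c))"
      using 2 to_model_high[of "n + 1" "dif n c"] unfolding r by simp
    ultimately show ?thesis unfolding D by (rule trans[OF _ sym, rotated])
  next
    case 3
    have "to_model n c = single n (retr h n c)" by (rule to_model_high[OF 3])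
    then have "Dif n (to_model n c) = single (n + 1) (dif n (retr h n c))" unfolding D[symmetric] using 3 by (simp add: Dif_def)
    moreover have "to_model (n + 1) (dif n c) = single (n + 1) (dif n (retr h n c))"
      using 3 to_model_high[of "n + 1" "dif n c"] unfolding r by simp
    ultimately show ?thesis by (rule trans[OF _ sym, rotated])
  qed
qed

text \<open>Up to sign the inclusion of \<open>tot n\<close> into \<open>tot (n - 1)\<close>,
  followed by the projection that matters only when the target is the split summand in degree
  \<open>lo\<close>.\<close>

definition hmod :: "int \<Rightarrow> (int \<Rightarrow> int \<times> int \<Rightarrow> nat \<Rightarrow> 'u) \<Rightarrow> int \<Rightarrow> int \<times> int \<Rightarrow> nat \<Rightarrow> 'u"
  where "hmod n x = (if n \<le> lo then 0 else - proj (n - 1) x)"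

lemma hmod_lin: "lin (mods n) tscale (mods (n - 1)) tscale (hmod n)"
proof (cases "n \<le> lo")
  case True
  then show ?thesis using lin_on_zero[OF mods_subgroup tscale_additive] by (simp add: hmod_def[abs_def])
next
  case False
  have "lin (mods n) tscale (mods (n - 1)) tscale (proj (n - 1))"
    by (rule lin_on_mono[OF proj_mods order_refl]) (auto simp: mods_def)
  from lin_on_diff[OF lin_on_zero[OF mods_subgroup tscale_additive] this mods_subgroup tscale_additive]
  show ?thesis using False by (simp add: hmod_def[abs_def])
qed

lemma to_from_model:
  assumes x: "x \<in> mods n"
  shows "to_model n (Psi n x) - x = Dif (n - 1) (hmod n x) + hmod (n + 1) (Dif n x)"
proof -
  have xt: "x \<in> total" by (rule mods_total[OF x])
  have st: "single n (retr h n (Psi n x)) \<in> total" by (rule tot_total[OF single_retr[OF lin_onD(1)[OF Psi_lin xt]]])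
  have Dt: "Del n x \<in> tot (n + 1)" by (rule lin_onD(1)[OF Del_lin xt])
  \<comment> \<open>The recursion for \<open>Del\<close> one degree lower, on elements that start in
    degree \<open>n\<close>: this is the homotopy identity before the modifications at the
    bottom.\<close>
  have key: "single n (retr h n (Psi n x)) = x - Del (n - 1) x - Del n x" if "lo \<le> n"
  proof -
    have xn: "x \<in> tot n" using that x mods_high[of n] xt by (cases "n = lo") auto
    show ?thesis
      using Del_rec'[OF xt, of "n - 1"] totD(2)[OF xn, of "n - 1"] upfrom_tot[OF xn]
      by (simp add: dif_zero single_0 fun_eq_iff)
  qed
  consider "n < lo" | "n = lo" | "n = lo + 1" | "lo + 1 < n" by linarith
  then show ?thesis
  proof cases
    case 1
    then show ?thesis using mods_low[OF x] lin_on_map_zero[OF Psi_lin zero_total] lin_on_map_zero[OF to_model_lin pol_zero]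
      by (simp add: Dif_def hmod_def)
  next
    case 2
    \<comment> \<open>In the lowest degree \<open>Del (n - 1)\<close> is \<open>idem\<close>, which
      vanishes on \<open>mods lo\<close>, so only the outgoing half of the homotopy remains.\<close>
    have "to_model n (Psi n x) = proj n (x - Del (n - 1) x - Del n x)" unfolding to_model_def key[OF eq_refl[OF 2[symmetric]]] ..
    also have "\<dots> = proj n (x - Del n x)" using mods_lo[of x] x 2 by (simp add: idem_def)
    also have "\<dots> = x - proj n (Del n x)"
      using lin_on_map_diff[OF proj_total tot_subgroup xt tot_total[OF Dt]] x by (simp add: mods_def)
    finally show ?thesis using 2 by (simp add: Dif_def hmod_def fun_eq_iff)
  next
    case 3
    \<comment> \<open>The homotopy lands in the split summand of degree \<open>lo\<close>; as
      \<open>Del lo\<close> kills the image of \<open>idem\<close>, the projection onto that summand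
      does not affect it.\<close>
    have 1: "Del (n - 1) (- proj lo x) = - Del (n - 1) x"
      using Del_idem[OF xt] lin_on_map_diff[OF Del_lin tot_subgroup zero_total lin_onD(1)[OF proj_total xt], of lo lo]
        lin_on_map_zero[OF Del_lin zero_total] 3 by (simp add: proj_def)
    have "hmod n x = - proj lo x" using 3 by (simp add: hmod_def)
    then have a: "Dif (n - 1) (hmod n x) = - Del (n - 1) x" unfolding 1[symmetric] using 3 by (simp add: Dif_def)
    have "proj n (Del n x) = Del n x"
      using 3 upfrom_tot[of "Del n x" n] Dt tot_antimono[of n "n + 1"] by (auto simp: proj_def)
    then have b: "hmod (n + 1) (Dif n x) = - Del n x" using 3 by (simp add: hmod_def Dif_def fun_eq_iff add.commute)
    have "lo < n" "lo \<le> n" using 3 by simp_all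
    then show ?thesis unfolding a b to_model_high[OF \<open>lo < n\<close>] key[OF \<open>lo \<le> n\<close>] by simp
  next
    case 4
    have "x \<in> tot n" using x mods_high 4 by simp
    then have p: "proj (n - 1) x = x" using 4 upfrom_tot[of x "n - 1"] tot_antimono[of "n - 1" n] by (auto simp: proj_def)
    have q: "proj n (Del n x) = Del n x" using 4 upfrom_tot[of "Del n x" n] Dt tot_antimono[of n "n + 1"]
      by (auto simp: proj_def)
    have t: "to_model n (Psi n x) = single n (retr h n (Psi n x))"
      using 4 by (auto simp: to_model_def proj_def upfrom_def single_def)
    have m: "Del (n - 1) (- x) = - Del (n - 1) x"
      using lin_on_map_diff[OF Del_lin tot_subgroup zero_total xt, of "n - 1"] lin_on_map_zero[OF Del_lin zero_total, of "n - 1"] by simp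
    have "hmod n x = - x" using 4 p by (simp add: hmod_def)
    moreover have "Dif (n - 1) (- x) = - Del (n - 1) x" using 4 m by (simp add: Dif_def)
    moreover have "hmod (n + 1) (Dif n x) = - Del n x" using 4 q by (simp add: hmod_def Dif_def)
    ultimately have "Dif (n - 1) (hmod n x) + hmod (n + 1) (Dif n x) = - Del (n - 1) x - Del n x" by simp
    moreover have "lo \<le> n" using 4 by simp
    ultimately show ?thesis unfolding t key[OF \<open>lo \<le> n\<close>] by simp
  qed
qed

end

section \<open>A type class ring containing every ring on a given type\<close>

text \<open>
  The product of all ring structures on \<open>'a\<close> is a ring in the type class sense; each ring \<open>R\<close> with
  elements in \<open>'a\<close> is a factor, cut out by a central idempotent. This gives access to type class
  algebra for a ring that is only given by a carrier set.
\<close>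

typedef 'a uring = "{F :: 'a ring \<Rightarrow> 'a. \<forall>G. F G \<in> (if ring G then carrier G else {undefined})}"
  by (rule exI[of _ "\<lambda>G. if ring G then \<zero>\<^bsub>G\<^esub> else undefined"]) (auto simp: ring.ring_simprules)

definition uabs :: "('a ring \<Rightarrow> 'a) \<Rightarrow> 'a uring"
  where "uabs f = Abs_uring (\<lambda>G. if ring G then f G else undefined)"

lemma Rep_uabs: "(\<And>G. ring G \<Longrightarrow> f G \<in> carrier G) \<Longrightarrow> ring G \<Longrightarrow> Rep_uring (uabs f) G = f G"
  unfolding uabs_def by (subst Abs_uring_inverse) auto

lemma Rep_carrier: "ring G \<Longrightarrow> Rep_uring u G \<in> carrier G"
  using Rep_uring[of u] by (auto split: if_splits)

lemma uring_eqI: "(\<And>G. ring G \<Longrightarrow> Rep_uring u G = Rep_uring v G) \<Longrightarrow> u = v"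
proof -
  assume a: "\<And>G. ring G \<Longrightarrow> Rep_uring u G = Rep_uring v G"
  have "Rep_uring u G = Rep_uring v G" for G
  proof (cases "ring G")
    case False
    have "\<And>w :: 'a uring. Rep_uring w G \<in> (if ring G then carrier G else {undefined})"
      using Rep_uring unfolding mem_Collect_eq by blast
    then have "\<And>w :: 'a uring. Rep_uring w G = undefined" using False by simp
    then show ?thesis by simp
  qed (rule a)
  then show "u = v" by (simp add: Rep_uring_inject[symmetric] fun_eq_iff)
qed

instantiation uring :: (type) ring
begin

definition "0 = uabs (\<lambda>G. \<zero>\<^bsub>G\<^esub>)"
definition "u + v = uabs (\<lambda>G. Rep_uring u G \<oplus>\<^bsub>G\<^esub> Rep_uring v G)"
definition "u * v = uabs (\<lambda>G. Rep_uring u G \<otimes>\<^bsub>G\<^esub> Rep_uring v G)"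
definition "- u = uabs (\<lambda>G. \<ominus>\<^bsub>G\<^esub> Rep_uring u G)"
definition "u - v = u + - (v :: 'a uring)"

lemma Rep_uring_ops:
  assumes "ring G"
  shows "Rep_uring 0 G = \<zero>\<^bsub>G\<^esub>" "Rep_uring (u + v) G = Rep_uring u G \<oplus>\<^bsub>G\<^esub> Rep_uring v G"
    "Rep_uring (u * v) G = Rep_uring u G \<otimes>\<^bsub>G\<^esub> Rep_uring v G" "Rep_uring (- u) G = \<ominus>\<^bsub>G\<^esub> Rep_uring u G"
  unfolding zero_uring_def plus_uring_def times_uring_def uminus_uring_def
  by (intro Rep_uabs assms; simp add: ring.ring_simprules Rep_carrier)+

instance
proof
  fix u v w :: "'a uring"
  note c = Rep_carrier and r = ring.ring_simprules and o = Rep_uring_ops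
  show "u + v + w = u + (v + w)" by (rule uring_eqI) (simp add: o c r)
  show "u + v = v + u" by (rule uring_eqI) (simp add: o c r)
  show "0 + u = u" by (rule uring_eqI) (simp add: o c r)
  show "- u + u = 0" by (rule uring_eqI) (simp add: o c r)
  show "u - v = u + - v" by (rule minus_uring_def)
  show "u * v * w = u * (v * w)" by (rule uring_eqI) (simp add: o c r)
  show "(u + v) * w = u * w + v * w" by (rule uring_eqI) (simp add: o c r)
  show "u * (v + w) = u * v + u * w" by (rule uring_eqI) (simp add: o c r)
qed

end

text \<open>The factors of the product are indexed by plain ring records, so the extra fields of a
  ring scheme have to be dropped to locate its factor.\<close>

lemma ring_truncate:
  assumes "ring R"
  shows "ring (ring.truncate R)"
proof -
  interpret ring R by (rule assms)
  have s: "carrier (ring.truncate R) = carrier R" "mult (ring.truncate R) = mult R" "one (ring.truncate R) = one R"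
    "ring.zero (ring.truncate R) = ring.zero R" "ring.add (ring.truncate R) = ring.add R"
    by (simp_all add: ring.truncate_def)
  show ?thesis
  proof (rule ringI)
    show "abelian_group (ring.truncate R)"
    proof (rule abelian_groupI)
      show "\<exists>y\<in>carrier (ring.truncate R). y \<oplus>\<^bsub>ring.truncate R\<^esub> x = \<zero>\<^bsub>ring.truncate R\<^esub>"
        if "x \<in> carrier (ring.truncate R)" for x
        using that by (intro bexI[of _ "\<ominus>\<^bsub>R\<^esub> x"]) (simp_all add: s l_neg)
    qed (simp_all add: s a_ac)
    show "monoid (ring.truncate R)"
      by (rule monoidI) (simp_all add: s m_assoc)
  qed (simp_all add: s l_distr r_distr)
qed

context ring
begin

definition em :: "'a \<Rightarrow> 'a uring"
  where "em r = uabs (\<lambda>G. if G = ring.truncate R then r else \<zero>\<^bsub>G\<^esub>)"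

definition pr :: "'a uring \<Rightarrow> 'a"
  where "pr u = Rep_uring u (ring.truncate R)"

lemma truncate_simps: "ring (ring.truncate R)" "carrier (ring.truncate R) = carrier R"
    "mult (ring.truncate R) = mult R" "one (ring.truncate R) = one R"
    "ring.zero (ring.truncate R) = ring.zero R" "ring.add (ring.truncate R) = ring.add R"
  by (rule ring_truncate, unfold_locales) (simp_all add: ring.truncate_def)

lemma Rep_em: "r \<in> carrier R \<Longrightarrow> ring G \<Longrightarrow> Rep_uring (em r) G = (if G = ring.truncate R then r else \<zero>\<^bsub>G\<^esub>)"
  unfolding em_def by (rule Rep_uabs) (auto simp: truncate_simps ring.ring_simprules)

lemma pr_carrier [simp]: "pr u \<in> carrier R"
  using Rep_carrier[OF truncate_simps(1), of u] by (simp add: pr_def truncate_simps)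

lemma pr_em [simp]: "r \<in> carrier R \<Longrightarrow> pr (em r) = r"
  by (simp add: pr_def Rep_em truncate_simps)

lemma pr_add: "pr (u + v) = pr u \<oplus> pr v" and pr_mult: "pr (u * v) = pr u \<otimes> pr v" and pr_zero: "pr 0 = \<zero>"
  by (simp_all add: pr_def Rep_uring_ops truncate_simps)

lemma em_add: "r \<in> carrier R \<Longrightarrow> s \<in> carrier R \<Longrightarrow> em (r \<oplus> s) = em r + em s"
  by (rule uring_eqI) (simp add: Rep_uring_ops Rep_em truncate_simps ring.ring_simprules)

lemma em_mult: "r \<in> carrier R \<Longrightarrow> s \<in> carrier R \<Longrightarrow> em (r \<otimes> s) = em r * em s"
  by (rule uring_eqI) (simp add: Rep_uring_ops Rep_em truncate_simps ring.ring_simprules)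

lemma em_zero: "em \<zero> = 0"
  by (rule uring_eqI) (simp add: Rep_uring_ops Rep_em truncate_simps)

text \<open>Multiplication by the central idempotent is the projection onto the factor R. Hence
  \<open>em \<one> * u = u\<close> characterizes the elements that come from the carrier.\<close>

lemma em_pr: "em (pr u) = em \<one> * u"
  by (rule uring_eqI) (simp add: Rep_uring_ops Rep_em pr_def[symmetric] truncate_simps ring.ring_simprules Rep_carrier)

lemma one_central: "em \<one> * u = u * em \<one>"
  by (rule uring_eqI) (simp add: Rep_uring_ops Rep_em pr_def[symmetric] truncate_simps ring.ring_simprules Rep_carrier)

lemma one_em: "r \<in> carrier R \<Longrightarrow> em \<one> * em r = em r"
  using em_mult[of \<one> r] by simp

lemma one_idem: "em \<one> * em \<one> = em \<one>"
  by (simp add: one_em)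

lemma em_inj: "r \<in> carrier R \<Longrightarrow> s \<in> carrier R \<Longrightarrow> em r = em s \<Longrightarrow> r = s"
  by (metis pr_em)

lemma em_0_iff: "r \<in> carrier R \<Longrightarrow> em r = 0 \<longleftrightarrow> r = \<zero>"
  using em_inj[of r \<zero>] em_zero by auto

end


section \<open>Modules on coded carriers\<close>

text \<open>The definitions of finite domination and projectivity prescribe the element types of
  their modules. The modules constructed here live in another type and are carried over by an
  encoding.\<close>

definition coded_rmod :: "'w::ab_group_add set \<Rightarrow> ('a \<Rightarrow> 'w \<Rightarrow> 'w) \<Rightarrow> ('w \<Rightarrow> 'z) \<Rightarrow> ('z \<Rightarrow> 'w) \<Rightarrow> ('a, 'z) right_module"
  where "coded_rmod S sc code dec = \<lparr>carrier = code ` S, mult = undefined, one = undefined,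
    ring.zero = code 0, ring.add = (\<lambda>z z'. code (dec z + dec z')), ract = (\<lambda>z r. code (sc r (dec z)))\<rparr>"

locale coded_module = ring R for R (structure) +
  fixes S :: "'w::ab_group_add set" and sc :: "'a \<Rightarrow> 'w \<Rightarrow> 'w" and code :: "'w \<Rightarrow> 'z" and dec :: "'z \<Rightarrow> 'w"
  assumes sub: "add_subgroup S" and sc_closed: "\<And>r x. r \<in> carrier R \<Longrightarrow> x \<in> S \<Longrightarrow> sc r x \<in> S"
    and sc_additive: "\<And>r. additive (sc r)"
    and sc_plus: "\<And>r s x. r \<in> carrier R \<Longrightarrow> s \<in> carrier R \<Longrightarrow> x \<in> S \<Longrightarrow> sc (r \<oplus> s) x = sc r x + sc s x"
    and sc_mult: "\<And>r s x. r \<in> carrier R \<Longrightarrow> s \<in> carrier R \<Longrightarrow> x \<in> S \<Longrightarrow> sc (r \<otimes> s) x = sc s (sc r x)"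
    and sc_one: "\<And>x. x \<in> S \<Longrightarrow> sc \<one> x = x"
    and dec: "\<And>x. x \<in> S \<Longrightarrow> dec (code x) = x"
begin

abbreviation "M \<equiv> coded_rmod S sc code dec"

lemma M_simps [simp]: "carrier M = code ` S" "ring.zero M = code 0"
    "ring.add M = (\<lambda>z z'. code (dec z + dec z'))" "ract M = (\<lambda>z r. code (sc r (dec z)))"
  by (simp_all add: coded_rmod_def)

lemmas S_zero = add_subgroup_zero[OF sub]
  and S_add = add_subgroup_add[OF sub]
  and S_minus = add_subgroup_minus[OF sub]
  and S_sum = add_subgroup_sum[OF sub]
  and sc_add = additive.add[OF sc_additive]

lemma abelian: "abelian_group M"
proof (rule abelian_groupI)
  show "\<exists>y\<in>carrier M. y \<oplus>\<^bsub>M\<^esub> x = \<zero>\<^bsub>M\<^esub>" if x: "x \<in> carrier M" for x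
  proof -
    obtain y where "y \<in> S" "x = code y" using x by auto
    then show ?thesis by (intro bexI[of _ "code (- y)"]) (simp_all add: dec S_minus)
  qed
qed (auto simp: dec S_zero S_add ac_simps)

lemma rmod: "right_module R M"
proof (intro right_module.intro abelian right_module_axioms.intro)
  show "ring R" by unfold_locales
qed (auto simp: dec sc_closed sc_plus sc_mult sc_one sc_add S_add)

lemma M_finsum: "finite I \<Longrightarrow> (\<And>i. i \<in> I \<Longrightarrow> y i \<in> S) \<Longrightarrow> finsum M (\<lambda>i. code (y i)) I = code (\<Sum>i\<in>I. y i)"
proof (induction I rule: finite_induct)
  interpret M: abelian_group M by (rule abelian)
  case (insert i I)
  have "finsum M (\<lambda>i. code (y i)) (insert i I) = code (y i) \<oplus>\<^bsub>M\<^esub> finsum M (\<lambda>i. code (y i)) I"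
    by (rule M.finsum_insert) (use insert in auto)
  also have "finsum M (\<lambda>i. code (y i)) I = code (\<Sum>i\<in>I. y i)" using insert by auto
  also have "code (y i) \<oplus>\<^bsub>M\<^esub> code (\<Sum>i\<in>I. y i) = code (y i + (\<Sum>i\<in>I. y i))"
    using insert.prems by (auto simp: dec S_sum)
  finally show ?case using insert.hyps by simp
next
  interpret M: abelian_group M by (rule abelian)
  case empty
  then show ?case by (simp add: M.finsum_empty)
qed

lemma sc_zero: "x \<in> S \<Longrightarrow> sc \<zero> x = 0"
  using sc_plus[of \<zero> \<zero> x] by simp

lemma M_lin_comb:
  assumes B: "finite B" "B \<subseteq> code ` S" and c: "\<And>b. b \<in> B \<Longrightarrow> c b \<in> carrier R"
  shows "lin_comb R M B c = code (\<Sum>b\<in>B. sc (c b) (dec b))"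
proof -
  have d: "dec b \<in> S" if "b \<in> B" for b using that B(2) by (auto simp: dec)
  have "lin_comb R M B c = finsum M (\<lambda>b. code (sc (c b) (dec b))) {b \<in> B. c b \<noteq> \<zero>}"
    by (simp add: lin_comb_def)
  also have "\<dots> = code (\<Sum>b\<in>{b \<in> B. c b \<noteq> \<zero>}. sc (c b) (dec b))"
    by (rule M_finsum) (use B(1) c d in \<open>auto intro: sc_closed\<close>)
  also have "(\<Sum>b\<in>{b \<in> B. c b \<noteq> \<zero>}. sc (c b) (dec b)) = (\<Sum>b\<in>B. sc (c b) (dec b))"
    by (rule sum.mono_neutral_left) (use B(1) d in \<open>auto simp: sc_zero\<close>)
  finally show ?thesis .
qed

lemma sc_sum:
  assumes "finite I" "x \<in> S" "\<And>i. i \<in> I \<Longrightarrow> a i \<in> carrier R"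
  shows "sc (\<Oplus>i\<in>I. a i) x = (\<Sum>i\<in>I. sc (a i) x)"
  using assms(1,3)
proof (induction I rule: finite_induct)
  case (insert i I)
  have "(\<Oplus>j\<in>insert i I. a j) = a i \<oplus> (\<Oplus>j\<in>I. a j)" by (rule finsum_insert) (use insert in auto)
  moreover have "(\<Oplus>j\<in>I. a j) \<in> carrier R" by (rule finsum_closed) (use insert in auto)
  ultimately have "sc (\<Oplus>j\<in>insert i I. a j) x = sc (a i) x + sc (\<Oplus>j\<in>I. a j) x"
    using sc_plus[OF _ _ assms(2)] insert.prems by simp
  moreover have "sc (\<Oplus>j\<in>I. a j) x = (\<Sum>j\<in>I. sc (a j) x)" by (rule insert.IH) (use insert.prems in auto)
  ultimately show ?case unfolding sum.insert[OF insert.hyps] by (rule trans[OF _ arg_cong])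
next
  case empty
  show ?case unfolding finsum_empty sum.empty by (rule sc_zero[OF assms(2)])
qed

lemma fg:
  assumes K: "finite K" and b: "\<And>k. k \<in> K \<Longrightarrow> b k \<in> S"
    and gen: "\<And>x. x \<in> S \<Longrightarrow> \<exists>a. (\<forall>k\<in>K. a k \<in> carrier R) \<and> x = (\<Sum>k\<in>K. sc (a k) (b k))"
  shows "fg_rmod R M"
  unfolding fg_rmod_def
proof (intro conjI rmod exI[of _ "(\<lambda>k. code (b k)) ` K"] ballI)
  let ?B = "(\<lambda>k. code (b k)) ` K"
  show "finite ?B" using K by simp
  show BM: "?B \<subseteq> carrier M" using b by auto
  fix z assume "z \<in> carrier M"
  then obtain x where x: "x \<in> S" "z = code x" by auto
  obtain a where a: "\<And>k. k \<in> K \<Longrightarrow> a k \<in> carrier R" "x = (\<Sum>k\<in>K. sc (a k) (b k))" using gen[OF x(1)] by blast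
  \<comment> \<open>A family of generators may contain repetitions, whereas \<open>lin_comb\<close>
    runs over a set, so the coefficients of equal generators are added.\<close>
  define c where "c = (\<lambda>\<beta>. \<Oplus>k\<in>{k\<in>K. code (b k) = \<beta>}. a k)"
  have c: "c \<beta> \<in> carrier R" for \<beta> unfolding c_def by (rule finsum_closed) (use a(1) in auto)
  have "(\<Sum>\<beta>\<in>?B. sc (c \<beta>) (dec \<beta>)) = (\<Sum>\<beta>\<in>?B. \<Sum>k\<in>{k\<in>K. code (b k) = \<beta>}. sc (a k) (b k))"
  proof (rule sum.cong[OF refl])
    fix \<beta> assume "\<beta> \<in> ?B"
    then have d: "dec \<beta> \<in> S" using b by (auto simp: dec)
    have "sc (c \<beta>) (dec \<beta>) = (\<Sum>k\<in>{k\<in>K. code (b k) = \<beta>}. sc (a k) (dec \<beta>))"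
      unfolding c_def by (rule sc_sum[OF _ d]) (use K a(1) in auto)
    also have "\<dots> = (\<Sum>k\<in>{k\<in>K. code (b k) = \<beta>}. sc (a k) (b k))"
      by (rule sum.cong[OF refl]) (use b in \<open>auto simp: dec\<close>)
    finally show "sc (c \<beta>) (dec \<beta>) = (\<Sum>k\<in>{k\<in>K. code (b k) = \<beta>}. sc (a k) (b k))" .
  qed
  also have "\<dots> = x" unfolding a(2) by (rule sum.image_gen[OF K, symmetric])
  finally have "lin_comb R M ?B c = z" using M_lin_comb[of ?B c] K BM c x(2) by simp
  then show "\<exists>c. c \<in> ?B \<rightarrow> carrier R \<and> z = lin_comb R M ?B c" using c by (intro exI[of _ c]) auto
qed

lemma free:
  assumes K: "finite K" and b: "\<And>k. k \<in> K \<Longrightarrow> b k \<in> S" and inj: "inj_on b K"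
    and gen: "\<And>x. x \<in> S \<Longrightarrow> \<exists>a. (\<forall>k\<in>K. a k \<in> carrier R) \<and> x = (\<Sum>k\<in>K. sc (a k) (b k))"
    and uniq: "\<And>a a' k. (\<And>k. k \<in> K \<Longrightarrow> a k \<in> carrier R) \<Longrightarrow> (\<And>k. k \<in> K \<Longrightarrow> a' k \<in> carrier R)
      \<Longrightarrow> (\<Sum>k\<in>K. sc (a k) (b k)) = (\<Sum>k\<in>K. sc (a' k) (b k)) \<Longrightarrow> k \<in> K \<Longrightarrow> a k = a' k"
  shows "free_rmod R M"
  unfolding free_rmod_def is_basis_def
proof (intro conjI rmod exI[of _ "(\<lambda>k. code (b k)) ` K"] ballI)
  let ?B = "(\<lambda>k. code (b k)) ` K"
  show BM: "?B \<subseteq> carrier M" using b by auto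
  have cinj: "inj_on (\<lambda>k. code (b k)) K"
  proof (rule inj_onI)
    fix k l assume k: "k \<in> K" "l \<in> K" "code (b k) = code (b l)"
    have "b k = b l" using arg_cong[OF k(3), of dec] unfolding dec[OF b[OF k(1)]] dec[OF b[OF k(2)]] .
    then show "k = l" using inj k by (simp add: inj_on_def)
  qed
  have lc: "lin_comb R M ?B c = code (\<Sum>k\<in>K. sc (c (code (b k))) (b k))" if "c \<in> ?B \<rightarrow> carrier R" for c
  proof -
    have "lin_comb R M ?B c = code (\<Sum>\<beta>\<in>?B. sc (c \<beta>) (dec \<beta>))"
      by (rule M_lin_comb) (use K BM that in auto)
    also have "(\<Sum>\<beta>\<in>?B. sc (c \<beta>) (dec \<beta>)) = (\<Sum>k\<in>K. sc (c (code (b k))) (b k))"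
      unfolding sum.reindex[OF cinj] by (rule sum.cong[OF refl]) (simp add: dec b)
    finally show ?thesis .
  qed
  have sS: "(\<Sum>k\<in>K. sc (a k) (b k)) \<in> S" if "\<And>k. k \<in> K \<Longrightarrow> a k \<in> carrier R" for a
    by (rule S_sum) (simp add: sc_closed that b)
  fix z assume "z \<in> carrier M"
  then obtain x where x: "x \<in> S" "z = code x" by auto
  obtain a where a: "\<And>k. k \<in> K \<Longrightarrow> a k \<in> carrier R" "x = (\<Sum>k\<in>K. sc (a k) (b k))" using gen[OF x(1)] by blast
  show "\<exists>!c. c \<in> ?B \<rightarrow>\<^sub>E carrier R \<and> finite {b \<in> ?B. c b \<noteq> \<zero>} \<and> z = lin_comb R M ?B c"
  proof (rule ex1I[of _ "restrict (\<lambda>\<beta>. a (the_inv_into K (\<lambda>k. code (b k)) \<beta>)) ?B"])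
    let ?c = "restrict (\<lambda>\<beta>. a (the_inv_into K (\<lambda>k. code (b k)) \<beta>)) ?B"
    have v: "?c (code (b k)) = a k" if "k \<in> K" for k
      using that the_inv_into_f_f[OF cinj that] by simp
    have cE: "?c \<in> ?B \<rightarrow>\<^sub>E carrier R" using v a(1) by auto
    have "lin_comb R M ?B ?c = code (\<Sum>k\<in>K. sc (?c (code (b k))) (b k))" by (rule lc) (use cE in auto)
    also have "(\<Sum>k\<in>K. sc (?c (code (b k))) (b k)) = x" unfolding a(2) by (rule sum.cong[OF refl]) (simp only: v)
    finally have "z = lin_comb R M ?B ?c" unfolding x(2) by (rule sym)
    with cE show "?c \<in> ?B \<rightarrow>\<^sub>E carrier R \<and> finite {b \<in> ?B. ?c b \<noteq> \<zero>} \<and> z = lin_comb R M ?B ?c"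
      using K by (intro conjI) auto
    fix c assume c: "c \<in> ?B \<rightarrow>\<^sub>E carrier R \<and> finite {b \<in> ?B. c b \<noteq> \<zero>} \<and> z = lin_comb R M ?B c"
    have cc: "c (code (b k)) \<in> carrier R" if "k \<in> K" for k using c that by auto
    have "code x = code (\<Sum>k\<in>K. sc (c (code (b k))) (b k))" using c lc[of c] x(2) by auto
    from arg_cong[OF this, of dec] have xe: "x = (\<Sum>k\<in>K. sc (c (code (b k))) (b k))"
      using dec[OF x(1)] dec[OF sS[of "\<lambda>k. c (code (b k))", OF cc]] by simp
    have e: "c (code (b k)) = a k" if "k \<in> K" for k
      by (rule uniq[OF cc a(1) trans[OF sym[OF xe] a(2)] that])
    show "c = ?c"
    proof (rule extensionalityI[of _ ?B])
      show "c \<in> extensional ?B" using c by (auto simp: PiE_def)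
      show "?c \<in> extensional ?B" by simp
      fix \<beta> assume "\<beta> \<in> ?B"
      then obtain k where "k \<in> K" "\<beta> = code (b k)" by auto
      then show "c \<beta> = ?c \<beta>" using e[of k] v[of k] by (simp only:)
    qed
  qed
qed

end

text \<open>A free module witnessing projectivity must have functions on the element type of the
  projective module as elements. If \<open>'a\<close> has two elements, the naturals embed into the
  argument type and a sequence is stored along them; otherwise there is only one sequence.\<close>

lemma inj_to_functions: "\<exists>\<iota> :: (nat \<Rightarrow> 'a) \<Rightarrow> ((nat \<Rightarrow> 'a) \<Rightarrow> 'a). inj \<iota>"
proof (cases "\<exists>p q :: 'a. p \<noteq> q")
  case True
  then obtain p q :: 'a where pq: "p \<noteq> q" by blast
  define u :: "nat \<Rightarrow> nat \<Rightarrow> 'a" where "u = (\<lambda>i k. if k = i then p else q)"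
  have "inj u" by (rule injI) (metis pq u_def)
  have "inj (\<lambda>x g. (x :: nat \<Rightarrow> 'a) (inv_into UNIV u g))"
  proof (rule injI, rule ext)
    fix x y :: "nat \<Rightarrow> 'a" and k assume "(\<lambda>g. x (inv_into UNIV u g)) = (\<lambda>g. y (inv_into UNIV u g))"
    from fun_cong[OF this, of "u k"] show "x k = y k" using inv_into_f_f[OF \<open>inj u\<close>, of k] by simp
  qed
  then show ?thesis by blast
next
  case False
  then have "x = y" for x y :: "nat \<Rightarrow> 'a" by (intro ext) blast
  then show ?thesis by (intro exI[of _ "\<lambda>x g. undefined"] injI)
qed

section \<open>Transfer of homotopy equivalences\<close>

text \<open>Identifies a module given by a carrier with a subgroup of a type class group, so that
  computations use ordinary addition and subtraction in place of record operations.\<close>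

locale coord =
  fixes R :: "('a, 'c) ring_scheme" and M :: "('a, 'm) right_module" and X :: "'w::ab_group_add set"
    and sc :: "'a \<Rightarrow> 'w \<Rightarrow> 'w" and c :: "'m \<Rightarrow> 'w" and d :: "'w \<Rightarrow> 'm"
  assumes rm: "right_module R M" and X: "add_subgroup X"
    and c: "\<And>x. x \<in> carrier M \<Longrightarrow> c x \<in> X" and dc: "\<And>x. x \<in> carrier M \<Longrightarrow> d (c x) = x"
    and d: "\<And>w. w \<in> X \<Longrightarrow> d w \<in> carrier M" and cd: "\<And>w. w \<in> X \<Longrightarrow> c (d w) = w"
    and c_add: "\<And>x y. x \<in> carrier M \<Longrightarrow> y \<in> carrier M \<Longrightarrow> c (x \<oplus>\<^bsub>M\<^esub> y) = c x + c y"
    and c_ract: "\<And>x r. x \<in> carrier M \<Longrightarrow> r \<in> carrier R \<Longrightarrow> c (x \<cdot>\<^bsub>M\<^esub> r) = sc r (c x)"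
begin

sublocale M: abelian_group M
  using rm by (simp add: right_module_def)

lemma ract: "x \<in> carrier M \<Longrightarrow> r \<in> carrier R \<Longrightarrow> x \<cdot>\<^bsub>M\<^esub> r \<in> carrier M"
  by (rule right_module.ract_closed[OF rm])

lemma c_minus: "x \<in> carrier M \<Longrightarrow> y \<in> carrier M \<Longrightarrow> c (x \<ominus>\<^bsub>M\<^esub> y) = c x - c y"
proof -
  assume x: "x \<in> carrier M" "y \<in> carrier M"
  have "(x \<ominus>\<^bsub>M\<^esub> y) \<oplus>\<^bsub>M\<^esub> y = x"
    unfolding M.minus_eq M.a_assoc[OF x(1) M.a_inv_closed[OF x(2)] x(2)] M.l_neg[OF x(2)] by (rule M.r_zero[OF x(1)])
  then show ?thesis using c_add[OF M.minus_closed[OF x] x(2)] by (simp only: eq_diff_eq)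
qed

lemma c_inj: "x \<in> carrier M \<Longrightarrow> y \<in> carrier M \<Longrightarrow> c x = c y \<Longrightarrow> x = y"
  by (metis dc)

lemma d_add: "v \<in> X \<Longrightarrow> w \<in> X \<Longrightarrow> d (v + w) = d v \<oplus>\<^bsub>M\<^esub> d w"
proof (rule c_inj)
  assume v: "v \<in> X" and w: "w \<in> X"
  show "d (v + w) \<in> carrier M" by (rule d[OF add_subgroup_add[OF X v w]])
  show "d v \<oplus>\<^bsub>M\<^esub> d w \<in> carrier M" by (rule M.a_closed[OF d[OF v] d[OF w]])
  show "c (d (v + w)) = c (d v \<oplus>\<^bsub>M\<^esub> d w)"
    unfolding c_add[OF d[OF v] d[OF w]] cd[OF v] cd[OF w] by (rule cd[OF add_subgroup_add[OF X v w]])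
qed

lemma d_ract: "w \<in> X \<Longrightarrow> r \<in> carrier R \<Longrightarrow> sc r w \<in> X \<and> d (sc r w) = d w \<cdot>\<^bsub>M\<^esub> r"
proof
  assume w: "w \<in> X" and r: "r \<in> carrier R"
  have e: "c (d w \<cdot>\<^bsub>M\<^esub> r) = sc r w" using c_ract[OF d[OF w] r] cd[OF w] by simp
  show "sc r w \<in> X" unfolding e[symmetric] by (rule c[OF ract[OF d[OF w] r]])
  show "d (sc r w) = d w \<cdot>\<^bsub>M\<^esub> r" unfolding e[symmetric] by (rule dc[OF ract[OF d[OF w] r]])
qed

end

lemma (in coded_module) coord: "coord R M S sc dec code"
  by (intro coord.intro rmod sub) (auto simp: dec sc_closed S_add)

lemma coord_hom:
  assumes M: "coord R M X sc c d" and N: "coord R N Y sc' c' d'" and f: "lin_on (carrier R) X sc Y sc' f"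
  shows "(\<lambda>x. d' (f (c x))) \<in> rmod_hom R M N"
proof -
  interpret M: coord R M X sc c d by (rule M)
  interpret N: coord R N Y sc' c' d' by (rule N)
  have "d' (f (c (x \<oplus>\<^bsub>M\<^esub> y))) = d' (f (c x)) \<oplus>\<^bsub>N\<^esub> d' (f (c y))" if "x \<in> carrier M" "y \<in> carrier M" for x y
    unfolding M.c_add[OF that] lin_onD(2)[OF f M.c[OF that(1)] M.c[OF that(2)]]
    by (rule N.d_add[OF lin_onD(1)[OF f M.c[OF that(1)]] lin_onD(1)[OF f M.c[OF that(2)]]])
  moreover have "d' (f (c (x \<cdot>\<^bsub>M\<^esub> r))) = d' (f (c x)) \<cdot>\<^bsub>N\<^esub> r" if "x \<in> carrier M" "r \<in> carrier R" for x r
    unfolding M.c_ract[OF that] lin_onD(3)[OF f that(2) M.c[OF that(1)]]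
    by (rule conjunct2[OF N.d_ract[OF lin_onD(1)[OF f M.c[OF that(1)]] that(2)]])
  moreover have "d' (f (c x)) \<in> carrier N" if "x \<in> carrier M" for x
    by (rule N.d[OF lin_onD(1)[OF f M.c[OF that]]])
  ultimately show ?thesis unfolding rmod_hom_def by blast
qed

lemma homD:
  assumes "h \<in> rmod_hom R M N"
  shows "x \<in> carrier M \<Longrightarrow> h x \<in> carrier N"
    "x \<in> carrier M \<Longrightarrow> y \<in> carrier M \<Longrightarrow> h (x \<oplus>\<^bsub>M\<^esub> y) = h x \<oplus>\<^bsub>N\<^esub> h y"
    "x \<in> carrier M \<Longrightarrow> a \<in> carrier R \<Longrightarrow> h (x \<cdot>\<^bsub>M\<^esub> a) = h x \<cdot>\<^bsub>N\<^esub> a"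
  using assms by (auto simp: rmod_hom_def)

lemma hom_coord:
  assumes M: "coord R M X sc c d" and N: "coord R N Y sc' c' d'" and k: "k \<in> rmod_hom R M N"
  shows "lin_on (carrier R) X sc Y sc' (\<lambda>w. c' (k (d w)))"
proof -
  interpret M: coord R M X sc c d by (rule M)
  interpret N: coord R N Y sc' c' d' by (rule N)
  show ?thesis
  proof (rule lin_onI)
    show "c' (k (d w)) \<in> Y" if "w \<in> X" for w by (rule N.c[OF homD(1)[OF k M.d[OF that]]])
    show "c' (k (d (v + w))) = c' (k (d v)) + c' (k (d w))" if v: "v \<in> X" and w: "w \<in> X" for v w
      unfolding M.d_add[OF v w] homD(2)[OF k M.d[OF v] M.d[OF w]]
      by (rule N.c_add[OF homD(1)[OF k M.d[OF v]] homD(1)[OF k M.d[OF w]]])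
    show "c' (k (d (sc r w))) = sc' r (c' (k (d w)))" if r: "r \<in> carrier R" and w: "w \<in> X" for r w
      unfolding conjunct2[OF M.d_ract[OF w r]] homD(3)[OF k M.d[OF w] r]
      by (rule N.c_ract[OF homD(1)[OF k M.d[OF w]] r])
  qed
qed

lemma lin_comb_map:
  fixes \<phi> :: "'m \<Rightarrow> 'w::ab_group_add"
  assumes M: "right_module R M" and B: "finite B" "B \<subseteq> carrier M" and a: "\<And>b. b \<in> B \<Longrightarrow> a b \<in> carrier R"
    and add: "\<And>x y. x \<in> carrier M \<Longrightarrow> y \<in> carrier M \<Longrightarrow> \<phi> (x \<oplus>\<^bsub>M\<^esub> y) = \<phi> x + \<phi> y"
    and ract: "\<And>x r. x \<in> carrier M \<Longrightarrow> r \<in> carrier R \<Longrightarrow> \<phi> (x \<cdot>\<^bsub>M\<^esub> r) = sc r (\<phi> x)"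
  shows "\<phi> (lin_comb R M B a) = (\<Sum>b\<in>{b \<in> B. a b \<noteq> \<zero>\<^bsub>R\<^esub>}. sc (a b) (\<phi> b))"
proof -
  interpret right_module R M by (rule M)
  have "\<phi> (finsum M (\<lambda>b. b \<cdot>\<^bsub>M\<^esub> a b) I) = (\<Sum>b\<in>I. sc (a b) (\<phi> b)) \<and> finsum M (\<lambda>b. b \<cdot>\<^bsub>M\<^esub> a b) I \<in> carrier M"
    if "finite I" "I \<subseteq> B" for I
    using that
  proof (induction I)
    case empty
    have "\<phi> \<zero>\<^bsub>M\<^esub> = \<phi> \<zero>\<^bsub>M\<^esub> + \<phi> \<zero>\<^bsub>M\<^esub>" using add[OF M.zero_closed M.zero_closed] unfolding M.l_zero[OF M.zero_closed] .
    then show ?case unfolding M.finsum_empty sum.empty by simp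
  next
    case (insert b I)
    have b: "b \<in> carrier M" "a b \<in> carrier R" using insert.prems B(2) a by auto
    have ba: "b \<cdot>\<^bsub>M\<^esub> a b \<in> carrier M" by (rule ract_closed[OF b])
    have IH: "\<phi> (finsum M (\<lambda>b. b \<cdot>\<^bsub>M\<^esub> a b) I) = (\<Sum>b\<in>I. sc (a b) (\<phi> b))" "finsum M (\<lambda>b. b \<cdot>\<^bsub>M\<^esub> a b) I \<in> carrier M"
      using insert by auto
    have "(\<lambda>b. b \<cdot>\<^bsub>M\<^esub> a b) \<in> I \<rightarrow> carrier M" using insert.prems B(2) a by (auto intro!: ract_closed)
    then have s: "finsum M (\<lambda>b. b \<cdot>\<^bsub>M\<^esub> a b) (insert b I) = b \<cdot>\<^bsub>M\<^esub> a b \<oplus>\<^bsub>M\<^esub> finsum M (\<lambda>b. b \<cdot>\<^bsub>M\<^esub> a b) I"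
      using ba by (intro M.finsum_insert insert.hyps)
    show ?case unfolding s add[OF ba IH(2)] ract[OF b] IH(1) sum.insert[OF insert.hyps]
      by (rule conjI[OF refl M.a_closed[OF ba IH(2)]])
  qed
  from this[of "{b \<in> B. a b \<noteq> \<zero>\<^bsub>R\<^esub>}"] show ?thesis using B(1) by (simp add: lin_comb_def)
qed

locale coord_complex =
  fixes R :: "('a, 'c) ring_scheme" and C :: "('a, 'm) cochain" and X :: "int \<Rightarrow> 'w::ab_group_add set"
    and sc :: "'a \<Rightarrow> 'w \<Rightarrow> 'w" and dX :: "int \<Rightarrow> 'w \<Rightarrow> 'w" and c :: "int \<Rightarrow> 'm \<Rightarrow> 'w" and d :: "int \<Rightarrow> 'w \<Rightarrow> 'm"
  assumes coord: "\<And>n. coord R (obj C n) (X n) sc (c n) (d n)"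
    and dC: "\<And>n x. x \<in> carrier (obj C n) \<Longrightarrow> diff C n x \<in> carrier (obj C (n + 1))"
    and c_dC: "\<And>n x. x \<in> carrier (obj C n) \<Longrightarrow> c (n + 1) (diff C n x) = dX n (c n x)"
begin

lemma c_dC': "x \<in> carrier (obj C (n - 1)) \<Longrightarrow> c n (diff C (n - 1) x) = dX (n - 1) (c (n - 1) x)"
  using c_dC[of x "n - 1"] by simp

lemma dC': "x \<in> carrier (obj C (n - 1)) \<Longrightarrow> diff C (n - 1) x \<in> carrier (obj C n)"
  using dC[of x "n - 1"] by simp

lemma homotopic_id:
  assumes k: "\<And>n x. x \<in> carrier (obj C n) \<Longrightarrow> k n x \<in> carrier (obj C n) \<and> c n (k n x) = q n (c n x)"
    and s: "\<And>n. lin_on (carrier R) (X n) sc (X (n - 1)) sc (s n)"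
    and eq: "\<And>n w. w \<in> X n \<Longrightarrow> q n w - w = dX (n - 1) (s n w) + s (n + 1) (dX n w)"
  shows "cochain_homotopic R C C k (\<lambda>n x. x)"
  unfolding cochain_homotopic_def
proof (intro exI[of _ "\<lambda>n x. d (n - 1) (s n (c n x))"] conjI allI ballI)
  show "(\<lambda>x. d (n - 1) (s n (c n x))) \<in> rmod_hom R (obj C n) (obj C (n - 1))" for n
    by (rule coord_hom[OF coord coord s])
  fix n x assume x: "x \<in> carrier (obj C n)"
  interpret N: coord R "obj C n" "X n" sc "c n" "d n" by (rule coord)
  interpret N': coord R "obj C (n - 1)" "X (n - 1)" sc "c (n - 1)" "d (n - 1)" by (rule coord)
  interpret N'': coord R "obj C (n + 1)" "X (n + 1)" sc "c (n + 1)" "d (n + 1)" by (rule coord)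
  have 1: "d (n - 1) (s n (c n x)) \<in> carrier (obj C (n - 1))" by (rule N'.d[OF lin_onD(1)[OF s N.c[OF x]]])
  have "s (n + 1) (c (n + 1) (diff C n x)) \<in> X (n + 1 - 1)" by (rule lin_onD(1)[OF s N''.c[OF dC[OF x]]])
  then have 2: "s (n + 1) (dX n (c n x)) \<in> X n" unfolding c_dC[OF x] add_diff_cancel_right' .
  have l: "c n (k n x \<ominus>\<^bsub>obj C n\<^esub> x) = q n (c n x) - c n x"
    unfolding N.c_minus[OF conjunct1[OF k[OF x]] x] conjunct2[OF k[OF x]] ..
  have r: "c n (diff C (n - 1) (d (n - 1) (s n (c n x))) \<oplus>\<^bsub>obj C n\<^esub> d n (s (n + 1) (dX n (c n x))))
      = dX (n - 1) (s n (c n x)) + s (n + 1) (dX n (c n x))"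
    unfolding N.c_add[OF dC'[OF 1] N.d[OF 2]] c_dC'[OF 1] N'.cd[OF lin_onD(1)[OF s N.c[OF x]]] N.cd[OF 2] ..
  show "k n x \<ominus>\<^bsub>obj C n\<^esub> x = diff C (n - 1) (d (n - 1) (s n (c n x)))
      \<oplus>\<^bsub>obj C n\<^esub> d (n + 1 - 1) (s (n + 1) (c (n + 1) (diff C n x)))"
    unfolding c_dC[OF x] add_diff_cancel_right'
  proof (rule N.c_inj[OF _ _ trans[OF l trans[OF eq[OF N.c[OF x]] sym[OF r]]]])
    show "k n x \<ominus>\<^bsub>obj C n\<^esub> x \<in> carrier (obj C n)"
      by (rule N.M.minus_closed[OF conjunct1[OF k[OF x]] x])
    show "diff C (n - 1) (d (n - 1) (s n (c n x))) \<oplus>\<^bsub>obj C n\<^esub> d n (s (n + 1) (dX n (c n x))) \<in> carrier (obj C n)"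
      by (rule N.M.a_closed[OF dC'[OF 1] N.d[OF 2]])
  qed
qed

end

text \<open>With coordinates on both complexes, a homotopy equivalence amounts to linear maps
  between the coordinate groups that satisfy the usual identities there.\<close>

lemma homotopy_equivalence_transfer:
  assumes C: "coord_complex R C X sc dX c d" and D: "coord_complex R D Y sc' dY c' d'"
    and f: "\<And>n. lin_on (carrier R) (X n) sc (Y n) sc' (f n)" "\<And>n w. w \<in> X n \<Longrightarrow> f (n + 1) (dX n w) = dY n (f n w)"
    and g: "\<And>n. lin_on (carrier R) (Y n) sc' (X n) sc (g n)" "\<And>n w. w \<in> Y n \<Longrightarrow> g (n + 1) (dY n w) = dX n (g n w)"
    and s: "\<And>n. lin_on (carrier R) (X n) sc (X (n - 1)) sc (s n)"
      "\<And>n w. w \<in> X n \<Longrightarrow> g n (f n w) - w = dX (n - 1) (s n w) + s (n + 1) (dX n w)"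
    and t: "\<And>n. lin_on (carrier R) (Y n) sc' (Y (n - 1)) sc' (t n)"
      "\<And>n w. w \<in> Y n \<Longrightarrow> f n (g n w) - w = dY (n - 1) (t n w) + t (n + 1) (dY n w)"
  shows "homotopy_equivalent_cochains R C D"
proof -
  interpret C: coord_complex R C X sc dX c d by (rule C)
  interpret D: coord_complex R D Y sc' dY c' d' by (rule D)
  have map: "cochain_map R C' D' (\<lambda>n x. e' n (k n (b n x)))"
    if "coord_complex R C' X' z dX' b e" "coord_complex R D' Y' z' dY' b' e'"
      "\<And>n. lin_on (carrier R) (X' n) z (Y' n) z' (k n)" "\<And>n w. w \<in> X' n \<Longrightarrow> k (n + 1) (dX' n w) = dY' n (k n w)"
    for C' :: "('a, 'x) cochain" and X' z dX' b e and D' :: "('a, 'y) cochain" and Y' z' dY' b' e' k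
    unfolding cochain_map_def
  proof (intro conjI allI ballI)
    interpret C: coord_complex R C' X' z dX' b e by (rule that(1))
    interpret D: coord_complex R D' Y' z' dY' b' e' by (rule that(2))
    show "(\<lambda>x. e' n (k n (b n x))) \<in> rmod_hom R (obj C' n) (obj D' n)" for n
      by (rule coord_hom[OF C.coord D.coord that(3)])
    fix n x assume x: "x \<in> carrier (obj C' n)"
    have bx: "b n x \<in> X' n" by (rule coord.c[OF C.coord x])
    have kx: "k n (b n x) \<in> Y' n" by (rule lin_onD(1)[OF that(3) bx])
    have ek: "e' n (k n (b n x)) \<in> carrier (obj D' n)" by (rule coord.d[OF D.coord kx])
    have "diff D' n (e' n (k n (b n x))) = e' (n + 1) (b' (n + 1) (diff D' n (e' n (k n (b n x)))))"
      by (rule coord.dc[OF D.coord D.dC[OF ek], symmetric])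
    also have "\<dots> = e' (n + 1) (dY' n (k n (b n x)))" unfolding D.c_dC[OF ek] coord.cd[OF D.coord kx] ..
    also have "\<dots> = e' (n + 1) (k (n + 1) (b (n + 1) (diff C' n x)))" unfolding C.c_dC[OF x] that(4)[OF bx] ..
    finally show "e' (n + 1) (k (n + 1) (b (n + 1) (diff C' n x))) = diff D' n (e' n (k n (b n x)))" by (rule sym)
  qed
  have 1: "cochain_homotopic R C C (\<lambda>n x. d n (g n (c' n (d' n (f n (c n x)))))) (\<lambda>n x. x)"
  proof (rule C.homotopic_id[where q = "\<lambda>n w. g n (f n w)" and s = s])
    fix n x assume x: "x \<in> carrier (obj C n)"
    have fx: "f n (c n x) \<in> Y n" by (rule lin_onD(1)[OF f(1) coord.c[OF C.coord x]])
    have gx: "g n (f n (c n x)) \<in> X n" by (rule lin_onD(1)[OF g(1) fx])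
    show "d n (g n (c' n (d' n (f n (c n x))))) \<in> carrier (obj C n)
        \<and> c n (d n (g n (c' n (d' n (f n (c n x)))))) = g n (f n (c n x))"
      unfolding coord.cd[OF D.coord fx] using coord.d[OF C.coord gx] coord.cd[OF C.coord gx] by simp
  qed (rule s)+
  have 2: "cochain_homotopic R D D (\<lambda>n x. d' n (f n (c n (d n (g n (c' n x)))))) (\<lambda>n x. x)"
  proof (rule D.homotopic_id[where q = "\<lambda>n w. f n (g n w)" and s = t])
    fix n x assume x: "x \<in> carrier (obj D n)"
    have gx: "g n (c' n x) \<in> X n" by (rule lin_onD(1)[OF g(1) coord.c[OF D.coord x]])
    have fx: "f n (g n (c' n x)) \<in> Y n" by (rule lin_onD(1)[OF f(1) gx])
    show "d' n (f n (c n (d n (g n (c' n x))))) \<in> carrier (obj D n)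
        \<and> c' n (d' n (f n (c n (d n (g n (c' n x)))))) = f n (g n (c' n x))"
      unfolding coord.cd[OF C.coord gx] using coord.d[OF D.coord fx] coord.cd[OF D.coord fx] by simp
  qed (rule t)+
  show ?thesis
    unfolding homotopy_equivalent_cochains_def
  proof (intro exI[of _ "\<lambda>n x. d' n (f n (c n x))"] exI[of _ "\<lambda>n x. d n (g n (c' n x))"] conjI)
    show "cochain_map R C D (\<lambda>n x. d' n (f n (c n x)))" by (rule map[OF C D f])
    show "cochain_map R D C (\<lambda>n x. d n (g n (c' n x)))" by (rule map[OF D C g])
  qed (rule 1, rule 2)
qed

section \<open>Finite domination of a complex of free modules\<close>

text \<open>Coordinates for the complex of Laurent polynomial modules, through which both domination
  and tensor products are analysed. That they exist is \<open>model_exists\<close>.\<close>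

locale model_complex = ring R + free_complex "ring.em R \<one>\<^bsub>R\<^esub>" rk P D lo hi
  for R :: "('a, 'c) ring_scheme" (structure) and rk P and D :: "int \<Rightarrow> int \<times> int \<Rightarrow> nat \<Rightarrow> nat \<Rightarrow> 'a uring" and lo hi +
  fixes C :: "('a series, 'm) cochain" and \<Theta> :: "int \<Rightarrow> 'm \<Rightarrow> int \<times> int \<Rightarrow> nat \<Rightarrow> 'a uring"
  assumes rmC: "\<And>n. right_module (LPoly R) (obj C n)"
    and dC: "\<And>n x. x \<in> carrier (obj C n) \<Longrightarrow> diff C n x \<in> carrier (obj C (n + 1))"
    and \<Theta>_bij: "\<And>n. bij_betw (\<Theta> n) (carrier (obj C n)) (pol n)"
    and \<Theta>_add: "\<And>n x y. x \<in> carrier (obj C n) \<Longrightarrow> y \<in> carrier (obj C n) \<Longrightarrow> \<Theta> n (x \<oplus>\<^bsub>obj C n\<^esub> y) = \<Theta> n x + \<Theta> n y"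
    and \<Theta>_ract: "\<And>n x a. x \<in> carrier (obj C n) \<Longrightarrow> a \<in> carrier (LPoly R)
      \<Longrightarrow> \<Theta> n (x \<cdot>\<^bsub>obj C n\<^esub> a) = (\<lambda>v i. \<Sum>p\<in>supp (\<Theta> n x). \<Theta> n x p i * em (a (v - p)))"
    and \<Theta>_dif: "\<And>n x. x \<in> carrier (obj C n) \<Longrightarrow> \<Theta> (n + 1) (diff C n x) = dif n (\<Theta> n x)"
begin

abbreviation "e \<equiv> em \<one>"

abbreviation "CR \<equiv> restrict_cochain (series_const R) C"

abbreviation "esc r \<equiv> scale (em r)"

abbreviation "inv\<Theta> n \<equiv> inv_into (carrier (obj C n)) (\<Theta> n)"

lemma \<Theta>_pol: "x \<in> carrier (obj C n) \<Longrightarrow> \<Theta> n x \<in> pol n"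
  using \<Theta>_bij by (auto simp: bij_betw_def)

lemma \<Theta>_inj: "x \<in> carrier (obj C n) \<Longrightarrow> y \<in> carrier (obj C n) \<Longrightarrow> \<Theta> n x = \<Theta> n y \<Longrightarrow> x = y"
  using \<Theta>_bij by (auto simp: bij_betw_def inj_on_def)

lemma const_carrier: "r \<in> carrier R \<Longrightarrow> series_const R r \<in> carrier (LPoly R)"
proof -
  assume r: "r \<in> carrier R"
  have "{v. series_const R r v \<noteq> \<zero>} \<subseteq> {0}" by (auto simp: series_const_def split: if_splits)
  then have "finite {v. series_const R r v \<noteq> \<zero>}" by (rule finite_subset) simp
  then show ?thesis using r by (simp add: LPoly_def series_ring_def laurent_polys_def series_on_def series_const_def)
qed

lemma \<Theta>_scale: "x \<in> carrier (obj C n) \<Longrightarrow> r \<in> carrier R \<Longrightarrow> \<Theta> n (x \<cdot>\<^bsub>obj C n\<^esub> series_const R r) = esc r (\<Theta> n x)"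
proof -
  assume x: "x \<in> carrier (obj C n)" and r: "r \<in> carrier R"
  have fin: "finite (supp (\<Theta> n x))" using \<Theta>_pol[OF x] by (simp add: pol_iff)
  have "(\<Sum>p\<in>supp (\<Theta> n x). \<Theta> n x p i * em (series_const R r (v - p))) = \<Theta> n x v i * em r" for v i
  proof -
    have "(\<Sum>p\<in>supp (\<Theta> n x). \<Theta> n x p i * em (series_const R r (v - p)))
        = (\<Sum>p\<in>supp (\<Theta> n x). if p = v then \<Theta> n x v i * em r else 0)"
      by (rule sum.cong[OF refl]) (auto simp: series_const_def em_zero)
    also have "\<dots> = \<Theta> n x v i * em r" using fin by (simp add: supp_def)
    finally show ?thesis .
  qed
  then show ?thesis unfolding \<Theta>_ract[OF x const_carrier[OF r]] by (simp add: scale_def)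
qed

lemma CR_simps: "carrier (obj CR n) = carrier (obj C n)" "\<zero>\<^bsub>obj CR n\<^esub> = \<zero>\<^bsub>obj C n\<^esub>"
    "add (obj CR n) = add (obj C n)" "x \<cdot>\<^bsub>obj CR n\<^esub> r = x \<cdot>\<^bsub>obj C n\<^esub> series_const R r" "diff CR n = diff C n"
  by (simp_all add: restrict_cochain_def restrict_scalars_def)

lemma esc_ring: "f \<in> pol n \<Longrightarrow> r \<in> carrier R \<Longrightarrow> s \<in> carrier R \<Longrightarrow> esc (r \<oplus> s) f = esc r f + esc s f"
    "f \<in> pol n \<Longrightarrow> r \<in> carrier R \<Longrightarrow> s \<in> carrier R \<Longrightarrow> esc (r \<otimes> s) f = esc s (esc r f)"
    "f \<in> pol n \<Longrightarrow> esc \<one> f = f"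
  by (simp_all add: scale_def em_add em_mult distrib_left mult.assoc fun_eq_iff one_central[symmetric] pol_e)

lemma coordC: "coord R (obj CR n) (pol n) esc (\<Theta> n) (inv\<Theta> n)"
proof -
  interpret M: right_module "LPoly R" "obj C n" by (rule rmC)
  have ract: "x \<cdot>\<^bsub>obj C n\<^esub> series_const R r \<in> carrier (obj C n)" if "x \<in> carrier (obj C n)" "r \<in> carrier R" for x r
    by (rule M.ract_closed[OF that(1) const_carrier[OF that(2)]])
  have ab: "abelian_group (obj CR n)"
  proof (rule abelian_groupI, goal_cases)
    case (6 x)
    then show ?case unfolding CR_simps by (intro bexI[of _ "\<ominus>\<^bsub>obj C n\<^esub> x"] M.M.l_neg M.M.a_inv_closed)
  qed (unfold CR_simps, simp_all add: M.M.a_ac)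
  show ?thesis
  proof (rule coord.intro)
    show "right_module R (obj CR n)"
    proof (intro right_module.intro ab right_module_axioms.intro)
      show "ring R" by unfold_locales
      fix x r assume x: "x \<in> carrier (obj CR n)" and r: "r \<in> carrier R"
      note x' = x[unfolded CR_simps]
      show "x \<cdot>\<^bsub>obj CR n\<^esub> r \<in> carrier (obj CR n)" unfolding CR_simps by (rule ract[OF x' r])
      show "(x \<oplus>\<^bsub>obj CR n\<^esub> y) \<cdot>\<^bsub>obj CR n\<^esub> r = x \<cdot>\<^bsub>obj CR n\<^esub> r \<oplus>\<^bsub>obj CR n\<^esub> y \<cdot>\<^bsub>obj CR n\<^esub> r"
        if y: "y \<in> carrier (obj CR n)" for y
        unfolding CR_simps by (rule M.ract_add_module[OF x' y[unfolded CR_simps] const_carrier[OF r]])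
      fix s assume s: "s \<in> carrier R"
      show "x \<cdot>\<^bsub>obj CR n\<^esub> (r \<oplus> s) = x \<cdot>\<^bsub>obj CR n\<^esub> r \<oplus>\<^bsub>obj CR n\<^esub> x \<cdot>\<^bsub>obj CR n\<^esub> s"
        unfolding CR_simps
      \<comment> \<open>The module laws over R are read off in coordinates, where constants act by
        right multiplication on the entries.\<close>
      proof (rule \<Theta>_inj)
        show "\<Theta> n (x \<cdot>\<^bsub>obj C n\<^esub> series_const R (r \<oplus> s))
            = \<Theta> n (x \<cdot>\<^bsub>obj C n\<^esub> series_const R r \<oplus>\<^bsub>obj C n\<^esub> x \<cdot>\<^bsub>obj C n\<^esub> series_const R s)"
          unfolding \<Theta>_add[OF ract[OF x' r] ract[OF x' s]] \<Theta>_scale[OF x' r] \<Theta>_scale[OF x' s] \<Theta>_scale[OF x' a_closed[OF r s]]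
          by (rule esc_ring(1)[OF \<Theta>_pol[OF x'] r s])
      qed (simp_all add: ract x' r s)
      show "x \<cdot>\<^bsub>obj CR n\<^esub> (r \<otimes> s) = x \<cdot>\<^bsub>obj CR n\<^esub> r \<cdot>\<^bsub>obj CR n\<^esub> s"
        unfolding CR_simps
      proof (rule \<Theta>_inj)
        show "\<Theta> n (x \<cdot>\<^bsub>obj C n\<^esub> series_const R (r \<otimes> s)) = \<Theta> n (x \<cdot>\<^bsub>obj C n\<^esub> series_const R r \<cdot>\<^bsub>obj C n\<^esub> series_const R s)"
          unfolding \<Theta>_scale[OF ract[OF x' r] s] \<Theta>_scale[OF x' r] \<Theta>_scale[OF x' m_closed[OF r s]]
          by (rule esc_ring(2)[OF \<Theta>_pol[OF x'] r s])
      qed (simp_all add: ract x' r s)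
    next
      fix x assume "x \<in> carrier (obj CR n)"
      note x' = this[unfolded CR_simps]
      show "x \<cdot>\<^bsub>obj CR n\<^esub> \<one> = x"
        unfolding CR_simps
        by (rule \<Theta>_inj[OF ract[OF x' one_closed] x']) (unfold \<Theta>_scale[OF x' one_closed], rule esc_ring(3)[OF \<Theta>_pol[OF x']])
    qed
  qed (unfold CR_simps, simp_all add: pol_subgroup \<Theta>_pol \<Theta>_add \<Theta>_scale bij_betw_inv_into_left[OF \<Theta>_bij]
      bij_betw_inv_into_right[OF \<Theta>_bij] bij_betwE[OF bij_betw_inv_into[OF \<Theta>_bij], rule_format])
qed

lemma coord_complexC: "coord_complex R CR pol esc dif \<Theta> (\<lambda>n. inv\<Theta> n)"
  by (rule coord_complex.intro[OF coordC]) (simp_all add: CR_simps dC \<Theta>_dif)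

text \<open>The scalars fixed by the idempotent are exactly the images of carrier elements under
  \<open>em\<close>, so linearity over either kind of scalar is the same.\<close>

lemma rlin_iff: "rlin n m B \<longleftrightarrow> lin_on (carrier R) (pol n) esc (pol m) esc B"
proof
  assume "rlin n m B"
  note r = rlinD[OF this]
  show "lin_on (carrier R) (pol n) esc (pol m) esc B"
    by (rule lin_onI, erule r(1), erule (1) r(2), rule r(3)) (simp_all add: one_em)
next
  assume B: "lin_on (carrier R) (pol n) esc (pol m) esc B"
  have "B (scale r f) = scale r (B f)" if "r \<in> {r. e * r = r}" "f \<in> pol n" for r f
    using lin_onD(3)[OF B pr_carrier that(2), of r] that(1) by (simp add: em_pr)
  then show "rlin n m B" by (intro rlinI) (simp_all add: lin_onD[OF B])
qed

text \<open>Given a homotopy equivalence with maps f and g, the map \<open>retr h\<close> becomes g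
  after f and factors through a finitely generated module. Its image is spanned by the images of
  finitely many generators, whose supports have a finite union.\<close>

lemma small_homotopy_if_finitely_dominated:
  assumes "finitely_dominated R CR"
  shows "\<exists>h. small_homotopy h"
proof -
  interpret CC: coord_complex R CR pol esc dif \<Theta> "\<lambda>n. inv\<Theta> n" by (rule coord_complexC)
  obtain E :: "('a, nat \<Rightarrow> 'a) cochain" and f g where fg: "\<And>n. fg_rmod R (obj E n)"
    and f: "cochain_map R CR E f" and g: "cochain_map R E CR g"
    and hom: "cochain_homotopic R CR CR (\<lambda>n x. g n (f n x)) (\<lambda>n x. x)"
    using assms unfolding finitely_dominated_def homotopy_equivalent_cochains_def by blast
  obtain s where s: "\<And>n. s n \<in> rmod_hom R (obj CR n) (obj CR (n - 1))"
    and eq: "\<And>n x. x \<in> carrier (obj CR n) \<Longrightarrow> g n (f n x) \<ominus>\<^bsub>obj CR n\<^esub> x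
      = diff CR (n - 1) (s n x) \<oplus>\<^bsub>obj CR n\<^esub> s (n + 1) (diff CR n x)"
    using hom unfolding cochain_homotopic_def by blast
  have fh: "f n \<in> rmod_hom R (obj CR n) (obj E n)" and gh: "g n \<in> rmod_hom R (obj E n) (obj CR n)" for n
    using f g by (simp_all add: cochain_map_def)
  \<comment> \<open>The sign comes from the conventions: the homotopy \<open>s\<close> satisfies g f
    - 1 = ds + sd, while \<open>retr h\<close> is 1 - dh - hd.\<close>
  define h where "h = (\<lambda>n w. - \<Theta> (n - 1) (s n (inv\<Theta> n w)))"
  have lin: "lin_on (carrier R) (pol n) esc (pol (n - 1)) esc (\<lambda>w. \<Theta> (n - 1) (s n (inv\<Theta> n w)))" for n
    by (rule hom_coord[OF coordC coordC s])
  have "rlin n (n - 1) (h n)" for n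
    unfolding rlin_iff h_def using lin_onD[OF lin[of n]]
    by (intro lin_onI) (simp_all add: add_subgroup_minus[OF pol_subgroup] additive.minus[OF scale_additive])
  moreover have "\<exists>F. finite F \<and> (\<forall>w\<in>pol n. supp (retr h n w) \<subseteq> F)" for n
  proof -
    have r: "retr h n w = \<Theta> n (g n (f n (inv\<Theta> n w)))" and c: "f n (inv\<Theta> n w) \<in> carrier (obj E n)" if w: "w \<in> pol n" for w
    proof -
      define x where "x = inv\<Theta> n w"
      have x: "x \<in> carrier (obj CR n)" and wx: "\<Theta> n x = w" unfolding x_def by (rule coord.d[OF coordC w], rule coord.cd[OF coordC w])
      have sx: "s n x \<in> carrier (obj CR (n - 1))" by (rule homD(1)[OF s x])
      have dx: "diff CR n x \<in> carrier (obj CR (n + 1))" by (rule CC.dC[OF x])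
      have "s (n + 1) (diff CR n x) \<in> carrier (obj CR (n + 1 - 1))" by (rule homD(1)[OF s dx])
      then have sdx: "s (n + 1) (diff CR n x) \<in> carrier (obj CR n)" by simp
      have gf: "g n (f n x) \<in> carrier (obj CR n)" by (rule homD(1)[OF gh homD(1)[OF fh x]])
      have idx: "inv\<Theta> (n + 1) (dif n w) = diff CR n x"
        unfolding wx[symmetric] CC.c_dC[OF x, symmetric] by (rule coord.dc[OF coordC dx])
      have "\<Theta> n (g n (f n x)) - w = dif (n - 1) (\<Theta> (n - 1) (s n x)) + \<Theta> n (s (n + 1) (diff CR n x))"
        using arg_cong[OF eq[OF x], of "\<Theta> n"]
        unfolding coord.c_minus[OF coordC gf x] coord.c_add[OF coordC CC.dC'[OF sx] sdx] CC.c_dC'[OF sx] wx .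
      then show "retr h n w = \<Theta> n (g n (f n (inv\<Theta> n w)))"
        unfolding retr_def h_def idx x_def[symmetric] add_diff_cancel_right' additive.minus[OF dif_additive]
        by (simp add: algebra_simps)
      show "f n (inv\<Theta> n w) \<in> carrier (obj E n)" unfolding x_def[symmetric] by (rule homD(1)[OF fh x])
    qed
    obtain B where B: "finite B" "B \<subseteq> carrier (obj E n)"
      "\<And>y. y \<in> carrier (obj E n) \<Longrightarrow> \<exists>c. c \<in> B \<rightarrow> carrier R \<and> y = lin_comb R (obj E n) B c"
      and rmE: "right_module R (obj E n)"
      using fg[of n] unfolding fg_rmod_def by blast
    define F where "F = (\<Union>b\<in>B. supp (\<Theta> n (g n b)))"
    have gB: "g n b \<in> carrier (obj CR n)" if "b \<in> B" for b using homD(1)[OF gh] B(2) that by blast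
    have "finite F" unfolding F_def
      using B(1) coord.c[OF coordC gB] by (auto simp: pol_iff)
    moreover have "supp (retr h n w) \<subseteq> F" if w: "w \<in> pol n" for w
    proof -
      obtain a where a: "a \<in> B \<rightarrow> carrier R" "f n (inv\<Theta> n w) = lin_comb R (obj E n) B a" using B(3)[OF c[OF w]] by blast
      have "retr h n w = (\<Sum>b\<in>{b \<in> B. a b \<noteq> \<zero>}. esc (a b) (\<Theta> n (g n b)))"
        unfolding r[OF w] a(2)
      proof (rule lin_comb_map[where \<phi> = "\<lambda>y. \<Theta> n (g n y)", OF rmE B(1,2)])
        show "a b \<in> carrier R" if "b \<in> B" for b using a(1) that by blast
        show "\<Theta> n (g n (x \<oplus>\<^bsub>obj E n\<^esub> y)) = \<Theta> n (g n x) + \<Theta> n (g n y)"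
          if "x \<in> carrier (obj E n)" "y \<in> carrier (obj E n)" for x y
          unfolding homD(2)[OF gh that] by (rule coord.c_add[OF coordC homD(1)[OF gh that(1)] homD(1)[OF gh that(2)]])
        show "\<Theta> n (g n (x \<cdot>\<^bsub>obj E n\<^esub> r)) = esc r (\<Theta> n (g n x))"
          if "x \<in> carrier (obj E n)" "r \<in> carrier R" for x r
          unfolding homD(3)[OF gh that] by (rule coord.c_ract[OF coordC homD(1)[OF gh that(1)] that(2)])
      qed
      then have "supp (retr h n w) \<subseteq> (\<Union>b\<in>{b \<in> B. a b \<noteq> \<zero>}. supp (esc (a b) (\<Theta> n (g n b))))"
        using supp_sum by (simp only:)
      also have "\<dots> \<subseteq> F" unfolding F_def using supp_scale by blast
      finally show ?thesis .
    qed
    ultimately show ?thesis by blast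
  qed
  ultimately show ?thesis unfolding small_homotopy_def by blast
qed

end

section \<open>The model as a complex of finitely generated projective modules\<close>

locale model_dominated = model_complex R rk P D lo hi C \<Theta> + dominated_complex "ring.em R \<one>\<^bsub>R\<^esub>" rk P D lo hi h F
  for R :: "('a, 'c) ring_scheme" (structure) and rk P and D :: "int \<Rightarrow> int \<times> int \<Rightarrow> nat \<Rightarrow> nat \<Rightarrow> 'a uring"
    and lo hi and C :: "('a series, 'm) cochain" and \<Theta> h F
begin

text \<open>The index triples are countable, so an element of the sum can be stored as a sequence of
  elements of R, which is the type that finite domination demands.\<close>

definition code :: "(int \<Rightarrow> int \<times> int \<Rightarrow> nat \<Rightarrow> 'a uring) \<Rightarrow> nat \<Rightarrow> 'a"
  where "code x = (\<lambda>k. case from_nat k of (m, v, i) \<Rightarrow> pr (x m v i))"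

definition decode :: "(nat \<Rightarrow> 'a) \<Rightarrow> int \<Rightarrow> int \<times> int \<Rightarrow> nat \<Rightarrow> 'a uring"
  where "decode z = (\<lambda>m v i. em (z (to_nat (m, v, i))))"

abbreviation "tsc r \<equiv> tscale (em r)"

lemma total_e: "x \<in> total \<Longrightarrow> e * x m v i = x m v i"
  by (rule pol_e[OF fpol_pol[OF totD(1)]])

lemma decode_code: "x \<in> total \<Longrightarrow> decode (code x) = x"
  by (simp add: decode_def code_def em_pr total_e fun_eq_iff)

lemma tsc_apply: "tsc r x m v i = x m v i * em r"
  by (simp add: tscale_def scale_def)

lemma coded_total:
  assumes S: "add_subgroup S" "S \<subseteq> total" "\<And>r x. r \<in> carrier R \<Longrightarrow> x \<in> S \<Longrightarrow> tsc r x \<in> S"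
    and dec: "\<And>x. x \<in> S \<Longrightarrow> dec (cod x) = x"
  shows "coded_module R S tsc cod dec"
proof (intro coded_module.intro coded_module_axioms.intro S dec)
  show "ring R" by unfold_locales
  show "additive (tsc r)" for r by (rule tscale_additive)
  show "tsc \<one> x = x" if "x \<in> S" for x
    using total_e[of x] S(2) that by (simp add: fun_eq_iff tsc_apply one_central[symmetric] subset_iff)
qed (simp_all add: fun_eq_iff tscale_def scale_def em_add em_mult distrib_left mult.assoc)

lemma coded_mods: "coded_module R (mods n) tsc code decode"
  by (rule coded_total) (auto simp: mods_subgroup mods_tscale one_em decode_code mods_total)

text \<open>The index set of an R-basis of the total sum; boundedness of the complex and finiteness
  of the boxes make it finite.\<close>

definition idx :: "(int \<times> (int \<times> int) \<times> nat) set"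
  where "idx = {(m, v, i). lo \<le> m \<and> m \<le> hi \<and> v \<in> box m \<and> i < rk m}"

lemma finite_idx: "finite idx"
proof -
  have "idx \<subseteq> (SIGMA m:{lo..hi}. box m \<times> {..<rk m})" by (auto simp: idx_def)
  then show ?thesis by (rule finite_subset) (auto intro!: finite_SigmaI simp: finite_box)
qed

definition bas :: "int \<times> (int \<times> int) \<times> nat \<Rightarrow> int \<Rightarrow> int \<times> int \<Rightarrow> nat \<Rightarrow> 'a uring"
  where "bas j = (\<lambda>m v i. if (m, v, i) = j then e else 0)"

lemma bas_total: "j \<in> idx \<Longrightarrow> bas j \<in> total"
proof -
  assume j: "j \<in> idx"
  obtain m v i where mvi: "j = (m, v, i)" "lo \<le> m" "v \<in> box m" "i < rk m" using j by (auto simp: idx_def)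
  have s: "supp (bas j m') \<subseteq> (if m' = m then {v} else {})" for m'
    by (auto simp: supp_def bas_def mvi(1) fun_eq_iff split: if_splits)
  have "bas j m' \<in> fpol m'" for m'
    unfolding fpol_def pol_iff mem_Collect_eq
  proof (intro conjI allI)
    show "bas j m' w \<in> vecs e (rk m')" for w
      using mvi by (intro vecsI) (auto simp: bas_def one_idem)
    show "finite (supp (bas j m'))" by (rule finite_subset[OF s]) simp
    show "supp (bas j m') \<subseteq> box m'" by (rule order_trans[OF s]) (use mvi in simp)
  qed
  moreover have "bas j m' = 0" if "m' < lo" for m' using that mvi by (auto simp: bas_def fun_eq_iff)
  ultimately show ?thesis by (simp add: tot_def)
qed

lemma bas_comb:
  assumes "\<And>j. j \<in> idx \<Longrightarrow> a j \<in> carrier R"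
  shows "(\<Sum>j\<in>idx. tsc (a j) (bas j)) m v i = (if (m, v, i) \<in> idx then em (a (m, v, i)) else 0)"
proof -
  have "(\<Sum>j\<in>idx. tsc (a j) (bas j)) m v i = (\<Sum>j\<in>idx. if j = (m, v, i) then em (a (m, v, i)) else 0)"
    unfolding sum_fun_app by (rule sum.cong[OF refl]) (use assms in \<open>auto simp: tsc_apply bas_def one_em\<close>)
  then show ?thesis using finite_idx by simp
qed

lemma total_expand: "x \<in> total \<Longrightarrow> x = (\<Sum>j\<in>idx. tsc (case j of (m, v, i) \<Rightarrow> pr (x m v i)) (bas j))"
proof (intro ext)
  fix m v i assume x: "x \<in> total"
  have "x m v i = 0" if "(m, v, i) \<notin> idx"
  proof -
    have xm: "x m \<in> fpol m" by (rule totD(1)[OF x])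
    show ?thesis
    proof (cases "m < lo \<or> hi < m")
      case True
      then show ?thesis using pol_low[OF fpol_pol[OF xm]] by simp
    next
      case False
      then have "v \<notin> box m \<or> rk m \<le> i" using that by (auto simp: idx_def)
      then show ?thesis using xm vecsD(2)[of "x m v" e "rk m" i] by (auto simp: fpol_def pol_iff supp_def fun_eq_iff)
    qed
  qed
  then show "x m v i = (\<Sum>j\<in>idx. tsc (case j of (m, v, i) \<Rightarrow> pr (x m v i)) (bas j)) m v i"
    by (subst bas_comb) (auto simp: em_pr total_e[OF x])
qed

text \<open>The module is the image of \<open>proj n\<close> on a free module with a finite basis,
  so the projected basis vectors generate it.\<close>

lemma mods_fg: "fg_rmod R (coded_rmod (mods n) tsc code decode)"
proof (rule coded_module.fg[OF coded_mods finite_idx])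
  show "proj n (bas j) \<in> mods n" if "j \<in> idx" for j by (rule lin_onD(1)[OF proj_mods bas_total[OF that]])
  fix x assume x: "x \<in> mods n"
  define a where "a = (\<lambda>j. case j of (m, v, i) \<Rightarrow> pr (x m v i))"
  have a: "a j \<in> carrier R" for j by (simp add: a_def split: prod.split)
  have t: "tsc (a j) (bas j) \<in> total" if "j \<in> idx" for j by (rule tscale_tot[OF _ bas_total[OF that]]) (simp add: one_em a)
  have ps: "proj n (\<Sum>j\<in>J. tsc (a j) (bas j)) = (\<Sum>j\<in>J. tsc (a j) (proj n (bas j)))" if "finite J" "J \<subseteq> idx" for J
    using that
  proof (induction J)
    case empty
    show ?case unfolding sum.empty by (rule lin_on_map_zero[OF proj_mods zero_total])
  next
    case (insert j J)
    have j: "j \<in> idx" "J \<subseteq> idx" using insert.prems by auto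
    have tt: "(\<Sum>j\<in>J. tsc (a j) (bas j)) \<in> total"
      by (rule add_subgroup_sum[OF tot_subgroup]) (use t j(2) in auto)
    have "e * em (a j) = em (a j)" by (rule one_em[OF a])
    then have r: "em (a j) \<in> Rset" by simp
    show ?case unfolding sum.insert[OF insert.hyps] lin_onD(2)[OF proj_mods t[OF j(1)] tt]
        lin_onD(3)[OF proj_mods r bas_total[OF j(1)]] insert.IH[OF j(2)] ..
  qed
  have px: "proj n x = x" using x by (simp add: mods_def)
  have xs: "(\<Sum>j\<in>idx. tsc (a j) (bas j)) = x" unfolding a_def by (rule total_expand[OF mods_total[OF x], symmetric])
  have "x = (\<Sum>j\<in>idx. tsc (a j) (proj n (bas j)))" using ps[OF finite_idx order_refl] unfolding xs px .
  with a show "\<exists>a. (\<forall>j\<in>idx. a j \<in> carrier R) \<and> x = (\<Sum>j\<in>idx. tsc (a j) (proj n (bas j)))"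
    by (intro exI[of _ a] conjI ballI)
qed

text \<open>\<open>proj n\<close> and the inclusion present the module as a retract of the free
  module \<open>total\<close>, which is encoded a second time because its elements must have the
  larger type of functions on sequences.\<close>

lemma mods_projective: "projective_rmod R (coded_rmod (mods n) tsc code decode)"
proof -
  obtain \<iota> :: "(nat \<Rightarrow> 'a) \<Rightarrow> ((nat \<Rightarrow> 'a) \<Rightarrow> 'a)" where \<iota>: "inj \<iota>" using inj_to_functions by blast
  define cod where "cod = (\<lambda>x. \<iota> (code x))"
  define dec where "dec = (\<lambda>z. decode (inv_into UNIV \<iota> z))"
  have dc: "dec (cod x) = x" if "x \<in> total" for x
    using that by (simp add: dec_def cod_def inv_into_f_f[OF \<iota>] decode_code)
  have rs: "tsc r x \<in> total" if "r \<in> carrier R" "x \<in> total" for r x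
    by (rule tscale_tot) (simp_all add: one_em that)
  have T: "coded_module R total tsc cod dec"
    by (rule coded_total) (simp_all add: tot_subgroup dc rs)
  have free: "free_rmod R (coded_rmod total tsc cod dec)"
  \<comment> \<open>Over the zero ring all vectors \<open>bas j\<close> vanish and cannot be indexed
    injectively; the module is then zero and has the empty basis.\<close>
  proof (cases "\<one> = \<zero>")
    case True
    have "x = 0" if "x \<in> total" for x using total_e[OF that] True by (simp add: em_zero fun_eq_iff)
    then show ?thesis by (intro coded_module.free[OF T, of "{}" "\<lambda>_. undefined"]) auto
  next
    case False
    then have e0: "e \<noteq> 0" by (simp add: em_0_iff)
    show ?thesis
    proof (rule coded_module.free[OF T finite_idx bas_total])
      show "inj_on bas idx"
      proof (rule inj_onI)
        fix j k assume "bas j = bas k"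
        moreover obtain m v i where "j = (m, v, i)" by (cases j)
        ultimately show "j = k" using e0 by (auto simp: bas_def fun_eq_iff split: if_splits)
      qed
      show "\<exists>a. (\<forall>k\<in>idx. a k \<in> carrier R) \<and> x = (\<Sum>k\<in>idx. tsc (a k) (bas k))" if "x \<in> total" for x
        by (rule exI[of _ "\<lambda>j. case j of (m, v, i) \<Rightarrow> pr (x m v i)"])
          (use total_expand[OF that] in \<open>simp split: prod.split\<close>)
      fix a a' k assume a: "\<And>k. k \<in> idx \<Longrightarrow> a k \<in> carrier R" "\<And>k. k \<in> idx \<Longrightarrow> a' k \<in> carrier R"
        and eq: "(\<Sum>k\<in>idx. tsc (a k) (bas k)) = (\<Sum>k\<in>idx. tsc (a' k) (bas k))" and k: "k \<in> idx"
      obtain m v i where mvi: "k = (m, v, i)" by (cases k)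
      show "a k = a' k"
        using fun_cong[OF fun_cong[OF fun_cong[OF eq, of m], of v], of i] k em_inj[OF a(1)[OF k] a(2)[OF k]]
        by (simp add: bas_comb a mvi)
    qed
  qed
  have coF: "coord R (coded_rmod total tsc cod dec) total tsc dec cod" by (rule coded_module.coord[OF T])
  have coP: "coord R (coded_rmod (mods n) tsc code decode) (mods n) tsc decode code" by (rule coded_module.coord[OF coded_mods])
  have i: "lin_on (carrier R) (mods n) tsc total tsc (\<lambda>x. x)" by (rule lin_onI) (simp_all add: mods_total)
  have p: "lin_on (carrier R) total tsc (mods n) tsc (proj n)"
    by (rule lin_onI) (simp_all add: lin_onD[OF proj_mods] one_em)
  show ?thesis
    unfolding projective_rmod_def
  proof (intro conjI coord.rm[OF coP] exI[of _ "coded_rmod total tsc cod dec"] free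
      bexI[OF _ coord_hom[OF coP coF i]] bexI[OF _ coord_hom[OF coF coP p]] ballI)
    fix z assume "z \<in> carrier (coded_rmod (mods n) tsc code decode)"
    then obtain x where x: "x \<in> mods n" "z = code x" by (auto simp: coded_rmod_def)
    then show "code (proj n (dec (cod (decode z)))) = z"
      by (simp add: decode_code dc mods_total) (simp add: mods_def)
  qed
qed

lemma finitely_dominated: "finitely_dominated R CR"
proof -
  define E where "E = \<lparr>obj = (\<lambda>n. coded_rmod (mods n) tsc code decode), diff = (\<lambda>n z. code (Dif n (decode z)))\<rparr>"
  have E_simps [simp]: "obj E n = coded_rmod (mods n) tsc code decode" "diff E n = (\<lambda>z. code (Dif n (decode z)))" for n
    by (simp_all add: E_def)
  have co: "coord R (obj E n) (mods n) tsc decode code" for n by (simp add: coded_module.coord[OF coded_mods])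
  have Dl: "lin_on (carrier R) (mods n) tsc (mods (n + 1)) tsc (Dif n)" for n
    by (rule lin_onI) (simp_all add: lin_onD[OF Dif_lin] one_em)
  have dD: "decode (code (Dif n x)) = Dif n x" if "x \<in> mods n" for n x
    by (rule decode_code[OF mods_total[OF lin_onD(1)[OF Dl that]]])
  have Dh: "diff E n \<in> rmod_hom R (obj E n) (obj E (n + 1))" for n
    using coord_hom[OF co co Dl[of n]] by simp
  have E: "coord_complex R E mods tsc Dif (\<lambda>n. decode) (\<lambda>n. code)"
    by (intro coord_complex.intro co homD(1)[OF Dh]) (auto simp: coded_rmod_def decode_code mods_total dD)
  have "cochain_complex R E"
    unfolding cochain_complex_def
  proof (intro conjI allI ballI coord.rm[OF co] Dh)
    fix n z assume "z \<in> carrier (obj E n)"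
    then obtain x where x: "x \<in> mods n" "z = code x" by (auto simp: coded_rmod_def)
    then show "diff E (n + 1) (diff E n z) = \<zero>\<^bsub>obj E (n + 2)\<^esub>"
      by (simp add: coded_rmod_def decode_code mods_total dD Dif_Dif)
  qed
  moreover have "bounded_cochain E"
    unfolding bounded_cochain_def
  proof (rule exI[of _ lo], rule exI[of _ hi], intro allI impI)
    fix n assume "n < lo \<or> hi < n"
    then have "mods n = {0}" using mods_low[of _ n] mods_above[of n] add_subgroup_zero[OF mods_subgroup[of n]] by auto
    then show "carrier (obj E n) = {\<zero>\<^bsub>obj E n\<^esub>}" by (simp add: coded_rmod_def)
  qed
  moreover have "homotopy_equivalent_cochains R CR E"
  proof -
    have alg: "x - a - b - x = - a + - b" for x a b :: "'v::ab_group_add" by simp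
    have f1: "lin_on (carrier R) (pol n) esc (mods n) tsc (to_model n)" for n
      by (rule lin_onI) (simp_all add: lin_onD[OF to_model_lin] one_em)
    have g1: "lin_on (carrier R) (mods n) tsc (pol n) esc (Psi n)" for n
      by (rule lin_onI) (simp_all add: lin_onD[OF from_model_lin] one_em)
    have t1: "lin_on (carrier R) (mods n) tsc (mods (n - 1)) tsc (hmod n)" for n
      by (rule lin_onI) (simp_all add: lin_onD[OF hmod_lin] one_em)
    \<comment> \<open>The homotopy from \<open>retr h\<close> to the identity is \<open>- h\<close>,
      because \<open>retr h\<close> minus the identity is -dh - hd.\<close>
    have s1: "lin_on (carrier R) (pol n) esc (pol (n - 1)) esc (\<lambda>w. - h n w)" for n
      by (rule lin_onI) (simp_all add: rlinD[OF h] one_em add_subgroup_minus[OF pol_subgroup] additive.minus[OF scale_additive])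
    have f2: "to_model (n + 1) (dif n w) = Dif n (to_model n w)" if "w \<in> pol n" for n w by (rule to_model_dif[OF that])
    have g2: "Psi (n + 1) (Dif n w) = dif n (Psi n w)" if "w \<in> mods n" for n w by (rule from_model_dif[OF that])
    have s2: "Psi n (to_model n w) - w = dif (n - 1) (- h n w) + - h (n + 1) (dif n w)" if "w \<in> pol n" for n w
      unfolding from_to_model[OF that] retr_def additive.minus[OF dif_additive] by (rule alg)
    have t2: "to_model n (Psi n w) - w = Dif (n - 1) (hmod n w) + hmod (n + 1) (Dif n w)" if "w \<in> mods n" for n w
      by (rule to_from_model[OF that])
    show ?thesis by (rule homotopy_equivalence_transfer[where f = to_model and g = Psi and s = "\<lambda>n w. - h n w" and t = hmod
      and X = pol and Y = mods and sc = esc and sc' = tsc and dX = dif and dY = Dif and R = R and C = CR and D = E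
      and c = \<Theta> and d = "\<lambda>n. inv\<Theta> n" and c' = "\<lambda>n. decode" and d' = "\<lambda>n. code",
      OF coord_complexC E f1 f2 g1 g2 s1 s2 t1 t2])
  qed
  moreover have "\<forall>n. fg_rmod R (obj E n) \<and> projective_rmod R (obj E n)"
    unfolding E_simps by (intro allI conjI mods_fg mods_projective)
  ultimately have E: "cochain_complex R E \<and> bounded_cochain E
      \<and> (\<forall>n. fg_rmod R (obj E n) \<and> projective_rmod R (obj E n)) \<and> homotopy_equivalent_cochains R CR E"
    by (intro conjI)
  show ?thesis unfolding finitely_dominated_def by (rule exI[of _ E], rule E)
qed

end

context model_complex
begin

lemma finitely_dominated_iff: "finitely_dominated R CR \<longleftrightarrow> (\<exists>h. small_homotopy h)"
proof
  assume "\<exists>h. small_homotopy h"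
  then obtain h where sh: "small_homotopy h" by (rule exE)
  note h = sh[unfolded small_homotopy_def, THEN conjunct1, THEN spec] sh[unfolded small_homotopy_def, THEN conjunct2, THEN spec]
  have "\<forall>n. \<exists>F. finite F \<and> (\<forall>f\<in>pol n. supp (retr h n f) \<subseteq> F)" by (intro allI h(2))
  from choice[OF this] obtain F where F: "\<forall>n. finite (F n) \<and> (\<forall>f\<in>pol n. supp (retr h n f) \<subseteq> F n)"
    by (rule exE)
  have "model_dominated R rk P D lo hi C \<Theta> h F"
  proof (intro model_dominated.intro dominated_complex.intro dominated_complex_axioms.intro)
    show "model_complex R rk P D lo hi C \<Theta>" by (rule model_complex_axioms)
    show "free_complex e rk P D lo hi" by (rule free_complex_axioms)
    show "rlin n (n - 1) (h n)" for n by (rule h(1))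
    show "finite (F n)" for n by (rule conjunct1[OF F[THEN spec, of n]])
    show "supp (retr h n f) \<subseteq> F n" if "f \<in> pol n" for n f by (rule bspec[OF conjunct2[OF F[THEN spec, of n]] that])
  qed
  then show "finitely_dominated R CR" by (rule model_dominated.finitely_dominated)
qed (rule small_homotopy_if_finitely_dominated)

end

section \<open>Tensor products with rings of series\<close>

lemma finsum_map:
  fixes \<phi> :: "'m \<Rightarrow> 'w::ab_group_add"
  assumes M: "abelian_group M" and I: "finite I" and h: "\<And>i. i \<in> I \<Longrightarrow> h i \<in> carrier M"
    and add: "\<And>x y. x \<in> carrier M \<Longrightarrow> y \<in> carrier M \<Longrightarrow> \<phi> (x \<oplus>\<^bsub>M\<^esub> y) = \<phi> x + \<phi> y"
  shows "\<phi> (finsum M h I) = (\<Sum>i\<in>I. \<phi> (h i)) \<and> finsum M h I \<in> carrier M"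
  using I h
proof (induction I rule: finite_induct)
  interpret M: abelian_group M by (rule M)
  case empty
  have "\<phi> \<zero>\<^bsub>M\<^esub> = \<phi> \<zero>\<^bsub>M\<^esub> + \<phi> \<zero>\<^bsub>M\<^esub>" using add[OF M.zero_closed M.zero_closed] unfolding M.l_zero[OF M.zero_closed] .
  then show ?case unfolding M.finsum_empty sum.empty by simp
next
  interpret M: abelian_group M by (rule M)
  case (insert i I)
  have c: "h i \<in> carrier M" "h \<in> I \<rightarrow> carrier M" using insert.prems by auto
  have IH: "\<phi> (finsum M h I) = (\<Sum>i\<in>I. \<phi> (h i))" "finsum M h I \<in> carrier M" using insert by auto
  have s: "finsum M h (insert i I) = h i \<oplus>\<^bsub>M\<^esub> finsum M h I" by (rule M.finsum_insert[OF insert.hyps c(2) c(1)])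
  show ?case unfolding s add[OF c(1) IH(2)] IH(1) sum.insert[OF insert.hyps]
    by (rule conjI[OF refl M.a_closed[OF c(1) IH(2)]])
qed

section \<open>Multiplication of coordinate vectors by series\<close>

context ring
begin

lemma em_finsum: "finite I \<Longrightarrow> (\<And>i. i \<in> I \<Longrightarrow> h i \<in> carrier R) \<Longrightarrow> em (\<Oplus>i\<in>I. h i) = (\<Sum>i\<in>I. em (h i))"
  by (rule conjunct1[OF finsum_map[OF abelian_group_axioms]]) (auto simp: em_add)

text \<open>The action of a series on a finitely supported vector. Summing over the support of the
  vector keeps the sum finite however large the support of the series is.\<close>

definition cnv :: "(int \<times> int \<Rightarrow> nat \<Rightarrow> 'a uring) \<Rightarrow> 'a series \<Rightarrow> int \<times> int \<Rightarrow> nat \<Rightarrow> 'a uring"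
  where "cnv g a = (\<lambda>v i. \<Sum>p\<in>supp g. g p i * em (a (v - p)))"

lemma cnv_eq: "finite F \<Longrightarrow> supp g \<subseteq> F \<Longrightarrow> cnv g a v i = (\<Sum>p\<in>F. g p i * em (a (v - p)))"
  unfolding cnv_def by (rule sum.mono_neutral_left) (auto simp: supp_def)

lemma supp_cnv: "supp (cnv g a) \<subseteq> (\<Union>p\<in>supp g. {v. v - p \<in> {w. a w \<noteq> \<zero>}})"
proof
  fix v assume "v \<in> supp (cnv g a)"
  then obtain i where "cnv g a v i \<noteq> 0" by (auto simp: supp_def fun_eq_iff)
  then have "(\<Sum>p\<in>supp g. g p i * em (a (v - p))) \<noteq> 0" by (simp add: cnv_def)
  then obtain p where p: "p \<in> supp g" "g p i * em (a (v - p)) \<noteq> 0" by (rule sum.not_neutral_contains_not_neutral)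
  have "a (v - p) \<noteq> \<zero>"
  proof
    assume "a (v - p) = \<zero>"
    then show False using p(2) by (simp add: em_zero)
  qed
  then show "v \<in> (\<Union>p\<in>supp g. {v. v - p \<in> {w. a w \<noteq> \<zero>}})" using p(1) by blast
qed

lemma finite_shift: "finite U \<Longrightarrow> finite {v. v - p \<in> (U :: (int \<times> int) set)}"
  by (rule finite_subset[of _ "(\<lambda>w. w + p) ` U"]) (force simp: image_iff)+

lemma finite_supp_cnv: "finite (supp g) \<Longrightarrow> finite {w. a w \<noteq> \<zero>} \<Longrightarrow> finite (supp (cnv g a))"
  by (rule finite_subset[OF supp_cnv]) (intro finite_UN_I finite_shift)

lemma em_series_mult:
  assumes f: "f \<in> series_on R" and g: "g \<in> series_on R" and F: "finite F" "{p. f p \<noteq> \<zero> \<and> g (v - p) \<noteq> \<zero>} \<subseteq> F"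
  shows "em (series_mult R f g v) = (\<Sum>p\<in>F. em (f p) * em (g (v - p)))"
proof -
  let ?A = "{p. f p \<noteq> \<zero> \<and> g (v - p) \<noteq> \<zero>}"
  have c: "f p \<in> carrier R" "g p \<in> carrier R" for p using f g by (simp_all add: series_on_def)
  have "em (series_mult R f g v) = (\<Sum>p\<in>?A. em (f p \<otimes> g (v - p)))"
    unfolding series_mult_def by (rule em_finsum[OF finite_subset[OF F(2,1)]]) (intro m_closed c)
  also have "\<dots> = (\<Sum>p\<in>?A. em (f p) * em (g (v - p)))" by (rule sum.cong[OF refl]) (rule em_mult[OF c(1) c(2)])
  also have "\<dots> = (\<Sum>p\<in>F. em (f p) * em (g (v - p)))"
    by (rule sum.mono_neutral_left[OF F]) (auto simp: em_zero)
  finally show ?thesis .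
qed

lemma LPoly_carrier: "a \<in> carrier (LPoly R) \<longleftrightarrow> a \<in> series_on R \<and> finite {w. a w \<noteq> \<zero>}"
  by (simp add: LPoly_def series_ring_def laurent_polys_def)

lemma LPoly_simps: "x \<oplus>\<^bsub>LPoly R\<^esub> y = (\<lambda>v. x v \<oplus> y v)" "x \<otimes>\<^bsub>LPoly R\<^esub> y = series_mult R x y" "\<zero>\<^bsub>LPoly R\<^esub> = (\<lambda>v. \<zero>)"
  by (simp_all add: LPoly_def series_ring_def series_const_def fun_eq_iff)

lemma cnv_add: "finite (supp f) \<Longrightarrow> finite (supp g) \<Longrightarrow> cnv (f + g) a = cnv f a + cnv g a"
proof (intro ext)
  fix v i assume fin: "finite (supp f)" "finite (supp g)"
  have F: "finite (supp f \<union> supp g)" using fin by simp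
  have 1: "cnv (f + g) a v i = (\<Sum>p\<in>supp f \<union> supp g. (f + g) p i * em (a (v - p)))" by (rule cnv_eq[OF F supp_add])
  have 2: "cnv f a v i = (\<Sum>p\<in>supp f \<union> supp g. f p i * em (a (v - p)))" by (rule cnv_eq[OF F]) simp
  have 3: "cnv g a v i = (\<Sum>p\<in>supp f \<union> supp g. g p i * em (a (v - p)))" by (rule cnv_eq[OF F]) simp
  show "cnv (f + g) a v i = (cnv f a + cnv g a) v i"
    unfolding plus_fun_apply 1 2 3 by (simp add: distrib_right sum.distrib)
qed

lemma cnv_add_series: "s \<in> series_on R \<Longrightarrow> t \<in> series_on R \<Longrightarrow> cnv g (\<lambda>v. s v \<oplus> t v) = cnv g s + cnv g t"
  by (intro ext) (simp add: cnv_def series_on_def em_add distrib_left sum.distrib)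

text \<open>Since \<open>g\<close> and \<open>a\<close> have finite support, one finite set
  \<open>Q\<close> of intermediate exponents serves both sides and the sums can be exchanged,
  although \<open>s\<close> may be infinite.\<close>

lemma cnv_assoc:
  assumes g: "finite (supp g)" and a: "a \<in> carrier (LPoly R)" and s: "s \<in> series_on R"
  shows "cnv (cnv g a) s = cnv g (series_mult R a s)"
proof (intro ext)
  fix v i
  have a': "a \<in> series_on R" "finite {w. a w \<noteq> \<zero>}" using a by (simp_all add: LPoly_carrier)
  define Q where "Q = (\<Union>p\<in>supp g. {v. v - p \<in> {w. a w \<noteq> \<zero>}})"
  have Q: "finite Q" unfolding Q_def by (intro finite_UN_I g finite_shift a'(2))
  have m: "em (series_mult R a s (v - p)) = (\<Sum>q\<in>Q. em (a (q - p)) * em (s (v - q)))" if p: "p \<in> supp g" for p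
  proof -
    have "em (series_mult R a s (v - p)) = (\<Sum>r\<in>(\<lambda>q. q - p) ` Q. em (a r) * em (s (v - p - r)))"
    proof (rule em_series_mult[OF a'(1) s finite_imageI[OF Q]])
      show "{r. a r \<noteq> \<zero> \<and> s (v - p - r) \<noteq> \<zero>} \<subseteq> (\<lambda>q. q - p) ` Q"
      proof
        fix r assume r: "r \<in> {r. a r \<noteq> \<zero> \<and> s (v - p - r) \<noteq> \<zero>}"
        have "r + p \<in> Q" unfolding Q_def by (rule UN_I[OF p]) (use r in simp)
        then have "r + p - p \<in> (\<lambda>q. q - p) ` Q" by (rule imageI)
        then show "r \<in> (\<lambda>q. q - p) ` Q" by simp
      qed
    qed
    also have "\<dots> = (\<Sum>q\<in>Q. em (a (q - p)) * em (s (v - p - (q - p))))"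
      by (subst sum.reindex) (simp_all add: inj_on_def)
    finally show ?thesis by simp
  qed
  have "cnv (cnv g a) s v i = (\<Sum>q\<in>Q. cnv g a q i * em (s (v - q)))"
    by (rule cnv_eq[OF Q]) (unfold Q_def, rule supp_cnv)
  also have "\<dots> = (\<Sum>q\<in>Q. \<Sum>p\<in>supp g. g p i * (em (a (q - p)) * em (s (v - q))))"
    by (simp add: cnv_def sum_distrib_right mult.assoc)
  also have "\<dots> = (\<Sum>p\<in>supp g. \<Sum>q\<in>Q. g p i * (em (a (q - p)) * em (s (v - q))))" by (rule sum.swap)
  also have "\<dots> = (\<Sum>p\<in>supp g. g p i * em (series_mult R a s (v - p)))"
    by (rule sum.cong[OF refl]) (simp only: m sum_distrib_left)
  finally show "cnv (cnv g a) s v i = cnv g (series_mult R a s) v i" by (simp add: cnv_def)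
qed

end

text \<open>The type class group in the form required by the universal property of free abelian
  groups.\<close>

definition additive_group :: "'v::ab_group_add monoid"
  where "additive_group = \<lparr>carrier = UNIV, monoid.mult = (+), one = 0\<rparr>"

lemma comm_group_additive_group: "comm_group additive_group"
proof (rule comm_groupI)
  fix x :: "'v::ab_group_add"
  show "\<exists>y\<in>carrier additive_group. y \<otimes>\<^bsub>additive_group\<^esub> x = \<one>\<^bsub>additive_group\<^esub>"
    by (rule bexI[of _ "- x"]) (simp_all add: additive_group_def)
qed (simp_all add: additive_group_def ac_simps)

lemma mat_act_sum: "mat_act m k M (\<lambda>i. \<Sum>r\<in>F. g r i * c r) i = (\<Sum>r\<in>F. mat_act m k M (g r) i * c r)"
proof (cases "i < m")
  case True
  have "mat_act m k M (\<lambda>i. \<Sum>r\<in>F. g r i * c r) i = (\<Sum>j<k. \<Sum>r\<in>F. M i j * (g r j * c r))"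
    using True by (simp add: mat_act_def sum_distrib_left)
  also have "\<dots> = (\<Sum>r\<in>F. \<Sum>j<k. M i j * (g r j * c r))" by (rule sum.swap)
  also have "\<dots> = (\<Sum>r\<in>F. mat_act m k M (g r) i * c r)"
    using True by (simp add: mat_act_def sum_distrib_right mult.assoc)
  finally show ?thesis .
qed (simp add: mat_act_def)

lemma frag_diff: "Poly_Mapping.keys c \<subseteq> X \<Longrightarrow> Poly_Mapping.keys d \<subseteq> X \<Longrightarrow> Poly_Mapping.keys (c - d) \<subseteq> X"
  for c d :: "'k \<Rightarrow>\<^sub>0 int"
  using keys_diff[of c d] by blast

lemma frag_add: "Poly_Mapping.keys c \<subseteq> X \<Longrightarrow> Poly_Mapping.keys d \<subseteq> X \<Longrightarrow> Poly_Mapping.keys (c + d) \<subseteq> X"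
  for c d :: "'k \<Rightarrow>\<^sub>0 int"
  using keys_add[of c d] by blast

locale tensor_model = model_complex R rk P D lo hi C \<Theta>
  for R :: "('a, 'c) ring_scheme" (structure) and rk P and D :: "int \<Rightarrow> int \<times> int \<Rightarrow> nat \<Rightarrow> nat \<Rightarrow> 'a uring"
    and lo hi and C :: "('a series, 'm) cochain" and \<Theta> +
  fixes \<S> :: "(int \<times> int) set set"
  assumes ideal: "support_ideal \<S>"
begin

definition ser :: "'a series set"
  where "ser = {s \<in> series_on R. {v. s v \<noteq> \<zero>} \<in> \<S>}"

abbreviation "K \<equiv> LPoly R"

abbreviation "S \<equiv> series_ring R ser"

abbreviation "pairs n \<equiv> carrier (obj C n) \<times> ser"

abbreviation "kr n \<equiv> tensor_ker K (obj C n) S"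

abbreviation "keys \<equiv> Poly_Mapping.keys"

lemma S_simps: "carrier S = ser" "x \<oplus>\<^bsub>S\<^esub> y = (\<lambda>v. x v \<oplus> y v)" "x \<otimes>\<^bsub>S\<^esub> y = series_mult R x y"
  by (simp_all add: series_ring_def)

lemma serD: "s \<in> ser \<Longrightarrow> s \<in> series_on R" "s \<in> ser \<Longrightarrow> s v \<in> carrier R" "s \<in> ser \<Longrightarrow> {v. s v \<noteq> \<zero>} \<in> \<S>"
  by (auto simp: ser_def series_on_def)

lemma serI: "(\<And>v. s v \<in> carrier R) \<Longrightarrow> {v. s v \<noteq> \<zero>} \<subseteq> U \<Longrightarrow> U \<in> \<S> \<Longrightarrow> s \<in> ser"
  unfolding ser_def series_on_def using support_idealD(2)[OF ideal, of U "{v. s v \<noteq> \<zero>}"] by simp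

lemma ser_zero: "(\<lambda>v. \<zero>) \<in> ser"
  by (rule serI[of _ "{}"]) (simp_all add: support_idealD(1)[OF ideal])

lemma ser_minus: "s \<in> ser \<Longrightarrow> t \<in> ser \<Longrightarrow> (\<lambda>v. s v \<ominus> t v) \<in> ser"
proof (rule serI[of _ "{v. s v \<noteq> \<zero>} \<union> {v. t v \<noteq> \<zero>}"])
  assume s: "s \<in> ser" and t: "t \<in> ser"
  show "s v \<ominus> t v \<in> carrier R" for v by (rule minus_closed[OF serD(2)[OF s] serD(2)[OF t]])
  show "{v. s v \<noteq> \<zero>} \<union> {v. t v \<noteq> \<zero>} \<in> \<S>" by (rule support_idealD(3)[OF ideal serD(3)[OF s] serD(3)[OF t]])
  show "{v. s v \<ominus> t v \<noteq> \<zero>} \<subseteq> {v. s v \<noteq> \<zero>} \<union> {v. t v \<noteq> \<zero>}" by (auto simp: minus_eq)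
qed

lemma minus_plus: "s \<in> ser \<Longrightarrow> t \<in> ser \<Longrightarrow> (\<lambda>v. (s v \<ominus> t v) \<oplus> t v) = s"
  by (rule ext) (simp add: minus_eq a_assoc l_neg serD)

lemma ser_mult: "a \<in> carrier K \<Longrightarrow> s \<in> ser \<Longrightarrow> series_mult R a s \<in> ser"
proof (rule serI[of _ "\<Union>p\<in>{w. a w \<noteq> \<zero>}. {v. v - p \<in> {w. s w \<noteq> \<zero>}}"])
  assume a: "a \<in> carrier K" and s: "s \<in> ser"
  have a': "a p \<in> carrier R" for p using a by (simp add: LPoly_carrier series_on_def)
  show "series_mult R a s v \<in> carrier R" for v
    unfolding series_mult_def by (rule finsum_closed) (simp add: a' serD(2)[OF s])
  show "(\<Union>p\<in>{w. a w \<noteq> \<zero>}. {v. v - p \<in> {w. s w \<noteq> \<zero>}}) \<in> \<S>"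
    by (rule support_ideal_UN[OF ideal])
      (use a in \<open>simp add: LPoly_carrier\<close>, rule support_idealD(4)[OF ideal serD(3)[OF s]])
  show "{v. series_mult R a s v \<noteq> \<zero>} \<subseteq> (\<Union>p\<in>{w. a w \<noteq> \<zero>}. {v. v - p \<in> {w. s w \<noteq> \<zero>}})"
  proof (rule subsetI, rule ccontr)
    fix v assume v: "v \<in> {v. series_mult R a s v \<noteq> \<zero>}" "v \<notin> (\<Union>p\<in>{w. a w \<noteq> \<zero>}. {v. v - p \<in> {w. s w \<noteq> \<zero>}})"
    have "{p. a p \<noteq> \<zero> \<and> s (v - p) \<noteq> \<zero>} = {}" using v(2) by blast
    then have "series_mult R a s v = \<zero>" unfolding series_mult_def by (simp only: finsum_empty)
    then show False using v(1) by simp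
  qed
qed

lemma pol_supp: "f \<in> pol n \<Longrightarrow> finite (supp f)"
  by (simp add: pol_iff)

lemma pol_vec: "f \<in> pol n \<Longrightarrow> f v \<in> vecs e (rk n)"
  by (simp add: pol_iff)

lemma cnv_cmpl: "g \<in> pol n \<Longrightarrow> s \<in> ser \<Longrightarrow> cnv g s \<in> cmpl \<S> n"
proof -
  assume g: "g \<in> pol n" and s: "s \<in> ser"
  have "cnv g s v \<in> vecs e (rk n)" for v
  proof (rule vecsI)
    show "e * cnv g s v i = cnv g s v i" for i
      by (simp add: cnv_def sum_distrib_left mult.assoc[symmetric] pol_e[OF g])
    show "cnv g s v i = 0" if "rk n \<le> i" for i
      using vecsD(2)[OF pol_vec[OF g] that] by (simp add: cnv_def)
  qed
  moreover have "supp (cnv g s) \<in> \<S>"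
    by (rule support_idealD(2)[OF ideal support_ideal_UN[OF ideal pol_supp[OF g]] supp_cnv])
      (rule support_idealD(4)[OF ideal serD(3)[OF s]])
  ultimately show ?thesis by (simp add: cmpl_def)
qed

lemma cnv_dif:
  assumes g: "g \<in> pol n"
  shows "cnv (dif n g) s = dif n (cnv g s)"
proof (intro ext)
  fix v i
  let ?m = "\<lambda>p. mat_act (rk (n + 1)) (rk n) (D n p)"
  define Q where "Q = (\<Union>p\<in>P. {v. v - p \<in> supp g})"
  have Q: "finite Q" unfolding Q_def by (intro finite_UN_I P finite_shift pol_supp[OF g])
  have m0: "?m p (g r) i = 0" if "r \<notin> supp g" for p r
    using that by (simp add: supp_def mat_act_def)
  have "cnv (dif n g) s v i = (\<Sum>q\<in>Q. dif n g q i * em (s (v - q)))"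
    by (rule cnv_eq[OF Q]) (unfold Q_def, rule supp_dif)
  also have "\<dots> = (\<Sum>q\<in>Q. \<Sum>p\<in>P. ?m p (g (q - p)) i * em (s (v - q)))"
    by (simp add: dif_apply sum_fun_app sum_distrib_right)
  also have "\<dots> = (\<Sum>p\<in>P. \<Sum>q\<in>Q. ?m p (g (q - p)) i * em (s (v - q)))" by (rule sum.swap)
  also have "\<dots> = (\<Sum>p\<in>P. ?m p (cnv g s (v - p)) i)"
  proof (rule sum.cong[OF refl])
    fix p assume p: "p \<in> P"
    have sub: "supp g \<subseteq> (\<lambda>q. q - p) ` Q"
    proof
      fix r assume r: "r \<in> supp g"
      have "r + p \<in> Q" unfolding Q_def by (rule UN_I[OF p]) (use r in simp)
      then have "r + p - p \<in> (\<lambda>q. q - p) ` Q" by (rule imageI)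
      then show "r \<in> (\<lambda>q. q - p) ` Q" by simp
    qed
    have "(\<Sum>q\<in>Q. ?m p (g (q - p)) i * em (s (v - q))) = (\<Sum>q\<in>Q. ?m p (g (q - p)) i * em (s (v - p - (q - p))))"
      by simp
    also have "\<dots> = (\<Sum>r\<in>(\<lambda>q. q - p) ` Q. ?m p (g r) i * em (s (v - p - r)))"
      by (subst sum.reindex) (simp_all add: inj_on_def)
    also have "\<dots> = (\<Sum>r\<in>supp g. ?m p (g r) i * em (s (v - p - r)))"
      by (rule sum.mono_neutral_right[OF finite_imageI[OF Q] sub]) (auto simp: m0)
    also have "\<dots> = ?m p (\<lambda>i. \<Sum>r\<in>supp g. g r i * em (s (v - p - r))) i" by (rule mat_act_sum[symmetric])
    finally show "(\<Sum>q\<in>Q. ?m p (g (q - p)) i * em (s (v - q))) = ?m p (cnv g s (v - p)) i" by (simp add: cnv_def)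
  qed
  finally show "cnv (dif n g) s v i = dif n (cnv g s) v i" by (simp add: dif_apply sum_fun_app)
qed

text \<open>The additive extension of the pairing of a module element with a series, which exists by
  the universal property of the free abelian group. It computes coordinates of formal sums of
  tensors and will identify the tensor product with \<open>cmpl \<S> n\<close>.\<close>

definition T :: "int \<Rightarrow> ('m \<times> 'a series \<Rightarrow>\<^sub>0 int) \<Rightarrow> int \<times> int \<Rightarrow> nat \<Rightarrow> 'a uring"
  where "T n = (SOME h. h \<in> hom (tensor_free (obj C n) S) additive_group
    \<and> (\<forall>k\<in>pairs n. h (frag_of k) = cnv (\<Theta> n (fst k)) (snd k)))"

lemma T: "T n \<in> hom (tensor_free (obj C n) S) additive_group \<and> (\<forall>k\<in>pairs n. T n (frag_of k) = cnv (\<Theta> n (fst k)) (snd k))"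
proof -
  define Q where "Q = (\<lambda>h. h \<in> hom (tensor_free (obj C n) S) additive_group
    \<and> (\<forall>k\<in>pairs n. h (frag_of k) = cnv (\<Theta> n (fst k)) (snd k)))"
  have im: "(\<lambda>k. cnv (\<Theta> n (fst k)) (snd k)) ` (carrier (obj C n) \<times> carrier S) \<subseteq> carrier additive_group"
    by (simp add: additive_group_def)
  have "\<exists>h. Q h"
  proof (rule comm_group.free_Abelian_group_universal[OF comm_group_additive_group im])
    fix h assume h: "h \<in> hom (tensor_free (obj C n) S) additive_group"
      "\<And>k. k \<in> carrier (obj C n) \<times> carrier S \<Longrightarrow> h (frag_of k) = cnv (\<Theta> n (fst k)) (snd k)"
    have "Q h" unfolding Q_def
    proof (intro conjI ballI h(1))
      fix k assume "k \<in> pairs n"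
      then show "h (frag_of k) = cnv (\<Theta> n (fst k)) (snd k)" by (intro h(2)) (simp only: S_simps)
    qed
    then show "\<exists>h. Q h" by (rule exI[of Q])
  qed
  then have "Q (SOME h. Q h)" by (rule someI_ex)
  then show ?thesis unfolding Q_def T_def .
qed

lemma T_of: "x \<in> carrier (obj C n) \<Longrightarrow> s \<in> ser \<Longrightarrow> T n (frag_of (x, s)) = cnv (\<Theta> n x) s"
  using conjunct2[OF T, of n] by auto

lemma T_add: "keys c \<subseteq> pairs n \<Longrightarrow> keys d \<subseteq> pairs n \<Longrightarrow> T n (c + d) = T n c + T n d"
  using hom_mult[OF conjunct1[OF T], of c n d] by (simp add: S_simps additive_group_def)

lemma T_diff: "keys c \<subseteq> pairs n \<Longrightarrow> keys d \<subseteq> pairs n \<Longrightarrow> T n (c - d) = T n c - T n d"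
proof -
  assume c: "keys c \<subseteq> pairs n" "keys d \<subseteq> pairs n"
  have "T n (c - d + d) = T n (c - d) + T n d" by (rule T_add[OF frag_diff[OF c] c(2)])
  then show ?thesis unfolding diff_add_cancel by (simp only: eq_diff_eq)
qed

lemma T_0: "T n 0 = 0"
  using T_diff[of 0 n 0] by (simp only: diff_self keys_zero empty_subsetI)

lemma T_sum: "(\<And>i. i \<in> I \<Longrightarrow> keys (f i) \<subseteq> pairs n) \<Longrightarrow> T n (sum f I) = (\<Sum>i\<in>I. T n (f i)) \<and> keys (sum f I) \<subseteq> pairs n"
proof (induction I rule: infinite_finite_induct)
  case (insert i I)
  have i: "keys (f i) \<subseteq> pairs n" using insert.prems by simp
  have IH: "T n (sum f I) = (\<Sum>i\<in>I. T n (f i))" "keys (sum f I) \<subseteq> pairs n" using insert by auto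
  show ?case unfolding sum.insert[OF insert.hyps] T_add[OF i IH(2)] IH(1) by (rule conjI[OF refl frag_add[OF i IH(2)]])
qed (simp_all add: T_0)

lemma of_keys: "x \<in> carrier (obj C n) \<Longrightarrow> s \<in> ser \<Longrightarrow> keys (frag_of (x, s)) \<subseteq> pairs n"
  by simp

lemma T_cmpl: "keys c \<subseteq> pairs n \<Longrightarrow> T n c \<in> cmpl \<S> n"
proof -
  assume c: "keys c \<subseteq> pairs n"
  have "keys c \<subseteq> pairs n \<and> T n c \<in> cmpl \<S> n"
    using c
  proof (induction c rule: frag_induction)
    case zero
    show ?case unfolding T_0 by (rule conjI[OF _ add_subgroup_zero[OF cmpl_subgroup[OF ideal]]]) simp
  next
    case (one k)
    obtain x s where k: "k = (x, s)" by (cases k)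
    have xs: "x \<in> carrier (obj C n)" "s \<in> ser" using one k by simp_all
    show ?case unfolding k T_of[OF xs] using cnv_cmpl[OF \<Theta>_pol[OF xs(1)] xs(2)] of_keys[OF xs] by blast
  next
    case (diff a b)
    have a: "keys a \<subseteq> pairs n" "T n a \<in> cmpl \<S> n" by (rule conjunct1[OF diff.IH(1)], rule conjunct2[OF diff.IH(1)])
    have b: "keys b \<subseteq> pairs n" "T n b \<in> cmpl \<S> n" by (rule conjunct1[OF diff.IH(2)], rule conjunct2[OF diff.IH(2)])
    show ?case unfolding T_diff[OF a(1) b(1)]
      by (rule conjI[OF frag_diff[OF a(1) b(1)] add_subgroup_diff[OF cmpl_subgroup[OF ideal] a(2) b(2)]])
  qed
  then show ?thesis ..
qed

lemma rmodC: "abelian_group (obj C n)"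
  using rmC[of n] by (simp add: right_module_def)

text \<open>The first two kinds of relation are killed because \<open>cnv\<close> is additive in
  each argument, and the balancing relation is \<open>cnv_assoc\<close>.\<close>

lemma rels_T: "c \<in> tensor_rels K (obj C n) S \<Longrightarrow> keys c \<subseteq> pairs n \<and> T n c = 0"
proof -
  assume c: "c \<in> tensor_rels K (obj C n) S"
  interpret M: right_module K "obj C n" by (rule rmC)
  consider x y s where "c = frag_of (x \<oplus>\<^bsub>obj C n\<^esub> y, s) - frag_of (x, s) - frag_of (y, s)"
      "x \<in> carrier (obj C n)" "y \<in> carrier (obj C n)" "s \<in> ser"
    | x s t where "c = frag_of (x, \<lambda>v. s v \<oplus> t v) - frag_of (x, s) - frag_of (x, t)" "x \<in> carrier (obj C n)" "s \<in> ser" "t \<in> ser"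
    | x a s where "c = frag_of (x \<cdot>\<^bsub>obj C n\<^esub> a, s) - frag_of (x, series_mult R a s)"
      "x \<in> carrier (obj C n)" "a \<in> carrier K" "s \<in> ser"
    using c unfolding tensor_rels_def S_simps by blast
  then show ?thesis
  proof cases
    case 1
    note m = M.M.a_closed[OF 1(2,3)]
    have k: "keys (frag_of (x \<oplus>\<^bsub>obj C n\<^esub> y, s)) \<subseteq> pairs n" "keys (frag_of (x, s)) \<subseteq> pairs n" "keys (frag_of (y, s)) \<subseteq> pairs n"
      by (rule of_keys[OF m 1(4)], rule of_keys[OF 1(2,4)], rule of_keys[OF 1(3,4)])
    have "T n c = 0"
      unfolding 1(1) T_diff[OF frag_diff[OF k(1,2)] k(3)] T_diff[OF k(1,2)] T_of[OF m 1(4)] T_of[OF 1(2,4)] T_of[OF 1(3,4)]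
        \<Theta>_add[OF 1(2,3)] cnv_add[OF pol_supp[OF \<Theta>_pol[OF 1(2)]] pol_supp[OF \<Theta>_pol[OF 1(3)]]] by simp
    then show ?thesis unfolding 1(1) using frag_diff[OF frag_diff[OF k(1,2)] k(3)] by blast
  next
    case 2
    have m: "(\<lambda>v. s v \<oplus> t v) \<in> ser"
    proof (rule serI[of _ "{v. s v \<noteq> \<zero>} \<union> {v. t v \<noteq> \<zero>}"])
      show "s v \<oplus> t v \<in> carrier R" for v by (rule a_closed[OF serD(2)[OF 2(3)] serD(2)[OF 2(4)]])
      show "{v. s v \<noteq> \<zero>} \<union> {v. t v \<noteq> \<zero>} \<in> \<S>" by (rule support_idealD(3)[OF ideal serD(3)[OF 2(3)] serD(3)[OF 2(4)]])
      show "{v. s v \<oplus> t v \<noteq> \<zero>} \<subseteq> {v. s v \<noteq> \<zero>} \<union> {v. t v \<noteq> \<zero>}" by auto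
    qed
    have k: "keys (frag_of (x, \<lambda>v. s v \<oplus> t v)) \<subseteq> pairs n" "keys (frag_of (x, s)) \<subseteq> pairs n" "keys (frag_of (x, t)) \<subseteq> pairs n"
      by (rule of_keys[OF 2(2) m], rule of_keys[OF 2(2,3)], rule of_keys[OF 2(2,4)])
    have "T n c = 0"
      unfolding 2(1) T_diff[OF frag_diff[OF k(1,2)] k(3)] T_diff[OF k(1,2)] T_of[OF 2(2) m] T_of[OF 2(2,3)] T_of[OF 2(2,4)]
        cnv_add_series[OF serD(1)[OF 2(3)] serD(1)[OF 2(4)]] by simp
    then show ?thesis unfolding 2(1) using frag_diff[OF frag_diff[OF k(1,2)] k(3)] by blast
  next
    case 3
    note m = M.ract_closed[OF 3(2,3)] and m' = ser_mult[OF 3(3,4)]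
    have k: "keys (frag_of (x \<cdot>\<^bsub>obj C n\<^esub> a, s)) \<subseteq> pairs n" "keys (frag_of (x, series_mult R a s)) \<subseteq> pairs n"
      by (rule of_keys[OF m 3(4)], rule of_keys[OF 3(2) m'])
    have "\<Theta> n (x \<cdot>\<^bsub>obj C n\<^esub> a) = cnv (\<Theta> n x) a" unfolding \<Theta>_ract[OF 3(2,3)] cnv_def ..
    then have "T n c = 0"
      unfolding 3(1) T_diff[OF k] T_of[OF m 3(4)] T_of[OF 3(2) m']
      using cnv_assoc[OF pol_supp[OF \<Theta>_pol[OF 3(2)]] 3(3) serD(1)[OF 3(4)]] by simp
    then show ?thesis unfolding 3(1) using frag_diff[OF k] by blast
  qed
qed

lemma \<Theta>_cnv: "x \<in> carrier (obj C n) \<Longrightarrow> a \<in> carrier K \<Longrightarrow> \<Theta> n (x \<cdot>\<^bsub>obj C n\<^esub> a) = cnv (\<Theta> n x) a"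
  unfolding \<Theta>_ract cnv_def by (rule refl)

lemma kr_subgroup: "subgroup (kr n) (tensor_free (obj C n) S)"
  unfolding tensor_ker_def
  by (rule group.generate_is_subgroup[OF group_free_Abelian_group]) (auto simp: S_simps dest!: rels_T)

lemma kr_rels: "c \<in> tensor_rels K (obj C n) S \<Longrightarrow> c \<in> kr n"
  unfolding tensor_ker_def by (rule generate.incl)

lemma kr_keys: "c \<in> kr n \<Longrightarrow> keys c \<subseteq> pairs n"
proof -
  assume "c \<in> kr n"
  then have "c \<in> carrier (tensor_free (obj C n) S)" using subgroup.subset[OF kr_subgroup[of n]] by blast
  then show ?thesis by (simp only: carrier_free_Abelian_group_iff S_simps)
qed

lemma kr_add: "c \<in> kr n \<Longrightarrow> d \<in> kr n \<Longrightarrow> c + d \<in> kr n"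
  using subgroup.m_closed[OF kr_subgroup[of n], of c d] by simp

lemma kr_zero: "0 \<in> kr n"
  using subgroup.one_closed[OF kr_subgroup[of n]] by simp

lemma kr_uminus: "c \<in> kr n \<Longrightarrow> - c \<in> kr n"
  using subgroup.m_inv_closed[OF kr_subgroup[of n], of c] kr_keys[of c n] inv_free_Abelian_group[of c "carrier (obj C n) \<times> carrier S"]
  by (simp add: S_simps)

lemma kr_diff: "c \<in> kr n \<Longrightarrow> d \<in> kr n \<Longrightarrow> c - d \<in> kr n"
  using kr_add[of c n "- d"] kr_uminus[of d n] by simp

lemma kr_sum: "(\<And>i. i \<in> I \<Longrightarrow> f i \<in> kr n) \<Longrightarrow> sum f I \<in> kr n"
  by (induction I rule: infinite_finite_induct) (simp_all add: kr_zero kr_add)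

lemma T_kr: "c \<in> kr n \<Longrightarrow> T n c = 0"
proof -
  let ?H = "{c. keys c \<subseteq> pairs n \<and> T n c = 0}"
  have H: "subgroup ?H (tensor_free (obj C n) S)"
  proof (rule group.subgroupI[OF group_free_Abelian_group])
    show "?H \<subseteq> carrier (tensor_free (obj C n) S)" by (auto simp: S_simps)
    have "0 \<in> ?H" by (simp add: T_0)
    then show "?H \<noteq> {}" by blast
    fix a assume "a \<in> ?H"
    then have a: "keys a \<subseteq> pairs n" "T n a = 0" by simp_all
    have "- a \<in> ?H" using frag_diff[of 0 "pairs n" a] T_diff[of 0 n a] a by (simp add: T_0)
    then show "inv\<^bsub>tensor_free (obj C n) S\<^esub> a \<in> ?H"
      using inv_free_Abelian_group[of a "carrier (obj C n) \<times> carrier S"] a(1) unfolding S_simps by simp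
    fix b assume "b \<in> ?H"
    then have b: "keys b \<subseteq> pairs n" "T n b = 0" by simp_all
    show "a \<otimes>\<^bsub>tensor_free (obj C n) S\<^esub> b \<in> ?H"
      using frag_add[OF a(1) b(1)] T_add[OF a(1) b(1)] a(2) b(2) by simp
  qed
  have "kr n \<subseteq> ?H"
    unfolding tensor_ker_def
    by (rule group.generate_subgroup_incl[OF group_free_Abelian_group _ H]) (use rels_T in blast)
  then show "c \<in> kr n \<Longrightarrow> T n c = 0" by blast
qed

lemma kr_add1: "x \<in> carrier (obj C n) \<Longrightarrow> y \<in> carrier (obj C n) \<Longrightarrow> s \<in> ser
    \<Longrightarrow> frag_of (x \<oplus>\<^bsub>obj C n\<^esub> y, s) - frag_of (x, s) - frag_of (y, s) \<in> kr n"
  by (rule kr_rels) (unfold tensor_rels_def S_simps, blast)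

lemma kr_add2: "x \<in> carrier (obj C n) \<Longrightarrow> s \<in> ser \<Longrightarrow> t \<in> ser
    \<Longrightarrow> frag_of (x, \<lambda>v. s v \<oplus> t v) - frag_of (x, s) - frag_of (x, t) \<in> kr n"
  by (rule kr_rels) (unfold tensor_rels_def S_simps, blast)

lemma kr_bal: "x \<in> carrier (obj C n) \<Longrightarrow> a \<in> carrier K \<Longrightarrow> s \<in> ser
    \<Longrightarrow> frag_of (x \<cdot>\<^bsub>obj C n\<^esub> a, s) - frag_of (x, series_mult R a s) \<in> kr n"
  by (rule kr_rels) (unfold tensor_rels_def S_simps, blast)

lemma kr_zero2: "x \<in> carrier (obj C n) \<Longrightarrow> frag_of (x, \<lambda>v. \<zero>) \<in> kr n"
proof -
  assume x: "x \<in> carrier (obj C n)"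
  have "frag_of (x, \<lambda>v. \<zero> \<oplus> \<zero>) - frag_of (x, \<lambda>v. \<zero>) - frag_of (x, \<lambda>v. \<zero>) \<in> kr n" by (rule kr_add2[OF x ser_zero ser_zero])
  then have "- frag_of (x, \<lambda>v. \<zero>) \<in> kr n" unfolding l_zero[OF zero_closed] by simp
  from kr_uminus[OF this] show ?thesis by simp
qed

lemma kr_zero1: "s \<in> ser \<Longrightarrow> frag_of (\<zero>\<^bsub>obj C n\<^esub>, s) \<in> kr n"
proof -
  assume s: "s \<in> ser"
  interpret M: abelian_group "obj C n" by (rule rmodC)
  have "frag_of (\<zero>\<^bsub>obj C n\<^esub> \<oplus>\<^bsub>obj C n\<^esub> \<zero>\<^bsub>obj C n\<^esub>, s) - frag_of (\<zero>\<^bsub>obj C n\<^esub>, s) - frag_of (\<zero>\<^bsub>obj C n\<^esub>, s) \<in> kr n"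
    by (rule kr_add1[OF M.zero_closed M.zero_closed s])
  then have "- frag_of (\<zero>\<^bsub>obj C n\<^esub>, s) \<in> kr n" unfolding M.l_zero[OF M.zero_closed] by simp
  from kr_uminus[OF this] show ?thesis by simp
qed

lemma kr_finsum:
  assumes s: "s \<in> ser" and "finite J" "\<And>j. j \<in> J \<Longrightarrow> h j \<in> carrier (obj C n)"
  shows "frag_of (finsum (obj C n) h J, s) - (\<Sum>j\<in>J. frag_of (h j, s)) \<in> kr n"
  using assms(2,3)
proof (induction J rule: finite_induct)
  interpret M: abelian_group "obj C n" by (rule rmodC)
  case empty
  show ?case unfolding M.finsum_empty sum.empty using kr_zero1[OF s] by simp
next
  interpret M: abelian_group "obj C n" by (rule rmodC)
  case (insert j J)
  have c: "h j \<in> carrier (obj C n)" "h \<in> J \<rightarrow> carrier (obj C n)" using insert.prems by auto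
  have IH: "frag_of (finsum (obj C n) h J, s) - (\<Sum>j\<in>J. frag_of (h j, s)) \<in> kr n" using insert by auto
  have e: "finsum (obj C n) h (insert j J) = h j \<oplus>\<^bsub>obj C n\<^esub> finsum (obj C n) h J"
    by (rule M.finsum_insert[OF insert.hyps c(2) c(1)])
  have k: "x - (a + b) = (x - a - y) + (y - b)" for x a b y :: "'m \<times> 'a series \<Rightarrow>\<^sub>0 int" by simp
  show ?case unfolding e sum.insert[OF insert.hyps] k[of _ _ _ "frag_of (finsum (obj C n) h J, s)"]
    by (rule kr_add[OF kr_add1[OF c(1) M.finsum_closed[OF c(2)] s] IH])
qed

section \<open>Normal forms of tensors\<close>

abbreviation "bs n j \<equiv> inv\<Theta> n (unit_pol j)"

lemma bs: "j < rk n \<Longrightarrow> bs n j \<in> carrier (obj C n)" "j < rk n \<Longrightarrow> \<Theta> n (bs n j) = unit_pol j"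
  using unit_pol[of j n] bij_betw_inv_into_right[OF \<Theta>_bij, of "unit_pol j" n] coord.d[OF coordC, of "unit_pol j" n]
  by (simp_all add: CR_simps)

lemma cnv_unit: "(\<And>v. s v \<in> carrier R) \<Longrightarrow> cnv (unit_pol j) s = (\<lambda>v i. if i = j then em (s v) else 0)"
proof (intro ext)
  fix v i assume s: "\<And>v. s v \<in> carrier R"
  have "supp (unit_pol j) \<subseteq> {0}" by (auto simp: supp_def unit_pol_def fun_eq_iff split: if_splits)
  then have "cnv (unit_pol j) s v i = (\<Sum>p\<in>{0}. unit_pol j p i * em (s (v - p)))" by (intro cnv_eq) simp_all
  then show "cnv (unit_pol j) s v i = (if i = j then em (s v) else 0)" by (simp add: unit_pol_def one_em[OF s])
qed

lemma pol_eqI: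
  assumes "f \<in> pol n" "(\<Sum>j<rk n. (\<lambda>v i. if i = j then em (pr (f v j)) else 0)) = g"
  shows "g = f"
proof (intro ext)
  fix v i
  have "g v i = (\<Sum>j<rk n. if i = j then em (pr (f v j)) else 0)" unfolding assms(2)[symmetric] by (simp add: sum_fun_app)
  also have "\<dots> = f v i"
  proof (cases "i < rk n")
    case True
    then show ?thesis by (simp add: em_pr pol_e[OF assms(1)])
  next
    case False
    then show ?thesis using vecsD(2)[OF pol_vec[OF assms(1)], of i v] by simp
  qed
  finally show "g v i = f v i" .
qed

lemma pr_poly: "f \<in> pol n \<Longrightarrow> (\<lambda>v. pr (f v j)) \<in> carrier K"
proof -
  assume f: "f \<in> pol n"
  have "{v. pr (f v j) \<noteq> \<zero>} \<subseteq> supp f" by (auto simp: supp_def pr_zero)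
  then show ?thesis using pol_supp[OF f] by (auto simp: LPoly_carrier series_on_def intro: finite_subset)
qed

lemma basis_expand:
  assumes x: "x \<in> carrier (obj C n)"
  shows "x = finsum (obj C n) (\<lambda>j. bs n j \<cdot>\<^bsub>obj C n\<^esub> (\<lambda>v. pr (\<Theta> n x v j))) {..<rk n}"
proof -
  interpret M: right_module K "obj C n" by (rule rmC)
  let ?h = "\<lambda>j. bs n j \<cdot>\<^bsub>obj C n\<^esub> (\<lambda>v. pr (\<Theta> n x v j))"
  have hc: "?h j \<in> carrier (obj C n)" if "j < rk n" for j by (rule M.ract_closed[OF bs(1)[OF that] pr_poly[OF \<Theta>_pol[OF x]]])
  have h: "\<Theta> n (?h j) = (\<lambda>v i. if i = j then em (pr (\<Theta> n x v j)) else 0)" if "j < rk n" for j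
    unfolding \<Theta>_cnv[OF bs(1)[OF that] pr_poly[OF \<Theta>_pol[OF x]]] bs(2)[OF that] by (rule cnv_unit) simp
  have s: "\<Theta> n (finsum (obj C n) ?h {..<rk n}) = (\<Sum>j<rk n. \<Theta> n (?h j)) \<and> finsum (obj C n) ?h {..<rk n} \<in> carrier (obj C n)"
    by (rule finsum_map[OF rmodC finite_lessThan hc \<Theta>_add]) simp
  have "(\<Sum>j<rk n. \<Theta> n (?h j)) = (\<Sum>j<rk n. (\<lambda>v i. if i = j then em (pr (\<Theta> n x v j)) else 0))"
    by (rule sum.cong[OF refl]) (simp only: h lessThan_iff)
  from trans[OF sym[OF this] sym[OF conjunct1[OF s]]]
  have "\<Theta> n (finsum (obj C n) ?h {..<rk n}) = \<Theta> n x" by (rule pol_eqI[OF \<Theta>_pol[OF x]])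
  from sym[OF this] show ?thesis by (rule \<Theta>_inj[OF x conjunct2[OF s]])
qed

text \<open>Expanding the module element in the basis and moving the polynomial coefficients across
  the tensor sign leaves one series for each basis element.\<close>

lemma normal_form:
  assumes "keys c \<subseteq> pairs n"
  shows "\<exists>s. (\<forall>j<rk n. s j \<in> ser) \<and> c - (\<Sum>j<rk n. frag_of (bs n j, s j)) \<in> kr n"
  using assms
proof (induction c rule: frag_induction)
  case zero
  have "(\<Sum>j<rk n. frag_of (bs n j, \<lambda>v. \<zero>)) \<in> kr n" by (rule kr_sum) (simp add: kr_zero2 bs(1))
  then show ?case using kr_uminus ser_zero by (intro exI[of _ "\<lambda>j v. \<zero>"]) simp
next
  case (one k)
  obtain x s where k: "k = (x, s)" by (cases k)
  have x: "x \<in> carrier (obj C n)" and s: "s \<in> ser" using one k by simp_all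
  interpret M: right_module K "obj C n" by (rule rmC)
  define a where "a = (\<lambda>j v. pr (\<Theta> n x v j))"
  have a: "a j \<in> carrier K" for j unfolding a_def by (rule pr_poly[OF \<Theta>_pol[OF x]])
  let ?h = "\<lambda>j. bs n j \<cdot>\<^bsub>obj C n\<^esub> a j"
  have xe: "finsum (obj C n) ?h {..<rk n} = x" unfolding a_def by (rule basis_expand[OF x, symmetric])
  have 1: "frag_of (finsum (obj C n) ?h {..<rk n}, s) - (\<Sum>j<rk n. frag_of (?h j, s)) \<in> kr n"
    by (rule kr_finsum[OF s]) (simp_all add: M.ract_closed bs(1) a)
  have 2: "(\<Sum>j<rk n. frag_of (?h j, s) - frag_of (bs n j, series_mult R (a j) s)) \<in> kr n"
    by (rule kr_sum) (rule kr_bal[OF bs(1) a s], simp)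
  have "frag_of (x, s) - (\<Sum>j<rk n. frag_of (bs n j, series_mult R (a j) s)) \<in> kr n"
    using kr_add[OF 1 2] unfolding xe by (simp add: sum_subtractf)
  then show ?case unfolding k by (intro exI[of _ "\<lambda>j. series_mult R (a j) s"] conjI allI impI ser_mult[OF a s])
next
  case (diff a b)
  from diff.IH(1) obtain s where s0: "(\<forall>j<rk n. s j \<in> ser) \<and> a - (\<Sum>j<rk n. frag_of (bs n j, s j)) \<in> kr n" by (elim exE)
  from diff.IH(2) obtain t where t0: "(\<forall>j<rk n. t j \<in> ser) \<and> b - (\<Sum>j<rk n. frag_of (bs n j, t j)) \<in> kr n" by (elim exE)
  note s = conjunct1[OF s0, rule_format] conjunct2[OF s0]
  note t = conjunct1[OF t0, rule_format] conjunct2[OF t0]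
  define u where "u = (\<lambda>j v. s j v \<ominus> t j v)"
  have u: "u j \<in> ser" if "j < rk n" for j unfolding u_def by (rule ser_minus[OF s(1)[OF that] t(1)[OF that]])
  have "(\<Sum>j<rk n. frag_of (bs n j, s j) - frag_of (bs n j, u j) - frag_of (bs n j, t j)) \<in> kr n"
  proof (rule kr_sum)
    fix j assume "j \<in> {..<rk n}"
    then have j: "j < rk n" by simp
    have "(\<lambda>v. u j v \<oplus> t j v) = s j" unfolding u_def by (rule minus_plus[OF s(1)[OF j] t(1)[OF j]])
    then show "frag_of (bs n j, s j) - frag_of (bs n j, u j) - frag_of (bs n j, t j) \<in> kr n"
      using kr_add2[OF bs(1)[OF j] u[OF j] t(1)[OF j]] by (simp only:)
  qed
  note m = kr_add[OF kr_diff[OF s(2) t(2)] this[unfolded sum_subtractf]]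
  have alg: "(a' - A) - (b' - B) + (A - U - B) = a' - b' - U" for a' b' A B U :: "'m \<times> 'a series \<Rightarrow>\<^sub>0 int" by simp
  have "a - b - (\<Sum>j<rk n. frag_of (bs n j, u j)) \<in> kr n" using m unfolding alg .
  then show ?case using u by (intro exI[of _ u]) simp
qed

lemma T_normal:
  assumes s: "\<And>j. j < rk n \<Longrightarrow> s j \<in> ser"
  shows "T n (\<Sum>j<rk n. frag_of (bs n j, s j)) = (\<lambda>v i. if i < rk n then em (s i v) else 0)"
    and "keys (\<Sum>j<rk n. frag_of (bs n j, s j)) \<subseteq> pairs n"
proof -
  have k: "keys (frag_of (bs n j, s j)) \<subseteq> pairs n" if "j < rk n" for j by (rule of_keys[OF bs(1)[OF that] s[OF that]])
  have t: "T n (frag_of (bs n j, s j)) = (\<lambda>v i. if i = j then em (s j v) else 0)" if "j < rk n" for j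
    unfolding T_of[OF bs(1)[OF that] s[OF that]] bs(2)[OF that] by (rule cnv_unit[OF serD(2)[OF s[OF that]]])
  have S: "T n (\<Sum>j<rk n. frag_of (bs n j, s j)) = (\<Sum>j<rk n. T n (frag_of (bs n j, s j)))
      \<and> keys (\<Sum>j<rk n. frag_of (bs n j, s j)) \<subseteq> pairs n"
    by (rule T_sum) (rule k, simp)
  show "keys (\<Sum>j<rk n. frag_of (bs n j, s j)) \<subseteq> pairs n" by (rule conjunct2[OF S])
  have "(\<Sum>j<rk n. T n (frag_of (bs n j, s j))) = (\<Sum>j<rk n. (\<lambda>v i. if i = j then em (s j v) else 0))"
    by (rule sum.cong[OF refl]) (rule t, simp)
  also have "\<dots> = (\<lambda>v i. if i < rk n then em (s i v) else 0)" by (intro ext) (simp add: sum_fun_app)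
  finally show "T n (\<Sum>j<rk n. frag_of (bs n j, s j)) = (\<lambda>v i. if i < rk n then em (s i v) else 0)"
    using conjunct1[OF S] by (simp only:)
qed

text \<open>Modulo the relations an element is in normal form, and \<open>T\<close> displays the
  series of a normal form as coordinates. If \<open>T\<close> vanishes, all of these series are
  zero, and so is the tensor.\<close>

lemma kr_eq: "kr n = {c. keys c \<subseteq> pairs n \<and> T n c = 0}"
proof (rule Set.set_eqI, rule iffI)
  fix c assume "c \<in> kr n"
  then show "c \<in> {c. keys c \<subseteq> pairs n \<and> T n c = 0}" using kr_keys T_kr by blast
next
  fix c assume "c \<in> {c. keys c \<subseteq> pairs n \<and> T n c = 0}"
  then have c: "keys c \<subseteq> pairs n" "T n c = 0" by simp_all
  from normal_form[OF c(1)] obtain s where s0: "(\<forall>j<rk n. s j \<in> ser) \<and> c - (\<Sum>j<rk n. frag_of (bs n j, s j)) \<in> kr n"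
    by (elim exE)
  have s: "s j \<in> ser" if "j < rk n" for j using conjunct1[OF s0] that by simp
  note d = conjunct2[OF s0]
  have N: "T n (\<Sum>j<rk n. frag_of (bs n j, s j)) = (\<lambda>v i. if i < rk n then em (s i v) else 0)"
    "keys (\<Sum>j<rk n. frag_of (bs n j, s j)) \<subseteq> pairs n"
    by (rule T_normal(1), erule s) (rule T_normal(2), erule s)
  have "T n c - T n (\<Sum>j<rk n. frag_of (bs n j, s j)) = 0"
    by (rule trans[OF sym[OF T_diff[OF c(1) N(2)]] T_kr[OF d]])
  then have "T n (\<Sum>j<rk n. frag_of (bs n j, s j)) = 0" by (simp only: c(2) diff_0 neg_equal_0_iff_equal)
  then have z: "(\<lambda>v i. if i < rk n then em (s i v) else 0) = 0" by (rule trans[OF sym[OF N(1)]])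
  have "s j = (\<lambda>v. \<zero>)" if j: "j < rk n" for j
  proof
    fix v
    have "em (s j v) = 0" using fun_cong[OF fun_cong[OF z, of v], of j] j by simp
    then show "s j v = \<zero>" using em_0_iff[OF serD(2)[OF s[OF j]]] by blast
  qed
  then have "(\<Sum>j<rk n. frag_of (bs n j, s j)) \<in> kr n" by (intro kr_sum) (simp add: kr_zero2 bs(1))
  from kr_add[OF d this] show "c \<in> kr n" by simp
qed

text \<open>The elements of the tensor product are cosets, that is, fibres of \<open>T\<close>;
  naming a coset by its value under \<open>T\<close> replaces choices of representatives.\<close>

definition fib :: "int \<Rightarrow> (int \<times> int \<Rightarrow> nat \<Rightarrow> 'a uring) \<Rightarrow> ('m \<times> 'a series \<Rightarrow>\<^sub>0 int) set"
  where "fib n w = {c. keys c \<subseteq> pairs n \<and> T n c = w}"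

lemma T_surj:
  assumes w: "w \<in> cmpl \<S> n"
  shows "\<exists>c. keys c \<subseteq> pairs n \<and> T n c = w"
proof -
  have wv: "w v \<in> vecs e (rk n)" for v using w by (simp add: cmpl_def)
  have s: "(\<lambda>v. pr (w v j)) \<in> ser" for j
  proof (rule serI[of _ "supp w"])
    show "{v. pr (w v j) \<noteq> \<zero>} \<subseteq> supp w" by (auto simp: supp_def pr_zero)
    show "supp w \<in> \<S>" using w by (simp add: cmpl_def)
  qed simp
  have "(\<lambda>v i. if i < rk n then em (pr (w v i)) else 0) = w"
    by (intro ext) (use vecsD(1)[OF wv] vecsD(2)[OF wv] in \<open>simp add: em_pr\<close>)
  note we = this
  note N = T_normal[of n "\<lambda>j v. pr (w v j)", OF s]
  show ?thesis by (rule exI, rule conjI, rule N(2), rule trans[OF N(1) we])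
qed

lemma fib_inj: "w \<in> cmpl \<S> n \<Longrightarrow> fib n w = fib n w' \<Longrightarrow> w = w'"
  using T_surj[of w n] unfolding fib_def by blast

lemma coset: "keys c \<subseteq> pairs n \<Longrightarrow> kr n #>\<^bsub>tensor_free (obj C n) S\<^esub> c = fib n (T n c)"
proof (rule Set.set_eqI, rule iffI)
  fix d assume c: "keys c \<subseteq> pairs n"
  {
    assume "d \<in> kr n #>\<^bsub>tensor_free (obj C n) S\<^esub> c"
    then obtain b where b: "b \<in> kr n" "d = b + c" by (auto simp: r_coset_def)
    show "d \<in> fib n (T n c)"
      unfolding fib_def b(2) using frag_add[OF kr_keys[OF b(1)] c] T_add[OF kr_keys[OF b(1)] c] T_kr[OF b(1)] by simp
  }
  assume "d \<in> fib n (T n c)"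
  then have d: "keys d \<subseteq> pairs n" "T n d = T n c" by (simp_all add: fib_def)
  have "d - c \<in> kr n" unfolding kr_eq using frag_diff[OF d(1) c] T_diff[OF d(1) c] d(2) by simp
  then have "(d - c) \<otimes>\<^bsub>tensor_free (obj C n) S\<^esub> c \<in> kr n #>\<^bsub>tensor_free (obj C n) S\<^esub> c" unfolding r_coset_def by blast
  then show "d \<in> kr n #>\<^bsub>tensor_free (obj C n) S\<^esub> c" by simp
qed

section \<open>The tensor complex in coordinates\<close>

abbreviation "TC \<equiv> tensor_cochain K C S"

lemma TC_carrier: "carrier (obj TC n) = fib n ` cmpl \<S> n"
proof -
  let ?F = "tensor_free (obj C n) S"
  have "carrier (obj TC n) = (\<Union>c\<in>carrier ?F. {kr n #>\<^bsub>?F\<^esub> c})"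
    by (simp add: tensor_cochain_def tensor_rmod_def FactGroup_def RCOSETS_def Let_def)
  also have "\<dots> = (\<lambda>c. kr n #>\<^bsub>?F\<^esub> c) ` carrier ?F" by (rule UNION_singleton_eq_range)
  also have "carrier ?F = {c. keys c \<subseteq> pairs n}" by (simp add: free_Abelian_group_def S_simps)
  also have "(\<lambda>c. kr n #>\<^bsub>?F\<^esub> c) ` {c. keys c \<subseteq> pairs n} = (\<lambda>c. fib n (T n c)) ` {c. keys c \<subseteq> pairs n}"
    by (rule image_cong[OF refl]) (rule coset, simp)
  also have "\<dots> = fib n ` (T n ` {c. keys c \<subseteq> pairs n})" by (simp only: image_image)
  also have "T n ` {c. keys c \<subseteq> pairs n} = cmpl \<S> n"
  proof
    show "T n ` {c. keys c \<subseteq> pairs n} \<subseteq> cmpl \<S> n" using T_cmpl by auto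
    show "cmpl \<S> n \<subseteq> T n ` {c. keys c \<subseteq> pairs n}"
    proof
      fix w assume "w \<in> cmpl \<S> n"
      from T_surj[OF this] show "w \<in> T n ` {c. keys c \<subseteq> pairs n}" by blast
    qed
  qed
  finally show ?thesis .
qed

lemma TC_zero: "\<zero>\<^bsub>obj TC n\<^esub> = fib n 0"
  unfolding fib_def kr_eq[symmetric] by (simp add: tensor_cochain_def tensor_rmod_def FactGroup_def Let_def)

lemma T_frag_extend:
  assumes "keys c \<subseteq> pairs n"
  shows "keys (frag_extend (frag_of \<circ> (\<lambda>(x, s). (diff C n x, s))) c) \<subseteq> pairs (n + 1)
    \<and> T (n + 1) (frag_extend (frag_of \<circ> (\<lambda>(x, s). (diff C n x, s))) c) = dif n (T n c) \<and> keys c \<subseteq> pairs n"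
  using assms
proof (induction c rule: frag_induction)
  case zero
  show ?case unfolding frag_extend_0 T_0 dif_zero by simp
next
  case (one k)
  obtain x s where k: "k = (x, s)" by (cases k)
  have x: "x \<in> carrier (obj C n)" and s: "s \<in> ser" using one k by simp_all
  have "T (n + 1) (frag_of (diff C n x, s)) = dif n (T n (frag_of (x, s)))"
    unfolding T_of[OF dC[OF x] s] T_of[OF x s] \<Theta>_dif[OF x] by (rule cnv_dif[OF \<Theta>_pol[OF x]])
  then show ?case using of_keys[OF dC[OF x] s] of_keys[OF x s] unfolding k by simp
next
  case (diff a b)
  note a = diff.IH(1) and b = diff.IH(2)
  show ?case
    unfolding frag_extend_diff T_diff[OF conjunct1[OF a] conjunct1[OF b]]
      T_diff[OF conjunct2[OF conjunct2[OF a]] conjunct2[OF conjunct2[OF b]]] dif_diff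
      conjunct1[OF conjunct2[OF a]] conjunct1[OF conjunct2[OF b]]
    by (intro conjI refl frag_diff[OF conjunct1[OF a] conjunct1[OF b]]
      frag_diff[OF conjunct2[OF conjunct2[OF a]] conjunct2[OF conjunct2[OF b]]])
qed

lemma TC_diff:
  assumes w: "w \<in> cmpl \<S> n"
  shows "diff TC n (fib n w) = fib (n + 1) (dif n w)"
proof -
  let ?\<phi> = "\<lambda>c. kr (n + 1) #>\<^bsub>tensor_free (obj C (n + 1)) S\<^esub> frag_extend (frag_of \<circ> (\<lambda>(x, s). (diff C n x, s))) c"
  have \<phi>: "?\<phi> c = fib (n + 1) (dif n w)" if "c \<in> fib n w" for c
  proof -
    have c: "keys c \<subseteq> pairs n" "T n c = w" using that by (simp_all add: fib_def)
    note t = T_frag_extend[OF c(1)]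
    show ?thesis unfolding coset[OF conjunct1[OF t]] conjunct1[OF conjunct2[OF t]] c(2) ..
  qed
  \<comment> \<open>The induced map is defined through \<open>the_elem\<close> of an image set; that
    set is a singleton because all representatives give the same coset and at least one
    representative exists.\<close>
  have "fib n w \<noteq> {}" using T_surj[OF w] by (auto simp: fib_def)
  then have "?\<phi> ` fib n w = {fib (n + 1) (dif n w)}" using \<phi> by auto
  then show ?thesis by (simp add: tensor_cochain_def tensor_map_def)
qed

text \<open>Through \<open>fib\<close> the tensor complex is the completion \<open>cmpl \<S>\<close>
  with differential \<open>dif\<close>, and \<open>fib_inj\<close> translates equality of cosets
  into equality of coordinates.\<close>

theorem acyclic_tensor_iff: "acyclic_cochain TC \<longleftrightarrow> acyclic_on \<S>"
proof
  assume ac: "acyclic_cochain TC"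
  show "acyclic_on \<S>"
    unfolding acyclic_on_def
  proof (rule allI, rule ballI, rule impI)
    fix n w assume w: "w \<in> cmpl \<S> n" and dw: "dif n w = 0"
    have eq: "{x \<in> carrier (obj TC n). diff TC n x = \<zero>\<^bsub>obj TC (n + 1)\<^esub>} = diff TC (n - 1) ` carrier (obj TC (n - 1))"
      by (rule ac[unfolded acyclic_cochain_def, THEN spec])
    have "fib n w \<in> {x \<in> carrier (obj TC n). diff TC n x = \<zero>\<^bsub>obj TC (n + 1)\<^esub>}"
    proof (rule CollectI, rule conjI)
      show "fib n w \<in> carrier (obj TC n)" unfolding TC_carrier by (rule imageI[OF w])
      show "diff TC n (fib n w) = \<zero>\<^bsub>obj TC (n + 1)\<^esub>" unfolding TC_diff[OF w] dw TC_zero ..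
    qed
    then have "fib n w \<in> diff TC (n - 1) ` carrier (obj TC (n - 1))" unfolding eq .
    then obtain Y where Y: "fib n w = diff TC (n - 1) Y" "Y \<in> carrier (obj TC (n - 1))" by (rule imageE)
    from Y(2)[unfolded TC_carrier] obtain g where g: "Y = fib (n - 1) g" "g \<in> cmpl \<S> (n - 1)" by (rule imageE)
    have "fib n w = fib (n - 1 + 1) (dif (n - 1) g)" unfolding Y(1) g(1) by (rule TC_diff[OF g(2)])
    then have "fib n w = fib n (dif (n - 1) g)" unfolding diff_add_cancel .
    from fib_inj[OF w this] have "dif (n - 1) g = w" by (rule sym)
    then show "\<exists>g\<in>cmpl \<S> (n - 1). dif (n - 1) g = w" by (rule bexI[OF _ g(2)])
  qed
next
  assume ac: "acyclic_on \<S>"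
  show "acyclic_cochain TC"
    unfolding acyclic_cochain_def
  proof
    fix n
    show "{x \<in> carrier (obj TC n). diff TC n x = \<zero>\<^bsub>obj TC (n + 1)\<^esub>} = diff TC (n - 1) ` carrier (obj TC (n - 1))"
    proof (rule Set.equalityI; rule Set.subsetI)
      fix X assume X: "X \<in> {x \<in> carrier (obj TC n). diff TC n x = \<zero>\<^bsub>obj TC (n + 1)\<^esub>}"
      from conjunct1[OF CollectD[OF X], unfolded TC_carrier] obtain w where w: "X = fib n w" "w \<in> cmpl \<S> n" by (rule imageE)
      have "fib (n + 1) (dif n w) = fib (n + 1) 0"
        using conjunct2[OF CollectD[OF X]] unfolding w(1) TC_diff[OF w(2)] TC_zero .
      then have dw: "dif n w = 0" by (rule fib_inj[OF dif_cmpl[OF ideal w(2)]])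
      from ac[unfolded acyclic_on_def, THEN spec, THEN bspec, OF w(2), THEN mp, OF dw]
      obtain g where g: "g \<in> cmpl \<S> (n - 1)" "dif (n - 1) g = w" by (rule bexE)
      have d: "diff TC (n - 1) (fib (n - 1) g) = X" using TC_diff[OF g(1)] unfolding diff_add_cancel g(2) w(1) .
      have "fib (n - 1) g \<in> carrier (obj TC (n - 1))" unfolding TC_carrier by (rule imageI[OF g(1)])
      from imageI[OF this, of "diff TC (n - 1)"] show "X \<in> diff TC (n - 1) ` carrier (obj TC (n - 1))" unfolding d .
    next
      fix X assume "X \<in> diff TC (n - 1) ` carrier (obj TC (n - 1))"
      then obtain Y where Y: "X = diff TC (n - 1) Y" "Y \<in> carrier (obj TC (n - 1))" by (rule imageE)
      from Y(2)[unfolded TC_carrier] obtain g where g: "Y = fib (n - 1) g" "g \<in> cmpl \<S> (n - 1)" by (rule imageE)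
      have "X = fib (n - 1 + 1) (dif (n - 1) g)" unfolding Y(1) g(1) by (rule TC_diff[OF g(2)])
      then have X: "X = fib n (dif (n - 1) g)" unfolding diff_add_cancel .
      have dg: "dif (n - 1) g \<in> cmpl \<S> n" using dif_cmpl[OF ideal g(2)] unfolding diff_add_cancel .
      have gv: "g v \<in> vecs e (rk (n - 1))" for v using g(2) by (simp add: cmpl_def)
      have "dif (n - 1 + 1) (dif (n - 1) g) = 0" by (rule dif_dif[OF gv])
      then have dd: "dif n (dif (n - 1) g) = 0" unfolding diff_add_cancel .
      show "X \<in> {x \<in> carrier (obj TC n). diff TC n x = \<zero>\<^bsub>obj TC (n + 1)\<^esub>}"
      proof (rule CollectI, rule conjI)
        show "X \<in> carrier (obj TC n)" unfolding X TC_carrier by (rule imageI[OF dg])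
        show "diff TC n X = \<zero>\<^bsub>obj TC (n + 1)\<^esub>" unfolding X TC_diff[OF dg] dd TC_zero ..
      qed
    qed
  qed
qed

end

section \<open>Coordinates of a complex of free modules\<close>

context ring
begin

text \<open>This will be \<open>pol n\<close> for \<open>k = rk n\<close>; it is introduced on its
  own because the matrices of the differential are extracted from these coordinates.\<close>

definition coords :: "nat \<Rightarrow> (int \<times> int \<Rightarrow> nat \<Rightarrow> 'a uring) set"
  where "coords k = {f. (\<forall>v. f v \<in> vecs (em \<one>) k) \<and> finite (supp f)}"

definition unit_at :: "nat \<Rightarrow> int \<times> int \<Rightarrow> nat \<Rightarrow> 'a uring"
  where "unit_at j = (\<lambda>v i. if v = 0 \<and> i = j then em \<one> else 0)"

definition crd :: "(int \<times> int \<Rightarrow> nat \<Rightarrow> 'a uring) \<Rightarrow> nat \<Rightarrow> 'a series"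
  where "crd f j = (\<lambda>v. pr (f v j))"

lemma coordsD: "f \<in> coords k \<Longrightarrow> em \<one> * f v i = f v i" "f \<in> coords k \<Longrightarrow> k \<le> i \<Longrightarrow> f v i = 0"
    "f \<in> coords k \<Longrightarrow> finite (supp f)"
proof -
  assume f: "f \<in> coords k"
  then have v: "f v \<in> vecs (em \<one>) k" by (simp add: coords_def)
  show "em \<one> * f v i = f v i" by (rule vecsD(1)[OF v])
  show "finite (supp f)" using f by (simp add: coords_def)
  show "k \<le> i \<Longrightarrow> f v i = 0" by (rule vecsD(2)[OF v])
qed

lemma coordsI: "(\<And>v i. em \<one> * f v i = f v i) \<Longrightarrow> (\<And>v i. k \<le> i \<Longrightarrow> f v i = 0) \<Longrightarrow> finite (supp f) \<Longrightarrow> f \<in> coords k"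
  by (simp add: coords_def vecs_def)

lemma coords_zero: "0 \<in> coords k"
proof (rule coordsI)
  have "supp (0 :: int \<times> int \<Rightarrow> nat \<Rightarrow> 'a uring) = {}" by (simp add: supp_def)
  then show "finite (supp (0 :: int \<times> int \<Rightarrow> nat \<Rightarrow> 'a uring))" by simp
qed simp_all

lemma coords_add: "f \<in> coords k \<Longrightarrow> g \<in> coords k \<Longrightarrow> f + g \<in> coords k"
proof (rule coordsI)
  assume f: "f \<in> coords k" and g: "g \<in> coords k"
  show "em \<one> * (f + g) v i = (f + g) v i" for v i using coordsD(1)[OF f, of v i] coordsD(1)[OF g, of v i] by (simp add: distrib_left)
  show "(f + g) v i = 0" if "k \<le> i" for v i using coordsD(2)[OF f that, of v] coordsD(2)[OF g that, of v] by simp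
  show "finite (supp (f + g))" by (rule finite_subset[OF supp_add]) (use coordsD(3)[OF f] coordsD(3)[OF g] in simp)
qed

lemma coords_sum: "(\<And>i. i \<in> I \<Longrightarrow> f i \<in> coords k) \<Longrightarrow> sum f I \<in> coords k"
  by (induction I rule: infinite_finite_induct) (simp_all add: coords_zero coords_add)

lemma em_crd: "f \<in> coords k \<Longrightarrow> em (crd f j v) = f v j"
  by (simp add: crd_def em_pr coordsD)

lemma crd_poly: "finite (supp f) \<Longrightarrow> crd f j \<in> carrier (LPoly R)"
proof -
  assume f: "finite (supp f)"
  have "{v. pr (f v j) \<noteq> \<zero>} \<subseteq> supp f" by (auto simp: supp_def pr_zero)
  then have "finite {v. pr (f v j) \<noteq> \<zero>}" using f by (rule finite_subset)
  then show ?thesis by (simp add: LPoly_carrier series_on_def crd_def)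
qed

lemma crd_add: "crd (f + g) j = crd f j \<oplus>\<^bsub>LPoly R\<^esub> crd g j"
  unfolding LPoly_simps by (rule ext) (simp add: crd_def pr_add)

lemma cnv_coords:
  assumes f: "f \<in> coords k" and a: "a \<in> carrier (LPoly R)"
  shows "cnv f a \<in> coords k"
proof (rule coordsI)
  show "em \<one> * cnv f a v i = cnv f a v i" for v i
    by (simp add: cnv_def sum_distrib_left mult.assoc[symmetric] coordsD(1)[OF f])
  show "cnv f a v i = 0" if "k \<le> i" for v i by (simp add: cnv_def coordsD(2)[OF f that])
  show "finite (supp (cnv f a))" by (rule finite_supp_cnv[OF coordsD(3)[OF f]]) (use a in \<open>simp add: LPoly_carrier\<close>)
qed

lemma crd_cnv:
  assumes f: "f \<in> coords k" and a: "a \<in> carrier (LPoly R)" and rg: "ring (LPoly R)"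
  shows "crd (cnv f a) j = crd f j \<otimes>\<^bsub>LPoly R\<^esub> a"
proof
  fix v
  have c: "crd f j \<in> carrier (LPoly R)" by (rule crd_poly[OF coordsD(3)[OF f]])
  have so: "crd f j \<in> series_on R" "a \<in> series_on R" using c a by (simp_all add: LPoly_carrier)
  have "crd f j \<otimes>\<^bsub>LPoly R\<^esub> a \<in> carrier (LPoly R)" by (rule ring.ring_simprules(5)[OF rg c a])
  then have m: "(crd f j \<otimes>\<^bsub>LPoly R\<^esub> a) v \<in> carrier R" by (simp add: LPoly_carrier series_on_def)
  have sub: "{p. crd f j p \<noteq> \<zero> \<and> a (v - p) \<noteq> \<zero>} \<subseteq> supp f" by (auto simp: supp_def crd_def pr_zero)
  have "em (crd (cnv f a) j v) = (\<Sum>p\<in>supp f. f p j * em (a (v - p)))"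
    unfolding em_crd[OF cnv_coords[OF f a]] by (simp add: cnv_def)
  also have "\<dots> = (\<Sum>p\<in>supp f. em (crd f j p) * em (a (v - p)))" by (simp add: em_crd[OF f])
  also have "\<dots> = em ((crd f j \<otimes>\<^bsub>LPoly R\<^esub> a) v)"
    unfolding LPoly_simps by (rule em_series_mult[OF so coordsD(3)[OF f] sub, symmetric])
  finally have "em (crd (cnv f a) j v) = em ((crd f j \<otimes>\<^bsub>LPoly R\<^esub> a) v)" .
  moreover have "crd (cnv f a) j v \<in> carrier R" by (simp add: crd_def)
  ultimately show "crd (cnv f a) j v = (crd f j \<otimes>\<^bsub>LPoly R\<^esub> a) v" using em_inj m by blast
qed

lemma unit_coords: "j < k \<Longrightarrow> unit_at j \<in> coords k"
proof (rule coordsI)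
  have "supp (unit_at j) \<subseteq> {0}" by (auto simp: supp_def unit_at_def fun_eq_iff split: if_splits)
  then show "finite (supp (unit_at j))" by (rule finite_subset) simp
qed (auto simp: unit_at_def one_idem)

lemma cnv_unit_at: "s \<in> series_on R \<Longrightarrow> cnv (unit_at j) s = (\<lambda>v i. if i = j then em (s v) else 0)"
proof (intro ext)
  fix v i assume s: "s \<in> series_on R"
  have "supp (unit_at j) \<subseteq> {0}" by (auto simp: supp_def unit_at_def fun_eq_iff split: if_splits)
  then have "cnv (unit_at j) s v i = (\<Sum>p\<in>{0}. unit_at j p i * em (s (v - p)))" by (intro cnv_eq) simp_all
  then show "cnv (unit_at j) s v i = (if i = j then em (s v) else 0)"
    using s by (simp add: unit_at_def one_em series_on_def)
qed

lemma coords_expand: "f \<in> coords k \<Longrightarrow> (\<Sum>j<k. cnv (unit_at j) (crd f j)) = f"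
proof (intro ext)
  fix v i assume f: "f \<in> coords k"
  have so: "crd f j \<in> series_on R" for j using crd_poly[OF coordsD(3)[OF f], of j] by (simp add: LPoly_carrier)
  have "(\<Sum>j<k. cnv (unit_at j) (crd f j)) v i = (\<Sum>j<k. if i = j then f v j else 0)"
    unfolding sum_fun_app cnv_unit_at[OF so] em_crd[OF f] ..
  also have "\<dots> = f v i" using coordsD(2)[OF f, of i v] by (cases "i < k") auto
  finally show "(\<Sum>j<k. cnv (unit_at j) (crd f j)) v i = f v i" .
qed

text \<open>A map that is linear over Laurent polynomials is determined by its values on unit
  vectors. Their coefficients form the matrices \<open>N p\<close>, and \<open>P\<close> collects
  the exponents that occur.\<close>

lemma linear_eq_local_op:
  assumes \<phi>: "\<And>f. f \<in> coords k \<Longrightarrow> \<phi> f \<in> coords m"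
    and add: "\<And>f g. f \<in> coords k \<Longrightarrow> g \<in> coords k \<Longrightarrow> \<phi> (f + g) = \<phi> f + \<phi> g"
    and ract: "\<And>f a. f \<in> coords k \<Longrightarrow> a \<in> carrier (LPoly R) \<Longrightarrow> \<phi> (cnv f a) = cnv (\<phi> f) a"
    and P: "finite P" "\<And>j. j < k \<Longrightarrow> supp (\<phi> (unit_at j)) \<subseteq> P"
    and N: "\<And>p i j. j < k \<Longrightarrow> N p i j = \<phi> (unit_at j) p i"
    and f: "f \<in> coords k"
  shows "\<phi> f = local_op P (\<lambda>p. mat_act m k (N p)) (\<lambda>p. p) f"
proof (intro ext)
  fix v i
  have c: "crd f j \<in> carrier (LPoly R)" for j by (rule crd_poly[OF coordsD(3)[OF f]])
  have z: "\<phi> 0 = 0" using add[OF coords_zero[of k] coords_zero[of k]] by (simp only: add_0_right add_cancel_right_right)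
  have s: "\<phi> (\<Sum>j\<in>J. cnv (unit_at j) (crd f j)) = (\<Sum>j\<in>J. cnv (\<phi> (unit_at j)) (crd f j))" if "finite J" "J \<subseteq> {..<k}" for J
    using that
  proof (induction J rule: finite_induct)
    case empty
    show ?case unfolding sum.empty by (rule z)
  next
    case (insert j J)
    have j: "j < k" "J \<subseteq> {..<k}" using insert.prems by auto
    have 1: "cnv (unit_at j) (crd f j) \<in> coords k" by (rule cnv_coords[OF unit_coords[OF j(1)] c])
    have 2: "(\<Sum>j\<in>J. cnv (unit_at j) (crd f j)) \<in> coords k"
      by (rule coords_sum) (use j(2) in \<open>auto intro!: cnv_coords unit_coords c\<close>)
    show ?case unfolding sum.insert[OF insert.hyps] add[OF 1 2] ract[OF unit_coords[OF j(1)] c] insert.IH[OF j(2)] ..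
  qed
  have "\<phi> f v i = (\<Sum>j<k. cnv (\<phi> (unit_at j)) (crd f j)) v i"
    using s[of "{..<k}"] unfolding coords_expand[OF f] by simp
  also have "\<dots> = (\<Sum>j<k. \<Sum>p\<in>P. N p i j * f (v - p) j)"
    unfolding sum_fun_app
  proof (rule sum.cong[OF refl])
    fix j assume "j \<in> {..<k}"
    then have j: "j < k" by simp
    show "cnv (\<phi> (unit_at j)) (crd f j) v i = (\<Sum>p\<in>P. N p i j * f (v - p) j)"
      unfolding cnv_eq[OF P(1) P(2)[OF j]] em_crd[OF f] N[OF j] ..
  qed
  also have "\<dots> = (\<Sum>p\<in>P. \<Sum>j<k. N p i j * f (v - p) j)" by (rule sum.swap)
  finally have e: "\<phi> f v i = (\<Sum>p\<in>P. \<Sum>j<k. N p i j * f (v - p) j)" .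
  show "\<phi> f v i = local_op P (\<lambda>p. mat_act m k (N p)) (\<lambda>p. p) f v i"
  proof (cases "i < m")
    case True
    then show ?thesis unfolding e by (simp add: local_op_def sum_fun_app mat_act_def)
  next
    case False
    then show ?thesis using coordsD(2)[OF \<phi>[OF f], of i v] by (simp add: local_op_def sum_fun_app mat_act_def)
  qed
qed

text \<open>The inverse map \<open>G\<close> is constructed, since linear combinations with
  coefficients \<open>crd f j\<close> visibly respect sums and scalars; existence and uniqueness in
  \<open>is_basis\<close> make \<open>G\<close> surjective and injective.\<close>

lemma free_module_coordinates:
  assumes rm: "right_module (LPoly R) M" and B: "finite B" "is_basis (LPoly R) M B"
  shows "\<exists>\<Theta>. bij_betw \<Theta> (carrier M) (coords (card B))
    \<and> (\<forall>x\<in>carrier M. \<forall>y\<in>carrier M. \<Theta> (x \<oplus>\<^bsub>M\<^esub> y) = \<Theta> x + \<Theta> y)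
    \<and> (\<forall>x\<in>carrier M. \<forall>a\<in>carrier (LPoly R). \<Theta> (x \<cdot>\<^bsub>M\<^esub> a) = cnv (\<Theta> x) a)"
proof -
  interpret M: right_module "LPoly R" M by (rule rm)
  have rg: "ring (LPoly R)" using rm by (simp add: right_module_def)
  define k where "k = card B"
  obtain b where "bij_betw b {0..<card B} B" using ex_bij_betw_nat_finite[OF B(1)] by blast
  then have binj: "inj_on b {..<k}" and bim: "b ` {..<k} = B" by (simp_all add: bij_betw_def atLeast0LessThan k_def)
  have BM: "B \<subseteq> carrier M" using B(2) by (simp add: is_basis_def)
  have uniq: "\<exists>!c. c \<in> B \<rightarrow>\<^sub>E carrier (LPoly R) \<and> finite {b \<in> B. c b \<noteq> \<zero>\<^bsub>LPoly R\<^esub>} \<and> x = lin_comb (LPoly R) M B c"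
    if "x \<in> carrier M" for x
    using B(2) that unfolding is_basis_def by (elim conjE) (erule bspec)
  have bM: "b j \<in> carrier M" if "j < k" for j using BM bim that by auto
  define G where "G = (\<lambda>f. finsum M (\<lambda>j. b j \<cdot>\<^bsub>M\<^esub> crd f j) {..<k})"
  have cK: "crd f j \<in> carrier (LPoly R)" if "f \<in> coords k" for f j by (rule crd_poly[OF coordsD(3)[OF that]])
  have t: "b j \<cdot>\<^bsub>M\<^esub> crd f j \<in> carrier M" if "f \<in> coords k" "j < k" for f j by (rule M.ract_closed[OF bM[OF that(2)] cK[OF that(1)]])
  have tF: "(\<lambda>j. b j \<cdot>\<^bsub>M\<^esub> crd f j) \<in> {..<k} \<rightarrow> carrier M" if "f \<in> coords k" for f using t[OF that] by auto
  have Gc: "G f \<in> carrier M" if "f \<in> coords k" for f unfolding G_def by (rule M.M.finsum_closed[OF tF[OF that]])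
  have idem0: "y = \<zero>\<^bsub>M\<^esub>" if y: "y \<in> carrier M" "y \<oplus>\<^bsub>M\<^esub> y = y" for y
  proof -
    have "y = \<zero>\<^bsub>M\<^esub> \<oplus>\<^bsub>M\<^esub> y" by (rule M.M.l_zero[OF y(1), symmetric])
    also have "\<dots> = (\<ominus>\<^bsub>M\<^esub> y \<oplus>\<^bsub>M\<^esub> y) \<oplus>\<^bsub>M\<^esub> y" unfolding M.M.l_neg[OF y(1)] ..
    also have "\<dots> = \<ominus>\<^bsub>M\<^esub> y \<oplus>\<^bsub>M\<^esub> (y \<oplus>\<^bsub>M\<^esub> y)" by (rule M.M.a_assoc[OF M.M.a_inv_closed[OF y(1)] y(1) y(1)])
    also have "\<dots> = \<zero>\<^bsub>M\<^esub>" unfolding y(2) by (rule M.M.l_neg[OF y(1)])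
    finally show ?thesis .
  qed
  have z1: "x \<cdot>\<^bsub>M\<^esub> \<zero>\<^bsub>LPoly R\<^esub> = \<zero>\<^bsub>M\<^esub>" if x: "x \<in> carrier M" for x
  proof (rule idem0)
    have zc: "\<zero>\<^bsub>LPoly R\<^esub> \<in> carrier (LPoly R)" by (rule M.R.zero_closed)
    show "x \<cdot>\<^bsub>M\<^esub> \<zero>\<^bsub>LPoly R\<^esub> \<in> carrier M" by (rule M.ract_closed[OF x zc])
    show "x \<cdot>\<^bsub>M\<^esub> \<zero>\<^bsub>LPoly R\<^esub> \<oplus>\<^bsub>M\<^esub> x \<cdot>\<^bsub>M\<^esub> \<zero>\<^bsub>LPoly R\<^esub> = x \<cdot>\<^bsub>M\<^esub> \<zero>\<^bsub>LPoly R\<^esub>"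
      using M.ract_add_ring[OF x zc zc] unfolding M.R.l_zero[OF zc] by (rule sym)
  qed
  have z2: "\<zero>\<^bsub>M\<^esub> \<cdot>\<^bsub>M\<^esub> a = \<zero>\<^bsub>M\<^esub>" if a: "a \<in> carrier (LPoly R)" for a
  proof (rule idem0)
    show "\<zero>\<^bsub>M\<^esub> \<cdot>\<^bsub>M\<^esub> a \<in> carrier M" by (rule M.ract_closed[OF M.M.zero_closed a])
    show "\<zero>\<^bsub>M\<^esub> \<cdot>\<^bsub>M\<^esub> a \<oplus>\<^bsub>M\<^esub> \<zero>\<^bsub>M\<^esub> \<cdot>\<^bsub>M\<^esub> a = \<zero>\<^bsub>M\<^esub> \<cdot>\<^bsub>M\<^esub> a"
      using M.ract_add_module[OF M.M.zero_closed M.M.zero_closed a] unfolding M.M.l_zero[OF M.M.zero_closed] by (rule sym)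
  qed
  have fr: "finsum M h J \<cdot>\<^bsub>M\<^esub> a = finsum M (\<lambda>j. h j \<cdot>\<^bsub>M\<^esub> a) J"
    if a: "a \<in> carrier (LPoly R)" and "finite J" "\<And>j. j \<in> J \<Longrightarrow> h j \<in> carrier M" for h J a
    using that(2,3)
  proof (induction J rule: finite_induct)
    case empty
    show ?case unfolding M.M.finsum_empty by (rule z2[OF a])
  next
    case (insert j J)
    have h: "h j \<in> carrier M" "h \<in> J \<rightarrow> carrier M" using insert.prems by auto
    have ha: "h j \<cdot>\<^bsub>M\<^esub> a \<in> carrier M" "(\<lambda>j. h j \<cdot>\<^bsub>M\<^esub> a) \<in> J \<rightarrow> carrier M"
      using insert.prems by (auto intro!: M.ract_closed a)
    have IH: "finsum M h J \<cdot>\<^bsub>M\<^esub> a = finsum M (\<lambda>j. h j \<cdot>\<^bsub>M\<^esub> a) J" using insert by auto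
    have 1: "finsum M h (insert j J) = h j \<oplus>\<^bsub>M\<^esub> finsum M h J" by (rule M.M.finsum_insert[OF insert.hyps h(2) h(1)])
    have 2: "finsum M (\<lambda>j. h j \<cdot>\<^bsub>M\<^esub> a) (insert j J) = h j \<cdot>\<^bsub>M\<^esub> a \<oplus>\<^bsub>M\<^esub> finsum M (\<lambda>j. h j \<cdot>\<^bsub>M\<^esub> a) J"
      using ha by (intro M.M.finsum_insert insert.hyps)
    show ?case unfolding 1 2 M.ract_add_module[OF h(1) M.M.finsum_closed[OF h(2)] a] IH ..
  qed
  have lc: "lin_comb (LPoly R) M B c = finsum M (\<lambda>j. b j \<cdot>\<^bsub>M\<^esub> c (b j)) {..<k}"
    if c: "\<And>\<beta>. \<beta> \<in> B \<Longrightarrow> c \<beta> \<in> carrier (LPoly R)" for c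
  proof -
    have cB: "(\<lambda>\<beta>. \<beta> \<cdot>\<^bsub>M\<^esub> c \<beta>) \<in> B \<rightarrow> carrier M" using BM c by (auto intro!: M.ract_closed)
    have "lin_comb (LPoly R) M B c = finsum M (\<lambda>\<beta>. \<beta> \<cdot>\<^bsub>M\<^esub> c \<beta>) B"
      unfolding lin_comb_def
    proof (rule M.M.add.finprod_mono_neutral_cong_left[OF B(1) _ _ refl cB])
      show "\<beta> \<cdot>\<^bsub>M\<^esub> c \<beta> = \<zero>\<^bsub>M\<^esub>" if "\<beta> \<in> B - {\<beta> \<in> B. c \<beta> \<noteq> \<zero>\<^bsub>LPoly R\<^esub>}" for \<beta>
      proof -
        have "\<beta> \<in> carrier M" "c \<beta> = \<zero>\<^bsub>LPoly R\<^esub>" using that BM by auto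
        then show ?thesis using z1 by simp
      qed
    qed blast
    also have "\<dots> = finsum M (\<lambda>\<beta>. \<beta> \<cdot>\<^bsub>M\<^esub> c \<beta>) (b ` {..<k})" unfolding bim ..
    also have "\<dots> = finsum M (\<lambda>j. b j \<cdot>\<^bsub>M\<^esub> c (b j)) {..<k}"
      by (rule M.M.finsum_reindex[OF _ binj]) (use cB bim in simp)
    finally show ?thesis .
  qed
  have Gi: "f = g" if f: "f \<in> coords k" and g: "g \<in> coords k" and eq: "G f = G g" for f g
  proof -
    \<comment> \<open>Uniqueness in \<open>is_basis\<close> holds among extensional coefficient
      functions, hence the \<open>restrict\<close>.\<close>
    define cf where "cf = (\<lambda>f. restrict (\<lambda>\<beta>. crd f (the_inv_into {..<k} b \<beta>)) B)"
    have v: "cf f (b j) = crd f j" if "j < k" for f j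
      using that the_inv_into_f_f[OF binj, of j] bim by (auto simp: cf_def)
    have cE: "cf f \<in> B \<rightarrow>\<^sub>E carrier (LPoly R)" if "f \<in> coords k" for f using cK[OF that] by (auto simp: cf_def)
    have Gl: "G f = lin_comb (LPoly R) M B (cf f)" if f: "f \<in> coords k" for f
    proof -
      have "lin_comb (LPoly R) M B (cf f) = finsum M (\<lambda>j. b j \<cdot>\<^bsub>M\<^esub> cf f (b j)) {..<k}"
        by (rule lc) (use cE[OF f] in auto)
      also have "\<dots> = G f" unfolding G_def by (rule M.M.finsum_cong'[OF refl tF[OF f]]) (simp add: v)
      finally show ?thesis by (rule sym)
    qed
    obtain c where c: "\<And>d. d \<in> B \<rightarrow>\<^sub>E carrier (LPoly R) \<and> finite {b \<in> B. d b \<noteq> \<zero>\<^bsub>LPoly R\<^esub>}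
        \<and> G f = lin_comb (LPoly R) M B d \<Longrightarrow> d = c"
      using uniq[OF Gc[OF f]] by (elim ex1E) blast
    have fin: "finite {b \<in> B. d b \<noteq> \<zero>\<^bsub>LPoly R\<^esub>}" for d using B(1) by simp
    have 1: "cf f = c" by (rule c) (intro conjI cE[OF f] fin Gl[OF f])
    have "G f = lin_comb (LPoly R) M B (cf g)" unfolding eq by (rule Gl[OF g])
    then have 2: "cf g = c" by (intro c conjI cE[OF g] fin)
    have "f v i = g v i" for v i
    proof (cases "i < k")
      case True
      have "crd f i = crd g i" using v[OF True, of f] v[OF True, of g] 1 2 by simp
      then show ?thesis using em_crd[OF f, of i v] em_crd[OF g, of i v] by simp
    next
      case False
      then show ?thesis using coordsD(2)[OF f, of i v] coordsD(2)[OF g, of i v] by simp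
    qed
    then show "f = g" by (intro ext)
  qed
  have Gs: "\<exists>f\<in>coords k. G f = x" if x: "x \<in> carrier M" for x
  proof -
    obtain c where c: "c \<in> B \<rightarrow>\<^sub>E carrier (LPoly R)" "x = lin_comb (LPoly R) M B c" using uniq[OF x] by blast
    have cb: "c (b i) \<in> carrier (LPoly R)" if "i < k" for i using c(1) bim that by auto
    have cv: "c (b i) v \<in> carrier R" if "i < k" for i v using cb[OF that] by (simp add: LPoly_carrier series_on_def)
    define f where "f = (\<lambda>v i. if i < k then em (c (b i) v) else 0)"
    have "supp f \<subseteq> (\<Union>i<k. {v. c (b i) v \<noteq> \<zero>})"
    proof
      fix v assume "v \<in> supp f"
      then obtain i where i: "f v i \<noteq> 0" by (auto simp: supp_def fun_eq_iff)
      then have k: "i < k" by (auto simp: f_def split: if_splits)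
      have "c (b i) v \<noteq> \<zero>"
      proof
        assume "c (b i) v = \<zero>"
        then show False using i k by (simp add: f_def em_zero)
      qed
      then show "v \<in> (\<Union>i<k. {v. c (b i) v \<noteq> \<zero>})" using k by blast
    qed
    moreover have "finite (\<Union>i<k. {v. c (b i) v \<noteq> \<zero>})" using cb by (auto simp: LPoly_carrier)
    ultimately have fin: "finite (supp f)" by (rule finite_subset)
    have f: "f \<in> coords k" by (rule coordsI[OF _ _ fin]) (simp_all add: f_def one_em cv)
    have cr: "crd f j = c (b j)" if "j < k" for j by (rule ext) (simp add: crd_def f_def that cv)
    have cB: "c \<beta> \<in> carrier (LPoly R)" if "\<beta> \<in> B" for \<beta> using c(1) that by auto
    have "G f = finsum M (\<lambda>j. b j \<cdot>\<^bsub>M\<^esub> c (b j)) {..<k}"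
      unfolding G_def by (rule M.M.finsum_cong'[OF refl]) (auto simp: cr intro!: M.ract_closed bM cb)
    also have "\<dots> = x" unfolding c(2) by (rule lc[OF cB, symmetric])
    finally show ?thesis using f by blast
  qed
  have Ga: "G (f + g) = G f \<oplus>\<^bsub>M\<^esub> G g" if f: "f \<in> coords k" and g: "g \<in> coords k" for f g
  proof -
    have "G (f + g) = finsum M (\<lambda>j. b j \<cdot>\<^bsub>M\<^esub> crd f j \<oplus>\<^bsub>M\<^esub> b j \<cdot>\<^bsub>M\<^esub> crd g j) {..<k}"
      unfolding G_def
    proof (rule M.M.finsum_cong'[OF refl])
      show "(\<lambda>j. b j \<cdot>\<^bsub>M\<^esub> crd f j \<oplus>\<^bsub>M\<^esub> b j \<cdot>\<^bsub>M\<^esub> crd g j) \<in> {..<k} \<rightarrow> carrier M"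
        using t[OF f] t[OF g] by (auto intro!: M.M.a_closed)
      fix j assume "j \<in> {..<k}"
      then have "b j \<in> carrier M" using bM by simp
      then show "b j \<cdot>\<^bsub>M\<^esub> crd (f + g) j = b j \<cdot>\<^bsub>M\<^esub> crd f j \<oplus>\<^bsub>M\<^esub> b j \<cdot>\<^bsub>M\<^esub> crd g j"
        unfolding crd_add by (rule M.ract_add_ring[OF _ cK[OF f] cK[OF g]])
    qed
    also have "\<dots> = G f \<oplus>\<^bsub>M\<^esub> G g" unfolding G_def by (rule M.M.finsum_addf[OF tF[OF f] tF[OF g]])
    finally show ?thesis .
  qed
  have Gr: "G (cnv f a) = G f \<cdot>\<^bsub>M\<^esub> a" if f: "f \<in> coords k" and a: "a \<in> carrier (LPoly R)" for f a
  proof -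
    have "G (cnv f a) = finsum M (\<lambda>j. b j \<cdot>\<^bsub>M\<^esub> crd f j \<cdot>\<^bsub>M\<^esub> a) {..<k}"
      unfolding G_def
    proof (rule M.M.finsum_cong'[OF refl])
      show "(\<lambda>j. b j \<cdot>\<^bsub>M\<^esub> crd f j \<cdot>\<^bsub>M\<^esub> a) \<in> {..<k} \<rightarrow> carrier M" by (intro Pi_I M.ract_closed[OF t[OF f] a]) simp
      fix j assume "j \<in> {..<k}"
      then have "b j \<in> carrier M" using bM by simp
      then show "b j \<cdot>\<^bsub>M\<^esub> crd (cnv f a) j = b j \<cdot>\<^bsub>M\<^esub> crd f j \<cdot>\<^bsub>M\<^esub> a"
        unfolding crd_cnv[OF f a rg] by (rule M.ract_mult[OF _ cK[OF f] a])
    qed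
    also have "\<dots> = G f \<cdot>\<^bsub>M\<^esub> a" unfolding G_def by (rule fr[OF a, symmetric]) (simp_all add: t[OF f])
    finally show ?thesis .
  qed
  have Gb: "bij_betw G (coords k) (carrier M)"
    unfolding bij_betw_def
  proof (rule conjI)
    show "inj_on G (coords k)" by (rule inj_onI) (rule Gi)
    show "G ` coords k = carrier M"
    proof (rule Set.equalityI; rule Set.subsetI)
      show "x \<in> carrier M" if "x \<in> G ` coords k" for x using that Gc by blast
      show "x \<in> G ` coords k" if "x \<in> carrier M" for x using Gs[OF that] by blast
    qed
  qed
  define \<Theta> where "\<Theta> = inv_into (coords k) G"
  have b\<Theta>: "bij_betw \<Theta> (carrier M) (coords k)" unfolding \<Theta>_def by (rule bij_betw_inv_into[OF Gb])
  have \<Theta>c: "\<Theta> x \<in> coords k" if "x \<in> carrier M" for x using bij_betwE[OF b\<Theta>] that by blast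
  have G\<Theta>: "G (\<Theta> x) = x" if "x \<in> carrier M" for x unfolding \<Theta>_def by (rule bij_betw_inv_into_right[OF Gb that])
  have \<Theta>G: "\<Theta> (G f) = f" if "f \<in> coords k" for f unfolding \<Theta>_def by (rule bij_betw_inv_into_left[OF Gb that])
  have "\<Theta> (x \<oplus>\<^bsub>M\<^esub> y) = \<Theta> x + \<Theta> y" if x: "x \<in> carrier M" and y: "y \<in> carrier M" for x y
    using \<Theta>G[OF coords_add[OF \<Theta>c[OF x] \<Theta>c[OF y]]] unfolding Ga[OF \<Theta>c[OF x] \<Theta>c[OF y]] G\<Theta>[OF x] G\<Theta>[OF y] .
  moreover have "\<Theta> (x \<cdot>\<^bsub>M\<^esub> a) = cnv (\<Theta> x) a" if x: "x \<in> carrier M" and a: "a \<in> carrier (LPoly R)" for x a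
    using \<Theta>G[OF cnv_coords[OF \<Theta>c[OF x] a]] unfolding Gr[OF \<Theta>c[OF x] a] G\<Theta>[OF x] .
  ultimately show ?thesis using b\<Theta> unfolding k_def by (intro exI[of _ \<Theta>] conjI ballI)
qed

text \<open>Choosing bases turns the differential into matrices of Laurent polynomials. Boundedness
  leaves finitely many matrices to consider, so one finite set of exponents serves all
  degrees.\<close>

lemma model_exists:
  fixes C :: "('a series, 'm) cochain"
  assumes cc: "cochain_complex (LPoly R) C" and bd: "bounded_cochain C" and fg: "\<forall>n. fg_free_rmod (LPoly R) (obj C n)"
  shows "\<exists>rk P D lo hi \<Theta>. model_complex R rk P D lo hi C \<Theta>"
proof -
  have rm: "right_module (LPoly R) (obj C n)" for n using cc by (simp add: cochain_complex_def)
  have dh: "diff C n \<in> rmod_hom (LPoly R) (obj C n) (obj C (n + 1))" for n using cc by (simp add: cochain_complex_def)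
  have dd: "diff C (n + 1) (diff C n x) = \<zero>\<^bsub>obj C (n + 2)\<^esub>" if "x \<in> carrier (obj C n)" for n x
    using cc that by (simp add: cochain_complex_def)
  obtain lo hi where b0: "\<And>n. n < lo \<or> hi < n \<Longrightarrow> carrier (obj C n) = {\<zero>\<^bsub>obj C n\<^esub>}"
    using bd unfolding bounded_cochain_def by blast
  have "\<forall>n. \<exists>k \<Theta>. bij_betw \<Theta> (carrier (obj C n)) (coords k)
    \<and> (\<forall>x\<in>carrier (obj C n). \<forall>y\<in>carrier (obj C n). \<Theta> (x \<oplus>\<^bsub>obj C n\<^esub> y) = \<Theta> x + \<Theta> y)
    \<and> (\<forall>x\<in>carrier (obj C n). \<forall>a\<in>carrier (LPoly R). \<Theta> (x \<cdot>\<^bsub>obj C n\<^esub> a) = cnv (\<Theta> x) a)"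
  proof
    fix n
    obtain B where B: "finite B" "is_basis (LPoly R) (obj C n) B" using fg[THEN spec, of n] unfolding fg_free_rmod_def by blast
    show "\<exists>k \<Theta>. bij_betw \<Theta> (carrier (obj C n)) (coords k)
      \<and> (\<forall>x\<in>carrier (obj C n). \<forall>y\<in>carrier (obj C n). \<Theta> (x \<oplus>\<^bsub>obj C n\<^esub> y) = \<Theta> x + \<Theta> y)
      \<and> (\<forall>x\<in>carrier (obj C n). \<forall>a\<in>carrier (LPoly R). \<Theta> (x \<cdot>\<^bsub>obj C n\<^esub> a) = cnv (\<Theta> x) a)"
      by (rule exI[of _ "card B"], rule free_module_coordinates[OF rm B])
  qed
  from choice[OF this] obtain rk where "\<forall>n. \<exists>\<Theta>. bij_betw \<Theta> (carrier (obj C n)) (coords (rk n))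
    \<and> (\<forall>x\<in>carrier (obj C n). \<forall>y\<in>carrier (obj C n). \<Theta> (x \<oplus>\<^bsub>obj C n\<^esub> y) = \<Theta> x + \<Theta> y)
    \<and> (\<forall>x\<in>carrier (obj C n). \<forall>a\<in>carrier (LPoly R). \<Theta> (x \<cdot>\<^bsub>obj C n\<^esub> a) = cnv (\<Theta> x) a)" by (elim exE)
  from choice[OF this] obtain \<Theta> where \<Theta>: "\<forall>n. bij_betw (\<Theta> n) (carrier (obj C n)) (coords (rk n))
    \<and> (\<forall>x\<in>carrier (obj C n). \<forall>y\<in>carrier (obj C n). \<Theta> n (x \<oplus>\<^bsub>obj C n\<^esub> y) = \<Theta> n x + \<Theta> n y)
    \<and> (\<forall>x\<in>carrier (obj C n). \<forall>a\<in>carrier (LPoly R). \<Theta> n (x \<cdot>\<^bsub>obj C n\<^esub> a) = cnv (\<Theta> n x) a)" by (elim exE)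
  have bij: "bij_betw (\<Theta> n) (carrier (obj C n)) (coords (rk n))" for n by (rule conjunct1[OF \<Theta>[THEN spec]])
  have \<Theta>a: "\<Theta> n (x \<oplus>\<^bsub>obj C n\<^esub> y) = \<Theta> n x + \<Theta> n y" if "x \<in> carrier (obj C n)" "y \<in> carrier (obj C n)" for n x y
    by (rule \<Theta>[THEN spec, THEN conjunct2, THEN conjunct1, THEN bspec, THEN bspec, OF that])
  have \<Theta>r: "\<Theta> n (x \<cdot>\<^bsub>obj C n\<^esub> a) = cnv (\<Theta> n x) a" if "x \<in> carrier (obj C n)" "a \<in> carrier (LPoly R)" for n x a
    by (rule \<Theta>[THEN spec, THEN conjunct2, THEN conjunct2, THEN bspec, THEN bspec, OF that])
  have \<Theta>c: "\<Theta> n x \<in> coords (rk n)" if "x \<in> carrier (obj C n)" for n x using bij_betwE[OF bij] that by blast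
  define \<Psi> where "\<Psi> = (\<lambda>n. inv_into (carrier (obj C n)) (\<Theta> n))"
  have \<Psi>c: "\<Psi> n f \<in> carrier (obj C n)" and \<Theta>\<Psi>: "\<Theta> n (\<Psi> n f) = f" if "f \<in> coords (rk n)" for n f
    using bij_betwE[OF bij_betw_inv_into[OF bij]] bij_betw_inv_into_right[OF bij that] that unfolding \<Psi>_def by blast+
  have \<Psi>\<Theta>: "\<Psi> n (\<Theta> n x) = x" if "x \<in> carrier (obj C n)" for n x
    unfolding \<Psi>_def by (rule bij_betw_inv_into_left[OF bij that])
  have dc: "diff C n x \<in> carrier (obj C (n + 1))" if "x \<in> carrier (obj C n)" for n x by (rule homD(1)[OF dh that])
  define \<phi> where "\<phi> = (\<lambda>n f. \<Theta> (n + 1) (diff C n (\<Psi> n f)))"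
  have \<phi>c: "\<phi> n f \<in> coords (rk (n + 1))" if "f \<in> coords (rk n)" for n f
    unfolding \<phi>_def by (rule \<Theta>c[OF dc[OF \<Psi>c[OF that]]])
  have \<phi>a: "\<phi> n (f + g) = \<phi> n f + \<phi> n g" if f: "f \<in> coords (rk n)" and g: "g \<in> coords (rk n)" for n f g
  proof -
    interpret M: right_module "LPoly R" "obj C n" by (rule rm)
    have "\<Psi> n (f + g) = \<Psi> n f \<oplus>\<^bsub>obj C n\<^esub> \<Psi> n g"
      using \<Psi>\<Theta>[OF M.M.a_closed[OF \<Psi>c[OF f] \<Psi>c[OF g]]] unfolding \<Theta>a[OF \<Psi>c[OF f] \<Psi>c[OF g]] \<Theta>\<Psi>[OF f] \<Theta>\<Psi>[OF g] .
    then show ?thesis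
      unfolding \<phi>_def by (simp only: homD(2)[OF dh \<Psi>c[OF f] \<Psi>c[OF g]] \<Theta>a[OF dc[OF \<Psi>c[OF f]] dc[OF \<Psi>c[OF g]]])
  qed
  have \<phi>r: "\<phi> n (cnv f a) = cnv (\<phi> n f) a" if f: "f \<in> coords (rk n)" and a: "a \<in> carrier (LPoly R)" for n f a
  proof -
    interpret M: right_module "LPoly R" "obj C n" by (rule rm)
    have "\<Psi> n (cnv f a) = \<Psi> n f \<cdot>\<^bsub>obj C n\<^esub> a"
      using \<Psi>\<Theta>[OF M.ract_closed[OF \<Psi>c[OF f] a]] unfolding \<Theta>r[OF \<Psi>c[OF f] a] \<Theta>\<Psi>[OF f] .
    then show ?thesis
      unfolding \<phi>_def by (simp only: homD(3)[OF dh \<Psi>c[OF f] a] \<Theta>r[OF dc[OF \<Psi>c[OF f]] a])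
  qed
  have \<phi>0: "\<phi> n 0 = 0" for n using \<phi>a[OF coords_zero coords_zero, of n] by (simp only: add_0_right add_cancel_right_right)
  have zero: "f = 0" if "n < lo \<or> hi < n" "f \<in> coords (rk n)" for n f
  proof -
    have "\<Psi> n f = \<Psi> n 0" using \<Psi>c[OF that(2)] \<Psi>c[OF coords_zero, of n] unfolding b0[OF that(1)] by simp
    then show ?thesis using \<Theta>\<Psi>[OF that(2)] \<Theta>\<Psi>[OF coords_zero, of n] by simp
  qed
  define D where "D = (\<lambda>n p i j. if j < rk n then \<phi> n (unit_at j) p i else 0)"
  define P where "P = (\<Union>n\<in>{lo..hi}. \<Union>j<rk n. supp (\<phi> n (unit_at j)))"
  have finP: "finite P" unfolding P_def using coordsD(3)[OF \<phi>c[OF unit_coords]] by auto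
  have suppP: "supp (\<phi> n (unit_at j)) \<subseteq> P" if j: "j < rk n" for n j
  proof (cases "n < lo \<or> hi < n")
    case True
    \<comment> \<open>Outside \<open>{lo..hi}\<close> the module is zero, yet the rank may be
      positive when R is the zero ring. The unit vectors are then zero and contribute no
      exponents.\<close>
    have "unit_at j = 0" by (rule zero[OF True unit_coords[OF j]])
    then have "supp (\<phi> n (unit_at j)) = {}" by (simp add: \<phi>0 supp_def)
    then show ?thesis by simp
  next
    case False
    then show ?thesis unfolding P_def using j by (intro UN_upper[THEN order_trans[rotated]] UN_upper) auto
  qed
  define L where "L = (\<lambda>n. local_op P (\<lambda>p. mat_act (rk (n + 1)) (rk n) (D n p)) (\<lambda>p :: int \<times> int. p))"
  have L\<phi>: "L n f = \<phi> n f" if f: "f \<in> coords (rk n)" for n f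
    unfolding L_def
  proof (rule linear_eq_local_op[symmetric, where \<phi> = "\<phi> n" and k = "rk n" and m = "rk (n + 1)", OF \<phi>c \<phi>a \<phi>r finP suppP _ f])
    show "D n p i j = \<phi> n (unit_at j) p i" if "j < rk n" for p i j using that by (simp add: D_def)
  qed
  have LL0: "L (n + 1) (L n f) = 0" if f: "f \<in> coords (rk n)" for n f
  proof -
    have "L (n + 1) (L n f) = \<Theta> (n + 1 + 1) (diff C (n + 1) (diff C n (\<Psi> n f)))"
      unfolding L\<phi>[OF f] L\<phi>[OF \<phi>c[OF f]] by (simp only: \<phi>_def \<Psi>\<Theta>[OF dc[OF \<Psi>c[OF f]]])
    also have "diff C (n + 1) (diff C n (\<Psi> n f)) = \<zero>\<^bsub>obj C (n + 2)\<^esub>" by (rule dd[OF \<Psi>c[OF f]])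
    also have "\<Theta> (n + 1 + 1) \<zero>\<^bsub>obj C (n + 2)\<^esub> = 0"
    proof -
      interpret M: right_module "LPoly R" "obj C (n + 2)" by (rule rm)
      have e: "n + 1 + 1 = n + 2" by simp
      have "\<Theta> (n + 2) \<zero>\<^bsub>obj C (n + 2)\<^esub> = \<Theta> (n + 2) \<zero>\<^bsub>obj C (n + 2)\<^esub> + \<Theta> (n + 2) \<zero>\<^bsub>obj C (n + 2)\<^esub>"
        using \<Theta>a[OF M.M.zero_closed M.M.zero_closed] unfolding M.M.l_zero[OF M.M.zero_closed] .
      then show ?thesis unfolding e by (simp only: add_cancel_right_right)
    qed
    finally show ?thesis .
  qed
  have fc: "free_complex (em \<one>) rk P D lo hi"
  proof (rule free_complex.intro[OF one_central one_idem finP])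
    show "em \<one> * D n p i j = D n p i j" for n p i j
      using coordsD(1)[OF \<phi>c[OF unit_coords, of j n], of p i] by (simp add: D_def)
    show "vecs (em \<one>) (rk n) = {0}" if n: "n < lo \<or> hi < n" for n
    proof (rule Set.equalityI; rule Set.subsetI)
      fix a assume a: "a \<in> vecs (em \<one>) (rk n)"
      \<comment> \<open>The vector is placed at the origin, so that the vanishing of the module,
        known for coordinate functions, applies to it.\<close>
      define f where "f = (\<lambda>v :: int \<times> int. if v = 0 then a else 0)"
      have "supp f \<subseteq> {0}" by (auto simp: supp_def f_def split: if_splits)
      then have "finite (supp f)" by (rule finite_subset) simp
      then have "f \<in> coords (rk n)" using vecsD[OF a] by (intro coordsI) (simp_all add: f_def)
      then have "f = 0" by (rule zero[OF n])
      then have "f 0 = 0" by (simp only: zero_fun_apply)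
      then show "a \<in> {0}" by (simp add: f_def)
    next
      fix a :: "nat \<Rightarrow> 'a uring" assume "a \<in> {0}"
      then show "a \<in> vecs (em \<one>) (rk n)" by (simp add: vecs_def)
    qed
    fix n and f :: "int \<times> int \<Rightarrow> nat \<Rightarrow> 'a uring" assume f: "\<And>v. f v \<in> vecs (em \<one>) (rk n)"
    have "L (n + 1) (L n f) v = 0" for v
    proof -
      \<comment> \<open>The value at \<open>v\<close> reads \<open>f\<close> only at the finitely
        many points \<open>v - p - q\<close>. Cutting \<open>f\<close> to them reduces an arbitrary
        function to a finitely supported one, which comes from the module.\<close>
      define W where "W = (\<lambda>(p, q). v - p - q) ` (P \<times> P)"
      define f' where "f' = (\<lambda>w. if w \<in> W then f w else 0)"
      have "supp f' \<subseteq> W" by (auto simp: supp_def f'_def)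
      then have "finite (supp f')" by (rule finite_subset) (simp add: W_def finP)
      then have f': "f' \<in> coords (rk n)" using vecsD[OF f] by (intro coordsI) (simp_all add: f'_def)
      have w: "f' (v - p - q) = f (v - p - q)" if "p \<in> P" "q \<in> P" for p q
      proof -
        have "v - p - q \<in> W" unfolding W_def using that by (intro image_eqI[of _ _ "(p, q)"]) simp_all
        then show ?thesis by (simp add: f'_def)
      qed
      have "L n f (v - p) = L n f' (v - p)" if "p \<in> P" for p
        unfolding L_def local_op_def by (rule sum.cong[OF refl]) (simp only: w[OF that])
      then have "L (n + 1) (L n f) v = L (n + 1) (L n f') v"
        unfolding L_def[of ] local_op_def by (intro sum.cong[OF refl]) (simp only:)
      then show ?thesis unfolding LL0[OF f'] by (simp only: zero_fun_apply)
    qed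
    then have "L (n + 1) (L n f) = 0" by (intro ext) (simp only: zero_fun_apply)
    then show "local_op P (\<lambda>p. mat_act (rk (n + 1 + 1)) (rk (n + 1)) (D (n + 1) p)) (\<lambda>p. p)
        (local_op P (\<lambda>p. mat_act (rk (n + 1)) (rk n) (D n p)) (\<lambda>p. p) f) = 0"
      unfolding L_def .
  qed
  interpret fc: free_complex "em \<one>" rk P D lo hi by (rule fc)
  have pc: "fc.pol n = coords (rk n)" for n unfolding coords_def using fc.pol_iff[of _ n] by blast
  have dL: "fc.dif n = L n" for n unfolding fc.dif_def L_def ..
  have "model_complex R rk P D lo hi C \<Theta>"
  proof (intro model_complex.intro model_complex_axioms.intro fc rm dc \<Theta>a)
    show "ring R" by (rule ring_axioms)
    show "bij_betw (\<Theta> n) (carrier (obj C n)) (fc.pol n)" for n unfolding pc by (rule bij)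
    show "\<Theta> n (x \<cdot>\<^bsub>obj C n\<^esub> a) = (\<lambda>v i. \<Sum>p\<in>supp (\<Theta> n x). \<Theta> n x p i * em (a (v - p)))"
      if "x \<in> carrier (obj C n)" "a \<in> carrier (LPoly R)" for n x a
      unfolding \<Theta>r[OF that] cnv_def ..
    show "\<Theta> (n + 1) (diff C n x) = fc.dif n (\<Theta> n x)" if "x \<in> carrier (obj C n)" for n x
      unfolding dL L\<phi>[OF \<Theta>c[OF that]] \<phi>_def \<Psi>\<Theta>[OF that] ..
  qed
  then show ?thesis by blast
qed

end

section \<open>The rings of Laurent series\<close>

lemma all_shift: "(\<forall>j::int. Q (j - c)) \<longleftrightarrow> (\<forall>j. Q j)"
proof
  assume a: "\<forall>j. Q (j - c)"
  show "\<forall>j. Q j"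
  proof
    fix j
    show "Q j" using a[THEN spec, of "j + c"] by simp
  qed
qed blast

lemma series_on_shift: "monom_shift u f \<in> series_on R \<longleftrightarrow> f \<in> series_on R"
proof
  assume a: "monom_shift u f \<in> series_on R"
  have "f n \<in> carrier R" for n
  proof -
    have "monom_shift u f (n + u) \<in> carrier R" using a by (simp add: series_on_def)
    then show ?thesis by (simp add: monom_shift_def)
  qed
  then show "f \<in> series_on R" by (simp add: series_on_def)
qed (simp add: series_on_def monom_shift_def)

lemma sign_shift: "\<epsilon> = 1 \<or> \<epsilon> = - 1 \<Longrightarrow> 0 \<le> \<epsilon> * (i + \<epsilon> * k) \<longleftrightarrow> - k \<le> \<epsilon> * (i :: int)"
  by (elim disjE) auto

text \<open>Shifting by the k-th power of the variable turns the lower bound 0 on the exponents into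
  \<open>- k\<close> and preserves finiteness of the coefficients, so membership for some k means
  that some lower bound exists.\<close>

lemma laurent_series_y_iff:
  assumes \<delta>: "\<delta> = 1 \<or> \<delta> = - 1"
  shows "laurent_series_y R \<delta> = {f \<in> series_on R. {v. f v \<noteq> \<zero>\<^bsub>R\<^esub>} \<in> edge_y \<delta>}"
proof (rule Set.set_eqI)
  fix f :: "int \<times> int \<Rightarrow> 'a"
  have s: "monom_shift (0, \<delta> * int k) f \<in> power_series_y R \<delta> \<longleftrightarrow> f \<in> series_on R
      \<and> (\<forall>j. finite {i. f (i, j) \<noteq> \<zero>\<^bsub>R\<^esub>}) \<and> (\<forall>j i. f (i, j) \<noteq> \<zero>\<^bsub>R\<^esub> \<longrightarrow> - int k \<le> \<delta> * j)" for k
  proof -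
    let ?c = "\<delta> * int k"
    have 1: "monom_shift (0, ?c) f (i, j) = f (i, j - ?c)" for i j by (simp add: monom_shift_def)
    have 2: "(\<forall>j. finite {i. f (i, j - ?c) \<noteq> \<zero>\<^bsub>R\<^esub>}) \<longleftrightarrow> (\<forall>j. finite {i. f (i, j) \<noteq> \<zero>\<^bsub>R\<^esub>})"
      by (rule all_shift)
    have "(\<forall>i j. f (i, j - ?c) \<noteq> \<zero>\<^bsub>R\<^esub> \<longrightarrow> 0 \<le> \<delta> * j)
        \<longleftrightarrow> (\<forall>j i. f (i, j - ?c) \<noteq> \<zero>\<^bsub>R\<^esub> \<longrightarrow> 0 \<le> \<delta> * ((j - ?c) + ?c))" unfolding diff_add_cancel by blast
    also have "\<dots> \<longleftrightarrow> (\<forall>j i. f (i, j) \<noteq> \<zero>\<^bsub>R\<^esub> \<longrightarrow> 0 \<le> \<delta> * (j + ?c))" by (rule all_shift)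
    finally have 3: "(\<forall>i j. f (i, j - ?c) \<noteq> \<zero>\<^bsub>R\<^esub> \<longrightarrow> 0 \<le> \<delta> * j)
        \<longleftrightarrow> (\<forall>j i. f (i, j) \<noteq> \<zero>\<^bsub>R\<^esub> \<longrightarrow> - int k \<le> \<delta> * j)" unfolding sign_shift[OF \<delta>] .
    show ?thesis unfolding power_series_y_def mem_Collect_eq series_on_shift 1 2 3 ..
  qed
  show "f \<in> laurent_series_y R \<delta> \<longleftrightarrow> f \<in> {f \<in> series_on R. {v. f v \<noteq> \<zero>\<^bsub>R\<^esub>} \<in> edge_y \<delta>}" (is "?l \<longleftrightarrow> ?r")
  proof
    assume ?l
    then obtain k where k: "f \<in> series_on R" "\<forall>j. finite {i. f (i, j) \<noteq> \<zero>\<^bsub>R\<^esub>}" "\<forall>j i. f (i, j) \<noteq> \<zero>\<^bsub>R\<^esub> \<longrightarrow> - int k \<le> \<delta> * j"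
      unfolding laurent_series_y_def mem_Collect_eq s by blast
    have "- int k \<le> \<delta> * snd v" if "v \<in> {v. f v \<noteq> \<zero>\<^bsub>R\<^esub>}" for v
      using k(3)[THEN spec, THEN spec, of "fst v" "snd v"] that by simp
    then have "\<exists>k. \<forall>v\<in>{v. f v \<noteq> \<zero>\<^bsub>R\<^esub>}. - k \<le> \<delta> * snd v" by (intro exI[of _ "int k"] ballI)
    then show ?r using k(1,2) by (simp add: edge_y_def)
  next
    assume ?r
    then obtain k where k: "f \<in> series_on R" "\<And>j. finite {i. f (i, j) \<noteq> \<zero>\<^bsub>R\<^esub>}" "\<And>v. f v \<noteq> \<zero>\<^bsub>R\<^esub> \<Longrightarrow> - k \<le> \<delta> * snd v"
      unfolding edge_y_def by auto
    have "- int (nat k) \<le> \<delta> * j" if "f (i, j) \<noteq> \<zero>\<^bsub>R\<^esub>" for i j using k(3)[OF that] by simp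
    then show ?l using k(1,2) unfolding laurent_series_y_def mem_Collect_eq s by blast
  qed
qed

lemma laurent_series_x_iff:
  assumes \<epsilon>: "\<epsilon> = 1 \<or> \<epsilon> = - 1"
  shows "laurent_series_x R \<epsilon> = {f \<in> series_on R. {v. f v \<noteq> \<zero>\<^bsub>R\<^esub>} \<in> edge_x \<epsilon>}"
proof (rule Set.set_eqI)
  fix f :: "int \<times> int \<Rightarrow> 'a"
  have s: "monom_shift (\<epsilon> * int k, 0) f \<in> power_series_x R \<epsilon> \<longleftrightarrow> f \<in> series_on R
      \<and> (\<forall>i. finite {j. f (i, j) \<noteq> \<zero>\<^bsub>R\<^esub>}) \<and> (\<forall>i j. f (i, j) \<noteq> \<zero>\<^bsub>R\<^esub> \<longrightarrow> - int k \<le> \<epsilon> * i)" for k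
  proof -
    let ?c = "\<epsilon> * int k"
    have 1: "monom_shift (?c, 0) f (i, j) = f (i - ?c, j)" for i j by (simp add: monom_shift_def)
    have 2: "(\<forall>i. finite {j. f (i - ?c, j) \<noteq> \<zero>\<^bsub>R\<^esub>}) \<longleftrightarrow> (\<forall>i. finite {j. f (i, j) \<noteq> \<zero>\<^bsub>R\<^esub>})"
      by (rule all_shift)
    have "(\<forall>i j. f (i - ?c, j) \<noteq> \<zero>\<^bsub>R\<^esub> \<longrightarrow> 0 \<le> \<epsilon> * i)
        \<longleftrightarrow> (\<forall>i j. f (i - ?c, j) \<noteq> \<zero>\<^bsub>R\<^esub> \<longrightarrow> 0 \<le> \<epsilon> * ((i - ?c) + ?c))" unfolding diff_add_cancel by blast
    also have "\<dots> \<longleftrightarrow> (\<forall>i j. f (i, j) \<noteq> \<zero>\<^bsub>R\<^esub> \<longrightarrow> 0 \<le> \<epsilon> * (i + ?c))" by (rule all_shift)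
    finally have 3: "(\<forall>i j. f (i - ?c, j) \<noteq> \<zero>\<^bsub>R\<^esub> \<longrightarrow> 0 \<le> \<epsilon> * i)
        \<longleftrightarrow> (\<forall>i j. f (i, j) \<noteq> \<zero>\<^bsub>R\<^esub> \<longrightarrow> - int k \<le> \<epsilon> * i)" unfolding sign_shift[OF \<epsilon>] .
    show ?thesis unfolding power_series_x_def mem_Collect_eq series_on_shift 1 2 3 ..
  qed
  show "f \<in> laurent_series_x R \<epsilon> \<longleftrightarrow> f \<in> {f \<in> series_on R. {v. f v \<noteq> \<zero>\<^bsub>R\<^esub>} \<in> edge_x \<epsilon>}" (is "?l \<longleftrightarrow> ?r")
  proof
    assume ?l
    then obtain k where k: "f \<in> series_on R" "\<forall>i. finite {j. f (i, j) \<noteq> \<zero>\<^bsub>R\<^esub>}" "\<forall>i j. f (i, j) \<noteq> \<zero>\<^bsub>R\<^esub> \<longrightarrow> - int k \<le> \<epsilon> * i"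
      unfolding laurent_series_x_def mem_Collect_eq s by blast
    have "- int k \<le> \<epsilon> * fst v" if "v \<in> {v. f v \<noteq> \<zero>\<^bsub>R\<^esub>}" for v
      using k(3)[THEN spec, THEN spec, of "fst v" "snd v"] that by simp
    then have "\<exists>k. \<forall>v\<in>{v. f v \<noteq> \<zero>\<^bsub>R\<^esub>}. - k \<le> \<epsilon> * fst v" by (intro exI[of _ "int k"] ballI)
    then show ?r using k(1,2) by (simp add: edge_x_def)
  next
    assume ?r
    then obtain k where k: "f \<in> series_on R" "\<And>i. finite {j. f (i, j) \<noteq> \<zero>\<^bsub>R\<^esub>}" "\<And>v. f v \<noteq> \<zero>\<^bsub>R\<^esub> \<Longrightarrow> - k \<le> \<epsilon> * fst v"
      unfolding edge_x_def by auto
    have "- int (nat k) \<le> \<epsilon> * i" if "f (i, j) \<noteq> \<zero>\<^bsub>R\<^esub>" for i j using k(3)[OF that] by simp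
    then show ?l using k(1,2) unfolding laurent_series_x_def mem_Collect_eq s by blast
  qed
qed

text \<open>All sufficiently large k are required here; a lower bound that works for one k works for
  every larger one, so a single bound on both exponents decides.\<close>

lemma laurent_series_xy_iff:
  assumes \<epsilon>: "\<epsilon> = 1 \<or> \<epsilon> = - 1" and \<delta>: "\<delta> = 1 \<or> \<delta> = - 1"
  shows "laurent_series_xy R \<epsilon> \<delta> = {f \<in> series_on R. {v. f v \<noteq> \<zero>\<^bsub>R\<^esub>} \<in> corner \<epsilon> \<delta>}"
proof (rule Set.set_eqI)
  fix f :: "int \<times> int \<Rightarrow> 'a"
  have s: "monom_shift (\<epsilon> * int k, \<delta> * int k) f \<in> power_series_xy R \<epsilon> \<delta> \<longleftrightarrow> f \<in> series_on R
      \<and> (\<forall>i j. f (i, j) \<noteq> \<zero>\<^bsub>R\<^esub> \<longrightarrow> - int k \<le> \<epsilon> * i \<and> - int k \<le> \<delta> * j)" for k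
  proof -
    let ?c = "\<epsilon> * int k" and ?d = "\<delta> * int k"
    have 1: "monom_shift (?c, ?d) f (i, j) = f (i - ?c, j - ?d)" for i j by (simp add: monom_shift_def)
    have "(\<forall>i j. f (i - ?c, j - ?d) \<noteq> \<zero>\<^bsub>R\<^esub> \<longrightarrow> 0 \<le> \<epsilon> * i \<and> 0 \<le> \<delta> * j)
        \<longleftrightarrow> (\<forall>i j. f (i - ?c, j - ?d) \<noteq> \<zero>\<^bsub>R\<^esub> \<longrightarrow> 0 \<le> \<epsilon> * ((i - ?c) + ?c) \<and> 0 \<le> \<delta> * ((j - ?d) + ?d))"
      unfolding diff_add_cancel ..
    also have "\<dots> \<longleftrightarrow> (\<forall>i j. f (i, j - ?d) \<noteq> \<zero>\<^bsub>R\<^esub> \<longrightarrow> 0 \<le> \<epsilon> * (i + ?c) \<and> 0 \<le> \<delta> * ((j - ?d) + ?d))" by (rule all_shift)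
    also have "\<dots> \<longleftrightarrow> (\<forall>i j. f (i, j) \<noteq> \<zero>\<^bsub>R\<^esub> \<longrightarrow> 0 \<le> \<epsilon> * (i + ?c) \<and> 0 \<le> \<delta> * (j + ?d))"
      by (intro iff_allI all_shift)
    finally have 2: "(\<forall>i j. f (i - ?c, j - ?d) \<noteq> \<zero>\<^bsub>R\<^esub> \<longrightarrow> 0 \<le> \<epsilon> * i \<and> 0 \<le> \<delta> * j)
        \<longleftrightarrow> (\<forall>i j. f (i, j) \<noteq> \<zero>\<^bsub>R\<^esub> \<longrightarrow> - int k \<le> \<epsilon> * i \<and> - int k \<le> \<delta> * j)"
      unfolding sign_shift[OF \<epsilon>] sign_shift[OF \<delta>] .
    show ?thesis unfolding power_series_xy_def mem_Collect_eq series_on_shift 1 2 ..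
  qed
  show "f \<in> laurent_series_xy R \<epsilon> \<delta> \<longleftrightarrow> f \<in> {f \<in> series_on R. {v. f v \<noteq> \<zero>\<^bsub>R\<^esub>} \<in> corner \<epsilon> \<delta>}" (is "?l \<longleftrightarrow> ?r")
  proof
    assume ?l
    then obtain k where k: "f \<in> series_on R" "\<forall>i j. f (i, j) \<noteq> \<zero>\<^bsub>R\<^esub> \<longrightarrow> - int k \<le> \<epsilon> * i \<and> - int k \<le> \<delta> * j"
      unfolding laurent_series_xy_def mem_Collect_eq s by blast
    have "- int k \<le> \<epsilon> * fst v \<and> - int k \<le> \<delta> * snd v" if "v \<in> {v. f v \<noteq> \<zero>\<^bsub>R\<^esub>}" for v
      using k(2)[THEN spec, THEN spec, of "fst v" "snd v"] that by simp
    then have "\<exists>k. \<forall>v\<in>{v. f v \<noteq> \<zero>\<^bsub>R\<^esub>}. - k \<le> \<epsilon> * fst v \<and> - k \<le> \<delta> * snd v" by (intro exI[of _ "int k"] ballI)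
    then show ?r using k(1) by (simp add: corner_def)
  next
    assume ?r
    then obtain k where k: "f \<in> series_on R" "\<And>v. f v \<noteq> \<zero>\<^bsub>R\<^esub> \<Longrightarrow> - k \<le> \<epsilon> * fst v \<and> - k \<le> \<delta> * snd v"
      unfolding corner_def by auto
    have "- int k' \<le> \<epsilon> * i \<and> - int k' \<le> \<delta> * j" if "f (i, j) \<noteq> \<zero>\<^bsub>R\<^esub>" "nat k \<le> k'" for i j k' using k(2)[OF that(1)] that(2) by auto
    then show ?l using k(1) unfolding laurent_series_xy_def mem_Collect_eq s by blast
  qed
qed

theorem theorem1p1p2:
  fixes R :: "('a, 'c) ring_scheme"
    and C :: "('a series, 'm) cochain"
  assumes "ring R"
    and "cochain_complex (LPoly R) C"
    and "bounded_cochain C"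
    and "\<forall>n. fg_free_rmod (LPoly R) (obj C n)"
  shows "finitely_dominated R (restrict_cochain (series_const R) C) \<longleftrightarrow>
    acyclic_cochain (tensor_cochain (LPoly R) C (LSer_y R 1)) \<and>
    acyclic_cochain (tensor_cochain (LPoly R) C (LSer_y R (-1))) \<and>
    acyclic_cochain (tensor_cochain (LPoly R) C (LSer_x R 1)) \<and>
    acyclic_cochain (tensor_cochain (LPoly R) C (LSer_x R (-1))) \<and>
    acyclic_cochain (tensor_cochain (LPoly R) C (LSer_xy R 1 1)) \<and>
    acyclic_cochain (tensor_cochain (LPoly R) C (LSer_xy R (-1) (-1))) \<and>
    acyclic_cochain (tensor_cochain (LPoly R) C (LSer_xy R 1 (-1))) \<and>
    acyclic_cochain (tensor_cochain (LPoly R) C (LSer_xy R (-1) 1))"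
proof -
  interpret ring R by (rule assms(1))
  obtain rk P D lo hi \<Theta> where m: "model_complex R rk P D lo hi C \<Theta>" using model_exists[OF assms(2,3,4)] by blast
  interpret model_complex R rk P D lo hi C \<Theta> by (rule m)
  \<comment> \<open>All eight rings are rings of series cut out by a family of supports, so a single
    statement for a general family covers every tensor product.\<close>
  have t: "acyclic_cochain (tensor_cochain (LPoly R) C (series_ring R {s \<in> series_on R. {v. s v \<noteq> \<zero>\<^bsub>R\<^esub>} \<in> \<S>}))
      \<longleftrightarrow> acyclic_on \<S>" if "support_ideal \<S>" for \<S>
  proof -
    have tm: "tensor_model R rk P D lo hi C \<Theta> \<S>" by (intro tensor_model.intro tensor_model_axioms.intro m that)
    show ?thesis using tensor_model.acyclic_tensor_iff[OF tm] unfolding tensor_model.ser_def[OF tm] .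
  qed
  have x: "acyclic_cochain (tensor_cochain (LPoly R) C (LSer_x R \<epsilon>)) \<longleftrightarrow> acyclic_on (edge_x \<epsilon>)" if "\<epsilon> = 1 \<or> \<epsilon> = - 1" for \<epsilon>
    unfolding LSer_x_def laurent_series_x_iff[OF that] by (rule t[OF support_ideal_edge_x])
  have y: "acyclic_cochain (tensor_cochain (LPoly R) C (LSer_y R \<delta>)) \<longleftrightarrow> acyclic_on (edge_y \<delta>)" if "\<delta> = 1 \<or> \<delta> = - 1" for \<delta>
    unfolding LSer_y_def laurent_series_y_iff[OF that] by (rule t[OF support_ideal_edge_y])
  have xy: "acyclic_cochain (tensor_cochain (LPoly R) C (LSer_xy R \<epsilon> \<delta>)) \<longleftrightarrow> acyclic_on (corner \<epsilon> \<delta>)"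
    if "\<epsilon> = 1 \<or> \<epsilon> = - 1" "\<delta> = 1 \<or> \<delta> = - 1" for \<epsilon> \<delta>
    unfolding LSer_xy_def laurent_series_xy_iff[OF that] by (rule t[OF support_ideal_corner])
  have s: "1 = (1 :: int) \<or> 1 = (- 1 :: int)" "- 1 = (1 :: int) \<or> - 1 = (- 1 :: int)" by simp_all
  have all: "(\<forall>b. Q (sign b)) \<longleftrightarrow> Q 1 \<and> Q (- 1)" for Q :: "int \<Rightarrow> bool"
    unfolding all_bool_eq sign_def if_True if_False by blast
  have all2: "(\<forall>b b'. Q (sign b) (sign b')) \<longleftrightarrow> (Q 1 1 \<and> Q 1 (- 1)) \<and> (Q (- 1) 1 \<and> Q (- 1) (- 1))" for Q :: "int \<Rightarrow> int \<Rightarrow> bool"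
    unfolding all[of "\<lambda>s. \<forall>b'. Q s (sign b')"] all[of "Q 1"] all[of "Q (- 1)"] ..
  show ?thesis
    unfolding finitely_dominated_iff small_homotopy_iff_acyclic all[of "\<lambda>s. acyclic_on (edge_x s)"]
      all[of "\<lambda>s. acyclic_on (edge_y s)"] all2[of "\<lambda>s s'. acyclic_on (corner s s')"]
      x[OF s(1)] x[OF s(2)] y[OF s(1)] y[OF s(2)] xy[OF s(1) s(1)] xy[OF s(1) s(2)] xy[OF s(2) s(1)] xy[OF s(2) s(2)]
    by blast
qed

end
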